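(* Let $\tau\in\mathbb{H}$, $q=e^{2\pi i\tau}$, and let $$F(\bm\zeta) :=\frac{1}{\left(\zeta_1q,\zeta_1^{-1}q,\zeta_2q,\zeta_2^{-1}q,\zeta_1\zeta_2q,\zeta_1^{-1}\zeta_2^{-1}q,\zeta_1^2 \zeta_2q,\zeta_1^{-2}\zeta_2^{-1}q ;q\right)_\infty}.$$ In the range $|q| < |\zeta_1^2|, |\zeta_2|, |\zeta_1 \zeta_2 |, |\zeta_1^2 \zeta_2 | <1$ we have $$\mathrm{CT}_{[\bm\zeta]}(F(\bm\zeta)) =\frac{q^{\frac13}}{\eta(\tau)^{8}}F_0(\tau)+\frac{9 q^{-\frac{1}{12}} }{2 \eta(\tau)^{8}} \Phi (\tau)+\frac{q^{-\frac{1}{12}}}{\eta(\tau)^2} \left(\frac{ \Lambda_{0,1}(\tau)}{\vartheta \left( \frac12; \tau \right)^2}+ \frac{q^{-\frac14} \Lambda_{1,0}(\tau)}{\vartheta \left( \frac{\tau}{2}; \tau \right)^2}- \frac{q^{-\frac14} \Lambda_{1,1}(\tau)}{\vartheta \left( \frac{\tau+1}{2}; \tau \right)^2}\right)$$ $$= 1 + 4q^2 + 12 q^3 + 38 q^4 + 100 q^5 + 276 q^6+688 q^7 + 1709 q^8 + 4020 q^9 + O\left(q^{10}\right).$$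
   Context: $(a;q)_\infty=\prod_{j\ge0}(1-aq^j)$, $(a_1,\dots,a_\ell;q)_\infty=\prod_j(a_j;q)_\infty$. $\mathrm{CT}_{[\bm\zeta]}$ is the constant term in the Laurent expansion in $\zeta_1,\zeta_2$ in the given range. ($F$ is $q^{\frac{10k}{24(k+3)}}(q;q)_\infty^2$ times the character of the universal affine vertex algebra $V_k(\mathfrak{so}_5)$ at generic level $k$; its constant term is, up to a power of $q$, the generic parafermion character of type $B_2$.) $\mathrm{sgn}(x)=x/|x|$ for $x\neq0$, $\mathrm{sgn}(0)=0$. $\eta(\tau)=q^{1/24}\prod_{n\ge1}(1-q^n)$, $\vartheta(z;\tau)=\sum_{n\in\mathbb{Z}+\frac12}e^{\pi i n}q^{\frac{n^2}{2}}e^{2\pi i nz}$, $E_2(\tau)=1-24\sum_{n\ge1}\sum_{d\mid n}d\,q^n$, and $\mathcal{D}_k:=\frac{1}{2\pi i}\frac{\partial}{\partial\tau}-\frac{k}{12}E_2(\tau)$. With $Q_B(\bm n):=\frac32n_1^2+3n_1n_2+3n_2^2$, set $\Phi:=\Phi_1+\Phi_2$, $$\Phi_1 (\tau) :=\sum_{\bm n\in\mathbb{Z}^2+\left(\frac 13,\frac 16\right)} (-1)^{n_1-\frac 13}\left( \mathrm{sgn}(n_2) + \mathrm{sgn} (n_1 + n_2) \right) \mathrm{sgn}(n_1) \left( ( n_1+2n_2 )^2 - \frac{E_2 (\tau)}{18} \right)q^{Q_B(\bm n)},$$ $$\Phi_2 (\tau) :=\sum_{\bm n\in\mathbb{Z}^2+\left(\frac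 13,\frac 16\right)} (-1)^{n_1-\frac 13}\,\mathrm{sgn} (n_1+n_2)\, \mathrm{sgn} (n_2)\, n_1(n_1+2n_2)\,q^{Q_B(\bm n)} ,$$ and for $\bm a=(a_1,a_2)\in\mathbb{Z}^2$ $$\Lambda_{\bm a} (\tau) :=\sum_{\bm n\in \mathbb{Z}^2+\left(\frac13,\frac{a_1}{2}+\frac16\right)}(-1)^{(a_2+1)\left(n_1-\frac13\right)} \,\mathrm{sgn}(n_1)\,\mathrm{sgn}(n_1+2n_2)\,q^{Q_B(\bm n)} .$$ Let $$\phi_{r} (\tau) := \sum_{n \in \mathbb{Z}+\frac{r}{6}} \mathrm{sgn} (n) q^{3 n^2},\qquad \omega_{r} (\tau) := \sum_{n \in \mathbb{Z}+\frac{r}{3} + \frac12} (-1)^{n-\frac{r}{3}-\frac12}\, \mathrm{sgn} (n) q^{\frac{3n^2}{2}},$$ and $$F_0 (\tau) := \frac{E_2 (\tau)+2}{4} + \frac{\eta(\tau)^6}{\vartheta ( \frac12; \tau )^2}+ 6 q^{-\frac{1}{24}} \mathcal{D}_{\frac12}( \omega_1 (\tau))- 6 q^{-\frac38} \mathcal{D}_{\frac12} (\omega_0 (\tau))$$ $$+\,q^{-\frac{1}{12}} \left( 6 \mathcal{D}_{\frac12} - \frac{\eta(\tau)^6}{\vartheta ( \frac12; \tau )^2} + q^{-\frac12} \frac{\eta(\tau)^6}{\vartheta ( \frac{\tau}{2}; \tau )^2} - q^{-\frac12} \frac{\eta(\tau)^6}{\vartheta ( \frac{\tau+1}{2}; \tau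 )^2}\right) (\phi_1 (\tau))$$ $$-\, q^{-\frac13} \left( 6 \mathcal{D}_{\frac12} + \frac{\eta(\tau)^6}{\vartheta ( \frac12; \tau )^2} + \frac{\eta(\tau)^6}{\vartheta ( \frac{\tau}{2}; \tau )^2} + \frac{\eta(\tau)^6}{\vartheta ( \frac{\tau+1}{2}; \tau )^2}\right)( \phi_2 (\tau)),$$ where functions inside the parenthesized operators act by multiplication. *)

theory Defs
  imports "HOL-Analysis.Analysis" "HOL-Library.Landau_Symbols"
begin

text \<open>Real powers of \<open>q = exp (2 \<pi> \<i> \<tau>)\<close> are not principal branches of powers of the
  number \<open>q\<close>: for real \<open>a\<close>, \<open>q\<^sup>a\<close> always means \<open>exp (2 \<pi> \<i> a \<tau>)\<close>.\<close>

definition qpow :: "real \<Rightarrow> complex \<Rightarrow> complex" where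
  "qpow a \<tau> = exp (2 * of_real pi * \<i> * of_real a * \<tau>)"

abbreviation nome :: "complex \<Rightarrow> complex" where
  "nome \<equiv> qpow 1"

definition qpoch_inf :: "complex \<Rightarrow> complex \<Rightarrow> complex" where
  "qpoch_inf a q = prodinf (\<lambda>j. 1 - a * q ^ j)"

definition qpoch_inf_list :: "complex list \<Rightarrow> complex \<Rightarrow> complex" where
  "qpoch_inf_list as q = (\<Prod>a\<leftarrow>as. qpoch_inf a q)"

definition is_laurent_expansion ::
  "(complex \<times> complex \<Rightarrow> complex) \<Rightarrow> (complex \<times> complex) set \<Rightarrow> (int \<Rightarrow> int \<Rightarrow> complex) \<Rightarrow> bool" where
  "is_laurent_expansion f R c \<longleftrightarrow>
     (\<forall>(\<zeta>1, \<zeta>2)\<in>R. ((\<lambda>(m, n). c m n * \<zeta>1 powi m * \<zeta>2 powi n) has_sum f (\<zeta>1, \<zeta>2)) UNIV)"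

text \<open>Only meaningful when \<open>f\<close> has exactly one Laurent expansion on \<open>R\<close>.\<close>

definition constant_term ::
  "(complex \<times> complex \<Rightarrow> complex) \<Rightarrow> (complex \<times> complex) set \<Rightarrow> complex" where
  "constant_term f R = (THE c. is_laurent_expansion f R c) 0 0"

definition F_B2 :: "complex \<Rightarrow> complex \<times> complex \<Rightarrow> complex" where
  "F_B2 \<tau> = (\<lambda>(\<zeta>1, \<zeta>2). let q = nome \<tau> in
     1 / qpoch_inf_list
       [\<zeta>1 * q, \<zeta>1 powi (-1) * q, \<zeta>2 * q, \<zeta>2 powi (-1) * q,
        \<zeta>1 * \<zeta>2 * q, \<zeta>1 powi (-1) * \<zeta>2 powi (-1) * q,
        \<zeta>1 ^ 2 * \<zeta>2 * q, \<zeta>1 powi (-2) * \<zeta>2 powi (-1) * q] q)"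

definition range_B2 :: "complex \<Rightarrow> (complex \<times> complex) set" where
  "range_B2 \<tau> = {(\<zeta>1, \<zeta>2). \<forall>x \<in> {\<zeta>1 ^ 2, \<zeta>2, \<zeta>1 * \<zeta>2, \<zeta>1 ^ 2 * \<zeta>2}.
     norm (nome \<tau>) < norm x \<and> norm x < 1}"

definition eta :: "complex \<Rightarrow> complex" where
  "eta \<tau> = qpow (1/24) \<tau> * prodinf (\<lambda>n. 1 - nome \<tau> ^ Suc n)"

text \<open>Here and below, a sum over a coset \<open>\<int> + s\<close> (or \<open>\<int>\<^sup>2 + (s, t)\<close>) is indexed by the
  integers \<open>m = n - s\<close>, so that signs such as \<open>(-1) powi m\<close> have integer exponents.\<close>

definition theta :: "complex \<Rightarrow> complex \<Rightarrow> complex" where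
  "theta z \<tau> = (\<Sum>\<^sub>\<infinity>m\<in>(UNIV :: int set). let n = of_int m + 1/2 :: real in
     exp (of_real pi * \<i> * of_real n) * qpow (n\<^sup>2 / 2) \<tau> *
     exp (2 * of_real pi * \<i> * of_real n * z))"

definition E2 :: "complex \<Rightarrow> complex" where
  "E2 \<tau> = 1 - 24 * (\<Sum>\<^sub>\<infinity>n\<in>{1::nat..}. of_nat (\<Sum>d | d dvd n. d) * nome \<tau> ^ n)"

definition serre_D :: "real \<Rightarrow> (complex \<Rightarrow> complex) \<Rightarrow> complex \<Rightarrow> complex" where
  "serre_D k f \<tau> = 1 / (2 * of_real pi * \<i>) * deriv f \<tau> - of_real (k / 12) * E2 \<tau> * f \<tau>"

definition Q_B :: "real \<Rightarrow> real \<Rightarrow> real" where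
  "Q_B n1 n2 = 3/2 * n1\<^sup>2 + 3 * n1 * n2 + 3 * n2\<^sup>2"

definition Phi1 :: "complex \<Rightarrow> complex" where
  "Phi1 \<tau> = (\<Sum>\<^sub>\<infinity>(m1, m2)\<in>(UNIV :: (int \<times> int) set).
     let n1 = of_int m1 + 1/3 :: real; n2 = of_int m2 + 1/6 :: real in
     (-1) powi m1 * of_real ((sgn n2 + sgn (n1 + n2)) * sgn n1) *
     (of_real ((n1 + 2 * n2)\<^sup>2) - E2 \<tau> / 18) * qpow (Q_B n1 n2) \<tau>)"

definition Phi2 :: "complex \<Rightarrow> complex" where
  "Phi2 \<tau> = (\<Sum>\<^sub>\<infinity>(m1, m2)\<in>(UNIV :: (int \<times> int) set).
     let n1 = of_int m1 + 1/3 :: real; n2 = of_int m2 + 1/6 :: real in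
     (-1) powi m1 * of_real (sgn (n1 + n2) * sgn n2 * n1 * (n1 + 2 * n2)) *
     qpow (Q_B n1 n2) \<tau>)"

definition Phi :: "complex \<Rightarrow> complex" where
  "Phi \<tau> = Phi1 \<tau> + Phi2 \<tau>"

definition Lambda :: "int \<Rightarrow> int \<Rightarrow> complex \<Rightarrow> complex" where
  "Lambda a1 a2 \<tau> = (\<Sum>\<^sub>\<infinity>(m1, m2)\<in>(UNIV :: (int \<times> int) set).
     let n1 = of_int m1 + 1/3 :: real; n2 = of_int m2 + (of_int a1 / 2 + 1/6) :: real in
     (-1) powi ((a2 + 1) * m1) * of_real (sgn n1 * sgn (n1 + 2 * n2)) *
     qpow (Q_B n1 n2) \<tau>)"

definition phi :: "int \<Rightarrow> complex \<Rightarrow> complex" where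
  "phi r \<tau> = (\<Sum>\<^sub>\<infinity>m\<in>(UNIV :: int set). let n = of_int m + of_int r / 6 :: real in
     of_real (sgn n) * qpow (3 * n\<^sup>2) \<tau>)"

definition omega :: "int \<Rightarrow> complex \<Rightarrow> complex" where
  "omega r \<tau> = (\<Sum>\<^sub>\<infinity>m\<in>(UNIV :: int set). let n = of_int m + (of_int r / 3 + 1/2) :: real in
     (-1) powi m * of_real (sgn n) * qpow (3 * n\<^sup>2 / 2) \<tau>)"

definition F0 :: "complex \<Rightarrow> complex" where
  "F0 \<tau> =
     (let A = eta \<tau> ^ 6 / theta (1/2) \<tau> ^ 2;
          B = eta \<tau> ^ 6 / theta (\<tau>/2) \<tau> ^ 2;
          C = eta \<tau> ^ 6 / theta ((\<tau> + 1)/2) \<tau> ^ 2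
      in (E2 \<tau> + 2) / 4 + A
         + 6 * qpow (-1/24) \<tau> * serre_D (1/2) (omega 1) \<tau>
         - 6 * qpow (-3/8) \<tau> * serre_D (1/2) (omega 0) \<tau>
         + qpow (-1/12) \<tau> *
             (6 * serre_D (1/2) (phi 1) \<tau>
              + (- A + qpow (-1/2) \<tau> * B - qpow (-1/2) \<tau> * C) * phi 1 \<tau>)
         - qpow (-1/3) \<tau> *
             (6 * serre_D (1/2) (phi 2) \<tau> + (A + B + C) * phi 2 \<tau>))"

end

theory Submission
  imports Defs
begin

text \<open>
  Put \<open>u = \<zeta>\<^sub>1 \<zeta>\<^sub>2\<close>, \<open>v = \<zeta>\<^sub>1\<close> and \<open>T x = (x, q / x; q)\<^sub>\<infinity>\<close>, \<open>W x = (1 - x) / T x\<close>, so that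
  \<open>F = W u W v W (u v) W (u / v) = (1 - u) (1 - u v) (1 - u / v) \<Psi>\<close> with
  \<open>\<Psi> = W v / (T u T (u v) T (u / v))\<close>. Hence the constant term of \<open>F\<close> is a combination of
  coefficients of \<open>\<Psi>\<close> at \<open>u\<^sup>-\<^sup>a\<close> with \<open>0 \<le> a \<le> 3\<close>. Such a coefficient sequence \<open>x a\<close> satisfies
  two reflections: \<open>x a = q\<^sup>a x (- a)\<close> because \<open>T (q / u) = T u\<close>, and \<open>x a + x (3 - a) = R a\<close>, where
  \<open>R a\<close> collects the residues at the poles \<open>u = 1, v\<^sup>\<plusminus>\<^sup>1\<close>. The composite of the two is a first
  order recursion, which is solved by a partial theta series in \<open>R\<close>. The \<open>v\<close>-coefficients of \<open>R\<close> are
  coefficients of \<open>1 / T v ^ 3\<close> and of \<open>1 / (T v ^ 2 T (v\<^sup>2))\<close>, and these are found in the same way, now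
  from the poles at \<open>v\<^sup>2 = 1\<close> and \<open>v\<^sup>2 = q\<close>; this is where \<open>E\<^sub>2\<close> and the three values
  \<open>\<eta>\<^sup>6 / \<vartheta>\<^sup>2\<close> at the half periods enter. The result is a sum of \<open>q\<^sup>Q\<close> over \<open>\<int>\<^sup>2\<close> weighted by products of
  signs. Up to terms supported on lines, which make up \<open>F\<^sub>0\<close>, it is the combination of \<open>\<Phi>\<close> and
  \<open>\<Lambda>\<close>.

  For the expansion, the constant term equals \<open>\<Sum> M\<^sub>i\<^sub>+\<^sub>j M\<^sub>i\<^sub>-\<^sub>j M\<^sub>i M\<^sub>j\<close> over \<open>\<int>\<^sup>2\<close>, where \<open>M\<^sub>n\<close> are the Laurent
  coefficients of \<open>W\<close>. As \<open>M\<^sub>n = O (q ^ \<bar>n\<bar>)\<close>, only \<open>\<bar>i\<bar>, \<bar>j\<bar> \<le> 3\<close> matter modulo \<open>q\<^sup>1\<^sup>0\<close>, and each \<open>M\<^sub>n\<close> is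
  expanded by iterating \<open>h\<^sub>a = q\<^sup>a (1 - h\<^sub>a\<^sub>+\<^sub>1)\<close> for the normalised tail sums
  \<open>h\<^sub>a = (q; q)\<^sub>\<infinity>\<^sup>2 (M\<^sub>a + M\<^sub>a\<^sub>+\<^sub>1 + \<dots>)\<close>.
\<close>

section \<open>Laurent expansions\<close>

text \<open>No contour integral occurs. A function with poles on a circle is written as a kernel
  with explicit coefficients times an even series that converges across the circle; a residue is
  then a value or a second moment of that series, and uniqueness of Laurent coefficients on a circle
  or torus replaces Cauchy's formula. The circles in u are chosen invariant under u -> q / u, which
  makes the first reflection usable. Its factor q^a is absorbed by a Gaussian weight; the weighted
  sums converge because Laurent coefficients grow at most exponentially. In the double sums the
  signs are normalised twice. Replacing sgn by a sign with value 1 at 0 pushes corrections onto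
  lines, and trading one product of signs for another leaves a term that is odd under an involution
  preserving \<open>Q_B\<close>. \<open>Phi2\<close> arises elsewhere, as a product of the
  triple-pole series with the outer series, since \<open>Q_B\<close> splits into squares of n1 + n2
  and n2. For the expansion, (q;q)^8 is cleared first, so that the comparison is one of products of
  integer polynomials.\<close>

lemma has_sum_product:
  fixes f :: "'a \<Rightarrow> complex" and g :: "'b \<Rightarrow> complex"
  assumes "(f has_sum x) A" "(g has_sum y) B"
  shows "((\<lambda>(a, b). f a * g b) has_sum (x * y)) (A \<times> B)"
proof -
  have "(\<lambda>x. norm (f x)) summable_on A" "(\<lambda>x. norm (g x)) summable_on B"
    using assms by (auto simp: summable_on_iff_abs_summable_on_complex[symmetric] dest: has_sum_imp_summable)
  then have g: "(\<lambda>a. norm (f a) * (\<Sum>\<^sub>\<infinity>b\<in>B. norm (g b))) summable_on A"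
    and h: "\<And>a. ((\<lambda>b. norm (f a) * norm (g b)) has_sum norm (f a) * (\<Sum>\<^sub>\<infinity>b\<in>B. norm (g b))) B"
    by (auto intro!: summable_on_cmult_left has_sum_cmult_right)
  have "(\<lambda>(a, b). norm (f a) * norm (g b)) summable_on A \<times> B"
  proof (rule summable_on_SigmaI[where g="\<lambda>a. norm (f a) * (\<Sum>\<^sub>\<infinity>b\<in>B. norm (g b))"])
    show "((\<lambda>b. case (a, b) of (a, b) \<Rightarrow> norm (f a) * norm (g b)) has_sum
        norm (f a) * (\<Sum>\<^sub>\<infinity>b\<in>B. norm (g b))) B" for a
      unfolding prod.case by (rule h)
    show "(case (a, b) of (a, b) \<Rightarrow> norm (f a) * norm (g b)) \<ge> 0" for a b
      unfolding prod.case by (intro mult_nonneg_nonneg norm_ge_zero)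
  qed (rule g)
  then have "(\<lambda>x. norm (case x of (a, b) \<Rightarrow> f a * g b)) summable_on A \<times> B"
    by (simp add: case_prod_unfold norm_mult)
  then have s: "(\<lambda>(a, b). f a * g b) summable_on A \<times> B"
    by (rule Infinite_Sum.abs_summable_summable)
  have "((\<lambda>a. f a * y) has_sum (x * y)) A"
    by (rule has_sum_cmult_left) (use assms in auto)
  moreover have "((\<lambda>b. f a * g b) has_sum (f a * y)) B" for a
    by (rule has_sum_cmult_right) (use assms in auto)
  ultimately show ?thesis
    using s by (intro has_sum_SigmaI[where g="\<lambda>a. f a * y"]) auto
qed

lemma has_sum_sum:
  fixes f :: "'a \<Rightarrow> 'b \<Rightarrow> complex"
  assumes "\<And>i. i \<in> I \<Longrightarrow> (f i has_sum s i) A"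
  shows "((\<lambda>x. \<Sum>i\<in>I. f i x) has_sum (\<Sum>i\<in>I. s i)) A"
  using assms by (induction I rule: infinite_finite_induct) (auto intro!: has_sum_add)

text \<open>The Cauchy product, after the shear (j, k) -> (j + k, j); the map \<open>X\<close> that
  turns sums into products is later i -> \<open>z powi i\<close>.\<close>

lemma has_sum_convolution:
  fixes X :: "'i::ab_group_add \<Rightarrow> complex"
  assumes X: "\<And>i j. X (i + j) = X i * X j"
    and c: "((\<lambda>i. c i * X i) has_sum x) UNIV" and d: "((\<lambda>i. d i * X i) has_sum y) UNIV"
  shows "((\<lambda>i. (\<Sum>\<^sub>\<infinity>j. c j * d (i - j)) * X i) has_sum (x * y)) UNIV"
proof -
  have "((\<lambda>(j, k). (c j * X j) * (d k * X k)) has_sum (x * y)) (UNIV \<times> UNIV)"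
    by (rule has_sum_product[OF c d])
  also have "?this \<longleftrightarrow> ((\<lambda>(i, j). c j * d (i - j) * X i) has_sum (x * y)) (UNIV \<times> UNIV)"
    by (rule has_sum_reindex_bij_witness[of _ "\<lambda>(i, j). (j, i - j)" "\<lambda>(j, k). (j + k, j)"])
       (auto simp: X[symmetric] mult_ac)
  finally have s: "((\<lambda>(i, j). c j * d (i - j) * X i) has_sum (x * y)) (UNIV \<times> UNIV)" .
  have "(\<lambda>j. c j * d (i - j) * X i) summable_on UNIV" for i
    using summable_on_SigmaD1[OF has_sum_imp_summable[OF s], of i] by simp
  then have "((\<lambda>j. c j * d (i - j) * X i) has_sum (\<Sum>\<^sub>\<infinity>j. c j * d (i - j)) * X i) UNIV" for i
    by (simp add: has_sum_iff infsum_cmult_left')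
  then show ?thesis
    by (intro has_sum_SigmaD[OF s]) simp
qed

text \<open>The domain is an explicit set because one function is expanded on several circles, with
  different coefficients on the two sides of a pole. Excluding 0 keeps negative powers
  genuine.\<close>

definition has_laurent :: "(complex \<Rightarrow> complex) \<Rightarrow> complex set \<Rightarrow> (int \<Rightarrow> complex) \<Rightarrow> bool" where
  "has_laurent f S c \<longleftrightarrow> (\<forall>z\<in>S. z \<noteq> 0 \<and> ((\<lambda>n. c n * z powi n) has_sum f z) UNIV)"

lemma has_laurentI:
  assumes "\<And>z. z \<in> S \<Longrightarrow> z \<noteq> 0" "\<And>z. z \<in> S \<Longrightarrow> ((\<lambda>n. c n * z powi n) has_sum f z) UNIV"
  shows "has_laurent f S c"
  using assms by (auto simp: has_laurent_def)

lemma has_laurentD: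
  assumes "has_laurent f S c" "z \<in> S"
  shows "z \<noteq> 0" "((\<lambda>n. c n * z powi n) has_sum f z) UNIV"
  using assms by (auto simp: has_laurent_def)

lemma has_laurent_subset: "has_laurent f S c \<Longrightarrow> S' \<subseteq> S \<Longrightarrow> has_laurent f S' c"
  by (auto simp: has_laurent_def)

lemma has_laurent_cong:
  assumes "has_laurent f S c" "\<And>z. z \<in> S \<Longrightarrow> z \<noteq> 0 \<Longrightarrow> f z = g z"
  shows "has_laurent g S c"
  using assms by (simp add: has_laurent_def)

definition conv :: "('i::ab_group_add \<Rightarrow> complex) \<Rightarrow> ('i \<Rightarrow> complex) \<Rightarrow> 'i \<Rightarrow> complex" where
  "conv c d i = (\<Sum>\<^sub>\<infinity>j. c j * d (i - j))"

lemma has_laurent_mult: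
  assumes "has_laurent f S c" "has_laurent g S d"
  shows "has_laurent (\<lambda>z. f z * g z) S (conv c d)"
proof (rule has_laurentI)
  fix z assume z: "z \<in> S"
  show z0: "z \<noteq> 0" using assms z by (auto dest: has_laurentD)
  have *: "z powi (i + j) = z powi i * z powi j" for i j
    using z0 by (simp add: power_int_add)
  show "((\<lambda>n. conv c d n * z powi n) has_sum f z * g z) UNIV"
    unfolding conv_def
    using has_sum_convolution[of "\<lambda>i. z powi i", OF * has_laurentD(2)[OF assms(1) z] has_laurentD(2)[OF assms(2) z]] .
qed

lemma has_laurent_add:
  assumes "has_laurent f S c" "has_laurent g S d"
  shows "has_laurent (\<lambda>z. f z + g z) S (\<lambda>n. c n + d n)"
  using assms by (auto simp: has_laurent_def ring_distribs intro!: has_sum_add)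

lemma has_laurent_cmult:
  assumes "has_laurent f S c"
  shows "has_laurent (\<lambda>z. a * f z) S (\<lambda>n. a * c n)"
  using assms by (auto simp: has_laurent_def mult.assoc intro!: has_sum_cmult_right)

lemma has_laurent_diff:
  assumes "has_laurent f S c" "has_laurent g S d"
  shows "has_laurent (\<lambda>z. f z - g z) S (\<lambda>n. c n - d n)"
  using has_laurent_add[OF assms(1) has_laurent_cmult[OF assms(2), of "-1"]] by simp

lemma has_laurent_shift:
  assumes "has_laurent f S c"
  shows "has_laurent (\<lambda>z. z powi k * f z) S (\<lambda>n. c (n - k))"
proof (rule has_laurentI)
  fix z assume z: "z \<in> S"
  show z0: "z \<noteq> 0" using assms z by (auto dest: has_laurentD)
  have "((\<lambda>n. z powi k * (c n * z powi n)) has_sum (z powi k * f z)) UNIV"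
    by (rule has_sum_cmult_right) (use assms z in \<open>auto dest: has_laurentD\<close>)
  also have "?this \<longleftrightarrow> ((\<lambda>n. c (n - k) * z powi n) has_sum (z powi k * f z)) UNIV"
    by (rule has_sum_reindex_bij_witness[of _ "\<lambda>n. n - k" "\<lambda>n. n + k"])
       (use z0 in \<open>auto simp: power_int_add\<close>)
  finally show "((\<lambda>n. c (n - k) * z powi n) has_sum (z powi k * f z)) UNIV" .
qed

lemma has_laurent_scale:
  assumes "has_laurent f S c" "a \<noteq> 0" "\<And>z. z \<in> S' \<Longrightarrow> a * z \<in> S"
  shows "has_laurent (\<lambda>z. f (a * z)) S' (\<lambda>n. c n * a powi n)"
proof (rule has_laurentI)
  fix z assume z: "z \<in> S'"
  note * = has_laurentD[OF assms(1) assms(3)[OF z]]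
  show "z \<noteq> 0" using * by auto
  show "((\<lambda>n. c n * a powi n * z powi n) has_sum f (a * z)) UNIV"
    using *(2) by (simp add: power_int_mult_distrib mult_ac)
qed

lemma has_laurent_reflect:
  assumes "has_laurent f S c" "a \<noteq> 0" "\<And>z. z \<in> S' \<Longrightarrow> a / z \<in> S"
  shows "has_laurent (\<lambda>z. f (a / z)) S' (\<lambda>n. c (- n) * a powi (- n))"
proof (rule has_laurentI)
  fix z assume z: "z \<in> S'"
  note * = has_laurentD[OF assms(1) assms(3)[OF z]]
  show z0: "z \<noteq> 0" using * by auto
  have "((\<lambda>n. c n * (a / z) powi n) has_sum f (a / z)) UNIV"
    by (rule *)
  also have "?this \<longleftrightarrow> ((\<lambda>n. c (-n) * a powi (-n) * z powi n) has_sum f (a / z)) UNIV"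
    by (rule has_sum_reindex_bij_witness[of _ "\<lambda>n. - n" "\<lambda>n. - n"])
       (use z0 in \<open>auto simp: power_int_divide_distrib power_int_minus field_simps\<close>)
  finally show "((\<lambda>n. c (- n) * a powi (- n) * z powi n) has_sum f (a / z)) UNIV" .
qed

lemma has_laurent_square:
  assumes "has_laurent f S c" "\<And>z. z \<in> S' \<Longrightarrow> z\<^sup>2 \<in> S"
  shows "has_laurent (\<lambda>z. f (z\<^sup>2)) S' (\<lambda>n. if even n then c (n div 2) else 0)"
proof (rule has_laurentI)
  fix z assume z: "z \<in> S'"
  note * = has_laurentD[OF assms(1) assms(2)[OF z]]
  show z0: "z \<noteq> 0" using * by auto
  have "((\<lambda>n. c n * (z\<^sup>2) powi n) has_sum f (z\<^sup>2)) UNIV"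
    by (rule *)
  also have "?this \<longleftrightarrow> ((\<lambda>n. (if even n then c (n div 2) else 0) * z powi n) has_sum f (z\<^sup>2)) {n. even n}"
    by (rule has_sum_reindex_bij_witness[of _ "\<lambda>n. n div 2" "\<lambda>n. 2 * n"])
       (auto simp: power_int_mult)
  also have "\<dots> \<longleftrightarrow> ((\<lambda>n. (if even n then c (n div 2) else 0) * z powi n) has_sum f (z\<^sup>2)) UNIV"
    by (rule has_sum_cong_neutral) auto
  finally show "((\<lambda>n. (if even n then c (n div 2) else 0) * z powi n) has_sum f (z\<^sup>2)) UNIV" .
qed

section \<open>Uniqueness of Laurent coefficients, by averaging over roots of unity\<close>

lemma sum_roots_of_unity_eq_0:
  assumes "0 < \<bar>n\<bar>" "\<bar>n\<bar> < int N"
  shows "(\<Sum>j<N. (exp (2 * of_real pi * \<i> / of_nat N) powi n) ^ j) = 0"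
proof -
  have N: "N > 0" using assms by auto
  define w where "w = exp (2 * of_real pi * \<i> / of_nat N) powi n"
  have w: "w = exp (of_int n * (2 * of_real pi * \<i> / of_nat N))"
    unfolding w_def by (simp add: exp_power_int)
  have "w ^ N = exp (of_nat N * (of_int n * (2 * of_real pi * \<i> / of_nat N)))"
    by (simp only: w exp_of_nat_mult)
  also have "of_nat N * (of_int n * (2 * of_real pi * \<i> / of_nat N)) = 2 * pi * \<i> * of_int n"
    using N by (simp add: field_simps)
  also have "exp \<dots> = 1"
    by (auto simp: exp_eq_1)
  finally have 1: "w ^ N = 1" .
  have "w \<noteq> 1"
  proof
    assume "w = 1"
    then obtain k :: int where k: "Im (of_int n * (2 * of_real pi * \<i> / of_nat N)) = of_int (2 * k) * pi"
      unfolding w exp_eq_1 by auto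
    have "pi * (real_of_int n * 2) = pi * (real_of_int k * 2 * real N)" using k N by (simp add: field_simps)
    then have "real_of_int n = real_of_int (k * int N)" using N by (simp add: field_simps)
    then have "n = k * int N" by (simp only: of_int_eq_iff)
    then have "int N dvd n" by simp
    then have "int N \<le> \<bar>n\<bar>" using assms by (intro zdvd_imp_le) auto
    then show False using assms by auto
  qed
  with 1 show ?thesis
    unfolding w_def[symmetric] by (simp add: geometric_sum)
qed

text \<open>Averaging over the points r w^j, with w a primitive N-th root of unity, stands in for
  the contour integral: it annihilates every index with 0 < |n| < N and leaves \<open>b 0\<close> up
  to a tail of an absolutely convergent sum, which can be made arbitrarily small.\<close>

lemma has_laurent_zero_coeff:
  assumes b: "has_laurent (\<lambda>_. 0) {z. norm z = r} b" and r: "r > 0"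
  shows "b 0 = 0"
proof -
  define a where "a n = b n * of_real r powi n" for n
  have "of_real r \<in> {z :: complex. norm z = r}" using r by simp
  then have "(a has_sum 0) UNIV"
    using has_laurentD(2)[OF b] unfolding a_def by blast
  then have abs: "(\<lambda>n. norm (a n)) summable_on UNIV"
    by (simp add: summable_on_iff_abs_summable_on_complex[symmetric] has_sum_imp_summable)
  have key: "norm (a 0) \<le> (\<Sum>\<^sub>\<infinity>n\<in>-F. norm (a n))" if F: "finite F" "0 \<in> F" for F
  proof -
    \<comment> \<open>N exceeds |n| for every n in F, so within F the average keeps only the index
      0.\<close>
    define N where "N = nat (Max (abs ` F)) + 1"
    have N: "\<bar>n\<bar> < int N" if "n \<in> F" for n
    proof -
      have "\<bar>n\<bar> \<le> Max (abs ` F)" using F that by (intro Max_ge) auto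
      with abs_ge_zero[of n] show ?thesis unfolding N_def by linarith
    qed
    have N0: "N > 0" by (simp add: N_def)
    define w where "w = exp (2 * of_real pi * \<i> / of_nat N)"
    have nw: "norm w = 1" unfolding w_def by (simp add: norm_exp_eq_Re)
    define s where "s n = (\<Sum>j<N. (w powi n) ^ j)" for n
    have w0: "w \<noteq> 0" unfolding w_def by simp
    have "((\<lambda>n. \<Sum>j<N. a n * (w powi n) ^ j) has_sum (\<Sum>j<N. 0)) UNIV"
    proof (rule has_sum_sum)
      fix j
      have pw: "(w ^ j) powi n = (w powi n) ^ j" for n
        by (metis power_int_mult power_int_of_nat mult.commute)
      have "of_real r * w ^ j \<in> {z :: complex. norm z = r}"
        using nw r by (simp add: norm_mult norm_power)
      then have "((\<lambda>n. b n * (of_real r * w ^ j) powi n) has_sum 0) UNIV"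
        using has_laurentD(2)[OF b] by blast
      then show "((\<lambda>n. a n * (w powi n) ^ j) has_sum 0) UNIV"
        unfolding a_def by (simp add: power_int_mult_distrib mult.assoc pw)
    qed
    then have hs: "((\<lambda>n. a n * s n) has_sum 0) UNIV"
      unfolding s_def by (simp add: sum_distrib_left)
    have ns: "norm (s n) \<le> N" for n
    proof -
      have "norm (s n) \<le> (\<Sum>j<N. norm ((w powi n) ^ j))"
        unfolding s_def by (rule norm_sum)
      also have "\<dots> = N" using nw by (simp add: norm_power norm_power_int)
      finally show ?thesis .
    qed
    have fin: "((\<lambda>n. a n * s n) has_sum (\<Sum>n\<in>F. a n * s n)) F"
      using F by (simp add: has_sum_finite)
    have "((\<lambda>n. a n * s n) has_sum (0 - (\<Sum>n\<in>F. a n * s n))) (UNIV - F)"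
      by (rule has_sum_Diff[OF hs fin]) auto
    moreover have "(\<Sum>n\<in>F. a n * s n) = (\<Sum>n\<in>{0}. a n * s n)"
    proof (rule sum.mono_neutral_right)
      show "\<forall>n\<in>F - {0}. a n * s n = 0"
      proof
        fix n assume n: "n \<in> F - {0}"
        have "s n = 0" unfolding s_def w_def
          by (rule sum_roots_of_unity_eq_0) (use n N in auto)
        then show "a n * s n = 0" by simp
      qed
    qed (use F in auto)
    moreover have "s 0 = of_nat N" unfolding s_def by simp
    ultimately have 1: "((\<lambda>n. a n * s n) has_sum (- (a 0 * of_nat N))) (- F)"
      by (simp add: Compl_eq_Diff_UNIV)
    have 2: "((\<lambda>n. norm (a n) * N) has_sum ((\<Sum>\<^sub>\<infinity>n\<in>-F. norm (a n)) * N)) (-F)"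
      by (intro has_sum_cmult_left has_sum_infsum summable_on_subset_banach[OF abs]) auto
    have "norm (- (a 0 * of_nat N)) \<le> (\<Sum>\<^sub>\<infinity>n\<in>-F. norm (a n)) * N"
      by (rule norm_infsum_le[OF 1 2]) (use ns in \<open>auto simp: norm_mult intro!: mult_left_mono\<close>)
    then show ?thesis using N0 by (simp add: norm_mult)
  qed
  have "norm (a 0) \<le> 0"
  proof (rule field_le_epsilon)
    fix e :: real assume "e > 0"
    then obtain F where F: "finite F" "dist (\<Sum>n\<in>F. norm (a n)) (\<Sum>\<^sub>\<infinity>n. norm (a n)) \<le> e"
      using infsum_finite_approximation[OF abs, of e] by auto
    define G where "G = insert 0 F"
    have G: "finite G" "0 \<in> G" "F \<subseteq> G" using F by (auto simp: G_def)
    have "norm (a 0) \<le> (\<Sum>\<^sub>\<infinity>n\<in>-G. norm (a n))" by (rule key[OF G(1,2)])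
    also have "\<dots> = (\<Sum>\<^sub>\<infinity>n. norm (a n)) - (\<Sum>n\<in>G. norm (a n))"
      using infsum_Diff[OF abs _, of G] G(1) by (simp add: Compl_eq_Diff_UNIV)
    also have "\<dots> \<le> (\<Sum>\<^sub>\<infinity>n. norm (a n)) - (\<Sum>n\<in>F. norm (a n))"
      using G sum_mono2[OF G(1,3), of "\<lambda>n. norm (a n)"] by simp
    also have "\<dots> \<le> e" using F(2) by (simp add: dist_real_def)
    finally show "norm (a 0) \<le> 0 + e" by simp
  qed
  then show ?thesis using r by (simp add: a_def)
qed

lemma has_laurent_unique:
  assumes c: "has_laurent f {z. norm z = r} c" and d: "has_laurent f {z. norm z = r} d" and r: "r > 0"
  shows "c = d"
proof
  fix k
  have "has_laurent (\<lambda>z. z powi (-k) * (f z - f z)) {z. norm z = r} (\<lambda>n. c (n - -k) - d (n - -k))"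
    by (intro has_laurent_shift[where c="\<lambda>n. c n - d n"] has_laurent_diff c d)
  then have "c (0 - -k) - d (0 - -k) = 0"
    by (intro has_laurent_zero_coeff[OF _ r]) simp
  then show "c k = d k" by simp
qed

section \<open>Gaussian sums and Euler's series\<close>

lemma summable_on_int_exp_neg_abs: "(\<lambda>n::int. exp (- \<bar>real_of_int n\<bar>)) summable_on UNIV"
proof -
  have "(\<lambda>n::nat. exp (-1) ^ n :: real) summable_on UNIV"
    by (rule summable_nonneg_imp_summable_on) (auto intro!: summable_geometric)
  then have g: "(\<lambda>n::nat. exp (- real n)) summable_on UNIV"
    by (simp only: exp_of_nat_mult[symmetric]) simp
  have "(\<lambda>n::int. exp (- \<bar>real_of_int n\<bar>)) summable_on {0..}"
    by (subst summable_on_reindex_bij_witness[where i=int and j=nat and T=UNIV and h="\<lambda>n::nat. exp (- real n)"])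
       (use g in auto)
  moreover have "(\<lambda>n::int. exp (- \<bar>real_of_int n\<bar>)) summable_on {..0}"
    by (subst summable_on_reindex_bij_witness[where i="\<lambda>n. - int n" and j="\<lambda>n. nat (-n)" and T=UNIV and h="\<lambda>n::nat. exp (- real n)"])
       (use g in auto)
  ultimately have "(\<lambda>n::int. exp (- \<bar>real_of_int n\<bar>)) summable_on ({0..} \<union> {..0})"
    by (rule summable_on_union)
  also have "{0..} \<union> {..0} = (UNIV :: int set)" by auto
  finally show ?thesis .
qed

lemma quadratic_exponent_bound:
  fixes a b t :: real
  assumes "a > 0"
  shows "- a * t\<^sup>2 + b * t \<le> b\<^sup>2 / (4 * a)"
proof -
  have "0 \<le> (2 * a * t - b)\<^sup>2 / (4 * a)" using assms by simp
  also have "\<dots> = a * t\<^sup>2 - b * t + b\<^sup>2 / (4 * a)"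
    using assms by (simp add: field_simps power2_eq_square)
  finally show ?thesis by simp
qed

text \<open>Completing the square in |n| absorbs the growth rate b and one further unit, which is
  what leaves the factor exp (- |n|).\<close>

lemma exp_gauss_le:
  fixes n :: int
  assumes "a > 0"
  shows "exp (- a * (real_of_int n)\<^sup>2 + b * \<bar>real_of_int n\<bar>)
           \<le> exp ((b + 1)\<^sup>2 / (4 * a)) * exp (- \<bar>real_of_int n\<bar>)"
  using quadratic_exponent_bound[OF assms, of "\<bar>real_of_int n\<bar>" "b + 1"]
  by (simp add: exp_add[symmetric] algebra_simps)

lemma summable_on_int_gauss:
  assumes "a > 0" "\<And>n::int. norm (f n :: complex) \<le> C * exp (- a * (real_of_int n)\<^sup>2 + b * \<bar>real_of_int n\<bar>)"
  shows "f summable_on UNIV"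
proof -
  have C: "C \<ge> 0" using assms(2)[of 0] order_trans[OF norm_ge_zero] by fastforce
  have "(\<lambda>n. norm (f n)) summable_on UNIV"
  proof (rule summable_on_comparison_test)
    show "(\<lambda>n. C * (exp ((b + 1)\<^sup>2 / (4 * a)) * exp (- \<bar>real_of_int n\<bar>))) summable_on UNIV"
      by (intro summable_on_cmult_right summable_on_int_exp_neg_abs)
    show "norm (f n) \<le> C * (exp ((b + 1)\<^sup>2 / (4 * a)) * exp (- \<bar>real_of_int n\<bar>))" for n
      using assms(2)[of n] mult_left_mono[OF exp_gauss_le[OF assms(1), of n b] C] by linarith
  qed auto
  then show ?thesis by (rule Infinite_Sum.abs_summable_summable)
qed

lemma summable_on_int2_exp_neg_abs:
  "(\<lambda>(m::int, n::int). exp (- \<bar>real_of_int m\<bar>) * exp (- \<bar>real_of_int n\<bar>)) summable_on UNIV"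
proof -
  let ?e = "\<lambda>n::int. complex_of_real (exp (- \<bar>real_of_int n\<bar>))"
  have "?e summable_on UNIV"
    by (intro summable_on_of_real summable_on_int_exp_neg_abs)
  then obtain s where "(?e has_sum s) UNIV" by (auto simp: summable_on_def)
  from has_sum_product[OF this this] have "(\<lambda>(m, n). ?e m * ?e n) summable_on UNIV"
    by (auto simp: summable_on_def)
  then have "(\<lambda>x. norm (case x of (m, n) \<Rightarrow> ?e m * ?e n)) summable_on UNIV"
    by (simp add: summable_on_iff_abs_summable_on_complex)
  then show ?thesis by (simp add: case_prod_unfold norm_mult)
qed

lemma summable_on_int2_gauss:
  assumes "a > 0" "\<And>m n::int. norm (f (m, n) :: complex) \<le>
     C * exp (- a * ((real_of_int m)\<^sup>2 + (real_of_int n)\<^sup>2) + b * (\<bar>real_of_int m\<bar> + \<bar>real_of_int n\<bar>))"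
  shows "f summable_on UNIV"
proof -
  have C: "C \<ge> 0" using assms(2)[of 0 0] order_trans[OF norm_ge_zero] by fastforce
  define K where "K = exp ((b + 1)\<^sup>2 / (4 * a))"
  have "(\<lambda>p. norm (f p)) summable_on UNIV"
  proof (rule summable_on_comparison_test)
    show "(\<lambda>p. C * K * K * (case p of (m, n) \<Rightarrow> exp (- \<bar>real_of_int m\<bar>) * exp (- \<bar>real_of_int n\<bar>))) summable_on UNIV"
      by (intro summable_on_cmult_right summable_on_int2_exp_neg_abs)
    show "norm (f p) \<le> C * K * K * (case p of (m, n) \<Rightarrow> exp (- \<bar>real_of_int m\<bar>) * exp (- \<bar>real_of_int n\<bar>))" for p
    proof (cases p)
      case (Pair m n)
      have "norm (f p) \<le> C * (exp (- a * (real_of_int m)\<^sup>2 + b * \<bar>real_of_int m\<bar>) * exp (- a * (real_of_int n)\<^sup>2 + b * \<bar>real_of_int n\<bar>))"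
        using assms(2)[of m n] unfolding Pair by (simp add: exp_add[symmetric] algebra_simps)
      also have "\<dots> \<le> C * ((K * exp (- \<bar>real_of_int m\<bar>)) * (K * exp (- \<bar>real_of_int n\<bar>)))"
        unfolding K_def by (intro mult_left_mono[OF _ C] mult_mono exp_gauss_le assms) auto
      finally show ?thesis by (simp add: Pair mult_ac)
    qed
  qed auto
  then show ?thesis by (rule Infinite_Sum.abs_summable_summable)
qed

section \<open>q-Pochhammer symbols and Euler's two series\<close>

locale nome_disc =
  fixes q :: complex
  assumes q0: "q \<noteq> 0" and q1: "norm q < 1"
begin

abbreviation P :: "complex \<Rightarrow> complex" where "P a \<equiv> qpoch_inf a q"

lemma convergent_prod_qpoch: "convergent_prod (\<lambda>j. 1 - a * q ^ j)"
proof -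
  have "summable (\<lambda>i. norm ((1 - a * q ^ i) - 1))"
    using q1 by (auto simp: norm_mult norm_power intro!: summable_mult summable_geometric)
  then show ?thesis
    by (intro abs_convergent_prod_imp_convergent_prod) (simp add: abs_convergent_prod_conv_summable)
qed

lemma qpoch_LIMSEQ: "(\<lambda>n. \<Prod>j<n. 1 - a * q ^ j) \<longlonglongrightarrow> P a"
proof -
  have "(\<lambda>n. \<Prod>j\<le>n. 1 - a * q ^ j) \<longlonglongrightarrow> P a"
    unfolding qpoch_inf_def by (rule convergent_prod_LIMSEQ[OF convergent_prod_qpoch])
  then have "(\<lambda>n. \<Prod>j<Suc n. 1 - a * q ^ j) \<longlonglongrightarrow> P a"
    by (simp only: lessThan_Suc_atMost)
  then show ?thesis by (rule LIMSEQ_imp_Suc)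
qed

lemma qpoch_step: "P a = (1 - a) * P (a * q)"
proof (rule LIMSEQ_unique)
  show "(\<lambda>n. \<Prod>j<Suc n. 1 - a * q ^ j) \<longlonglongrightarrow> P a"
    by (rule LIMSEQ_Suc[OF qpoch_LIMSEQ])
  show "(\<lambda>n. \<Prod>j<Suc n. 1 - a * q ^ j) \<longlonglongrightarrow> (1 - a) * P (a * q)"
    using tendsto_mult_left[OF qpoch_LIMSEQ[of "a * q"], of "1 - a"]
    by (simp only: prod.lessThan_Suc_shift) (simp add: mult_ac)
qed

lemma qpoch_nonzero:
  assumes "\<And>j. a * q ^ j \<noteq> 1"
  shows "P a \<noteq> 0"
  unfolding qpoch_inf_def using assms convergent_prod_qpoch by (intro prodinf_nonzero) auto

lemma qpoch_nonzero': assumes "norm a < 1" shows "P a \<noteq> 0"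
proof (rule qpoch_nonzero)
  fix j
  have "norm (a * q ^ j) \<le> norm a * 1"
    unfolding norm_mult norm_power using q1 by (intro mult_left_mono power_le_one) auto
  then show "a * q ^ j \<noteq> 1" using assms by auto
qed

lemma qpoch_1 [simp]: "P 1 = 0"
  using qpoch_step[of 1] by simp

text \<open>One of the factors is 1 - 1. In the triple product these zeros remove the terms of
  negative index.\<close>

lemma qpoch_powi_nonpos: "P (q powi (- int n)) = 0"
proof (induction n)
  case (Suc n)
  have "q powi (- int (Suc n)) * q = q powi (- int n)"
    using power_int_add_1[of q "- int (Suc n)"] q0 by simp
  then show ?case using qpoch_step[of "q powi (- int (Suc n))"] Suc by simp
qed auto

definition E :: complex where "E = P q"

lemma E_nonzero: "E \<noteq> 0"
  unfolding E_def by (rule qpoch_nonzero') (rule q1)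

definition qfac :: "nat \<Rightarrow> complex" where "qfac n = (\<Prod>j<n. 1 - q * q ^ j)"

lemma qfac_0 [simp]: "qfac 0 = 1" and qfac_Suc: "qfac (Suc n) = qfac n * (1 - q ^ Suc n)"
  by (simp_all add: qfac_def)

lemma qfac_nonzero: "qfac n \<noteq> 0"
proof -
  have "q ^ Suc j \<noteq> 1" for j
  proof
    assume "q ^ Suc j = 1"
    then have "norm q ^ Suc j = 1" by (metis norm_one norm_power)
    then show False using q1 power_Suc_less_one[of "norm q" j] by (cases "norm q = 0") auto
  qed
  then show ?thesis unfolding qfac_def by auto
qed

lemma inverse_qfac_bounded: "\<exists>K>0. \<forall>n. norm (1 / qfac n) \<le> K"
proof -
  have "(\<lambda>n. 1 / qfac n) \<longlonglongrightarrow> 1 / E"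
    unfolding qfac_def E_def by (intro tendsto_intros qpoch_LIMSEQ) (use E_nonzero in \<open>simp add: E_def\<close>)
  then have "Bseq (\<lambda>n. 1 / qfac n)"
    by (intro convergent_imp_Bseq) (auto simp: convergent_def)
  then show ?thesis by (auto simp: Bseq_def)
qed

lemma qpoch_qpower: "P (q ^ Suc n) * qfac n = E"
proof (induction n)
  case (Suc n)
  then show ?case using qpoch_step[of "q ^ Suc n"] by (simp add: qfac_Suc mult_ac)
qed (simp add: E_def)

lemma q_powser_summable:
  fixes c :: "nat \<Rightarrow> complex"
  assumes K: "\<And>n. norm (c n) \<le> K" and x: "norm x < 1"
  shows "summable (\<lambda>n. norm (c n * x ^ n))"
proof (rule summable_comparison_test')
  show "summable (\<lambda>n. K * norm x ^ n)" using x by (intro summable_mult summable_geometric) auto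
  show "norm (norm (c n * x ^ n)) \<le> K * norm x ^ n" for n
    using mult_right_mono[OF K[of n], of "norm x ^ n"] by (simp add: norm_mult norm_power)
qed

text \<open>Equations relating f (x) to f (x q) are iterated below; this limit determines the
  constant that remains.\<close>

lemma powser_qpow_tendsto:
  assumes s: "summable (\<lambda>n. norm (c n * x ^ n))"
  shows "(\<lambda>k. \<Sum>n. c n * (x * q ^ k) ^ n) \<longlonglongrightarrow> (c 0 :: complex)"
proof (cases "x = 0")
  case True
  have "(\<lambda>n. c n * 0 ^ n) = (\<lambda>n. if n = 0 then c n else 0)" by auto
  then show ?thesis using True powser_zero[of c] by simp
next
  case False
  have "isCont (\<lambda>y. \<Sum>n. c n * y ^ n) 0"
    by (rule isCont_powser[of _ x]) (use summable_norm_cancel[OF s] False in auto)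
  moreover have "(\<lambda>k. x * q ^ k) \<longlonglongrightarrow> x * 0"
    using q1 by (intro tendsto_intros LIMSEQ_power_zero)
  ultimately have "(\<lambda>k. \<Sum>n. c n * (x * q ^ k) ^ n) \<longlonglongrightarrow> (\<Sum>n. c n * 0 ^ n)"
    using isCont_tendsto_compose[of 0 "\<lambda>y. \<Sum>n. c n * y ^ n" "\<lambda>k. x * q ^ k"] by simp
  then show ?thesis by (simp only: powser_zero)
qed

lemma norm_mult_qpow_le: "norm (x * q ^ k) \<le> norm x"
proof -
  have "norm x * norm q ^ k \<le> norm x * 1"
    using q1 by (intro mult_left_mono power_le_one) auto
  then show ?thesis by (simp add: norm_mult norm_power)
qed

text \<open>The series and 1 / P satisfy the same equation f (y q) = (1 - y) f (y); iterating it
  down to 0 leaves the constant coefficient 1.\<close>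

lemma euler_inverse_qpoch:
  assumes x: "norm x < 1"
  shows "((\<lambda>n. x ^ n / qfac n) has_sum (1 / P x)) UNIV"
proof -
  obtain K where K: "\<And>n. norm (1 / qfac n) \<le> K" using inverse_qfac_bounded by auto
  define c where "c n = 1 / qfac n" for n
  define f where "f y = (\<Sum>n. c n * y ^ n)" for y
  have sm: "summable (\<lambda>n. norm (c n * y ^ n))" if "norm y < 1" for y
    by (rule q_powser_summable[OF _ that]) (use K in \<open>simp add: c_def\<close>)
  have step: "f (y * q) = (1 - y) * f y" if y: "norm y < 1" for y
  proof -
    have yq: "norm (y * q) < 1" using norm_mult_qpow_le[of y 1] y by simp
    note s1 = summable_norm_cancel[OF sm[OF y]] and s2 = summable_norm_cancel[OF sm[OF yq]]
    have "f y - f (y * q) = (\<Sum>n. c n * y ^ n - c n * (y * q) ^ n)"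
      unfolding f_def by (rule suminf_diff[OF s1 s2])
    also have "\<dots> = (\<Sum>n. c (Suc n) * y ^ Suc n - c (Suc n) * (y * q) ^ Suc n)"
      by (subst suminf_split_head) (use summable_diff[OF s1 s2] in auto)
    also have "\<dots> = (\<Sum>n. y * (c n * y ^ n))"
    proof (rule suminf_cong)
      fix n
      have "c (Suc n) * (1 - q ^ Suc n) = c n"
        using qfac_nonzero[of "Suc n"] qfac_nonzero[of n] by (simp add: c_def qfac_Suc field_simps)
      then have "y ^ Suc n * (c (Suc n) * (1 - q ^ Suc n)) = y ^ Suc n * c n" by (simp only:)
      then show "c (Suc n) * y ^ Suc n - c (Suc n) * (y * q) ^ Suc n = y * (c n * y ^ n)"
        by (simp add: power_mult_distrib algebra_simps)
    qed
    also have "\<dots> = y * f y"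
      unfolding f_def by (rule suminf_mult[OF s1])
    finally show ?thesis by (simp add: algebra_simps)
  qed
  have it: "f (x * q ^ k) = (\<Prod>j<k. 1 - x * q ^ j) * f x" for k
  proof (induction k)
    case (Suc k)
    show ?case using step[of "x * q ^ k"] norm_mult_qpow_le[of x k] x Suc by (simp add: mult_ac)
  qed simp
  have "(\<lambda>k. f (x * q ^ k)) \<longlonglongrightarrow> c 0"
    unfolding f_def by (rule powser_qpow_tendsto[OF sm[OF x]])
  moreover have "(\<lambda>k. f (x * q ^ k)) \<longlonglongrightarrow> P x * f x"
    unfolding it by (intro tendsto_intros qpoch_LIMSEQ)
  ultimately have "P x * f x = 1" using LIMSEQ_unique by (fastforce simp: c_def)
  then have fx: "f x = 1 / P x" using qpoch_nonzero'[OF x] by (simp add: field_simps)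
  have "((\<lambda>n. c n * x ^ n) has_sum f x) UNIV"
    unfolding f_def by (rule norm_summable_imp_has_sum[OF sm[OF x]]) (use summable_norm_cancel[OF sm[OF x]] in \<open>simp add: summable_sums\<close>)
  then show ?thesis by (simp add: c_def fx)
qed

text \<open>The same method with f (y) = (1 - y) f (y q). The factor q^(n choose 2) decays faster
  than any geometric sequence, hence there is no bound on x.\<close>

lemma euler_qpoch: "((\<lambda>n. (-1) ^ n * q ^ (n choose 2) * x ^ n / qfac n) has_sum P x) UNIV"
proof -
  obtain K where K: "\<And>n. norm (1 / qfac n) \<le> K" using inverse_qfac_bounded by auto
  define c where "c n = (-1) ^ n * q ^ (n choose 2) / qfac n" for n
  define f where "f y = (\<Sum>n. c n * y ^ n)" for y
  have K0: "K \<ge> 0" using K[of 0] by simp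
  have cK: "norm (c n) \<le> K * norm q ^ (n choose 2)" for n
  proof -
    have "norm (c n) = norm (1 / qfac n) * norm q ^ (n choose 2)"
      by (simp add: c_def norm_mult norm_divide norm_power)
    then show ?thesis using K[of n] by (simp add: mult_right_mono)
  qed
  have sm: "summable (\<lambda>n. norm (c n * y ^ n))" for y
  proof (cases "y = 0")
    case True
    then show ?thesis by (intro summable_finite[of "{0}"]) auto
  next
    case False
    have ly: "(\<lambda>n. norm y * norm q ^ n) \<longlonglongrightarrow> norm y * 0"
      using q1 by (intro tendsto_intros LIMSEQ_power_zero) auto
    then have "eventually (\<lambda>n. norm y * norm q ^ n < 1 / 2) sequentially"
      by (intro order_tendstoD(2)) auto
    then obtain N where N: "\<And>n. n \<ge> N \<Longrightarrow> norm y * norm q ^ n < 1 / 2"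
      by (auto simp: eventually_sequentially)
    have "summable (\<lambda>n. norm q ^ (n choose 2) * norm y ^ n)"
    proof (rule summable_ratio_test[of "1/2" N])
      fix n assume n: "n \<ge> N"
      have "norm q ^ (Suc n choose 2) * norm y ^ Suc n = (norm q ^ (n choose 2) * norm y ^ n) * (norm y * norm q ^ n)"
        by (simp add: numeral_2_eq_2 power_add mult_ac)
      also have "\<dots> \<le> (norm q ^ (n choose 2) * norm y ^ n) * (1 / 2)"
        using N[OF n] by (intro mult_left_mono) auto
      finally show "norm (norm q ^ (Suc n choose 2) * norm y ^ Suc n) \<le> 1 / 2 * norm (norm q ^ (n choose 2) * norm y ^ n)"
        by simp
    qed simp
    then have "summable (\<lambda>n. K * (norm q ^ (n choose 2) * norm y ^ n))" by (rule summable_mult)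
    then show ?thesis
    proof (rule summable_comparison_test')
      show "norm (norm (c n * y ^ n)) \<le> K * (norm q ^ (n choose 2) * norm y ^ n)" for n
        using mult_right_mono[OF cK[of n], of "norm y ^ n"] by (simp add: norm_mult norm_power mult_ac)
    qed
  qed
  have step: "f y = (1 - y) * f (y * q)" for y
  proof -
    note s1 = summable_norm_cancel[OF sm[of y]] and s2 = summable_norm_cancel[OF sm[of "y * q"]]
    have "f y - f (y * q) = (\<Sum>n. c n * y ^ n - c n * (y * q) ^ n)"
      unfolding f_def by (rule suminf_diff[OF s1 s2])
    also have "\<dots> = (\<Sum>n. c (Suc n) * y ^ Suc n - c (Suc n) * (y * q) ^ Suc n)"
      by (subst suminf_split_head) (use summable_diff[OF s1 s2] in auto)
    also have "\<dots> = (\<Sum>n. - y * (c n * (y * q) ^ n))"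
    proof (rule suminf_cong)
      fix n
      have "c (Suc n) * (1 - q ^ Suc n) = - c n * q ^ n"
        using qfac_nonzero[of "Suc n"] qfac_nonzero[of n]
        by (simp add: c_def qfac_Suc numeral_2_eq_2 power_add field_simps)
      then have "y ^ Suc n * (c (Suc n) * (1 - q ^ Suc n)) = y ^ Suc n * (- c n * q ^ n)" by (simp only:)
      then show "c (Suc n) * y ^ Suc n - c (Suc n) * (y * q) ^ Suc n = - y * (c n * (y * q) ^ n)"
        by (simp add: power_mult_distrib algebra_simps)
    qed
    also have "\<dots> = - y * f (y * q)"
      unfolding f_def by (rule suminf_mult[OF s2])
    finally show ?thesis by (simp add: algebra_simps)
  qed
  have it: "f x = (\<Prod>j<k. 1 - x * q ^ j) * f (x * q ^ k)" for k
  proof (induction k)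
    case (Suc k)
    then show ?case using step[of "x * q ^ k"] by (simp add: mult_ac)
  qed simp
  have "(\<lambda>k. (\<Prod>j<k. 1 - x * q ^ j) * f (x * q ^ k)) \<longlonglongrightarrow> P x * c 0"
    unfolding f_def by (intro tendsto_mult powser_qpow_tendsto[OF sm] qpoch_LIMSEQ)
  then have "(\<lambda>k::nat. f x) \<longlonglongrightarrow> P x * c 0"
    by (simp only: it[symmetric])
  then have fx: "f x = P x" using LIMSEQ_unique[OF tendsto_const] by (fastforce simp: c_def numeral_2_eq_2)
  have "((\<lambda>n. c n * x ^ n) has_sum f x) UNIV"
    unfolding f_def by (rule norm_summable_imp_has_sum[OF sm]) (use summable_norm_cancel[OF sm] in \<open>simp add: summable_sums\<close>)
  then show ?thesis by (simp add: c_def fx)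
qed

end

section \<open>The theta function and its reciprocal\<close>

lemma powi_eq_exp: "x > 0 \<Longrightarrow> (x :: real) powi n = exp (of_int n * ln x)"
  using exp_power_int[of "ln x" n] by simp

lemma triangular_int: "2 * (n * (n - 1) div 2) = n * (n - 1)" for n :: int
  by (simp add: even_iff_mod_2_eq_zero[symmetric])

lemma real_triangular_int: "real_of_int (n * (n - 1) div 2) = of_int n * (of_int n - 1) / 2"
proof -
  have "2 * real_of_int (n * (n - 1) div 2) = of_int (2 * (n * (n - 1) div 2))"
    by (simp only: of_int_mult of_int_numeral)
  also have "\<dots> = of_int (n * (n - 1))" by (simp only: triangular_int)
  also have "\<dots> = of_int n * (of_int n - 1)" by simp
  finally show ?thesis by simp
qed

context nome_disc
begin

definition T :: "complex \<Rightarrow> complex" where "T x = P x * P (q / x)"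
text \<open>A product rather than (1 - x) / T x, so that the value at x = 1 is the removable one, 1
  / E^2; residues are read off from it.\<close>

definition W :: "complex \<Rightarrow> complex" where "W x = 1 / (P (x * q) * P (q / x))"

lemma T_q_div: "x \<noteq> 0 \<Longrightarrow> T (q / x) = T x"
  using q0 by (simp add: T_def mult.commute)

lemma T_eq: "T x = (1 - x) * P (x * q) * P (q / x)"
  unfolding T_def using qpoch_step[of x] by simp

lemma T_inverse: "x \<noteq> 0 \<Longrightarrow> T (1 / x) = - T x / x"
proof -
  assume x: "x \<noteq> 0"
  define k where "k = P (x * q) * P (q / x)"
  have "T (1 / x) = (1 - 1 / x) * k" "T x = (1 - x) * k"
    using T_eq[of "1 / x"] T_eq[of x] by (simp_all add: k_def mult_ac)
  then show ?thesis using x by (simp only:) (simp add: field_simps)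
qed

text \<open>The annulus around the unit circle that is bounded by the nearest poles of
  \<open>W\<close>. It is stable under inversion, and the only zero of \<open>T\<close> in it is x =
  1.\<close>

definition annulus :: "complex set" where "annulus = {x. norm q < norm x \<and> norm x < 1 / norm q}"

lemma annulus_nonzero: "x \<in> annulus \<Longrightarrow> x \<noteq> 0"
  unfolding annulus_def using q0 by auto

lemma annulusD: "x \<in> annulus \<Longrightarrow> norm (x * q) < 1" "x \<in> annulus \<Longrightarrow> norm (q / x) < 1"
proof -
  assume x: "x \<in> annulus"
  show "norm (x * q) < 1" using x q0 by (simp add: annulus_def norm_mult field_simps)
  have "norm x > 0" using annulus_nonzero[OF x] by simp
  then show "norm (q / x) < 1" using x by (simp add: annulus_def norm_divide)
qed

lemma one_in_annulus: "1 \<in> annulus"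
  using q0 q1 by (simp add: annulus_def field_simps)

lemma W_nonzero: "x \<in> annulus \<Longrightarrow> W x \<noteq> 0"
  unfolding W_def using annulusD qpoch_nonzero' by auto

lemma T_mult_W: "x \<in> annulus \<Longrightarrow> T x * W x = 1 - x"
  unfolding W_def T_eq using annulusD qpoch_nonzero' by auto

lemma W_eq: "x \<in> annulus \<Longrightarrow> x \<noteq> 1 \<Longrightarrow> W x = (1 - x) / T x"
  using T_mult_W[of x] by (auto simp: eq_divide_eq mult.commute)

lemma T_nonzero: "x \<in> annulus \<Longrightarrow> x \<noteq> 1 \<Longrightarrow> T x \<noteq> 0"
  using T_mult_W[of x] by auto

lemma W_inverse: "x \<noteq> 0 \<Longrightarrow> W (1 / x) = W x"
  by (simp add: W_def mult_ac)

lemma W_1: "W 1 = 1 / E\<^sup>2"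
  by (simp add: W_def E_def power2_eq_square)

definition ecoef :: "int \<Rightarrow> complex" where
  "ecoef i = (if i \<ge> 0 then q ^ nat i / qfac (nat i) else 0)"

lemma has_laurent_inverse_qpoch: "has_laurent (\<lambda>x. 1 / P (x * q)) annulus ecoef"
proof (rule has_laurentI)
  fix x assume x: "x \<in> annulus"
  have "((\<lambda>n. (x * q) ^ n / qfac n) has_sum (1 / P (x * q))) UNIV"
    by (rule euler_inverse_qpoch) (rule annulusD[OF x])
  also have "?this \<longleftrightarrow> ((\<lambda>n. ecoef n * x powi n) has_sum (1 / P (x * q))) {0..}"
    by (rule has_sum_reindex_bij_witness[where i=nat and j=int])
       (auto simp: ecoef_def power_mult_distrib)
  also have "\<dots> \<longleftrightarrow> ((\<lambda>n. ecoef n * x powi n) has_sum (1 / P (x * q))) UNIV"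
    by (rule has_sum_cong_neutral) (auto simp: ecoef_def)
  finally show "((\<lambda>n. ecoef n * x powi n) has_sum (1 / P (x * q))) UNIV" .
qed (rule annulus_nonzero)

definition M :: "int \<Rightarrow> complex" where "M = conv ecoef (\<lambda>n. ecoef (- n))"

lemma inverse_in_annulus: "x \<in> annulus \<Longrightarrow> 1 / x \<in> annulus"
  using annulus_nonzero[of x] q0 by (simp add: annulus_def norm_divide field_simps)

lemma has_laurent_W: "has_laurent W annulus M"
proof -
  have "has_laurent (\<lambda>x. 1 / P (1 / x * q)) annulus (\<lambda>n. ecoef (- n) * 1 powi (- n))"
    by (rule has_laurent_reflect[OF has_laurent_inverse_qpoch]) (auto intro: inverse_in_annulus)
  from has_laurent_mult[OF has_laurent_inverse_qpoch this] show ?thesis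
    unfolding M_def W_def by simp
qed

lemma M_minus [simp]: "M (- n) = M n"
proof -
  have "M (- n) = (\<Sum>\<^sub>\<infinity>j. ecoef j * ecoef (n + j))"
    by (simp add: M_def conv_def algebra_simps)
  also have "\<dots> = (\<Sum>\<^sub>\<infinity>j. ecoef j * ecoef (j - n))"
    by (rule infsum_reindex_bij_witness[of _ "\<lambda>j. j - n" "\<lambda>j. j + n"]) (auto simp: algebra_simps)
  finally show ?thesis by (simp add: M_def conv_def)
qed

definition theta_term :: "complex \<Rightarrow> int \<Rightarrow> complex" where
  "theta_term x n = (-1) powi n * q powi (n * (n - 1) div 2) * x powi n"

lemma theta_term_summable:
  assumes x: "x \<noteq> 0"
  shows "theta_term x summable_on UNIV"
proof (rule summable_on_int_gauss)
  show "- ln (norm q) / 2 > 0" using q0 q1 by simp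
  fix n :: int
  have "norm (theta_term x n) = norm q powi (n * (n - 1) div 2) * norm x powi n"
    by (simp add: theta_term_def norm_mult norm_power_int)
  also have "\<dots> = exp (of_int n * (of_int n - 1) / 2 * ln (norm q) + of_int n * ln (norm x))"
    using q0 x by (simp add: powi_eq_exp exp_add real_triangular_int)
  also have "\<dots> \<le> exp (- (- ln (norm q) / 2) * (of_int n)\<^sup>2 + (- ln (norm q) / 2 + \<bar>ln (norm x)\<bar>) * \<bar>of_int n\<bar>)"
  proof -
    have "of_int n * ln (norm x) \<le> \<bar>ln (norm x)\<bar> * \<bar>of_int n\<bar>"
      using abs_ge_self[of "of_int n * ln (norm x)"] by (simp add: abs_mult mult.commute)
    moreover have "of_int n * ln (norm q) / (-2) \<le> - ln (norm q) / 2 * \<bar>of_int n\<bar>"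
      using abs_ge_self[of "of_int n * (- ln (norm q) / 2)"] q0 q1 by (simp add: abs_mult mult.commute)
    ultimately show ?thesis
      by (simp add: algebra_simps power2_eq_square diff_divide_distrib)
  qed
  finally show "norm (theta_term x n) \<le> 1 * exp (- (- ln (norm q) / 2) * (of_int n)\<^sup>2
      + (- ln (norm q) / 2 + \<bar>ln (norm x)\<bar>) * \<bar>of_int n\<bar>)" by simp
qed

text \<open>Andrews' proof: expand \<open>(x;q)\<^sub>\<infinity>\<close> and then each \<open>(q\<^sup>n\<^sup>+\<^sup>1;q)\<^sub>\<infinity>\<close> by Euler's series; the terms with
  \<open>n < 0\<close> may be added freely because those products vanish.\<close>

lemma jacobi_triple_product:
  assumes x: "norm q < norm x"
  shows "(theta_term x has_sum (E * T x)) UNIV"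
proof -
  have x0: "x \<noteq> 0" using x by auto
  have qx: "norm (q / x) < 1" using x x0 by (simp add: norm_divide)
  obtain \<Theta> where th: "(theta_term x has_sum \<Theta>) UNIV"
    using theta_term_summable[OF x0] by (auto simp: summable_on_def)
  have "((\<lambda>(N, m). theta_term x N * ((q / x) ^ m / qfac m)) has_sum (\<Theta> * (1 / P (q / x)))) (UNIV \<times> UNIV)"
    by (rule has_sum_product[OF th euler_inverse_qpoch[OF qx]])
  also have "?this \<longleftrightarrow> ((\<lambda>(n, m). theta_term x n * ((-1) ^ m * q ^ (m choose 2) * (q powi (n + 1)) ^ m / qfac m))
      has_sum (\<Theta> * (1 / P (q / x)))) (UNIV \<times> UNIV)"
  proof (rule has_sum_reindex_bij_witness[where i="\<lambda>(n, m). (n + int m, m)" and j="\<lambda>(N, m). (N - int m, m)"], goal_cases)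
    case (5 a)
    obtain N m where a: "a = (N, m)" by (cases a)
    define n where "n = N - int m"
    have ch: "int (m choose 2) = int m * (int m - 1) div 2"
    proof (cases m)
      case (Suc k)
      then show ?thesis by (simp add: choose_two zdiv_int algebra_simps)
    qed (simp add: numeral_2_eq_2)
    \<comment> \<open>The exponent identity is checked after doubling, where
      \<open>triangular_int\<close> removes the divisions by two.\<close>
    have "2 * (N * (N - 1) div 2 + int m) = 2 * (n * (n - 1) div 2 + int m * (int m - 1) div 2 + (n + 1) * int m)"
      unfolding distrib_left triangular_int by (simp add: n_def algebra_simps)
    then have ex: "N * (N - 1) div 2 + int m = n * (n - 1) div 2 + int (m choose 2) + (n + 1) * int m"
      unfolding ch by (subst (asm) mult_cancel_left) simp
    have pw: "(q powi (n + 1)) ^ m = q powi ((n + 1) * int m)"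
      by (simp add: power_int_mult)
    have "q powi (N * (N - 1) div 2) * q ^ m = q powi (N * (N - 1) div 2 + int m)"
      using q0 by (simp add: power_int_add)
    also have "\<dots> = q powi (n * (n - 1) div 2) * q ^ (m choose 2) * (q powi (n + 1)) ^ m"
      unfolding ex pw using q0 by (simp add: power_int_add del: of_nat_mult)
    finally have e1: "q powi (N * (N - 1) div 2) * q ^ m = \<dots>" .
    have e2: "x powi N = x powi n * x ^ m" and e3: "(-1 :: complex) powi N = (-1) powi n * (-1) ^ m"
      using x0 by (simp_all add: n_def power_int_diff power_int_minus_one_mult_self field_simps flip: power_mult_distrib)
    have "theta_term x N * ((q / x) ^ m / qfac m) = (-1) powi N * (x powi N / x ^ m) * (q powi (N * (N - 1) div 2) * q ^ m) / qfac m"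
      by (simp add: theta_term_def power_divide)
    also have "\<dots> = theta_term x n * ((-1) ^ m * q ^ (m choose 2) * (q powi (n + 1)) ^ m / qfac m)"
      unfolding e1 e2 e3 theta_term_def using x0 by simp
    finally show ?case unfolding a prod.case n_def[symmetric] by (rule sym)
  qed auto
  finally have dbl: "((\<lambda>(n, m). theta_term x n * ((-1) ^ m * q ^ (m choose 2) * (q powi (n + 1)) ^ m / qfac m))
      has_sum (\<Theta> * (1 / P (q / x)))) (UNIV \<times> UNIV)" .
  have "((\<lambda>n. theta_term x n * P (q powi (n + 1))) has_sum (\<Theta> * (1 / P (q / x)))) UNIV"
  proof (rule has_sum_SigmaD[OF dbl])
    show "((\<lambda>m. case (n, m) of (n, m) \<Rightarrow> theta_term x n * ((-1) ^ m * q ^ (m choose 2) * (q powi (n + 1)) ^ m / qfac m))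
      has_sum theta_term x n * P (q powi (n + 1))) UNIV" for n
      unfolding prod.case by (rule has_sum_cmult_right[OF euler_qpoch])
  qed
  also have "?this \<longleftrightarrow> ((\<lambda>n. theta_term x n * P (q powi (n + 1))) has_sum (\<Theta> * (1 / P (q / x)))) {0..}"
  proof (rule has_sum_cong_neutral)
    show "theta_term x n * P (q powi (n + 1)) = 0" if "n \<in> UNIV - {0..}" for n
      using qpoch_powi_nonpos[of "nat (- n - 1)"] that by (simp add: algebra_simps)
  qed auto
  also have "\<dots> \<longleftrightarrow> ((\<lambda>n. E * ((-1) ^ n * q ^ (n choose 2) * x ^ n / qfac n)) has_sum (\<Theta> * (1 / P (q / x)))) UNIV"
  proof (rule has_sum_reindex_bij_witness[where j=nat and i=int])
    show "E * ((-1) ^ nat n * q ^ (nat n choose 2) * x ^ nat n / qfac (nat n)) = theta_term x n * P (q powi (n + 1))"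
      if n: "n \<in> {0..}" for n
    proof -
      obtain k where k: "n = int k" using n nonneg_int_cases by auto
      have "P (q ^ Suc k) = E / qfac k" using qpoch_qpower[of k] qfac_nonzero[of k] by (simp add: field_simps)
      moreover have "q powi (n + 1) = q ^ Suc k" unfolding k by (metis of_nat_Suc add.commute power_int_of_nat)
      moreover have "n * (n - 1) div 2 = int (k choose 2)"
      proof (cases k)
        case (Suc j)
        then show ?thesis by (simp add: k choose_two zdiv_int algebra_simps)
      qed (simp add: k numeral_2_eq_2)
      ultimately show ?thesis by (simp add: theta_term_def k)
    qed
  qed auto
  finally have "((\<lambda>n. E * ((-1) ^ n * q ^ (n choose 2) * x ^ n / qfac n)) has_sum (\<Theta> * (1 / P (q / x)))) UNIV" .
  moreover have "((\<lambda>n. E * ((-1) ^ n * q ^ (n choose 2) * x ^ n / qfac n)) has_sum (E * P x)) UNIV"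
    by (rule has_sum_cmult_right[OF euler_qpoch])
  ultimately have "\<Theta> * (1 / P (q / x)) = E * P x" by (rule has_sum_unique)
  then have "\<Theta> = E * T x"
    using qpoch_nonzero'[OF qx] by (simp add: T_def field_simps)
  then show ?thesis using th by simp
qed

end

section \<open>Second moments\<close>

lemma has_sum_convolution_weight:
  fixes c d :: "int \<Rightarrow> complex"
  assumes "((\<lambda>(j, k). w (j + k) * (c j * d k)) has_sum s) UNIV"
  shows "((\<lambda>i. w i * conv c d i) has_sum s) UNIV"
proof -
  have "((\<lambda>(i, j). w i * (c j * d (i - j))) has_sum s) (UNIV \<times> UNIV)"
  proof (subst has_sum_reindex_bij_witness[where i="\<lambda>(j, k). (j + k, j)" and j="\<lambda>(i, j). (j, i - j)"
        and h="\<lambda>(j, k). w (j + k) * (c j * d k)" and T=UNIV and s'=s])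
    show "((\<lambda>(j, k). w (j + k) * (c j * d k)) has_sum s) UNIV" by fact
  qed auto
  then show ?thesis
  proof (rule has_sum_SigmaD)
    fix i
    have "(\<lambda>j. w i * (c j * d (i - j))) summable_on UNIV"
      using summable_on_SigmaD1[OF has_sum_imp_summable
        [OF \<open>((\<lambda>(i, j). w i * (c j * d (i - j))) has_sum s) (UNIV \<times> UNIV)\<close>], of i] by simp
    then have "((\<lambda>j. w i * (c j * d (i - j))) has_sum w i * conv c d i) UNIV"
      by (simp add: has_sum_iff conv_def infsum_cmult_right')
    then show "((\<lambda>j. case (i, j) of (i, j) \<Rightarrow> w i * (c j * d (i - j))) has_sum w i * conv c d i) UNIV"
      by simp
  qed
qed

text \<open>For an even Laurent series on the unit circle these are its value at 1 and the value
  there of its second derivative under z d/dz: all that a pole of order at most three at 1 can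
  see.\<close>

definition moments :: "(int \<Rightarrow> complex) \<Rightarrow> complex \<Rightarrow> complex \<Rightarrow> bool" where
  "moments c m0 m2 \<longleftrightarrow> (\<forall>n. c (- n) = c n) \<and> (c has_sum m0) UNIV \<and> ((\<lambda>n. (of_int n)\<^sup>2 * c n) has_sum m2) UNIV"

text \<open>The first moment exists because |n| \<le> n^2 for integers, and n -> - n then turns it
  into its negative.\<close>

lemma moments_odd:
  assumes "moments c m0 m2"
  shows "((\<lambda>n. of_int n * c n) has_sum 0) UNIV"
proof -
  have "(\<lambda>n. (of_int n)\<^sup>2 * c n) summable_on UNIV"
    using assms by (auto simp: moments_def dest: has_sum_imp_summable)
  then have "(\<lambda>n. norm ((of_int n)\<^sup>2 * c n)) summable_on UNIV"
    by (simp add: summable_on_iff_abs_summable_on_complex)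
  then have "(\<lambda>n. norm (of_int n * c n)) summable_on UNIV"
  proof (rule summable_on_comparison_test)
    fix n :: int
    have "\<bar>n\<bar> * 1 \<le> \<bar>n\<bar> * \<bar>n\<bar>" 
      using mult_left_mono[of 1 "\<bar>n\<bar>" "\<bar>n\<bar>"] by (cases "n = 0") auto
    then have "\<bar>n\<bar> \<le> n\<^sup>2" by (simp add: power2_eq_square flip: abs_mult)
    then have "\<bar>real_of_int n\<bar> \<le> (real_of_int n)\<^sup>2" by (metis of_int_abs of_int_le_iff of_int_power)
    then show "norm (of_int n * c n) \<le> norm ((of_int n)\<^sup>2 * c n)"
      by (auto simp: norm_mult norm_power intro!: mult_right_mono)
  qed auto
  from Infinite_Sum.abs_summable_summable[OF this]
  obtain s where s: "((\<lambda>n. of_int n * c n) has_sum s) UNIV"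
    by (auto simp: summable_on_def)
  then have "((\<lambda>n. - (of_int n * c n)) has_sum s) UNIV"
    by (subst has_sum_reindex_bij_witness[where i=uminus and j=uminus and h="\<lambda>n. of_int n * c n" and T=UNIV and s'=s])
       (use assms in \<open>auto simp: moments_def\<close>)
  then have "- s = s" using has_sum_uminusI[OF s] has_sum_unique by blast
  then show ?thesis using s by (simp add: equal_neg_zero)
qed

text \<open>Leibniz rule: in (j + k)^2 = j^2 + 2 j k + k^2 the mixed term sums to a product of first
  moments, which vanish by evenness.\<close>

lemma moments_conv:
  assumes c: "moments c m0 m2" and d: "moments d n0 n2"
  shows "moments (conv c d) (m0 * n0) (m2 * n0 + m0 * n2)"
proof -
  have c0: "(c has_sum m0) UNIV" and c2: "((\<lambda>n. (of_int n)\<^sup>2 * c n) has_sum m2) UNIV"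
    and d0: "(d has_sum n0) UNIV" and d2: "((\<lambda>n. (of_int n)\<^sup>2 * d n) has_sum n2) UNIV"
    using assms by (auto simp: moments_def)
  note c1 = moments_odd[OF c] and d1 = moments_odd[OF d]
  have "conv c d (- n) = conv c d n" for n
    unfolding conv_def
  proof (rule infsum_reindex_bij_witness[of _ uminus uminus])
    show "c (- a) * d (n - - a) = c a * d (- n - a)" for a
    proof -
      have "d (- n - a) = d (n + a)" using d unfolding moments_def by (metis minus_add_distrib diff_conv_add_uminus)
      then show ?thesis using c by (simp add: moments_def)
    qed
  qed auto
  moreover have "(conv c d has_sum m0 * n0) UNIV"
    using has_sum_convolution_weight[of "\<lambda>_. 1" c d] has_sum_product[OF c0 d0] by simp
  moreover have "((\<lambda>n. (of_int n)\<^sup>2 * conv c d n) has_sum (m2 * n0 + m0 * n2)) UNIV"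
  proof (rule has_sum_convolution_weight)
    have "((\<lambda>p. (case p of (j, k) \<Rightarrow> (of_int j)\<^sup>2 * c j * d k) + 2 * (case p of (j, k) \<Rightarrow> (of_int j * c j) * (of_int k * d k))
            + (case p of (j, k) \<Rightarrow> c j * ((of_int k)\<^sup>2 * d k))) has_sum (m2 * n0 + 2 * (0 * 0) + m0 * n2)) (UNIV \<times> UNIV)"
      by (intro has_sum_add has_sum_cmult_right has_sum_product c0 c1 c2 d0 d1 d2)
    then show "((\<lambda>(j, k). (of_int (j + k))\<^sup>2 * (c j * d k)) has_sum (m2 * n0 + m0 * n2)) UNIV"
      by (simp add: case_prod_unfold power2_eq_square algebra_simps)
  qed
  ultimately show ?thesis by (simp add: moments_def)
qed

lemma moments_dilate2:
  assumes "moments c m0 m2"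
  shows "moments (\<lambda>n. if even n then c (n div 2) else 0) m0 (4 * m2)"
proof -
  have *: "((\<lambda>n. w n * (if even n then c (n div 2) else 0)) has_sum s) UNIV"
    if "((\<lambda>n. w (2 * n) * c n) has_sum s) UNIV" for w :: "int \<Rightarrow> complex" and s
  proof -
    have "((\<lambda>n. w n * (if even n then c (n div 2) else 0)) has_sum s) {n. even n}"
      by (subst has_sum_reindex_bij_witness[where i="\<lambda>n. 2 * n" and j="\<lambda>n. n div 2" and h="\<lambda>n. w (2 * n) * c n" and T=UNIV and s'=s])
         (use that in auto)
    then show ?thesis by (subst has_sum_cong_neutral[where T="{n. even n}"]) auto
  qed
  have "c (- n div 2) = c (n div 2)" if "even n" for n
  proof -
    have "- n div 2 = - (n div 2)" using that by presburger
    then show ?thesis using assms by (simp add: moments_def)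
  qed
  moreover have "((\<lambda>n. if even n then c (n div 2) else 0) has_sum m0) UNIV"
    using *[of "\<lambda>_. 1"] assms by (simp add: moments_def)
  moreover have "((\<lambda>n. (of_int n)\<^sup>2 * (if even n then c (n div 2) else 0)) has_sum (4 * m2)) UNIV"
  proof (rule *)
    have "((\<lambda>n. 4 * ((of_int n)\<^sup>2 * c n)) has_sum (4 * m2)) UNIV"
      using assms by (intro has_sum_cmult_right) (simp add: moments_def)
    then show "((\<lambda>n. (of_int (2 * n))\<^sup>2 * c n) has_sum (4 * m2)) UNIV"
      by (simp add: power_mult_distrib mult.assoc)
  qed
  ultimately show ?thesis by (simp add: moments_def)
qed

lemma has_sum_even_int:
  fixes g :: "int \<Rightarrow> complex"
  assumes "(g has_sum s) UNIV" "\<And>n. g (- n) = g n" "g 0 = 0"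
  shows "(\<lambda>n. g (int n)) sums (s / 2)"
proof -
  have s: "g summable_on UNIV" using assms(1) by (rule has_sum_imp_summable)
  obtain t where t: "(g has_sum t) {0..}"
    using summable_on_subset_banach[OF s, of "{0..}"] by (auto simp: summable_on_def)
  have "(g has_sum t) {..0}"
    by (subst has_sum_reindex_bij_witness[where i=uminus and j=uminus and h=g and T="{0..}" and s'=t])
       (use t assms in auto)
  then have "(g has_sum t) {..<0}"
    by (subst has_sum_cong_neutral[where T="{..0}"]) (use assms in auto)
  moreover have "{0::int..} \<inter> {..<0} = {}" by auto
  ultimately have "(g has_sum (t + t)) ({0..} \<union> {..<0})"
    by (rule has_sum_Un_disjoint[OF t])
  also have "{0..} \<union> {..<0} = (UNIV :: int set)" by auto
  finally have "t + t = s" using assms(1) has_sum_unique by blast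
  then have t2: "t = s / 2" by (metis mult_2 nonzero_mult_div_cancel_left zero_neq_numeral)
  have "((\<lambda>n. g (int n)) has_sum t) UNIV"
    by (subst has_sum_reindex_bij_witness[where i=nat and j=int and h=g and T="{0..}" and s'=t])
       (use t in auto)
  then show ?thesis unfolding t2 by (rule has_sum_imp_sums)
qed

text \<open>After expansion only monomials of degree at least two are left; bounding them one by one
  gives the same expression in the norms, and 1 + x \<le> exp x finishes.\<close>

lemma norm_prod_minus_1_minus_sum_le:
  fixes a :: "nat \<Rightarrow> complex"
  shows "norm ((\<Prod>k<n. 1 + a k) - 1 - (\<Sum>k<n. a k)) \<le> exp (\<Sum>k<n. norm (a k)) - 1 - (\<Sum>k<n. norm (a k))"
proof -
  have "norm ((\<Prod>k<n. 1 + a k) - 1 - (\<Sum>k<n. a k)) \<le> (\<Prod>k<n. 1 + norm (a k)) - 1 - (\<Sum>k<n. norm (a k))"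
  proof (induction n)
    case (Suc n)
    have "(\<Prod>k<Suc n. 1 + a k) - 1 - (\<Sum>k<Suc n. a k) =
        ((\<Prod>k<n. 1 + a k) - 1 - (\<Sum>k<n. a k)) + ((\<Prod>k<n. 1 + a k) - 1) * a n"
      by (simp add: algebra_simps)
    also have "norm \<dots> \<le> norm ((\<Prod>k<n. 1 + a k) - 1 - (\<Sum>k<n. a k)) + norm ((\<Prod>k<n. 1 + a k) - 1) * norm (a n)"
      by (metis norm_triangle_ineq norm_mult)
    also have "\<dots> \<le> ((\<Prod>k<n. 1 + norm (a k)) - 1 - (\<Sum>k<n. norm (a k))) + ((\<Prod>k<n. 1 + norm (a k)) - 1) * norm (a n)"
      by (intro add_mono Suc.IH mult_right_mono norm_prod_minus1_le_prod_minus1) auto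
    also have "\<dots> = (\<Prod>k<Suc n. 1 + norm (a k)) - 1 - (\<Sum>k<Suc n. norm (a k))"
      by (simp add: algebra_simps)
    finally show ?case .
  qed simp
  also have "(\<Prod>k<n. 1 + norm (a k)) \<le> exp (\<Sum>k<n. norm (a k))"
    by (rule prod_le_exp_sum) auto
  finally show ?thesis by simp
qed

section \<open>The second moment of \<open>M\<close> and the Lambert series behind
  \<open>E2\<close>\<close>

context nome_disc
begin

text \<open>Convergence on two circles, one on each side of the unit circle, forces geometric decay
  of c in both directions, which beats n^2.\<close>

lemma has_laurent_summable_square:
  assumes c: "has_laurent f annulus c"
  shows "(\<lambda>n. (of_int n)\<^sup>2 * c n) summable_on UNIV"
proof -
  \<comment> \<open>The radius |q|^(1/2) and its inverse both lie strictly inside the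
    annulus.\<close>
  define b where "b = sqrt (norm q)"
  have b: "b > 0" "b < 1" using q0 q1 by (auto simp: b_def)
  have bq: "norm q = b * b" by (simp add: b_def)
  have m: "of_real b \<in> annulus" "1 / of_real b \<in> annulus"
    using b mult_strict_mono[of b 1 b 1] mult_strict_mono[of b 1 "b * b" 1]
    by (auto simp: annulus_def bq norm_divide field_simps)
  have 1: "(\<lambda>n. norm (c n) * b powi n) summable_on UNIV"
    using has_sum_imp_summable[OF has_laurentD(2)[OF c m(1)]] b
    by (simp add: summable_on_iff_abs_summable_on_complex norm_mult norm_power_int)
  have 2: "(\<lambda>n. norm (c n) * (1 / b) powi n) summable_on UNIV"
    using has_sum_imp_summable[OF has_laurentD(2)[OF c m(2)]] b
    by (simp add: summable_on_iff_abs_summable_on_complex norm_mult norm_power_int norm_divide)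
  define \<beta> where "\<beta> = - ln b"
  have \<beta>: "\<beta> > 0" using b by (simp add: \<beta>_def)
  have "(\<lambda>n. norm ((of_int n)\<^sup>2 * c n)) summable_on UNIV"
  proof (rule summable_on_comparison_test)
    show "(\<lambda>n. 4 / \<beta>\<^sup>2 * (norm (c n) * b powi n + norm (c n) * (1 / b) powi n)) summable_on UNIV"
      by (intro summable_on_cmult_right summable_on_add 1 2)
    fix n :: int
    have "\<beta> * \<bar>n\<bar> / 2 \<le> exp (\<beta> * \<bar>n\<bar> / 2)"
      using exp_ge_add_one_self[of "\<beta> * \<bar>n\<bar> / 2"] by linarith
    then have "(\<beta> * \<bar>n\<bar> / 2)\<^sup>2 \<le> (exp (\<beta> * \<bar>n\<bar> / 2))\<^sup>2"
      using \<beta> by (intro power_mono) auto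
    also have "\<dots> = exp (\<beta> * \<bar>n\<bar>)" by (simp add: power2_eq_square flip: exp_add)
    also have "\<dots> \<le> b powi n + (1 / b) powi n"
      using b by (auto simp: powi_eq_exp \<beta>_def ln_div abs_if mult.commute)
    finally have "(of_int n)\<^sup>2 \<le> 4 / \<beta>\<^sup>2 * (b powi n + (1 / b) powi n)"
      using \<beta> by (simp add: field_simps power2_eq_square)
    from mult_right_mono[OF this, of "norm (c n)"]
    show "norm ((of_int n)\<^sup>2 * c n) \<le> 4 / \<beta>\<^sup>2 * (norm (c n) * b powi n + norm (c n) * (1 / b) powi n)"
      by (simp add: norm_mult norm_power algebra_simps add_divide_distrib)
  qed auto
  then show ?thesis by (rule Infinite_Sum.abs_summable_summable)
qed

definition yterm :: "nat \<Rightarrow> complex" where "yterm k = q ^ Suc k / (1 - q ^ Suc k)\<^sup>2"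
text \<open>The Lambert series of the sum-of-divisors function, so that \<open>E2\<close> is 1 - 24
  Y.\<close>

definition Y :: complex where "Y = (\<Sum>k. yterm k)"

lemma one_minus_q_power_nz: "1 - q ^ Suc k \<noteq> 0"
  using qfac_nonzero[of "Suc k"] by (auto simp: qfac_Suc)

lemma yterm_summable: "summable (\<lambda>k. norm (yterm k))"
proof (rule summable_comparison_test')
  show "summable (\<lambda>k. norm q ^ Suc k / (1 - norm q)\<^sup>2)"
    using q1 by (intro summable_divide) (simp add: summable_geometric)
  fix k
  have "norm (q ^ Suc k) \<le> norm q" using norm_mult_qpow_le[of q k] by simp
  then have "1 - norm q \<le> norm (1 - q ^ Suc k)"
    using norm_triangle_ineq2[of 1 "q ^ Suc k"] by simp
  then have "(1 - norm q)\<^sup>2 \<le> norm (1 - q ^ Suc k) ^ 2"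
    using q1 by (intro power_mono) auto
  then have "norm (yterm k) \<le> norm q ^ Suc k / (1 - norm q)\<^sup>2"
    using q1 unfolding yterm_def norm_divide norm_power
    by (intro divide_left_mono mult_pos_pos) (use one_minus_q_power_nz[of k] in auto)
  then show "norm (norm (yterm k)) \<le> norm q ^ Suc k / (1 - norm q)\<^sup>2" by simp
qed

text \<open>When the factors belonging to v and 1 / v are paired, each quotient becomes 1 - s *
  \<open>yterm k\<close> with one and the same s = v + 1 / v - 2, so the product is 1 - s Y up to O
  (s^2).\<close>

lemma inverse_W_second_order:
  assumes v: "norm v = 1" and A: "norm (v + 1 / v - 2) * (\<Sum>k. norm (yterm k)) \<le> 1"
  shows "norm (P (v * q) * P (q / v) / E\<^sup>2 - 1 + (v + 1 / v - 2) * Y) \<le> (norm (v + 1 / v - 2) * (\<Sum>k. norm (yterm k)))\<^sup>2"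
proof -
  define s where "s = v + 1 / v - 2"
  define Y' where "Y' = (\<Sum>k. norm (yterm k))"
  have v0: "v \<noteq> 0" using v by auto
  have Y'0: "Y' \<ge> 0" unfolding Y'_def by (intro suminf_nonneg yterm_summable) auto
  have fac: "(1 - v * q * q ^ k) * (1 - q / v * q ^ k) / (1 - q * q ^ k)\<^sup>2 = 1 + - s * yterm k" for k
  proof -
    define Q where "Q = q * q ^ k"
    have Q: "1 - Q \<noteq> 0" using one_minus_q_power_nz[of k] by (simp add: Q_def)
    have "(1 - v * Q) * (1 - Q / v) = (1 - Q)\<^sup>2 - s * Q"
      using v0 by (simp add: s_def field_simps power2_eq_square)
    then have "(1 - v * Q) * (1 - Q / v) / (1 - Q)\<^sup>2 = 1 + - s * (Q / (1 - Q)\<^sup>2)"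
      using Q by (simp add: diff_divide_distrib)
    then show ?thesis by (simp add: Q_def yterm_def mult.assoc)
  qed
  have "(\<lambda>n. (\<Prod>k<n. 1 + - s * yterm k) - 1 - (\<Sum>k<n. - s * yterm k)) \<longlonglongrightarrow> P (v * q) * P (q / v) / E\<^sup>2 - 1 - - s * Y"
  proof (intro tendsto_intros)
    have "(\<lambda>n. (\<Prod>k<n. 1 - v * q * q ^ k) * (\<Prod>k<n. 1 - q / v * q ^ k) / (\<Prod>k<n. 1 - q * q ^ k)\<^sup>2) \<longlonglongrightarrow> P (v * q) * P (q / v) / (P q)\<^sup>2"
      by (intro tendsto_intros qpoch_LIMSEQ) (use E_nonzero in \<open>auto simp: E_def\<close>)
    then show "(\<lambda>n. \<Prod>k<n. 1 + - s * yterm k) \<longlonglongrightarrow> P (v * q) * P (q / v) / E\<^sup>2"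
      by (simp only: fac[symmetric] prod_dividef prod.distrib prod_power_distrib E_def)
    have "(\<lambda>n. - s * (\<Sum>k<n. yterm k)) \<longlonglongrightarrow> - s * Y"
      unfolding Y_def by (intro tendsto_intros summable_LIMSEQ summable_norm_cancel[OF yterm_summable])
    then show "(\<lambda>n. \<Sum>k<n. - s * yterm k) \<longlonglongrightarrow> - s * Y"
      by (simp only: sum_distrib_left)
  qed
  then have "(\<lambda>n. norm ((\<Prod>k<n. 1 + - s * yterm k) - 1 - (\<Sum>k<n. - s * yterm k))) \<longlonglongrightarrow> norm (P (v * q) * P (q / v) / E\<^sup>2 - 1 - - s * Y)"
    by (rule tendsto_norm)
  then have "norm (P (v * q) * P (q / v) / E\<^sup>2 - 1 - - s * Y) \<le> (norm s * Y')\<^sup>2"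
  proof (rule LIMSEQ_le_const2, intro exI allI impI)
    fix n :: nat
    define t where "t = (\<Sum>k<n. norm (- s * yterm k))"
    have "t = norm s * (\<Sum>k<n. norm (yterm k))" by (simp add: t_def norm_mult sum_distrib_left)
    also have "\<dots> \<le> norm s * Y'" unfolding Y'_def
      by (intro mult_left_mono sum_le_suminf yterm_summable) auto
    finally have t: "t \<le> norm s * Y'" .
    have t0: "t \<ge> 0" by (auto simp: t_def intro: sum_nonneg)
    have "norm ((\<Prod>k<n. 1 + - s * yterm k) - 1 - (\<Sum>k<n. - s * yterm k)) \<le> exp t - 1 - t"
      unfolding t_def by (rule norm_prod_minus_1_minus_sum_le)
    also have "\<dots> \<le> t\<^sup>2" using exp_bound[of t] t t0 A by (simp add: s_def Y'_def)
    also have "\<dots> \<le> (norm s * Y')\<^sup>2" using t t0 by (intro power_mono)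
    finally show "norm ((\<Prod>k<n. 1 + - s * yterm k) - 1 - (\<Sum>k<n. - s * yterm k)) \<le> (norm s * Y')\<^sup>2" .
  qed
  then show ?thesis unfolding s_def[symmetric] Y'_def[symmetric] by simp
qed

text \<open>W (v) - W (1) is evaluated in two ways as v tends to 1 on the unit circle: from the
  Laurent series, pairing n with - n, and from the product. Division by s = v + 1 / v - 2 gives half
  the second moment on one side and Y / E^2 on the other.\<close>

lemma second_moment_M: "((\<lambda>n. (of_int n)\<^sup>2 * M n) has_sum (2 * Y / E\<^sup>2)) UNIV"
proof -
  obtain S2 where S2: "((\<lambda>n. (of_int n)\<^sup>2 * M n) has_sum S2) UNIV"
    using has_laurent_summable_square[OF has_laurent_W] by (auto simp: summable_on_def)
  have S2': "(\<lambda>n. (of_nat n)\<^sup>2 * M (int n)) sums (S2 / 2)"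
    using has_sum_even_int[OF S2] by simp
  define v where "v N = cis (1 / real (Suc N))" for N
  define s where "s N = v N + 1 / v N - 2" for N
  \<comment> \<open>v^n + v^(- n) - 2 is s times this expression, which tends to n^2 and is bounded
    by n^2 on the unit circle, as Tannery's theorem requires.\<close>
  define kap where "kap n z = (\<Sum>j<n. z ^ j)\<^sup>2 * z / z ^ n" for n and z :: complex
  have nv: "norm (v N) = 1" and v0: "v N \<noteq> 0" for N by (auto simp: v_def)
  have v1: "v N \<noteq> 1" for N
  proof
    assume "v N = 1"
    then have "sin (1 / real (Suc N)) = 0" by (simp add: v_def cis.ctr complex_eq_iff)
    moreover have "1 / real (Suc N) \<le> 1" by simp
    then have "1 / real (Suc N) < pi" using pi_gt3 by linarith
    then have "sin (1 / real (Suc N)) > 0" by (intro sin_gt_zero) auto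
    ultimately show False by simp
  qed
  have s_eq: "s N = (v N - 1)\<^sup>2 / v N" for N using v0[of N] by (simp add: s_def field_simps power2_eq_square)
  have s0: "s N \<noteq> 0" for N using v1[of N] v0[of N] by (simp add: s_eq)
  have kap: "v N ^ n + 1 / v N ^ n - 2 = s N * kap n (v N)" for n N
  proof -
    have "(v N - 1) * (\<Sum>j<n. v N ^ j) = v N ^ n - 1" by (rule power_diff_1_eq[symmetric])
    then have "s N * kap n (v N) = (v N ^ n - 1)\<^sup>2 / v N ^ n"
      using v0[of N] unfolding s_eq kap_def by (simp add: power_mult_distrib[symmetric])
    then show ?thesis using v0[of N] by (simp add: field_simps power2_eq_square)
  qed
  have v_lim: "v \<longlonglongrightarrow> 1"
  proof -
    have "(\<lambda>N. cis (1 / real (Suc N))) \<longlonglongrightarrow> cis 0"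
      by (intro tendsto_intros LIMSEQ_Suc[OF lim_1_over_n])
    then show ?thesis by (simp add: v_def[abs_def])
  qed
  have s_lim: "s \<longlonglongrightarrow> 0"
    unfolding s_def using tendsto_diff[OF tendsto_add[OF v_lim tendsto_divide[OF tendsto_const[of 1] v_lim]] tendsto_const[of 2]] by simp
  have Weq: "(\<Sum>n. M (int n) * kap n (v N)) = (W (v N) - W 1) / s N" for N
  proof -
    have vin: "v N \<in> annulus" "1 / v N \<in> annulus" using nv q0 q1 by (auto simp: annulus_def norm_divide field_simps)
    have h1: "((\<lambda>n. M n * v N powi n) has_sum W (v N)) UNIV" and h0: "((\<lambda>n. M n * 1 powi n) has_sum W 1) UNIV"
      and h2: "((\<lambda>n. M n * (1 / v N) powi n) has_sum W (v N)) UNIV"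
      using has_laurentD(2)[OF has_laurent_W] vin one_in_annulus W_inverse[OF v0] by metis+
    have "((\<lambda>n. M n * v N powi n + M n * (1 / v N) powi n + - 2 * (M n * 1 powi n)) has_sum (W (v N) + W (v N) + - 2 * W 1)) UNIV"
      by (intro has_sum_add has_sum_cmult_right h0 h1 h2)
    then have "(\<lambda>n. M (int n) * v N powi int n + M (int n) * (1 / v N) powi int n + - 2 * (M (int n) * 1 powi int n)) sums ((W (v N) + W (v N) + - 2 * W 1) / 2)"
      by (rule has_sum_even_int) (auto simp: power_int_minus divide_inverse power_int_inverse)
    also have "(W (v N) + W (v N) + - 2 * W 1) / 2 = W (v N) - W 1" by simp
    finally have "(\<lambda>n. M (int n) * (s N * kap n (v N))) sums (W (v N) - W 1)"
      by (simp add: kap[symmetric] power_divide algebra_simps)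
    then have "(\<lambda>n. M (int n) * (s N * kap n (v N)) / s N) sums ((W (v N) - W 1) / s N)"
      by (rule sums_divide)
    then show ?thesis using s0[of N] by (simp add: sums_iff)
  qed
  have lim1: "(\<lambda>N. \<Sum>n. M (int n) * kap n (v N)) \<longlonglongrightarrow> (\<Sum>n. M (int n) * (of_nat n)\<^sup>2)"
  proof (rule conjunct2[OF conjunct2[OF tannerys_theorem[where M="\<lambda>n. norm ((of_nat n)\<^sup>2 * M (int n))"]]])
    show "(\<lambda>N. M (int n) * kap n (v N)) \<longlonglongrightarrow> M (int n) * (of_nat n)\<^sup>2" for n
    proof -
      have "(\<lambda>N. M (int n) * ((\<Sum>j<n. v N ^ j)\<^sup>2 * v N / v N ^ n)) \<longlonglongrightarrow> M (int n) * ((\<Sum>j<n. 1 ^ j)\<^sup>2 * 1 / 1 ^ n)"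
        by (intro tendsto_intros v_lim) auto
      then show ?thesis by (simp add: kap_def)
    qed
    have "norm (M (int n) * kap n (v N)) \<le> norm ((of_nat n)\<^sup>2 * M (int n))" for n N
    proof -
      have "norm (\<Sum>j<n. v N ^ j) \<le> (\<Sum>j<n. norm (v N ^ j))" by (rule norm_sum)
      also have "\<dots> = n" using nv by (simp add: norm_power)
      finally have "(norm (\<Sum>j<n. v N ^ j))\<^sup>2 \<le> (real n)\<^sup>2" by (intro power_mono) auto
      then show ?thesis using nv[of N]
        by (simp add: kap_def norm_mult norm_divide norm_power mult.commute mult_left_mono)
    qed
    then show "\<forall>\<^sub>F (n, N) in sequentially \<times>\<^sub>F sequentially. norm (M (int n) * kap n (v N)) \<le> norm ((of_nat n)\<^sup>2 * M (int n))"
      by (intro always_eventually) auto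
    have "(\<lambda>n. norm ((of_int n)\<^sup>2 * M n)) summable_on UNIV"
      using has_sum_imp_summable[OF S2] by (simp add: summable_on_iff_abs_summable_on_complex)
    then have "(\<lambda>n. norm ((of_int n)\<^sup>2 * M n)) summable_on {0..}"
      by (rule summable_on_subset_banach) auto
    then have "(\<lambda>n. norm ((of_nat n)\<^sup>2 * M (int n))) summable_on UNIV"
      by (subst summable_on_reindex_bij_witness[where i=nat and j=int and h="\<lambda>n. norm ((of_int n)\<^sup>2 * M n)" and T="{0..}"]) auto
    then show "summable (\<lambda>n. norm ((of_nat n)\<^sup>2 * M (int n)))"
      by (rule summable_on_imp_summable)
  qed auto
  define Y' where "Y' = (\<Sum>k. norm (yterm k))"
  define D where "D N = P (v N * q) * P (q / v N)" for N
  have small: "eventually (\<lambda>N. norm (s N) * Y' \<le> 1) sequentially"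
  proof -
    have "(\<lambda>N. norm (s N) * Y') \<longlonglongrightarrow> norm (0 :: complex) * Y'" by (intro tendsto_intros s_lim)
    then have "eventually (\<lambda>N. norm (s N) * Y' < 1) sequentially" by (intro order_tendstoD(2)[where y="norm (0 :: complex) * Y'"]) auto
    then show ?thesis by (rule eventually_mono) auto
  qed
  have lim2: "(\<lambda>N. (D N / E\<^sup>2 - 1) / s N + Y) \<longlonglongrightarrow> 0"
  proof (rule Lim_null_comparison)
    show "(\<lambda>N. norm (s N) * Y'\<^sup>2) \<longlonglongrightarrow> 0"
      using tendsto_mult[OF tendsto_norm[OF s_lim] tendsto_const[of "Y'\<^sup>2"]] by simp
    show "eventually (\<lambda>N. norm ((D N / E\<^sup>2 - 1) / s N + Y) \<le> norm (s N) * Y'\<^sup>2) sequentially"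
      using small
    proof (rule eventually_mono)
      fix N assume "norm (s N) * Y' \<le> 1"
      then have "norm (D N / E\<^sup>2 - 1 + s N * Y) \<le> (norm (s N) * Y')\<^sup>2"
        unfolding D_def s_def Y'_def by (intro inverse_W_second_order nv)
      moreover have "(D N / E\<^sup>2 - 1) / s N + Y = (D N / E\<^sup>2 - 1 + s N * Y) / s N"
        using s0[of N] by (simp add: field_simps)
      ultimately show "norm ((D N / E\<^sup>2 - 1) / s N + Y) \<le> norm (s N) * Y'\<^sup>2"
        using s0[of N] by (simp add: norm_divide divide_le_eq power2_eq_square mult_ac)
    qed
  qed
  have lim3: "(\<lambda>N. (D N / E\<^sup>2 - 1) / s N) \<longlonglongrightarrow> - Y"
    using tendsto_diff[OF lim2 tendsto_const[of Y]] by simp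
  have lim4: "(\<lambda>N. D N / E\<^sup>2) \<longlonglongrightarrow> 1"
    using tendsto_add[OF tendsto_mult[OF lim3 s_lim] tendsto_const[of 1]] s0 by simp
  have "(\<lambda>N. - ((D N / E\<^sup>2 - 1) / s N) / (D N / E\<^sup>2) / E\<^sup>2) \<longlonglongrightarrow> - (- Y) / 1 / E\<^sup>2"
    by (intro tendsto_intros lim3 lim4) (use E_nonzero in auto)
  also have "(\<lambda>N. - ((D N / E\<^sup>2 - 1) / s N) / (D N / E\<^sup>2) / E\<^sup>2) = (\<lambda>N. (W (v N) - W 1) / s N)"
  proof
    fix N
    have vin: "v N \<in> annulus" using nv q0 q1 by (auto simp: annulus_def field_simps)
    have WD: "W (v N) = 1 / D N" by (simp add: W_def D_def)
    then have "D N \<noteq> 0" using W_nonzero[OF vin] by auto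
    then show "- ((D N / E\<^sup>2 - 1) / s N) / (D N / E\<^sup>2) / E\<^sup>2 = (W (v N) - W 1) / s N"
      using E_nonzero s0[of N] WD unfolding W_1 by (simp add: field_simps)
  qed
  finally have "(\<Sum>n. M (int n) * (of_nat n)\<^sup>2) = Y / E\<^sup>2"
    using lim1 LIMSEQ_unique unfolding Weq by fastforce
  then have "S2 / 2 = Y / E\<^sup>2" using S2' by (simp add: sums_iff mult.commute)
  then show ?thesis using S2 by (simp add: field_simps)
qed

lemma moments_M: "moments M (1 / E\<^sup>2) (2 * Y / E\<^sup>2)"
  using second_moment_M has_laurentD(2)[OF has_laurent_W one_in_annulus] by (simp add: moments_def W_1)

text \<open>The terms d q^(k d) are summed in two ways: over d for fixed k they give the Lambert
  series, and collected by n = k d they give the divisor sums.\<close>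

lemma divisor_sum_eq_Y: "(\<Sum>\<^sub>\<infinity>n\<in>{1::nat..}. of_nat (\<Sum>d | d dvd n. d) * q ^ n) = Y"
proof -
  have geo: "((\<lambda>d. of_nat d * z ^ d) has_sum (z / (1 - z)\<^sup>2)) {1..}" if z: "norm z < 1" for z :: complex
  proof -
    have "(\<lambda>d. of_nat (Suc d) * z ^ d) sums (1 / (1 - z)\<^sup>2)" by (rule geometric_deriv_sums[OF z])
    moreover have "summable (\<lambda>d. norm (of_nat (Suc d) * z ^ d))"
      using geometric_deriv_sums[of "norm z"] z by (simp add: norm_mult norm_power sums_iff del: of_nat_Suc)
    ultimately have "((\<lambda>d. of_nat (Suc d) * z ^ d) has_sum (1 / (1 - z)\<^sup>2)) UNIV"
      by (intro norm_summable_imp_has_sum)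
    then have "((\<lambda>d. z * (of_nat (Suc d) * z ^ d)) has_sum (z * (1 / (1 - z)\<^sup>2))) UNIV"
      by (rule has_sum_cmult_right)
    then show ?thesis
      by (subst has_sum_reindex_bij_witness[where i=Suc and j="\<lambda>d. d - 1" and T=UNIV and h="\<lambda>d. z * (of_nat (Suc d) * z ^ d)" and s'="z * (1 / (1 - z)\<^sup>2)"])
         (auto simp: power_eq_if)
  qed
  have nq: "norm (q ^ k) < 1" if "k \<ge> 1" for k
  proof -
    have "norm q ^ k \<le> norm q ^ 1" using that q1 by (intro power_decreasing) auto
    then show ?thesis using q1 by (simp add: norm_power)
  qed
  have inner: "((\<lambda>d. of_nat d * q ^ (k * d)) has_sum (q ^ k / (1 - q ^ k)\<^sup>2)) {1..}" if "k \<ge> 1" for k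
    using geo[OF nq[OF that]] by (simp add: power_mult)
  have "((\<lambda>k. yterm k) has_sum Y) UNIV"
    unfolding Y_def by (rule norm_summable_imp_has_sum[OF yterm_summable summable_sums[OF summable_norm_cancel[OF yterm_summable]]])
  then have outer: "((\<lambda>k. q ^ k / (1 - q ^ k)\<^sup>2) has_sum Y) {1..}"
    by (subst has_sum_reindex_bij_witness[where i=Suc and j="\<lambda>d. d - 1" and T=UNIV and h=yterm and s'=Y])
       (auto simp: yterm_def[abs_def] dest!: Suc_le_D)
  have "(\<lambda>(k, d). of_nat d * q ^ (k * d)) summable_on {1..} \<times> {1..}"
  proof -
    have "(\<lambda>(k, d). real d * norm q ^ (k * d)) summable_on {1..} \<times> {1..}"
    proof (rule summable_on_SigmaI[where g="\<lambda>k. norm q ^ k / (1 - norm q ^ k)\<^sup>2"])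
      \<comment> \<open>The same Lambert series at |q| provides absolute summability of the double
        sum.\<close>
      interpret r: nome_disc "of_real (norm q)" by standard (use q0 q1 in auto)
      show "((\<lambda>d. case (k, d) of (k, d) \<Rightarrow> real d * norm q ^ (k * d)) has_sum norm q ^ k / (1 - norm q ^ k)\<^sup>2) {1..}"
        if "k \<in> {1..}" for k
      proof -
        have "norm (complex_of_real (norm q ^ k)) < 1" using nq[of k] that by (simp add: norm_power)
        from geo[OF this] have "((\<lambda>d. complex_of_real (real d * norm q ^ (k * d))) has_sum complex_of_real (norm q ^ k / (1 - norm q ^ k)\<^sup>2)) {1..}"
          by (simp add: power_mult)
        then show ?thesis by (simp only: has_sum_of_real_iff prod.case)
      qed
      have "(\<lambda>k. norm q ^ Suc k / (1 - norm q ^ Suc k)\<^sup>2) summable_on UNIV"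
      proof (rule summable_nonneg_imp_summable_on)
        have "summable (\<lambda>k. norm (r.yterm k))" by (rule r.yterm_summable)
        moreover have "norm (r.yterm k) = norm q ^ Suc k / (1 - norm q ^ Suc k)\<^sup>2" for k
        proof -
          have "r.yterm k = complex_of_real (norm q ^ Suc k / (1 - norm q ^ Suc k)\<^sup>2)"
            unfolding r.yterm_def by simp
          then show ?thesis by (simp only: norm_of_real) simp
        qed
        ultimately show "summable (\<lambda>k. norm q ^ Suc k / (1 - norm q ^ Suc k)\<^sup>2)" by simp
      qed auto
      then show "(\<lambda>k. norm q ^ k / (1 - norm q ^ k)\<^sup>2) summable_on {1..}"
        by (subst summable_on_reindex_bij_witness[where i=Suc and j="\<lambda>d. d - 1" and T=UNIV and h="\<lambda>k. norm q ^ Suc k / (1 - norm q ^ Suc k)\<^sup>2"]) auto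
    qed auto
    then have "(\<lambda>x. norm (case x of (k, d) \<Rightarrow> of_nat d * q ^ (k * d))) summable_on {1..} \<times> {1..}"
      by (simp add: case_prod_unfold norm_mult norm_power)
    then show ?thesis by (rule Infinite_Sum.abs_summable_summable)
  qed
  then have "((\<lambda>(k, d). of_nat d * q ^ (k * d)) has_sum Y) ({1..} \<times> {1..})"
    by (intro has_sum_SigmaI[OF _ outer]) (use inner in auto)
  also have "?this \<longleftrightarrow> ((\<lambda>(n, d). of_nat d * q ^ n) has_sum Y) (SIGMA n:{1..}. {d. d dvd n})"
    by (rule has_sum_reindex_bij_witness[where i="\<lambda>(n, d). (n div d, d)" and j="\<lambda>(k, d). (k * d, d)"])
       (auto elim!: dvdE simp: Suc_le_eq)
  finally have "((\<lambda>n. of_nat (\<Sum>d | d dvd n. d) * q ^ n) has_sum Y) {1..}"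
  proof (rule has_sum_SigmaD)
    show "((\<lambda>d. case (n, d) of (n, d) \<Rightarrow> of_nat d * q ^ n) has_sum of_nat (\<Sum>d | d dvd n. d) * q ^ n) {d. d dvd n}"
      if "n \<in> {1..}" for n
      using that by (intro has_sum_finiteI) (auto simp: sum_distrib_right)
  qed
  then show ?thesis by (rule infsumI)
qed

end

section \<open>Coefficients in one variable\<close>

text \<open>For an even Laurent series g this is the coefficient of z^(- a) in the product of g with
  the one-sided series of all p m z^m, m >= 0; see \<open>conv_causal\<close>.\<close>

definition half :: "(int \<Rightarrow> complex) \<Rightarrow> (int \<Rightarrow> complex) \<Rightarrow> int \<Rightarrow> complex" where
  "half p g a = (\<Sum>\<^sub>\<infinity>m\<in>{0..}. p m * g (a + m))"

text \<open>The reflection \<open>m \<mapsto> -K - m\<close> turns the two half sums into one bilateral sum: this is the residue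
  theorem for the poles of \<open>\<Sum> p\<^sub>m z\<^sup>m\<close> on the unit circle.\<close>

lemma half_reflect:
  assumes g: "\<And>n. g (- n) = g n" and p: "\<And>m. p (- K - m) = p m" and p0: "\<And>m. - K < m \<Longrightarrow> m < 0 \<Longrightarrow> p m = 0"
    and S: "((\<lambda>m. p m * g (a + m)) has_sum S) UNIV" and K: "K > 0"
  shows "half p g a + half p g (K - a) = S"
proof -
  define f where "f m = p m * g (a + m)" for m
  have s: "f summable_on UNIV" using S has_sum_imp_summable by (auto simp: f_def[abs_def])
  have 1: "(f has_sum half p g a) {0..}"
    unfolding half_def f_def[symmetric] by (intro has_sum_infsum summable_on_subset_banach[OF s]) auto
  have s2: "f summable_on {..- K}" by (intro summable_on_subset_banach[OF s]) auto
  have "infsum f {..- K} = half p g (K - a)"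
    unfolding half_def
  proof (rule infsum_reindex_bij_witness[of _ "\<lambda>m. - K - m" "\<lambda>m. - K - m"])
    fix m
    have "g (K - a + (- K - m)) = g (a + m)" using g[of "a + m"] by simp
    then show "p (- K - m) * g (K - a + (- K - m)) = f m" by (simp add: p f_def)
  qed auto
  with s2 have "(f has_sum half p g (K - a)) {..- K}" by (simp add: has_sum_iff)
  then have 2: "(f has_sum half p g (K - a)) {..<0}"
    by (subst has_sum_cong_neutral[where T="{..- K}"]) (use K in \<open>auto simp: f_def p0\<close>)
  have "{0..} \<inter> {..<0} = ({} :: int set)" by auto
  from has_sum_Un_disjoint[OF 1 2 this]
  have "(f has_sum half p g a + half p g (K - a)) ({0..} \<union> {..<0})" .
  also have "{0..} \<union> {..<0} = (UNIV :: int set)" by auto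
  finally show ?thesis using S has_sum_unique by (auto simp: f_def[abs_def])
qed

abbreviation causal :: "(int \<Rightarrow> complex) \<Rightarrow> int \<Rightarrow> complex" where
  "causal p \<equiv> (\<lambda>m. if m \<ge> 0 then p m else 0)"

lemma conv_causal:
  assumes "\<And>n. g (- n) = g n"
  shows "conv (causal p) g n = half p g (- n)"
proof -
  have "g (n - j) = g (- n + j)" for j using assms[of "n - j"] by simp
  then have "conv (causal p) g n = (\<Sum>\<^sub>\<infinity>j. causal p j * g (- n + j))" by (simp add: conv_def)
  also have "\<dots> = half p g (- n)"
    unfolding half_def by (rule infsum_cong_neutral) auto
  finally show ?thesis .
qed

lemma has_laurent_causal_mult:
  assumes "has_laurent k S (causal p)" "has_laurent f S g" "\<And>n. g (- n) = g n"
  shows "has_laurent (\<lambda>z. k z * f z) S (\<lambda>n. half p g (- n))"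
proof -
  have "conv (causal p) g = (\<lambda>n. half p g (- n))"
    by (rule ext) (rule conv_causal[of g p, OF assms(3)])
  with has_laurent_mult[OF assms(1,2)] show ?thesis by (simp only:)
qed

lemma has_laurent_geometric:
  assumes "\<And>z. z \<in> S \<Longrightarrow> z \<noteq> 0 \<and> norm (r * z) < 1"
  shows "has_laurent (\<lambda>z. 1 / (1 - r * z)) S (causal (\<lambda>m. r ^ nat m))"
proof (rule has_laurentI)
  fix z :: complex assume z: "z \<in> S"
  show "z \<noteq> 0" using assms z by auto
  have n: "norm (r * z) < 1" using assms z by auto
  have "((\<lambda>m. (r * z) ^ m) has_sum (1 / (1 - r * z))) UNIV"
    by (rule norm_summable_imp_has_sum) (use n in \<open>auto simp: norm_power intro: summable_geometric geometric_sums\<close>)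
  also have "?this \<longleftrightarrow> ((\<lambda>m. causal (\<lambda>m. r ^ nat m) m * z powi m) has_sum (1 / (1 - r * z))) {0..}"
    by (rule has_sum_reindex_bij_witness[where i=nat and j=int]) (auto simp: power_mult_distrib)
  also have "\<dots> \<longleftrightarrow> ((\<lambda>m. causal (\<lambda>m. r ^ nat m) m * z powi m) has_sum (1 / (1 - r * z))) UNIV"
    by (rule has_sum_cong_neutral) auto
  finally show "((\<lambda>m. causal (\<lambda>m. r ^ nat m) m * z powi m) has_sum (1 / (1 - r * z))) UNIV" .
qed

text \<open>Used with r = 1 and r = -1, where each further pole factor amounts to one more plain or
  alternating partial summation.\<close>

lemma conv_causal_geometric:
  "conv (causal c) (causal (\<lambda>m. r ^ nat m)) = causal (\<lambda>n. \<Sum>j\<le>nat n. c (int j) * r ^ (nat n - j))"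
proof
  fix n
  have "conv (causal c) (causal (\<lambda>m. r ^ nat m)) n = (\<Sum>\<^sub>\<infinity>j\<in>{0..n}. c j * r ^ nat (n - j))"
    unfolding conv_def by (rule infsum_cong_neutral) auto
  also have "\<dots> = (\<Sum>j\<in>{0..n}. c j * r ^ nat (n - j))" by (rule infsum_finite) auto
  also have "\<dots> = causal (\<lambda>n. \<Sum>j\<le>nat n. c (int j) * r ^ (nat n - j)) n"
  proof (cases "n \<ge> 0")
    case True
    then have "(\<Sum>j\<in>{0..n}. c j * r ^ nat (n - j)) = (\<Sum>j\<le>nat n. c (int j) * r ^ (nat n - j))"
      by (intro sum.reindex_bij_witness[where i=int and j=nat]) (auto simp: nat_diff_distrib)
    then show ?thesis using True by simp
  qed auto
  finally show "conv (causal c) (causal (\<lambda>m. r ^ nat m)) n = causal (\<lambda>n. \<Sum>j\<le>nat n. c (int j) * r ^ (nat n - j)) n" .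
qed

text \<open>The coefficients of \<open>1 / (1 - z) ^ 3\<close>, of \<open>1 / ((1 - z)\<^sup>2 (1 - z\<^sup>2))\<close> and of \<open>1 / (1 - z\<^sup>2)\<close>, continued
  as quasi-polynomials to negative indices.\<close>

definition kerp3 :: "int \<Rightarrow> complex" where "kerp3 m = (of_int m + 1) * (of_int m + 2) / 2"
definition kerp4 :: "int \<Rightarrow> complex" where "kerp4 m = (of_int m + 2)\<^sup>2 / 4 - (1 - (-1) powi m) / 8"
definition kerp2 :: "int \<Rightarrow> complex" where "kerp2 m = (if even m then 1 else 0)"

lemma has_laurent_kerp3:
  assumes "\<And>z. z \<in> S \<Longrightarrow> z \<noteq> 0 \<and> norm z < 1"
  shows "has_laurent (\<lambda>z. 1 / (1 - z) ^ 3) S (causal kerp3)"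
proof -
  have g: "has_laurent (\<lambda>z. 1 / (1 - z)) S (causal (\<lambda>m. 1 ^ nat m))"
    using has_laurent_geometric[of S 1] assms by simp
  have 2: "conv (causal (\<lambda>m. 1 ^ nat m)) (causal (\<lambda>m. 1 ^ nat m)) = causal (\<lambda>n. of_nat (nat n) + 1)"
    unfolding conv_causal_geometric by (auto simp: fun_eq_iff)
  have 3: "(\<Sum>j\<le>n. of_nat j + 1) = (of_nat n + 1) * (of_nat n + 2) / (2 :: complex)" for n
    by (induction n) (auto simp: field_simps)
  have 4: "conv (causal (\<lambda>n. of_nat (nat n) + 1)) (causal (\<lambda>m. 1 ^ nat m)) = causal kerp3"
    unfolding conv_causal_geometric by (auto simp: fun_eq_iff 3 kerp3_def)
  have "has_laurent (\<lambda>z. 1 / (1 - z) * (1 / (1 - z)) * (1 / (1 - z))) S (causal kerp3)"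
    using has_laurent_mult[OF has_laurent_mult[OF g g] g] unfolding 2 4 .
  then show ?thesis
    by (rule has_laurent_cong) (simp add: power3_eq_cube)
qed

text \<open>Since (1 - z)^2 (1 - z^2) = (1 - z)^3 (1 + z), one alternating summation of
  \<open>kerp3\<close> is enough.\<close>

lemma has_laurent_kerp4:
  assumes "\<And>z. z \<in> S \<Longrightarrow> z \<noteq> 0 \<and> norm z < 1"
  shows "has_laurent (\<lambda>z. 1 / ((1 - z)\<^sup>2 * (1 - z\<^sup>2))) S (causal kerp4)"
proof -
  have g: "has_laurent (\<lambda>z. 1 / (1 - (-1) * z)) S (causal (\<lambda>m. (-1) ^ nat m))"
    by (rule has_laurent_geometric) (use assms in simp)
  have 4: "(\<Sum>j\<le>n. kerp3 (int j) * (-1) ^ (n - j)) = kerp4 (int n)" for n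
  proof (induction n)
    case (Suc n)
    have "(\<Sum>j\<le>Suc n. kerp3 (int j) * (-1) ^ (Suc n - j)) = kerp3 (int (Suc n)) + (\<Sum>j\<le>n. kerp3 (int j) * (-1) ^ (Suc n - j))"
      by simp
    also have "(\<Sum>j\<le>n. kerp3 (int j) * (-1) ^ (Suc n - j)) = - (\<Sum>j\<le>n. kerp3 (int j) * (-1) ^ (n - j))"
      unfolding sum_negf[symmetric] by (rule sum.cong) (auto simp: Suc_diff_le)
    also have "kerp3 (int (Suc n)) + - (\<Sum>j\<le>n. kerp3 (int j) * (-1) ^ (n - j)) = kerp4 (int (Suc n))"
      unfolding Suc.IH unfolding kerp3_def kerp4_def power_int_of_nat by (simp add: field_simps power2_eq_square)
    finally show ?case .
  qed (simp add: kerp3_def kerp4_def)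
  have "conv (causal kerp3) (causal (\<lambda>m. (-1) ^ nat m)) = causal kerp4"
    unfolding conv_causal_geometric 4 by auto
  with has_laurent_mult[OF has_laurent_kerp3[OF assms] g]
  have "has_laurent (\<lambda>z. 1 / (1 - z) ^ 3 * (1 / (1 - (-1) * z))) S (causal kerp4)"
    by simp
  then show ?thesis
  proof (rule has_laurent_cong)
    fix z :: complex assume "z \<in> S"
    then have "1 - z \<noteq> 0" "1 + z \<noteq> 0"
      using assms[of z] by (auto simp: add_eq_0_iff)
    moreover have "1 - z\<^sup>2 = (1 - z) * (1 + z)" by (simp add: power2_eq_square algebra_simps)
    ultimately show "1 / (1 - z) ^ 3 * (1 / (1 - (-1) * z)) = 1 / ((1 - z)\<^sup>2 * (1 - z\<^sup>2))"
      by (simp add: power3_eq_cube power2_eq_square)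
  qed
qed

lemma kerp3_reflect: "kerp3 (- 3 - m) = kerp3 m"
  by (simp add: kerp3_def field_simps)

lemma minus_one_powi_cases: "(-1 :: 'a :: division_ring) powi m = (if even m then 1 else -1)"
  by (auto simp: power_int_minus_left)

lemma kerp4_reflect: "kerp4 (- 4 - m) = kerp4 m"
  by (simp add: kerp4_def field_simps minus_one_powi_cases power2_eq_square)

lemma has_laurent_even:
  assumes f: "has_laurent f {z. norm z = 1} c" and "\<And>z. norm z = 1 \<Longrightarrow> f (1 / z) = f z"
  shows "c (- n) = c n"
proof -
  have "has_laurent (\<lambda>z. f (1 / z)) {z. norm z = 1} (\<lambda>n. c (- n) * 1 powi (- n))"
    by (rule has_laurent_reflect[OF f]) (auto simp: norm_divide)
  then have "has_laurent (\<lambda>z. f (1 / z)) {z. norm z = 1} (\<lambda>n. c (- n))" by simp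
  then have "has_laurent f {z. norm z = 1} (\<lambda>n. c (- n))"
    by (rule has_laurent_cong) (use assms(2) in auto)
  from has_laurent_unique[OF f this] show ?thesis by (metis zero_less_one)
qed

lemma has_sum_shift_int: "((\<lambda>m::int. f (a + m)) has_sum S) UNIV \<longleftrightarrow> (f has_sum S) UNIV"
  by (rule has_sum_reindex_bij_witness[where i="\<lambda>n. n - a" and j="\<lambda>m. a + m"]) auto

section \<open>Coefficients of 1 / T z ^ 3 and of 1 / (T z ^ 2 * T (z^2))\<close>

locale nome_sqrt = nome_disc +
  fixes p :: complex
  assumes p2: "p\<^sup>2 = q"
begin

lemma p0: "p \<noteq> 0" using p2 q0 by auto

lemma norm_p: "norm p ^ 2 = norm q" using p2 by (metis norm_power)

lemma norm_p_less: "norm p < 1"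
proof (rule ccontr)
  assume "\<not> norm p < 1"
  then have "1 \<le> norm p ^ 2" by (intro one_le_power) auto
  then show False using norm_p q1 by simp
qed

lemma norm_q_less_p: "norm q < norm p"
  using norm_p norm_p_less p0 mult_strict_left_mono[of "norm p" 1 "norm p"] by (simp add: power2_eq_square)

text \<open>The region where z^2 stays in \<open>annulus\<close>. Its inner radius is |p| because T
  (z^2) also vanishes at z = p and z = - p; the circle |z| = |p| is the one fixed by z -> q /
  z.\<close>

definition annulus2 :: "complex set" where "annulus2 = {z. norm p < norm z \<and> norm z < 1 / norm p}"

lemma annulus2_power: assumes "z \<in> annulus2" shows "z\<^sup>2 \<in> annulus"
proof -
  have "norm p ^ 2 < norm z ^ 2" using assms by (intro power_strict_mono) (auto simp: annulus2_def)
  moreover have "norm z ^ 2 < (1 / norm p) ^ 2" using assms by (intro power_strict_mono) (auto simp: annulus2_def)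
  ultimately show ?thesis by (simp add: annulus_def norm_power norm_p power_divide)
qed

lemma annulus2_subset: "annulus2 \<subseteq> annulus"
proof
  fix z :: complex assume z: "z \<in> annulus2"
  have "1 / norm p \<le> 1 / norm q" using norm_q_less_p q0 p0 by (intro divide_left_mono) auto
  then show "z \<in> annulus" using z norm_q_less_p by (auto simp: annulus2_def annulus_def)
qed

lemma unit_in_annulus2: "norm z = 1 \<Longrightarrow> z \<in> annulus2"
  using norm_p_less p0 by (simp add: annulus2_def)

definition M2 :: "int \<Rightarrow> complex" where "M2 n = (if even n then M (n div 2) else 0)"

lemma has_laurent_W2: "has_laurent (\<lambda>z. W (z\<^sup>2)) annulus2 M2"
  unfolding M2_def[abs_def] by (rule has_laurent_square[OF has_laurent_W annulus2_power])

definition g3 :: "int \<Rightarrow> complex" where "g3 = conv (conv M M) M"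
definition g4 :: "int \<Rightarrow> complex" where "g4 = conv (conv M M) M2"

lemma moments_g3: "moments g3 (1 / E ^ 6) (6 * Y / E ^ 6)"
proof -
  have "moments g3 (1 / E\<^sup>2 * (1 / E\<^sup>2) * (1 / E\<^sup>2)) ((2 * Y / E\<^sup>2 * (1 / E\<^sup>2) + 1 / E\<^sup>2 * (2 * Y / E\<^sup>2)) * (1 / E\<^sup>2) + 1 / E\<^sup>2 * (1 / E\<^sup>2) * (2 * Y / E\<^sup>2))"
    unfolding g3_def by (intro moments_conv moments_M)
  then show ?thesis by (simp add: field_simps flip: power_add)
qed

lemma moments_g4: "moments g4 (1 / E ^ 6) (12 * Y / E ^ 6)"
proof -
  have "moments M2 (1 / E\<^sup>2) (4 * (2 * Y / E\<^sup>2))"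
    unfolding M2_def by (intro moments_dilate2 moments_M)
  then have "moments g4 (1 / E\<^sup>2 * (1 / E\<^sup>2) * (1 / E\<^sup>2)) ((2 * Y / E\<^sup>2 * (1 / E\<^sup>2) + 1 / E\<^sup>2 * (2 * Y / E\<^sup>2)) * (1 / E\<^sup>2) + 1 / E\<^sup>2 * (1 / E\<^sup>2) * (4 * (2 * Y / E\<^sup>2)))"
    unfolding g4_def by (intro moments_conv moments_M)
  then show ?thesis by (simp add: field_simps flip: power_add)
qed

lemma g3_even: "g3 (- n) = g3 n" and g4_even: "g4 (- n) = g4 n"
  using moments_g3 moments_g4 by (auto simp: moments_def)

text \<open>Indexed by the negated exponent: \<open>tseq b\<close> and \<open>sseq b\<close> belong
  to z^(- b), in the ranges |q| < |z| < 1 and |p| < |z| < 1 respectively.\<close>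

definition tseq :: "int \<Rightarrow> complex" where "tseq = half kerp3 g3"
definition sseq :: "int \<Rightarrow> complex" where "sseq = half kerp4 g4"

lemma has_laurent_T3:
  assumes "norm q < \<rho>" "\<rho> < 1"
  shows "has_laurent (\<lambda>z. 1 / T z ^ 3) {z. norm z = \<rho>} (\<lambda>n. tseq (- n))"
proof -
  have \<rho>: "\<rho> > 0" using assms(1) norm_ge_zero[of q] by linarith
  have q': "1 < 1 / norm q" using q0 q1 by simp
  have sub: "{z. norm z = \<rho>} \<subseteq> annulus" using assms q' by (auto simp: annulus_def)
  have "has_laurent (\<lambda>z. W z * W z * W z) {z. norm z = \<rho>} g3"
    unfolding g3_def by (intro has_laurent_mult has_laurent_subset[OF has_laurent_W sub])
  then have "has_laurent (\<lambda>z. 1 / (1 - z) ^ 3 * (W z * W z * W z)) {z. norm z = \<rho>} (\<lambda>n. tseq (- n))"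
    unfolding tseq_def by (intro has_laurent_causal_mult has_laurent_kerp3 g3_even) (use assms \<rho> in auto)
  then show ?thesis
  proof (rule has_laurent_cong)
    fix z :: complex assume z: "z \<in> {z. norm z = \<rho>}"
    then have "z \<noteq> 1" using assms by auto
    then show "1 / (1 - z) ^ 3 * (W z * W z * W z) = 1 / T z ^ 3"
      using W_eq[of z] sub z by (auto simp: power3_eq_cube)
  qed
qed

text \<open>The residue at the triple pole z = 1. As \<open>kerp3 (n - b)\<close> is a quadratic
  polynomial in n, its sum against \<open>g3\<close> involves only the moments of order 0, 1 and 2,
  and Y enters through the last.\<close>

lemma tseq_reflect: "tseq b + tseq (3 - b) = ((of_int b - 3/2)\<^sup>2 / 2 - (1 - 24 * Y) / 8) / E ^ 6"
  unfolding tseq_def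
proof (rule half_reflect[where g=g3 and p=kerp3 and K=3])
  have 0: "(g3 has_sum 1 / E ^ 6) UNIV" and 2: "((\<lambda>n. (of_int n)\<^sup>2 * g3 n) has_sum 6 * Y / E ^ 6) UNIV"
    using moments_g3 by (auto simp: moments_def)
  note 1 = moments_odd[OF moments_g3]
  have "((\<lambda>n. 1/2 * ((of_int n)\<^sup>2 * g3 n) + (3 - 2 * of_int b) / 2 * (of_int n * g3 n) + (of_int b - 1) * (of_int b - 2) / 2 * g3 n)
      has_sum (1/2 * (6 * Y / E ^ 6) + (3 - 2 * of_int b) / 2 * 0 + (of_int b - 1) * (of_int b - 2) / 2 * (1 / E ^ 6))) UNIV"
    by (intro has_sum_add has_sum_cmult_right 0 1 2)
  also have "(1/2 * (6 * Y / E ^ 6) + (3 - 2 * of_int b) / 2 * 0 + (of_int b - 1) * (of_int b - 2) / 2 * (1 / E ^ 6))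
      = ((of_int b - 3/2)\<^sup>2 / 2 - (1 - 24 * Y) / 8) / E ^ 6"
    using E_nonzero by (simp add: field_simps power2_eq_square)
  also have "(\<lambda>n. 1/2 * ((of_int n)\<^sup>2 * g3 n) + (3 - 2 * of_int b) / 2 * (of_int n * g3 n) + (of_int b - 1) * (of_int b - 2) / 2 * g3 n)
      = (\<lambda>n. kerp3 (n - b) * g3 n)"
    by (auto simp: kerp3_def field_simps power2_eq_square)
  finally show "((\<lambda>m. kerp3 m * g3 (b + m)) has_sum ((of_int b - 3/2)\<^sup>2 / 2 - (1 - 24 * Y) / 8) / E ^ 6) UNIV"
    by (subst (asm) has_sum_shift_int[symmetric, of _ _ b]) simp
  show "kerp3 m = 0" if "- 3 < m" "m < 0" for m
  proof -
    have "m = -1 \<or> m = -2" using that by auto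
    then show ?thesis by (auto simp: kerp3_def)
  qed
qed (simp_all add: g3_even kerp3_reflect)

text \<open>On |z| = |p| the map z -> q / z preserves both the circle and T.\<close>

lemma tseq_shift: "tseq b = q powi b * tseq (- b)"
proof -
  have "norm (q / z) = norm p" if "norm z = norm p" for z :: complex
    using that p0 by (simp add: norm_divide norm_p[symmetric] power2_eq_square)
  then have r: "has_laurent (\<lambda>z. 1 / T (q / z) ^ 3) {z. norm z = norm p} (\<lambda>n. tseq (- (- n)) * q powi (- n))"
    by (intro has_laurent_reflect[OF has_laurent_T3[OF norm_q_less_p norm_p_less]] q0) auto
  have "has_laurent (\<lambda>z. 1 / T z ^ 3) {z. norm z = norm p} (\<lambda>n. tseq (- (- n)) * q powi (- n))"
    by (rule has_laurent_cong[OF r]) (simp add: T_q_div)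
  from has_laurent_unique[OF has_laurent_T3[OF norm_q_less_p norm_p_less] this] p0
  have "tseq (- n) = tseq n * q powi (- n)" for n by (simp add: fun_eq_iff)
  from this[of "- b"] show ?thesis by (simp add: mult.commute)
qed

lemma has_laurent_T4:
  assumes "norm p < \<rho>" "\<rho> < 1"
  shows "has_laurent (\<lambda>z. 1 / (T z ^ 2 * T (z\<^sup>2))) {z. norm z = \<rho>} (\<lambda>n. sseq (- n))"
proof -
  have \<rho>: "\<rho> > 0" using assms(1) norm_ge_zero[of p] by linarith
  have p': "1 < 1 / norm p" using p0 norm_p_less by simp
  have sub: "{z. norm z = \<rho>} \<subseteq> annulus2" using assms p' by (auto simp: annulus2_def)
  have "has_laurent (\<lambda>z. W z * W z * W (z\<^sup>2)) {z. norm z = \<rho>} g4"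
    unfolding g4_def
    by (intro has_laurent_mult has_laurent_subset[OF has_laurent_W] has_laurent_subset[OF has_laurent_W2 sub] order_trans[OF sub annulus2_subset])
  then have "has_laurent (\<lambda>z. 1 / ((1 - z)\<^sup>2 * (1 - z\<^sup>2)) * (W z * W z * W (z\<^sup>2))) {z. norm z = \<rho>} (\<lambda>n. sseq (- n))"
    unfolding sseq_def by (intro has_laurent_causal_mult has_laurent_kerp4 g4_even) (use assms \<rho> in auto)
  then show ?thesis
  proof (rule has_laurent_cong)
    fix z :: complex assume z: "z \<in> {z. norm z = \<rho>}"
    have "norm (z\<^sup>2) \<noteq> 1" using z assms \<rho> by (auto simp: norm_power power2_eq_1_iff)
    then have "z\<^sup>2 \<noteq> 1" by (metis norm_one)
    moreover have "z \<noteq> 1" using z assms by auto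
    moreover have "z \<in> annulus" "z\<^sup>2 \<in> annulus" using sub z annulus2_subset annulus2_power by auto
    ultimately show "1 / ((1 - z)\<^sup>2 * (1 - z\<^sup>2)) * (W z * W z * W (z\<^sup>2)) = 1 / (T z ^ 2 * T (z\<^sup>2))"
      by (simp add: W_eq power2_eq_square)
  qed
qed

text \<open>The poles are z = 1, of order three, and z = - 1, of order one. The quadratic part of
  \<open>kerp4\<close> meets the moments of \<open>g4\<close>, its alternating part the value of the
  series at - 1.\<close>

lemma sseq_reflect:
  "sseq b + sseq (4 - b) = ((of_int b - 2)\<^sup>2 / 4 - (1 - 24 * Y) / 8 + (-1) powi b * (E ^ 4 / T (-1) ^ 2) / 2) / E ^ 6"
  unfolding sseq_def
proof (rule half_reflect[where g=g4 and p=kerp4 and K=4])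
  have 0: "(g4 has_sum 1 / E ^ 6) UNIV" and 2: "((\<lambda>n. (of_int n)\<^sup>2 * g4 n) has_sum 12 * Y / E ^ 6) UNIV"
    using moments_g4 by (auto simp: moments_def)
  note 1 = moments_odd[OF moments_g4]
  have m1: "-1 \<in> annulus2" by (rule unit_in_annulus2) simp
  have "has_laurent (\<lambda>z. W z * W z * W (z\<^sup>2)) annulus2 g4"
    unfolding g4_def
    by (intro has_laurent_mult has_laurent_subset[OF has_laurent_W annulus2_subset] has_laurent_W2)
  from has_laurentD(2)[OF this m1]
  have 3: "((\<lambda>n. g4 n * (-1) powi n) has_sum (W (-1) * W (-1) * W 1)) UNIV" by simp
  \<comment> \<open>W (- 1) = 2 / T (- 1), which is the origin of the factor 4.\<close>
  have W1: "W (-1) * W (-1) * W 1 = 4 * (E ^ 4 / T (-1) ^ 2) / E ^ 6"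
    using W_eq[of "-1"] m1 annulus2_subset E_nonzero unfolding W_1 by (auto simp: power2_eq_square field_simps eval_nat_numeral)
  have "((\<lambda>n. 1/4 * ((of_int n)\<^sup>2 * g4 n) + (2 - of_int b) / 2 * (of_int n * g4 n) + ((of_int b - 2)\<^sup>2 / 4 - 1/8) * g4 n + (-1) powi b / 8 * (g4 n * (-1) powi n))
      has_sum (1/4 * (12 * Y / E ^ 6) + (2 - of_int b) / 2 * 0 + ((of_int b - 2)\<^sup>2 / 4 - 1/8) * (1 / E ^ 6) + (-1) powi b / 8 * (4 * (E ^ 4 / T (-1) ^ 2) / E ^ 6))) UNIV"
    using 3 unfolding W1 by (intro has_sum_add has_sum_cmult_right 0 1 2)
  also have "(1/4 * (12 * Y / E ^ 6) + (2 - of_int b) / 2 * 0 + ((of_int b - 2)\<^sup>2 / 4 - 1/8) * (1 / E ^ 6) + (-1) powi b / 8 * (4 * (E ^ 4 / T (-1) ^ 2) / E ^ 6))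
      = ((of_int b - 2)\<^sup>2 / 4 - (1 - 24 * Y) / 8 + (-1) powi b * (E ^ 4 / T (-1) ^ 2) / 2) / E ^ 6"
    by (simp add: add_divide_distrib diff_divide_distrib)
  also have "(\<lambda>n. 1/4 * ((of_int n)\<^sup>2 * g4 n) + (2 - of_int b) / 2 * (of_int n * g4 n) + ((of_int b - 2)\<^sup>2 / 4 - 1/8) * g4 n + (-1) powi b / 8 * (g4 n * (-1) powi n))
      = (\<lambda>n. kerp4 (n - b) * g4 n)"
    by (auto simp: kerp4_def field_simps power2_eq_square minus_one_powi_cases)
  finally show "((\<lambda>m. kerp4 m * g4 (b + m)) has_sum ((of_int b - 2)\<^sup>2 / 4 - (1 - 24 * Y) / 8 + (-1) powi b * (E ^ 4 / T (-1) ^ 2) / 2) / E ^ 6) UNIV"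
    by (subst (asm) has_sum_shift_int[symmetric, of _ _ b]) simp
  show "kerp4 m = 0" if "- 4 < m" "m < 0" for m
  proof -
    have "m = -1 \<or> m = -2 \<or> m = -3" using that by auto
    then show ?thesis by (auto simp: kerp4_def minus_one_powi_cases)
  qed
qed (simp_all add: g4_even kerp4_reflect)

definition lseq :: "int \<Rightarrow> complex" where "lseq n = half (\<lambda>m. 1 ^ nat m) M (- n)"

lemma has_laurent_inverse_T: "has_laurent (\<lambda>z. 1 / T z) {z. norm q < norm z \<and> norm z < 1} lseq"
proof -
  have q': "1 < 1 / norm q" using q0 q1 by simp
  have sub: "{z. norm q < norm z \<and> norm z < 1} \<subseteq> annulus" using q' by (auto simp: annulus_def)
  have "has_laurent (\<lambda>z. 1 / (1 - 1 * z) * W z) {z. norm q < norm z \<and> norm z < 1} lseq"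
    unfolding lseq_def[abs_def]
    by (intro has_laurent_causal_mult has_laurent_geometric has_laurent_subset[OF has_laurent_W sub]) auto
  then show ?thesis
  proof (rule has_laurent_cong)
    fix z :: complex assume z: "z \<in> {z. norm q < norm z \<and> norm z < 1}"
    then have "z \<noteq> 1" by auto
    then show "1 / (1 - 1 * z) * W z = 1 / T z"
      using W_eq[of z] sub z by auto
  qed
qed

text \<open>The substitution z = p w moves the poles z^2 = q to w^2 = 1. What remains once the pole
  factor is removed is invariant under w -> 1 / w, by \<open>T_p_inverse\<close>.\<close>

definition e4 :: "int \<Rightarrow> complex" where
  "e4 = conv (conv (\<lambda>n. lseq n * p powi n) (\<lambda>n. lseq n * p powi n)) M2"

lemma has_laurent_e4: "has_laurent (\<lambda>w. 1 / T (p * w) * (1 / T (p * w)) * W (w\<^sup>2)) annulus2 e4"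
proof -
  have "norm q < norm p * norm w" "norm p * norm w < 1" if "w \<in> annulus2" for w
    using that p0 norm_p by (simp_all add: annulus2_def power2_eq_square field_simps flip: norm_p)
  then have "has_laurent (\<lambda>w. 1 / T (p * w)) annulus2 (\<lambda>n. lseq n * p powi n)"
    by (intro has_laurent_scale[OF has_laurent_inverse_T p0]) (auto simp: norm_mult)
  then show ?thesis unfolding e4_def by (intro has_laurent_mult has_laurent_W2)
qed

lemma T_p_inverse: "w \<noteq> 0 \<Longrightarrow> T (p / w) = T (p * w)"
  using T_q_div[of "p * w"] p0 by (simp add: power2_eq_square flip: p2)

lemma e4_even: "e4 (- n) = e4 n"
proof (rule has_laurent_even)
  show "has_laurent (\<lambda>w. 1 / T (p * w) * (1 / T (p * w)) * W (w\<^sup>2)) {z. norm z = 1} e4"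
    by (rule has_laurent_subset[OF has_laurent_e4]) (auto intro: unit_in_annulus2)
  fix z :: complex assume "norm z = 1"
  then have "z \<noteq> 0" by auto
  then show "1 / T (p * (1 / z)) * (1 / T (p * (1 / z))) * W ((1 / z)\<^sup>2) = 1 / T (p * z) * (1 / T (p * z)) * W (z\<^sup>2)"
    using W_inverse[of "z\<^sup>2"] T_p_inverse[of z] by (simp add: power_divide)
qed

text \<open>From T (q w^2) = - T (w^2) / w^2 the pole factor is 1 / (1 - w^(-2)), to be expanded in
  1 / w because |w| > 1; hence the detour through x = 1 / w.\<close>

lemma has_laurent_shifted_T4:
  assumes "1 < r" "r < 1 / norm p"
  shows "has_laurent (\<lambda>w. 1 / (T (p * w) ^ 2 * T ((p * w)\<^sup>2))) {w. norm w = r} (\<lambda>n. half kerp2 e4 n)"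
proof -
  define S where "S = {w :: complex. norm w = r}"
  have sub: "S \<subseteq> annulus2" using assms norm_p_less by (auto simp: annulus2_def S_def)
  have e: "has_laurent (\<lambda>w. 1 / T (p * w) * (1 / T (p * w)) * W (w\<^sup>2)) S e4"
    by (rule has_laurent_subset[OF has_laurent_e4 sub])
  have k0: "has_laurent (\<lambda>x. 1 / (1 - 1 * x)) {x. norm x = 1 / r ^ 2} (causal (\<lambda>m. 1 ^ nat m))"
    using assms by (intro has_laurent_geometric) auto
  have "1 / (r * r) < 1" using assms by (simp add: less_1_mult)
  have "has_laurent (\<lambda>x. 1 / (1 - 1 * x\<^sup>2)) {x. norm x = 1 / r} (\<lambda>n. if even n then causal (\<lambda>m. 1 ^ nat m) (n div 2) else 0)"
    by (rule has_laurent_square[OF k0]) (use assms in \<open>auto simp: norm_power power_divide\<close>)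
  also have "(\<lambda>n. if even n then causal (\<lambda>m. 1 ^ nat m) (n div 2) else 0) = causal kerp2"
    by (auto simp: kerp2_def fun_eq_iff)
  finally have k: "has_laurent (\<lambda>x. 1 / (1 - 1 * x\<^sup>2)) {x. norm x = 1 / r} (causal kerp2)" .
  have "has_laurent (\<lambda>x. 1 / T (p * (1 / x)) * (1 / T (p * (1 / x))) * W ((1 / x)\<^sup>2)) {x. norm x = 1 / r} (\<lambda>n. e4 (- n) * 1 powi (- n))"
    by (rule has_laurent_reflect[OF e]) (use assms in \<open>auto simp: S_def norm_divide\<close>)
  then have "has_laurent (\<lambda>x. 1 / (1 - 1 * x\<^sup>2) * (1 / T (p * (1 / x)) * (1 / T (p * (1 / x))) * W ((1 / x)\<^sup>2))) {x. norm x = 1 / r} (\<lambda>n. half kerp2 e4 (- n))"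
    by (intro has_laurent_causal_mult[OF k] e4_even) (simp add: e4_even)
  then have "has_laurent (\<lambda>w. 1 / (1 - 1 * (1 / w)\<^sup>2) * (1 / T (p * (1 / (1 / w))) * (1 / T (p * (1 / (1 / w)))) * W ((1 / (1 / w))\<^sup>2))) S (\<lambda>n. half kerp2 e4 (- (- n)) * 1 powi (- n))"
    by (rule has_laurent_reflect) (use assms in \<open>auto simp: S_def norm_divide\<close>)
  then have "has_laurent (\<lambda>w. 1 / (1 - 1 * (1 / w)\<^sup>2) * (1 / T (p * (1 / (1 / w))) * (1 / T (p * (1 / (1 / w)))) * W ((1 / (1 / w))\<^sup>2))) S (\<lambda>n. half kerp2 e4 n)"
    by simp
  then have "has_laurent (\<lambda>w. 1 / (T (p * w) ^ 2 * T ((p * w)\<^sup>2))) S (\<lambda>n. half kerp2 e4 n)"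
  proof (rule has_laurent_cong)
    fix w :: complex assume w: "w \<in> S"
    have w0: "w \<noteq> 0" using w assms by (auto simp: S_def)
    have "norm (w\<^sup>2) \<noteq> 1" using w assms by (auto simp: norm_power power2_eq_1_iff S_def)
    then have w1: "w\<^sup>2 \<noteq> 1" by (metis norm_one)
    have w2: "w\<^sup>2 \<in> annulus" using sub w annulus2_power by auto
    have "T (p ^ 2 * w ^ 2) = T (1 / w\<^sup>2)"
      unfolding p2 using T_q_div[of "1 / w\<^sup>2"] w0 by simp
    also have "\<dots> = - T (w\<^sup>2) / w\<^sup>2" using T_inverse[of "w\<^sup>2"] w0 by simp
    finally have T2: "T ((p * w)\<^sup>2) = - T (w\<^sup>2) / w\<^sup>2" by (simp add: power_mult_distrib)
    show "1 / (1 - 1 * (1 / w)\<^sup>2) * (1 / T (p * (1 / (1 / w))) * (1 / T (p * (1 / (1 / w)))) * W ((1 / (1 / w))\<^sup>2)) = 1 / (T (p * w) ^ 2 * T ((p * w)\<^sup>2))"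
    proof -
      have "1 / (1 - (1 / w)\<^sup>2) * W (w\<^sup>2) = 1 / T ((p * w)\<^sup>2)"
        unfolding T2 W_eq[OF w2 w1] using w0 w1 T_nonzero[OF w2 w1]
        by (simp add: power_divide divide_simps) (simp add: algebra_simps)
      then show ?thesis by (simp add: power2_eq_square)
    qed
  qed
  then show ?thesis by (simp add: S_def)
qed

text \<open>Crossing the poles w = 1 and w = - 1, that is z = p and z = - p:
  \<open>half_reflect\<close> with K = 2 yields the sum of the two residues.\<close>

lemma sseq_shift:
  "sseq b + q powi (b + 1) * sseq (- 2 - b) = p powi b * (1 / T p ^ 2 + (-1) powi b / T (- p) ^ 2) / (2 * E\<^sup>2)"
proof -
  \<comment> \<open>Then |p| r = |p|^(1/2) lies strictly between |p| and 1, where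
    \<open>has_laurent_T4\<close> applies, while r itself exceeds 1.\<close>
  define r where "r = 1 / sqrt (norm p)"
  have np: "0 < norm p" "norm p < 1" using p0 norm_p_less by auto
  have sq: "norm p < sqrt (norm p)" "sqrt (norm p) < 1"
    using np real_less_rsqrt[of "norm p" "norm p"] mult_strict_left_mono[of "norm p" 1 "norm p"] by (auto simp: power2_eq_square)
  have r: "1 < r" "r < 1 / norm p" using np sq by (auto simp: r_def field_simps)
  have pr: "norm p * r = sqrt (norm p)" using np by (simp add: r_def real_div_sqrt)
  have 1: "has_laurent (\<lambda>w. 1 / (T (p * w) ^ 2 * T ((p * w)\<^sup>2))) {w. norm w = r} (\<lambda>n. sseq (- n) * p powi n)"
    by (rule has_laurent_scale[OF has_laurent_T4[OF sq] p0]) (auto simp: norm_mult pr)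
  from has_laurent_unique[OF 1 has_laurent_shifted_T4[OF r]] r
  have h: "sseq (- n) * p powi n = half kerp2 e4 n" for n by (simp add: fun_eq_iff)
  define G where "G w = 1 / T (p * w) * (1 / T (p * w)) * W (w\<^sup>2)" for w
  have "half kerp2 e4 (- b) + half kerp2 e4 (2 - (- b)) = (G 1 + (-1) powi b * G (-1)) / 2"
  proof (rule half_reflect[where g=e4 and p=kerp2 and K=2])
    have G1: "((\<lambda>n. e4 n) has_sum G 1) UNIV" and G2: "((\<lambda>n. e4 n * (-1) powi n) has_sum G (-1)) UNIV"
      using has_laurentD(2)[OF has_laurent_e4 unit_in_annulus2, of 1] has_laurentD(2)[OF has_laurent_e4 unit_in_annulus2, of "-1"]
      by (simp_all add: G_def)
    have "((\<lambda>n. 1/2 * e4 n + (-1) powi b / 2 * (e4 n * (-1) powi n)) has_sum (1/2 * G 1 + (-1) powi b / 2 * G (-1))) UNIV"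
      by (intro has_sum_add has_sum_cmult_right G1 G2)
    also have "(\<lambda>n. 1/2 * e4 n + (-1) powi b / 2 * (e4 n * (-1) powi n)) = (\<lambda>n. kerp2 (n - (- b)) * e4 n)"
      by (auto simp: kerp2_def minus_one_powi_cases)
    finally show "((\<lambda>m. kerp2 m * e4 (- b + m)) has_sum (G 1 + (-1) powi b * G (-1)) / 2) UNIV"
      by (subst (asm) has_sum_shift_int[symmetric, of _ _ "- b"]) (simp add: field_simps)
    show "kerp2 m = 0" if "- 2 < m" "m < 0" for m
    proof -
      have "m = -1" using that by auto
      then show ?thesis by (auto simp: kerp2_def)
    qed
  qed (auto simp: e4_even kerp2_def)
  moreover have hb: "sseq (- 2 - b) * p powi (b + 2) = half kerp2 e4 (2 - (- b))"
  proof -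
    have "- (b + 2) = - 2 - b" "b + 2 = 2 - (- b)" by simp_all
    then show ?thesis using h[of "b + 2"] by metis
  qed
  ultimately have e1: "p powi b * (sseq b * p powi (- b) + sseq (- 2 - b) * p powi (b + 2)) = p powi b * ((G 1 + (-1) powi b * G (-1)) / 2)"
    using h[of "- b"] hb by simp
  have e2: "p powi b * p powi (b + 2) = q powi (b + 1)"
  proof -
    have "q powi (b + 1) = p powi (2 * (b + 1))" by (subst power_int_mult) (simp add: p2)
    also have "2 * (b + 1) = b + (b + 2)" by simp
    also have "p powi (b + (b + 2)) = p powi b * p powi (b + 2)" using p0 by (intro power_int_add) simp
    finally show ?thesis by simp
  qed
  have e3: "p powi b * p powi (- b) = 1" using p0 by (simp add: power_int_minus)
  have "sseq b + q powi (b + 1) * sseq (- 2 - b)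
      = (p powi b * p powi (- b)) * sseq b + (p powi b * p powi (b + 2)) * sseq (- 2 - b)"
    by (simp only: e2 e3 mult_1)
  also have "\<dots> = p powi b * (sseq b * p powi (- b) + sseq (- 2 - b) * p powi (b + 2))"
    by (simp only: algebra_simps)
  also have "\<dots> = p powi b * ((G 1 + (-1) powi b * G (-1)) / 2)" by (rule e1)
  also have "\<dots> = p powi b * (1 / T p ^ 2 + (-1) powi b / T (- p) ^ 2) / (2 * E\<^sup>2)"
    by (simp add: G_def W_1 power2_eq_square add_divide_distrib distrib_left mult_ac)
  finally show ?thesis .
qed

end

section \<open>Coefficients in two variables\<close>

text \<open>A single torus suffices: it already determines the coefficients, and all two-variable
  identities below are compared on it.\<close>

definition has_laurent2 :: "(complex \<Rightarrow> complex \<Rightarrow> complex) \<Rightarrow> real \<Rightarrow> real \<Rightarrow> (int \<Rightarrow> int \<Rightarrow> complex) \<Rightarrow> bool" where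
  "has_laurent2 f r \<rho> c \<longleftrightarrow> (\<forall>u v. norm u = r \<longrightarrow> norm v = \<rho> \<longrightarrow>
     ((\<lambda>(m, n). c m n * u powi m * v powi n) has_sum f u v) UNIV)"

text \<open>Reads the double series as a series in u with functions of v as coefficients, so that
  one-variable results apply to each variable in turn.\<close>

definition slice :: "(int \<Rightarrow> int \<Rightarrow> complex) \<Rightarrow> int \<Rightarrow> complex \<Rightarrow> complex" where
  "slice c m v = (\<Sum>\<^sub>\<infinity>n. c m n * v powi n)"

lemma has_laurent2D:
  "has_laurent2 f r \<rho> c \<Longrightarrow> norm u = r \<Longrightarrow> norm v = \<rho> \<Longrightarrow>
     ((\<lambda>(m, n). c m n * u powi m * v powi n) has_sum f u v) UNIV"
  by (auto simp: has_laurent2_def)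

lemma slice_has_sum:
  assumes f: "has_laurent2 f r \<rho> c" and r: "r > 0" and v: "norm v = \<rho>"
  shows "((\<lambda>n. c m n * v powi n) has_sum slice c m v) UNIV"
proof -
  define u where "u = complex_of_real r"
  have u: "norm u = r" "u \<noteq> 0" using r by (auto simp: u_def)
  have "(\<lambda>(m, n). c m n * u powi m * v powi n) summable_on UNIV \<times> UNIV"
    using has_sum_imp_summable[OF has_laurent2D[OF f u(1) v]] by simp
  from summable_on_SigmaD1[OF this, of m]
  have "(\<lambda>n. c m n * u powi m * v powi n) summable_on UNIV" by simp
  then have "(\<lambda>n. inverse (u powi m) * (c m n * u powi m * v powi n)) summable_on UNIV"
    by (rule summable_on_cmult_right)
  also have "(\<lambda>n. inverse (u powi m) * (c m n * u powi m * v powi n)) = (\<lambda>n. c m n * v powi n)"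
    using u by (auto simp: fun_eq_iff)
  finally have "(\<lambda>n. c m n * v powi n) summable_on UNIV" .
  then show ?thesis by (simp add: slice_def)
qed

lemma has_laurent_slice1:
  assumes f: "has_laurent2 f r \<rho> c" and r: "r > 0" and v: "norm v = \<rho>"
  shows "has_laurent (\<lambda>u. f u v) {u. norm u = r} (\<lambda>m. slice c m v)"
proof (rule has_laurentI)
  fix u :: complex assume "u \<in> {u. norm u = r}"
  then have u: "norm u = r" by simp
  then show "u \<noteq> 0" using r by auto
  have s: "((\<lambda>(m, n). c m n * u powi m * v powi n) has_sum f u v) (UNIV \<times> UNIV)"
    using has_laurent2D[OF f u v] by simp
  show "((\<lambda>m. slice c m v * u powi m) has_sum f u v) UNIV"
  proof (rule has_sum_SigmaD[OF s])
    fix m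
    have "((\<lambda>n. u powi m * (c m n * v powi n)) has_sum u powi m * slice c m v) UNIV"
      by (rule has_sum_cmult_right[OF slice_has_sum[OF f r v]])
    then show "((\<lambda>n. case (m, n) of (m, n) \<Rightarrow> c m n * u powi m * v powi n) has_sum slice c m v * u powi m) UNIV"
      by (simp add: mult_ac)
  qed
qed

lemma has_laurent_slice2:
  assumes "has_laurent2 f r \<rho> c" "r > 0" "\<rho> > 0"
  shows "has_laurent (slice c m) {v. norm v = \<rho>} (c m)"
  by (rule has_laurentI) (use assms slice_has_sum in auto)

lemma has_laurent2_unique:
  assumes c: "has_laurent2 f r \<rho> c" and d: "has_laurent2 f r \<rho> d" and r: "r > 0" "\<rho> > 0"
  shows "c = d"
proof
  fix m
  have "slice c m v = slice d m v" if "norm v = \<rho>" for v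
    using has_laurent_unique[OF has_laurent_slice1[OF c r(1) that] has_laurent_slice1[OF d r(1) that] r(1)]
    by (simp add: fun_eq_iff)
  then have "has_laurent (slice c m) {v. norm v = \<rho>} (d m)"
    by (intro has_laurent_cong[OF has_laurent_slice2[OF d r]]) auto
  from has_laurent_unique[OF has_laurent_slice2[OF c r] this r(2)] show "c m = d m" .
qed

lemma has_laurent2_add:
  assumes "has_laurent2 f r \<rho> c" "has_laurent2 g r \<rho> d"
  shows "has_laurent2 (\<lambda>u v. f u v + g u v) r \<rho> (\<lambda>m n. c m n + d m n)"
  unfolding has_laurent2_def
proof (intro allI impI)
  fix u v :: complex assume "norm u = r" "norm v = \<rho>"
  from has_sum_add[OF has_laurent2D[OF assms(1) this] has_laurent2D[OF assms(2) this]]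
  show "((\<lambda>(m, n). (c m n + d m n) * u powi m * v powi n) has_sum f u v + g u v) UNIV"
    by (simp add: case_prod_unfold ring_distribs)
qed

lemma has_laurent2_uminus:
  assumes "has_laurent2 f r \<rho> c"
  shows "has_laurent2 (\<lambda>u v. - f u v) r \<rho> (\<lambda>m n. - c m n)"
  unfolding has_laurent2_def
proof (intro allI impI)
  fix u v :: complex assume "norm u = r" "norm v = \<rho>"
  from has_sum_uminusI[OF has_laurent2D[OF assms(1) this]]
  show "((\<lambda>(m, n). - c m n * u powi m * v powi n) has_sum - f u v) UNIV"
    by (simp add: case_prod_unfold)
qed

lemma has_laurent2_shift:
  assumes f: "has_laurent2 f r \<rho> c" and r: "r > 0" "\<rho> > 0"
  shows "has_laurent2 (\<lambda>u v. u powi i * v powi j * f u v) r \<rho> (\<lambda>m n. c (m - i) (n - j))"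
  unfolding has_laurent2_def
proof (intro allI impI)
  fix u v :: complex assume uv: "norm u = r" "norm v = \<rho>"
  then have nz: "u \<noteq> 0" "v \<noteq> 0" using r by auto
  have "((\<lambda>p. u powi i * v powi j * (case p of (m, n) \<Rightarrow> c m n * u powi m * v powi n)) has_sum u powi i * v powi j * f u v) UNIV"
    by (rule has_sum_cmult_right[OF has_laurent2D[OF f uv]])
  also have "?this \<longleftrightarrow> ((\<lambda>(m, n). c (m - i) (n - j) * u powi m * v powi n) has_sum u powi i * v powi j * f u v) UNIV"
    by (rule has_sum_reindex_bij_witness[where i="\<lambda>(m, n). (m - i, n - j)" and j="\<lambda>(m, n). (m + i, n + j)"])
       (use nz in \<open>auto simp: power_int_add\<close>)
  finally show "((\<lambda>(m, n). c (m - i) (n - j) * u powi m * v powi n) has_sum u powi i * v powi j * f u v) UNIV" .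
qed

text \<open>The coefficient of u^m v^n in a product of four series in u, v, u v and u / v; i and j
  are the exponents of u v and u / v.\<close>

definition coef4 :: "(int \<Rightarrow> complex) \<Rightarrow> (int \<Rightarrow> complex) \<Rightarrow> (int \<Rightarrow> complex) \<Rightarrow> (int \<Rightarrow> complex) \<Rightarrow> int \<Rightarrow> int \<Rightarrow> complex" where
  "coef4 a b c d m n = (\<Sum>\<^sub>\<infinity>(i, j). a (m - i - j) * b (n - i + j) * (c i * d j))"

lemma has_sum_coef4:
  assumes nz: "u \<noteq> 0" "v \<noteq> 0"
    and a: "((\<lambda>i. a i * u powi i) has_sum A) UNIV" and b: "((\<lambda>i. b i * v powi i) has_sum B) UNIV"
    and c: "((\<lambda>i. c i * (u * v) powi i) has_sum C) UNIV" and d: "((\<lambda>i. d i * (u / v) powi i) has_sum D) UNIV"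
  shows "((\<lambda>(m, n). coef4 a b c d m n * u powi m * v powi n) has_sum A * B * (C * D)) UNIV"
    and "(\<lambda>(i, j). a (m - i - j) * b (n - i + j) * (c i * d j)) summable_on UNIV"
proof -
  let ?t = "\<lambda>(m, n). \<lambda>(i, j). a (m - i - j) * b (n - i + j) * (c i * d j)"
  have "((\<lambda>(x, y). (case x of (k, l) \<Rightarrow> (a k * u powi k) * (b l * v powi l)) *
      (case y of (i, j) \<Rightarrow> (c i * (u * v) powi i) * (d j * (u / v) powi j))) has_sum A * B * (C * D)) ((UNIV \<times> UNIV) \<times> (UNIV \<times> UNIV))"
    by (intro has_sum_product a b c d)
  also have "?this \<longleftrightarrow> ((\<lambda>(x, y). (case x of (m, n) \<Rightarrow> u powi m * v powi n) * ?t x y) has_sum A * B * (C * D)) ((UNIV \<times> UNIV) \<times> (UNIV \<times> UNIV))"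
    by (rule has_sum_reindex_bij_witness[where i="\<lambda>((m, n), (i, j)). ((m - i - j, n - i + j), (i, j))" and j="\<lambda>((k, l), (i, j)). ((k + i + j, l + i - j), (i, j))"])
       (use nz in \<open>auto simp: power_int_add power_int_diff power_int_mult_distrib power_int_divide_distrib\<close>)
  finally have s: "((\<lambda>(x, y). (case x of (m, n) \<Rightarrow> u powi m * v powi n) * ?t x y) has_sum A * B * (C * D)) (UNIV \<times> UNIV)"
    by simp
  have sm: "?t x summable_on UNIV" for x
  proof -
    obtain m n where x: "x = (m, n)" by (cases x)
    have "(\<lambda>y. u powi m * v powi n * ?t x y) summable_on UNIV"
      using summable_on_SigmaD1[OF has_sum_imp_summable[OF s], of x] by (simp add: x)
    then have "(\<lambda>y. inverse (u powi m * v powi n) * (u powi m * v powi n * ?t x y)) summable_on UNIV"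
      by (rule summable_on_cmult_right)
    also have "(\<lambda>y. inverse (u powi m * v powi n) * (u powi m * v powi n * ?t x y)) = ?t x"
    proof
      fix y
      have *: "inverse X * (X * z) = z" if "X \<noteq> 0" for X z :: complex
        using that by simp
      show "inverse (u powi m * v powi n) * (u powi m * v powi n * ?t x y) = ?t x y"
        by (rule *) (use nz in simp)
    qed
    finally show ?thesis .
  qed
  from sm[of "(m, n)"] show "(\<lambda>(i, j). a (m - i - j) * b (n - i + j) * (c i * d j)) summable_on UNIV" by simp
  show "((\<lambda>(m, n). coef4 a b c d m n * u powi m * v powi n) has_sum A * B * (C * D)) UNIV"
  proof (rule has_sum_SigmaD[OF s])
    fix x :: "int \<times> int"
    obtain m n where x: "x = (m, n)" by (cases x)
    have "(?t x has_sum coef4 a b c d m n) UNIV"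
      using sm[of x] by (simp add: coef4_def x)
    from has_sum_cmult_right[OF this, of "u powi m * v powi n"]
    show "((\<lambda>y. case (x, y) of (x, y) \<Rightarrow> (case x of (m, n) \<Rightarrow> u powi m * v powi n) * ?t x y) has_sum
       (case x of (m, n) \<Rightarrow> coef4 a b c d m n * u powi m * v powi n)) UNIV"
      by (simp add: x mult_ac)
  qed
qed

section \<open>The torus, the function \<open>Psi\<close> and its residues in u\<close>

context nome_sqrt
begin

definition cF :: "int \<Rightarrow> int \<Rightarrow> complex" where "cF = coef4 M M M M"

lemma has_sum_cF:
  assumes "u \<in> annulus" "v \<in> annulus" "u * v \<in> annulus" "u / v \<in> annulus"
  shows "((\<lambda>(m, n). cF m n * u powi m * v powi n) has_sum W u * W v * (W (u * v) * W (u / v))) UNIV"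
  unfolding cF_def
  by (intro has_sum_coef4 has_laurentD(2)[OF has_laurent_W] assms annulus_nonzero)

text \<open>|u| = |q|^(1/2) is the circle preserved by u -> q / u. With |v| = |q|^(1/4) one gets |u
  v| = |q|^(3/4) and |u / v| = |q|^(1/4), so all four arguments lie strictly between |q| and
  1.\<close>

definition r0 :: real where "r0 = norm p"
definition \<rho>0 :: real where "\<rho>0 = sqrt (norm p)"

lemma r0_pos: "r0 > 0" and \<rho>0_pos: "\<rho>0 > 0"
  using p0 by (auto simp: r0_def \<rho>0_def)

lemma \<rho>0_bounds: "r0 < \<rho>0" "\<rho>0 < 1" "\<rho>0 * \<rho>0 = r0" "norm q = r0 * r0"
proof -
  show 1: "\<rho>0 < 1" using norm_p_less by (simp add: \<rho>0_def)
  show 2: "\<rho>0 * \<rho>0 = r0" by (simp add: \<rho>0_def r0_def)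
  show "r0 < \<rho>0" using mult_strict_left_mono[OF 1 \<rho>0_pos] 2 by simp
  show "norm q = r0 * r0" using norm_p by (simp add: r0_def power2_eq_square)
qed

definition disc_annulus :: "complex set" where "disc_annulus = {z. norm q < norm z \<and> norm z < 1}"

lemma disc_annulus_subset: "disc_annulus \<subseteq> annulus"
proof -
  have "1 < 1 / norm q" using q0 q1 by simp
  then show ?thesis by (auto simp: annulus_def disc_annulus_def)
qed

lemma torus_in_annulus:
  assumes "norm u = r0" "norm v = \<rho>0"
  shows "u \<in> disc_annulus" "v \<in> disc_annulus" "u * v \<in> disc_annulus" "u / v \<in> disc_annulus"
proof -
  note b = \<rho>0_bounds r0_pos \<rho>0_pos
  have r1: "r0 < 1" using b by linarith
  have q: "norm q < r0" using b r1 mult_strict_left_mono[of r0 1 r0] by simp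
  have 1: "r0 * \<rho>0 < 1" using b r1 mult_strict_mono[of r0 1 \<rho>0 1] by simp
  have 2: "norm q < r0 * \<rho>0" using b by simp
  have 3: "r0 / \<rho>0 = \<rho>0" using b by (simp add: field_simps)
  show "u \<in> disc_annulus" "v \<in> disc_annulus" "u * v \<in> disc_annulus" "u / v \<in> disc_annulus"
    unfolding disc_annulus_def mem_Collect_eq norm_mult norm_divide assms 3
    using b(1,2) q r1 1 2 by linarith+
qed

lemma has_laurent2_F: "has_laurent2 (\<lambda>u v. W u * W v * (W (u * v) * W (u / v))) r0 \<rho>0 cF"
  unfolding has_laurent2_def
proof (intro allI impI)
  fix u v :: complex assume uv: "norm u = r0" "norm v = \<rho>0"
  show "((\<lambda>(m, n). cF m n * u powi m * v powi n) has_sum W u * W v * (W (u * v) * W (u / v))) UNIV"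
    by (intro has_sum_cF subsetD[OF disc_annulus_subset] torus_in_annulus[OF uv])
qed

definition Psi :: "complex \<Rightarrow> complex \<Rightarrow> complex" where
  "Psi u v = 1 / T u * W v * (1 / T (u * v) * (1 / T (u / v)))"

definition cPsi :: "int \<Rightarrow> int \<Rightarrow> complex" where "cPsi = coef4 lseq M lseq lseq"

lemma has_laurent2_Psi: "has_laurent2 Psi r0 \<rho>0 cPsi"
  unfolding has_laurent2_def
proof (intro allI impI)
  fix u v :: complex assume uv: "norm u = r0" "norm v = \<rho>0"
  note t = torus_in_annulus[OF uv]
  have nz: "u \<noteq> 0" "v \<noteq> 0" using uv r0_pos \<rho>0_pos by auto
  have l: "((\<lambda>n. lseq n * z powi n) has_sum 1 / T z) UNIV" if "z \<in> disc_annulus" for z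
    using has_laurentD(2)[OF has_laurent_inverse_T] that by (simp add: disc_annulus_def)
  have w: "((\<lambda>n. M n * v powi n) has_sum W v) UNIV"
    using has_laurentD(2)[OF has_laurent_W] t disc_annulus_subset by blast
  show "((\<lambda>(m, n). cPsi m n * u powi m * v powi n) has_sum Psi u v) UNIV"
    unfolding cPsi_def Psi_def by (intro has_sum_coef4 nz l w t)
qed

text \<open>u -> q / u preserves the torus, fixes T u and exchanges T (u v) with T (u / v).\<close>

lemma cPsi_reflect: "cPsi (- m) n = q powi m * cPsi m n"
proof -
  have "slice cPsi (- m) v = q powi m * slice cPsi m v" if v: "norm v = \<rho>0" for v
  proof -
    note L = has_laurent_slice1[OF has_laurent2_Psi r0_pos v]
    have v0: "v \<noteq> 0" using v \<rho>0_pos by auto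
    have nrm: "norm (q / u) = r0" if "norm u = r0" for u :: complex
      using that r0_pos \<rho>0_bounds(4) by (simp add: norm_divide)
    have "has_laurent (\<lambda>u. Psi (q / u) v) {u. norm u = r0} (\<lambda>n. slice cPsi (- n) v * q powi (- n))"
      by (rule has_laurent_reflect[OF L q0]) (use nrm in auto)
    then have "has_laurent (\<lambda>u. Psi u v) {u. norm u = r0} (\<lambda>n. slice cPsi (- n) v * q powi (- n))"
    proof (rule has_laurent_cong)
      fix u :: complex assume "u \<in> {u. norm u = r0}" and u0: "u \<noteq> 0"
      have "q / u * v = q / (u / v)" "q / u / v = q / (u * v)" by simp_all
      then show "Psi (q / u) v = Psi u v"
        using T_q_div[of "u / v"] T_q_div[of "u * v"] T_q_div[of u] u0 v0 by (simp add: Psi_def)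
    qed
    from fun_cong[OF has_laurent_unique[OF L this r0_pos], of m]
    have "slice cPsi m v * q powi m = slice cPsi (- m) v * (q powi (- m) * q powi m)" by simp
    also have "q powi (- m) * q powi m = 1" using q0 by (simp add: power_int_minus)
    finally show ?thesis by (simp add: mult.commute)
  qed
  moreover note L2 = has_laurent_slice2[OF has_laurent2_Psi r0_pos \<rho>0_pos]
  ultimately have "has_laurent (slice cPsi (- m)) {v. norm v = \<rho>0} (\<lambda>n. q powi m * cPsi m n)"
    by (intro has_laurent_cong[OF has_laurent_cmult[OF L2[of m]]]) auto
  from has_laurent_unique[OF L2[of "- m"] this \<rho>0_pos] show ?thesis by (simp add: fun_eq_iff)
qed

lemma partial_fraction:
  fixes u v :: complex
  assumes "v \<noteq> 0" "v \<noteq> 1" "v \<noteq> -1" "u \<noteq> 1" "u * v \<noteq> 1" "u \<noteq> v"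
  defines "C \<equiv> 1 / ((1 - v) * (1 - v\<^sup>2))"
  shows "1 / ((1 - u) * (1 - u * v) * (1 - u / v)) = - v / (1 - v)\<^sup>2 * (1 / (1 - u)) + v ^ 3 * C * (1 / (1 - v * u)) + C * (1 / (1 - (1 / v) * u))"
proof -
  have nz: "1 - v \<noteq> 0" "1 + v \<noteq> 0" "1 - u \<noteq> 0" "1 - v * u \<noteq> 0" "v - u \<noteq> 0"
    using assms by (auto simp: add_eq_0_iff mult.commute)
  have C: "C = 1 / ((1 - v)\<^sup>2 * (1 + v))"
    using nz by (simp add: C_def power2_eq_square field_simps)
  have r: "1 - u / v = (v - u) / v" "1 - (1 / v) * u = (v - u) / v" using assms(1) by (simp_all add: field_simps)
  have "v * ((1 - v)\<^sup>2 * (1 + v)) = - v * (1 + v) * ((1 - v * u) * (v - u)) + v ^ 3 * ((1 - u) * (v - u)) + v * ((1 - u) * (1 - v * u))"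
    by (simp add: power2_eq_square power3_eq_cube algebra_simps)
  then have "v / ((1 - u) * (1 - v * u) * (v - u)) = (- v * (1 + v) * ((1 - v * u) * (v - u)) + v ^ 3 * ((1 - u) * (v - u)) + v * ((1 - u) * (1 - v * u))) / ((1 - v)\<^sup>2 * (1 + v) * ((1 - u) * (1 - v * u) * (v - u)))"
    using nz by (simp add: divide_simps)
  also have "\<dots> = - v / (1 - v)\<^sup>2 * (1 / (1 - u)) + v ^ 3 * C * (1 / (1 - v * u)) + C * (v / (v - u))"
    unfolding C add_divide_distrib using nz by (simp add: divide_simps)
  finally show ?thesis by (simp add: r mult.commute)
qed

text \<open>For fixed v, partial fractions in u separate the poles u = 1, 1 / v and v from an even
  function G that is regular at all three; \<open>half_reflect\<close> with K = 3 then turns the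
  poles into values of G.\<close>

lemma slice_Psi_reflect:
  assumes v: "norm v = \<rho>0"
  shows "slice cPsi (- a) v + slice cPsi (a - 3) v =
    (- (v powi 1 * (1 / T v ^ 3)) + v powi 2 * (1 / T v ^ 3)
      + v powi a * (1 / (T v ^ 2 * T (v\<^sup>2))) - v powi (a + 1) * (1 / (T v ^ 2 * T (v\<^sup>2)))
      + v powi (3 - a) * (1 / (T v ^ 2 * T (v\<^sup>2))) - v powi (4 - a) * (1 / (T v ^ 2 * T (v\<^sup>2)))) / E\<^sup>2"
proof -
  note b = \<rho>0_bounds r0_pos \<rho>0_pos
  have v0: "v \<noteq> 0" and v1: "v \<noteq> 1" and vm: "v \<noteq> -1" using v b by auto
  have "norm (v\<^sup>2) = r0" by (simp only: power2_eq_square norm_mult v b)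
  then have v2a: "v\<^sup>2 \<in> disc_annulus" and v21: "v\<^sup>2 \<noteq> 1"
    using torus_in_annulus[OF _ v, of "v\<^sup>2"] b by auto
  have va: "v \<in> disc_annulus" using torus_in_annulus[of "of_real r0" v] v r0_pos by auto
  \<comment> \<open>Here u, u v and u / v all lie in \<open>annulus\<close>. The set contains the
    unit circle, both points v and 1 / v, and the circle |u| = r0.\<close>
  define Sv where "Sv = {u :: complex. norm q / \<rho>0 < norm u \<and> norm u < \<rho>0 / norm q}"
  have Sv: "u \<in> annulus" "v * u \<in> annulus" "(1 / v) * u \<in> annulus" if u: "u \<in> Sv" for u
  proof -
    have u1: "norm q < norm u * \<rho>0" "norm u * norm q < \<rho>0"
      using u b q0 by (simp_all add: Sv_def field_simps)
    have u2: "norm u * \<rho>0 < norm u"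
      using b u1(1) mult_strict_left_mono[of \<rho>0 1 "norm u"] by (cases "norm u = 0") auto
    have qp: "norm q > 0" using q0 by simp
    have q\<rho>: "norm q * \<rho>0 < norm q" using b qp mult_strict_left_mono[of \<rho>0 1 "norm q"] by simp
    have u3: "norm u * norm q * \<rho>0 \<le> norm u * norm q"
      using mult_left_mono[of \<rho>0 1 "norm u * norm q"] b by simp
    have "norm q < norm u" "norm u < 1 / norm q"
      using u1 u2 b(2) by (simp_all add: pos_less_divide_eq[OF qp])
    moreover have "norm q < \<rho>0 * norm u" "\<rho>0 * norm u < 1 / norm q"
      using u1 u3 b(2) by (simp_all add: pos_less_divide_eq[OF qp] mult_ac)
    moreover have "norm q < 1 / \<rho>0 * norm u"
      using u1 u2 q\<rho> b(6) by (simp add: pos_less_divide_eq)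
    moreover have "1 / \<rho>0 * norm u < 1 / norm q"
      using u1 b(6) qp by (simp add: divide_simps mult_ac)
    ultimately show "u \<in> annulus" "v * u \<in> annulus" "(1 / v) * u \<in> annulus"
      unfolding annulus_def mem_Collect_eq norm_mult norm_divide v norm_one by auto
  qed
  have unitSv: "u \<in> Sv" if "norm u = 1" for u
  proof -
    have "r0 * r0 < r0 * 1" by (rule mult_strict_left_mono) (use b in auto)
    then have "norm q < \<rho>0" using b by linarith
    then show ?thesis using that b q0 by (simp add: Sv_def)
  qed
  have r3: "r0 * r0 < \<rho>0 * \<rho>0" "r0 * r0 < r0 * \<rho>0" using b mult_strict_left_mono[of r0 1 r0] by auto
  have vSv: "v \<in> Sv" "1 / v \<in> Sv" and rSv: "{u. norm u = r0} \<subseteq> Sv"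
  proof -
    have n: "norm q < \<rho>0 * \<rho>0" "norm q < r0 * \<rho>0" "norm q < 1"
      using r3 b q1 by auto
    have "r0 * norm q < r0 * 1" by (rule mult_strict_left_mono) (use n b in auto)
    then have n4: "r0 * norm q < \<rho>0" using b by linarith
    have qp: "norm q > 0" using q0 by simp
    have "norm q / \<rho>0 < \<rho>0" "\<rho>0 < \<rho>0 / norm q" "norm q / \<rho>0 < 1 / \<rho>0" "1 / \<rho>0 < \<rho>0 / norm q"
      "norm q / \<rho>0 < r0" "r0 < \<rho>0 / norm q"
      using n n4 b(6) qp by (simp_all add: divide_simps mult.commute)
    then show "v \<in> Sv" "1 / v \<in> Sv" "{u. norm u = r0} \<subseteq> Sv"
      by (auto simp: Sv_def norm_divide v)
  qed
  define g where "g = conv (conv M (\<lambda>n. M n * v powi n)) (\<lambda>n. M n * (1 / v) powi n)"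
  define G where "G u = W u * W (v * u) * W ((1 / v) * u)" for u
  have gG: "has_laurent G Sv g"
    unfolding g_def G_def[abs_def]
    by (intro has_laurent_mult has_laurent_scale[OF has_laurent_W] has_laurent_subset[OF has_laurent_W])
       (use Sv v0 in auto)
  have Ginv: "G (1 / u) = G u" if "u \<noteq> 0" for u
  proof -
    have "v * (1 / u) = 1 / ((1 / v) * u)" "(1 / v) * (1 / u) = 1 / (v * u)" using v0 by simp_all
    then show ?thesis using W_inverse[of u] W_inverse[of "v * u"] W_inverse[of "(1 / v) * u"] that v0
      unfolding G_def by (simp only:) (simp add: mult_ac)
  qed
  have geven: "g (- n) = g n" for n
  proof (rule has_laurent_even[OF has_laurent_subset[OF gG]])
    show "G (1 / z) = G z" if "norm z = 1" for z
      by (rule Ginv) (use that in auto)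
  qed (use unitSv in auto)
  define A B C where "A = - v / (1 - v)\<^sup>2" and "B = v ^ 3 * (1 / ((1 - v) * (1 - v\<^sup>2)))" and "C = 1 / ((1 - v) * (1 - v\<^sup>2))"
  define k where "k m = A + B * v powi m + C * (1 / v) powi m" for m
  have ker: "has_laurent (\<lambda>u. A * (1 / (1 - 1 * u)) + B * (1 / (1 - v * u)) + C * (1 / (1 - (1 / v) * u))) {u. norm u = r0} (causal k)"
  proof -
    have "has_laurent (\<lambda>u. A * (1 / (1 - 1 * u)) + B * (1 / (1 - v * u)) + C * (1 / (1 - (1 / v) * u))) {u. norm u = r0}
      (\<lambda>m. A * causal (\<lambda>m. 1 ^ nat m) m + B * causal (\<lambda>m. v ^ nat m) m + C * causal (\<lambda>m. (1 / v) ^ nat m) m)"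
    proof (intro has_laurent_add has_laurent_cmult has_laurent_geometric)
      fix z :: complex assume z: "z \<in> {u. norm u = r0}"
      note t = torus_in_annulus[of z v]
      show "z \<noteq> 0 \<and> norm (1 * z) < 1" "z \<noteq> 0 \<and> norm (v * z) < 1" "z \<noteq> 0 \<and> norm ((1 / v) * z) < 1"
        using t z v b by (auto simp: disc_annulus_def norm_mult norm_divide mult.commute)
    qed
    also have "(\<lambda>m. A * causal (\<lambda>m. 1 ^ nat m) m + B * causal (\<lambda>m. v ^ nat m) m + C * causal (\<lambda>m. (1 / v) ^ nat m) m) = causal k"
      by (auto simp: k_def fun_eq_iff power_int_def)
    finally show ?thesis .
  qed
  have "has_laurent (\<lambda>u. (A * (1 / (1 - 1 * u)) + B * (1 / (1 - v * u)) + C * (1 / (1 - (1 / v) * u))) * G u) {u. norm u = r0} (\<lambda>n. half k g (- n))"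
    by (rule has_laurent_causal_mult[OF ker has_laurent_subset[OF gG rSv] geven])
  then have "has_laurent (\<lambda>u. W v * ((A * (1 / (1 - 1 * u)) + B * (1 / (1 - v * u)) + C * (1 / (1 - (1 / v) * u))) * G u)) {u. norm u = r0} (\<lambda>n. W v * half k g (- n))"
    by (rule has_laurent_cmult)
  then have "has_laurent (\<lambda>u. Psi u v) {u. norm u = r0} (\<lambda>n. W v * half k g (- n))"
  proof (rule has_laurent_cong)
    fix u :: complex assume u: "u \<in> {u. norm u = r0}"
    have t: "u \<in> disc_annulus" "u * v \<in> disc_annulus" "u / v \<in> disc_annulus" using torus_in_annulus[of u v] u v by auto
    have n1: "u \<noteq> 1" "u * v \<noteq> 1" "u / v \<noteq> 1" using t by (auto simp: disc_annulus_def)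
    have t': "u \<in> annulus" "u * v \<in> annulus" "u / v \<in> annulus" using t disc_annulus_subset by auto
    have "A * (1 / (1 - 1 * u)) + B * (1 / (1 - v * u)) + C * (1 / (1 - (1 / v) * u)) = 1 / ((1 - u) * (1 - u * v) * (1 - u / v))"
      unfolding A_def B_def C_def using partial_fraction[of v u] v0 v1 vm n1 by (simp only: mult_1_left) auto
    moreover have "G u = W u * W (u * v) * W (u / v)" by (simp add: G_def mult.commute)
    ultimately show "W v * ((A * (1 / (1 - 1 * u)) + B * (1 / (1 - v * u)) + C * (1 / (1 - (1 / v) * u))) * G u) = Psi u v"
      unfolding Psi_def using W_eq[OF t'(1) n1(1)] W_eq[OF t'(2) n1(2)] W_eq[OF t'(3) n1(3)] n1 v0 by simp
  qed
  from has_laurent_unique[OF has_laurent_slice1[OF has_laurent2_Psi r0_pos v] this r0_pos]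
  have sl: "slice cPsi n v = W v * half k g (- n)" for n by (simp add: fun_eq_iff)
  have nz: "1 - v \<noteq> 0" "1 + v \<noteq> 0" using v1 vm by (auto simp: add_eq_0_iff)
  \<comment> \<open>Over the common denominator of C, the coefficients \<open>k\<close> are visibly
    symmetric under m -> - 3 - m and zero at - 1 and - 2.\<close>
  have A': "A = - (v + v\<^sup>2) * C" unfolding A_def C_def using nz v21 by (simp add: power2_eq_square divide_simps) (simp add: algebra_simps)
  have B': "B = v ^ 3 * C" by (simp add: B_def C_def)
  have "half k g a + half k g (3 - a) = A * G 1 + B * v powi (- a) * G v + C * v powi a * G (1 / v)"
  proof (rule half_reflect[where g=g and p=k and K=3])
    have h: "((\<lambda>n. g n * z powi n) has_sum G z) UNIV" if "z \<in> Sv" for z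
      using has_laurentD(2)[OF gG that] .
    have "((\<lambda>n. A * (g n * 1 powi n) + B * v powi (- a) * (g n * v powi n) + C * v powi a * (g n * (1 / v) powi n))
       has_sum (A * G 1 + B * v powi (- a) * G v + C * v powi a * G (1 / v))) UNIV"
      by (intro has_sum_add has_sum_cmult_right h vSv unitSv) simp
    also have "(\<lambda>n. A * (g n * 1 powi n) + B * v powi (- a) * (g n * v powi n) + C * v powi a * (g n * (1 / v) powi n)) = (\<lambda>n. k (n - a) * g n)"
      using v0 by (auto simp: k_def fun_eq_iff power_int_diff power_int_minus power_int_divide_distrib field_simps)
    finally show "((\<lambda>m. k m * g (a + m)) has_sum (A * G 1 + B * v powi (- a) * G v + C * v powi a * G (1 / v))) UNIV"
      by (subst (asm) has_sum_shift_int[symmetric, of _ _ a]) simp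
    show "k (- 3 - m) = k m" for m
      using v0 by (simp add: k_def B' power_int_diff power_int_minus power_int_divide_distrib field_simps power3_eq_cube)
    show "k m = 0" if "- 3 < m" "m < 0" for m
    proof -
      have "m = -1 \<or> m = -2" using that by auto
      then show ?thesis using v0 by (auto simp: k_def A' B' power_int_minus field_simps power3_eq_cube power2_eq_square)
    qed
  qed (simp_all add: geven)
  also have "G 1 = W v * W v * W 1"
    using W_inverse[OF v0] by (simp add: G_def)
  also have "G (1 / v) = G v" using Ginv[OF v0] .
  also have "G v = W v * W (v\<^sup>2) * W 1" using v0 by (simp add: G_def power2_eq_square)
  finally have hh: "half k g a + half k g (3 - a) = A * (W v * W v * W 1) + B * v powi (- a) * (W v * W (v\<^sup>2) * W 1) + C * v powi a * (W v * W (v\<^sup>2) * W 1)" .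
  have Wv: "W v = (1 - v) / T v" and Wv2: "W (v\<^sup>2) = (1 - v\<^sup>2) / T (v\<^sup>2)"
    using W_eq va v2a v1 v21 disc_annulus_subset by auto
  have "v powi (3 - a) = v ^ 3 * v powi (- a)" "v powi (4 - a) = v ^ 4 * v powi (- a)" "v powi (a + 1) = v * v powi a"
    using v0 by (simp_all add: power_int_diff power_int_minus power_int_add divide_inverse)
  note pw = this
  have "slice cPsi (- a) v + slice cPsi (a - 3) v = W v * (half k g a + half k g (3 - a))"
    unfolding sl by (simp add: distrib_left)
  also have "\<dots> = (A * (1 - v) ^ 3 * (1 / T v ^ 3) + (B * v powi (- a) + C * v powi a) * ((1 - v)\<^sup>2 * (1 - v\<^sup>2)) * (1 / (T v ^ 2 * T (v\<^sup>2)))) / E\<^sup>2"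
    unfolding hh W_1 Wv Wv2 by (simp add: power2_eq_square power3_eq_cube add_divide_distrib distrib_left distrib_right mult_ac)
  also have "A * (1 - v) ^ 3 = - v + v\<^sup>2"
  proof -
    have "A * (1 - v) ^ 3 = - v / (1 - v)\<^sup>2 * ((1 - v)\<^sup>2 * (1 - v))"
      by (simp add: A_def power2_eq_square power3_eq_cube mult.assoc)
    also have "\<dots> = - v * (1 - v)" using nz by simp
    finally show ?thesis by (simp add: power2_eq_square algebra_simps)
  qed
  also have "(B * v powi (- a) + C * v powi a) * ((1 - v)\<^sup>2 * (1 - v\<^sup>2)) = (v powi (3 - a) + v powi a) * (1 - v)"
  proof -
    have "C * ((1 - v)\<^sup>2 * (1 - v\<^sup>2)) = 1 - v" unfolding C_def using nz v21 by (simp add: power2_eq_square)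
    then have "(v powi (3 - a) + v powi a) * (C * ((1 - v)\<^sup>2 * (1 - v\<^sup>2))) = (v powi (3 - a) + v powi a) * (1 - v)" by simp
    then show ?thesis unfolding B' pw by (simp add: algebra_simps)
  qed
  finally show ?thesis unfolding pw by (simp add: algebra_simps add_divide_distrib diff_divide_distrib eval_nat_numeral)
qed

lemma cPsi_sum:
  "cPsi (- a) n + cPsi (a - 3) n =
    (- tseq (1 - n) + tseq (2 - n) + sseq (a - n) - sseq (a + 1 - n) + sseq (3 - a - n) - sseq (4 - a - n)) / E\<^sup>2"
proof -
  note L2 = has_laurent_slice2[OF has_laurent2_Psi r0_pos \<rho>0_pos]
  have t: "has_laurent (\<lambda>z. 1 / T z ^ 3) {z. norm z = \<rho>0} (\<lambda>n. tseq (- n))"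
  proof (rule has_laurent_T3)
    have "norm q < r0" using \<rho>0_bounds r0_pos mult_strict_left_mono[of r0 1 r0] by simp
    then show "norm q < \<rho>0" "\<rho>0 < 1" using \<rho>0_bounds by auto
  qed
  have s: "has_laurent (\<lambda>z. 1 / (T z ^ 2 * T (z\<^sup>2))) {z. norm z = \<rho>0} (\<lambda>n. sseq (- n))"
    by (rule has_laurent_T4) (use \<rho>0_bounds in \<open>auto simp: r0_def\<close>)
  have "has_laurent (\<lambda>v. 1 / E\<^sup>2 * (-1 * (v powi 1 * (1 / T v ^ 3)) + v powi 2 * (1 / T v ^ 3)
      + v powi a * (1 / (T v ^ 2 * T (v\<^sup>2))) - v powi (a + 1) * (1 / (T v ^ 2 * T (v\<^sup>2)))
      + v powi (3 - a) * (1 / (T v ^ 2 * T (v\<^sup>2))) - v powi (4 - a) * (1 / (T v ^ 2 * T (v\<^sup>2))))) {z. norm z = \<rho>0}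
    (\<lambda>n. 1 / E\<^sup>2 * (-1 * tseq (- (n - 1)) + tseq (- (n - 2)) + sseq (- (n - a)) - sseq (- (n - (a + 1))) + sseq (- (n - (3 - a))) - sseq (- (n - (4 - a)))))"
    by (intro has_laurent_cmult has_laurent_add has_laurent_diff has_laurent_shift[OF t] has_laurent_shift[OF s])
  then have "has_laurent (\<lambda>v. slice cPsi (- a) v + slice cPsi (a - 3) v) {z. norm z = \<rho>0}
    (\<lambda>n. 1 / E\<^sup>2 * (-1 * tseq (- (n - 1)) + tseq (- (n - 2)) + sseq (- (n - a)) - sseq (- (n - (a + 1))) + sseq (- (n - (3 - a))) - sseq (- (n - (4 - a)))))"
    by (rule has_laurent_cong) (simp add: slice_Psi_reflect)
  from has_laurent_unique[OF has_laurent_add[OF L2[of "- a"] L2[of "a - 3"]] this \<rho>0_pos]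
  have "cPsi (- a) n + cPsi (a - 3) n = 1 / E\<^sup>2 * (-1 * tseq (- (n - 1)) + tseq (- (n - 2)) + sseq (- (n - a)) - sseq (- (n - (a + 1))) + sseq (- (n - (3 - a))) - sseq (- (n - (4 - a))))"
    by (simp only: fun_eq_iff)
  moreover have "- (n - 1) = 1 - n" "- (n - 2) = 2 - n" "- (n - a) = a - n" "- (n - (a + 1)) = a + 1 - n"
    "- (n - (3 - a)) = 3 - a - n" "- (n - (4 - a)) = 4 - a - n" by simp_all
  ultimately show ?thesis by (simp only:) simp
qed

text \<open>(1 - u) (1 - u v) (1 - u / v) = 1 - s u + s u^2 - u^3 with s = 1 + v + 1 / v, so only
  the combinations \<open>yseq\<close> and \<open>zseq\<close> of v-coefficients enter. The factor
  E^8 clears the powers of E in the residues.\<close>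

definition yseq :: "int \<Rightarrow> complex" where "yseq a = E ^ 8 * cPsi (- a) 0"
definition zseq :: "int \<Rightarrow> complex" where "zseq a = E ^ 8 * (cPsi (- a) 0 + cPsi (- a) 1 + cPsi (- a) (-1))"

lemma cF_eq: "E ^ 8 * cF 0 0 = yseq 0 - zseq 1 + zseq 2 - yseq 3"
proof -
  note sh = has_laurent2_shift[OF has_laurent2_Psi r0_pos \<rho>0_pos]
  have "has_laurent2 (\<lambda>u v. u powi 0 * v powi 0 * Psi u v + - (u powi 1 * v powi 0 * Psi u v) + - (u powi 1 * v powi 1 * Psi u v) + - (u powi 1 * v powi (-1) * Psi u v)
      + u powi 2 * v powi 1 * Psi u v + u powi 2 * v powi (-1) * Psi u v + u powi 2 * v powi 0 * Psi u v + - (u powi 3 * v powi 0 * Psi u v)) r0 \<rho>0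
    (\<lambda>m n. cPsi (m - 0) (n - 0) + - cPsi (m - 1) (n - 0) + - cPsi (m - 1) (n - 1) + - cPsi (m - 1) (n - (-1))
      + cPsi (m - 2) (n - 1) + cPsi (m - 2) (n - (-1)) + cPsi (m - 2) (n - 0) + - cPsi (m - 3) (n - 0))"
    by (intro has_laurent2_add has_laurent2_uminus sh)
  moreover have "u powi 0 * v powi 0 * Psi u v + - (u powi 1 * v powi 0 * Psi u v) + - (u powi 1 * v powi 1 * Psi u v) + - (u powi 1 * v powi (-1) * Psi u v)
      + u powi 2 * v powi 1 * Psi u v + u powi 2 * v powi (-1) * Psi u v + u powi 2 * v powi 0 * Psi u v + - (u powi 3 * v powi 0 * Psi u v)
      = W u * W v * (W (u * v) * W (u / v))" if uv: "norm u = r0" "norm v = \<rho>0" for u v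
  proof -
    have v0: "v \<noteq> 0" using uv \<rho>0_pos by auto
    have t: "u \<in> disc_annulus" "u * v \<in> disc_annulus" "u / v \<in> disc_annulus" using torus_in_annulus[of u v] uv by auto
    have n1: "u \<noteq> 1" "u * v \<noteq> 1" "u / v \<noteq> 1" using t by (auto simp: disc_annulus_def)
    have t': "u \<in> annulus" "u * v \<in> annulus" "u / v \<in> annulus" using t disc_annulus_subset by auto
    have "u powi 0 * v powi 0 * Psi u v + - (u powi 1 * v powi 0 * Psi u v) + - (u powi 1 * v powi 1 * Psi u v) + - (u powi 1 * v powi (-1) * Psi u v)
      + u powi 2 * v powi 1 * Psi u v + u powi 2 * v powi (-1) * Psi u v + u powi 2 * v powi 0 * Psi u v + - (u powi 3 * v powi 0 * Psi u v)
      = (1 - u - u * v - u * inverse v + u ^ 2 * v + u ^ 2 * inverse v + u ^ 2 - u ^ 3) * Psi u v"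
      by (simp add: power_int_minus algebra_simps)
    also have "1 - u - u * v - u * inverse v + u ^ 2 * v + u ^ 2 * inverse v + u ^ 2 - u ^ 3 = (1 - u) * (1 - u * v) * (1 - u / v)"
      using v0 by (simp add: field_simps power2_eq_square power3_eq_cube)
    also have "\<dots> * Psi u v = W u * W v * (W (u * v) * W (u / v))"
      unfolding W_eq[OF t'(1) n1(1)] W_eq[OF t'(2) n1(2)] W_eq[OF t'(3) n1(3)] Psi_def by simp
    finally show ?thesis .
  qed
  ultimately have "has_laurent2 (\<lambda>u v. W u * W v * (W (u * v) * W (u / v))) r0 \<rho>0
    (\<lambda>m n. cPsi (m - 0) (n - 0) + - cPsi (m - 1) (n - 0) + - cPsi (m - 1) (n - 1) + - cPsi (m - 1) (n - (-1))
      + cPsi (m - 2) (n - 1) + cPsi (m - 2) (n - (-1)) + cPsi (m - 2) (n - 0) + - cPsi (m - 3) (n - 0))"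
    unfolding has_laurent2_def by (metis (no_types, lifting))
  from has_laurent2_unique[OF has_laurent2_F this r0_pos \<rho>0_pos]
  have "cF 0 0 = cPsi 0 0 - cPsi (-1) 0 - cPsi (-1) (-1) - cPsi (-1) 1 + cPsi (-2) (-1) + cPsi (-2) 1 + cPsi (-2) 0 - cPsi (-3) 0"
    by (simp add: fun_eq_iff)
  then show ?thesis unfolding yseq_def zseq_def by (simp only:) (simp add: algebra_simps)
qed

lemma yseq_shift: "yseq a = q powi a * yseq (- a)" and zseq_shift: "zseq a = q powi a * zseq (- a)"
  using cPsi_reflect[of a] by (simp_all add: yseq_def zseq_def algebra_simps)

definition tn :: "int \<Rightarrow> complex" where "tn b = E ^ 6 * tseq b"
definition sn :: "int \<Rightarrow> complex" where "sn b = E ^ 6 * sseq b"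

lemma E8_div: "E ^ 8 * (x / E\<^sup>2) = E ^ 6 * x"
proof -
  have "E ^ 8 = E ^ 6 * E\<^sup>2" by (simp flip: power_add)
  moreover have "E\<^sup>2 * (x / E\<^sup>2) = x" using E_nonzero by simp
  ultimately show ?thesis by (simp only: mult.assoc)
qed

lemma yseq_reflect:
  "yseq a + yseq (3 - a) = tn 2 - tn 1 + sn a - sn (a + 1) + sn (3 - a) - sn (4 - a)"
proof -
  have "yseq a + yseq (3 - a) = E ^ 8 * (cPsi (- a) 0 + cPsi (a - 3) 0)"
    by (simp add: yseq_def algebra_simps)
  then show ?thesis unfolding cPsi_sum E8_div by (simp add: tn_def sn_def algebra_simps)
qed

lemma zseq_reflect:
  "zseq a + zseq (3 - a) = tn 3 - tn 0 + sn (a - 1) - sn (a + 2) + sn (2 - a) - sn (5 - a)"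
proof -
  have "zseq a + zseq (3 - a) = E ^ 8 * ((cPsi (- a) 0 + cPsi (a - 3) 0) + (cPsi (- a) 1 + cPsi (a - 3) 1) + (cPsi (- a) (-1) + cPsi (a - 3) (-1)))"
    by (simp add: zseq_def algebra_simps)
  also have "\<dots> = E ^ 8 * ((tseq 3 - tseq 0 + sseq (a - 1) - sseq (a + 2) + sseq (2 - a) - sseq (5 - a)) / E\<^sup>2)"
    unfolding cPsi_sum by (simp add: algebra_simps add_divide_distrib diff_divide_distrib)
  finally show ?thesis unfolding E8_div by (simp add: tn_def sn_def algebra_simps)
qed

end

section \<open>Solving pairs of reflections\<close>

text \<open>The sign of j + d for any 0 < d < 1, so its value at 0 is 1, whereas \<open>sgn\<close>
  gives weight 0 to j = 0. The later line terms record this difference.\<close>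

definition sg :: "int \<Rightarrow> complex" where "sg j = (if j \<ge> 0 then 1 else -1)"

lemma infsum_int_split:
  fixes f :: "int \<Rightarrow> complex"
  assumes "f summable_on UNIV"
  shows "infsum f UNIV = (\<Sum>\<^sub>\<infinity>i::nat. f (int i)) + (\<Sum>\<^sub>\<infinity>i::nat. f (- 1 - int i))"
proof -
  have "infsum f ({0..} \<union> {..<0}) = infsum f {0..} + infsum f {..<0}"
    by (rule infsum_Un_disjoint) (auto intro: summable_on_subset_banach[OF assms])
  moreover have "{0..} \<union> {..<0} = (UNIV :: int set)" by auto
  moreover have "infsum f {0..} = (\<Sum>\<^sub>\<infinity>i::nat. f (int i))"
    by (rule infsum_reindex_bij_witness[of _ int nat]) auto
  moreover have "infsum f {..<0} = (\<Sum>\<^sub>\<infinity>i::nat. f (- 1 - int i))"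
    by (rule infsum_reindex_bij_witness[of _ "\<lambda>i. - 1 - int i" "\<lambda>j. nat (- 1 - j)"]) auto
  ultimately show ?thesis by simp
qed

lemma summable_on_int_progression:
  fixes f :: "int \<Rightarrow> complex"
  assumes "f summable_on UNIV" "P \<noteq> 0"
  shows "(\<lambda>j. f (b + P * j)) summable_on UNIV"
proof -
  have "inj (\<lambda>j. b + P * j)" using assms(2) by (auto simp: inj_def)
  then have "(f \<circ> (\<lambda>j. b + P * j)) summable_on UNIV \<longleftrightarrow> f summable_on (range (\<lambda>j. b + P * j))"
    by (intro summable_on_reindex[symmetric])
  then show ?thesis using summable_on_subset_banach[OF assms(1)] by (auto simp: o_def)
qed

lemma summable_on_bounded_mult:
  fixes f :: "'a \<Rightarrow> complex"
  assumes f: "f summable_on A" and k: "\<And>x. norm (k x) \<le> K"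
  shows "(\<lambda>x. k x * f x) summable_on A"
proof -
  have "(\<lambda>x. norm (k x * f x)) summable_on A"
  proof (rule summable_on_comparison_test)
    show "(\<lambda>x. K * norm (f x)) summable_on A"
      using f by (intro summable_on_cmult_right) (simp add: summable_on_iff_abs_summable_on_complex)
    show "norm (k x * f x) \<le> K * norm (f x)" for x
      using k[of x] by (simp add: norm_mult mult_right_mono)
  qed auto
  then show ?thesis by (rule Infinite_Sum.abs_summable_summable)
qed

lemma norm_sg [simp]: "norm (sg j) = 1"
  by (simp add: sg_def)

lemma norm_of_int_sgn: "norm (of_int (sgn j) :: complex) \<le> 1"
  by (simp add: sgn_if)

lemma infsum_int_sg:
  fixes f :: "int \<Rightarrow> complex"
  assumes "f summable_on UNIV"
  shows "(\<Sum>\<^sub>\<infinity>j. sg j * f j) = (\<Sum>\<^sub>\<infinity>i::nat. f (int i)) - (\<Sum>\<^sub>\<infinity>i::nat. f (- 1 - int i))"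
  by (subst infsum_int_split) (auto intro!: summable_on_bounded_mult[OF assms, of _ 1] simp: sg_def infsum_uminus)

lemma infsum_nat_split_head:
  fixes f :: "nat \<Rightarrow> complex"
  assumes "f summable_on UNIV"
  shows "infsum f UNIV = f 0 + (\<Sum>\<^sub>\<infinity>i. f (Suc i))"
proof -
  have "infsum f ({0} \<union> {1..}) = infsum f {0} + infsum f {1..}"
    by (rule infsum_Un_disjoint) (auto intro: summable_on_subset_banach[OF assms])
  moreover have "{0} \<union> {1..} = (UNIV :: nat set)" by auto
  moreover have "infsum f {1..} = (\<Sum>\<^sub>\<infinity>i. f (Suc i))"
    by (rule infsum_reindex_bij_witness[of _ Suc "\<lambda>j. j - 1"]) auto
  ultimately show ?thesis by simp
qed

lemma summable_on_int_nat:
  fixes f :: "int \<Rightarrow> complex"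
  assumes "f summable_on UNIV"
  shows "(\<lambda>i::nat. f (int i)) summable_on UNIV"
proof -
  have "f summable_on {0..}" by (rule summable_on_subset_banach[OF assms]) auto
  then show ?thesis
    by (subst summable_on_reindex_bij_witness[where i=nat and j=int and T="{0..}" and h=f]) auto
qed

lemma infsum_int_sgn:
  fixes f :: "int \<Rightarrow> complex"
  assumes "f summable_on UNIV"
  shows "(\<Sum>\<^sub>\<infinity>j. of_int (sgn j) * f j) = (\<Sum>\<^sub>\<infinity>i::nat. f (1 + int i)) - (\<Sum>\<^sub>\<infinity>i::nat. f (- 1 - int i))"
proof -
  have s: "(\<lambda>j. of_int (sgn j) * f j) summable_on UNIV"
    by (rule summable_on_bounded_mult[OF assms norm_of_int_sgn])
  have "(\<Sum>\<^sub>\<infinity>i::nat. of_int (sgn (int i)) * f (int i)) = (\<Sum>\<^sub>\<infinity>i::nat. f (1 + int i))"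
    by (subst infsum_nat_split_head[OF summable_on_int_nat[OF s]]) simp
  moreover have "(\<Sum>\<^sub>\<infinity>i::nat. of_int (sgn (- 1 - int i)) * f (- 1 - int i)) = - (\<Sum>\<^sub>\<infinity>i::nat. f (- 1 - int i))"
    by (subst infsum_uminus[symmetric]) (simp add: sgn_if)
  ultimately show ?thesis by (subst infsum_int_split[OF s]) simp
qed

text \<open>A sequence with reflections \<open>a \<mapsto> K - a\<close> and \<open>a \<mapsto> K - P - a\<close> satisfies a first order recursion with
  step \<open>P\<close>; summing it upwards from \<open>a\<close> and from \<open>K - a\<close> gives the two halves of a bilateral sum.\<close>

lemma two_reflections:
  fixes x R U :: "int \<Rightarrow> complex" and \<epsilon> :: complex
  assumes r1: "\<And>a. x a + x (K - a) = R a" and r2: "\<And>a. x a + \<epsilon> * x (K - P - a) = U a"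
    and e: "\<epsilon> * \<epsilon> = 1" and P: "P > 0" and x: "x summable_on UNIV"
  shows "2 * x a - R a = (\<Sum>\<^sub>\<infinity>j. sg j * (\<epsilon> powi j * U (a + P * j))) - (\<Sum>\<^sub>\<infinity>j. of_int (sgn j) * (\<epsilon> powi j * R (a + P * j)))"
proof -
  have e0: "\<epsilon> \<noteq> 0" using e by auto
  have ne: "norm \<epsilon> = 1"
  proof -
    have "\<epsilon> = 1 \<or> \<epsilon> = -1" using e by (metis power2_eq_square power2_eq_1_iff)
    then show ?thesis by auto
  qed
  have refl: "(\<lambda>a. x (c - a)) summable_on UNIV" for c
    by (subst summable_on_reindex_bij_witness[where i="\<lambda>a. c - a" and j="\<lambda>a. c - a" and T=UNIV and h=x]) (use x in auto)
  have R: "R summable_on UNIV" using summable_on_add[OF x refl[of K]] by (simp add: r1)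
  have U: "U summable_on UNIV" using summable_on_add[OF x summable_on_cmult_right[OF refl[of "K - P"], of \<epsilon>]] by (simp add: r2)
  have sm: "(\<lambda>j. \<epsilon> powi j * f (b + P * j)) summable_on UNIV" if "f summable_on UNIV" for f b
    by (rule summable_on_bounded_mult[of _ _ _ 1])
       (use that P ne in \<open>auto intro: summable_on_int_progression simp: norm_power_int\<close>)
  \<comment> \<open>The upward recursion meets U from index 0 on but R only from index 1 on; hence
    \<open>sg\<close> for U and \<open>sgn\<close> for R in the bilateral sums.\<close>
  have half: "x b = (\<Sum>\<^sub>\<infinity>i::nat. \<epsilon> powi (int i) * U (b + P * int i)) - (\<Sum>\<^sub>\<infinity>i::nat. \<epsilon> powi (1 + int i) * R (b + P * (1 + int i)))" for b
  proof -
    have step: "x c = U c - \<epsilon> * R (c + P) + \<epsilon> * x (c + P)" for c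
    proof -
      have "x (c + P) + x (K - P - c) = R (c + P)" using r1[of "c + P"] by (simp add: algebra_simps)
      then have k: "x (K - P - c) = R (c + P) - x (c + P)" by (simp only: eq_diff_eq add.commute)
      have "U c = x c + \<epsilon> * (R (c + P) - x (c + P))" unfolding k[symmetric] by (rule r2[symmetric])
      then show ?thesis by (simp add: algebra_simps)
    qed
    define f where "f i = \<epsilon> powi int i * U (b + P * int i) - \<epsilon> powi (1 + int i) * R (b + P * (1 + int i))" for i :: nat
    have fin: "x b - (\<epsilon> ^ n) * x (b + P * int n) = (\<Sum>i<n. f i)" for n
    proof (induction n)
      case (Suc n)
      let ?c = "b + P * int n"
      have c: "b + P * int (Suc n) = ?c + P" "b + P * (1 + int n) = ?c + P" by (simp_all add: algebra_simps)
      have "x b - \<epsilon> ^ Suc n * x (?c + P) = (x b - \<epsilon> ^ n * x ?c) + \<epsilon> ^ n * (x ?c - \<epsilon> * x (?c + P))"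
        by (simp add: algebra_simps)
      also have "x ?c - \<epsilon> * x (?c + P) = U ?c - \<epsilon> * R (?c + P)" by (subst step) simp
      also have "(x b - \<epsilon> ^ n * x ?c) + \<epsilon> ^ n * (U ?c - \<epsilon> * R (?c + P)) = (\<Sum>i<Suc n. f i)"
        unfolding Suc.IH using e0 by (simp add: f_def power_int_add c algebra_simps)
      finally show ?case unfolding c .
    qed simp
    have "(\<lambda>n. \<epsilon> powi int n * x (b + P * int n)) summable_on (UNIV :: nat set)"
      by (rule summable_on_int_nat[OF sm[OF x]])
    then have "(\<lambda>n. \<epsilon> powi int n * x (b + P * int n)) \<longlonglongrightarrow> 0"
      by (intro summable_LIMSEQ_zero summable_on_imp_summable)
    then have "(\<lambda>n. x b - \<epsilon> powi int n * x (b + P * int n)) \<longlonglongrightarrow> x b - 0"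
      by (intro tendsto_intros)
    then have 1: "f sums x b" unfolding sums_def fin[symmetric] by simp
    have sU: "(\<lambda>i::nat. \<epsilon> powi int i * U (b + P * int i)) summable_on UNIV"
      by (rule summable_on_int_nat[OF sm[OF U]])
    have "(\<lambda>j. \<epsilon> powi (1 + j) * R (b + P * (1 + j))) summable_on UNIV"
      using summable_on_int_progression[OF sm[OF R, of b], of 1 1] by simp
    then have sR: "(\<lambda>i::nat. \<epsilon> powi (1 + int i) * R (b + P * (1 + int i))) summable_on UNIV"
      by (rule summable_on_int_nat)
    have "(f has_sum (\<Sum>\<^sub>\<infinity>i::nat. \<epsilon> powi (int i) * U (b + P * int i)) + - (\<Sum>\<^sub>\<infinity>i::nat. \<epsilon> powi (1 + int i) * R (b + P * (1 + int i)))) UNIV"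
      unfolding f_def diff_conv_add_uminus
      by (intro has_sum_add has_sum_infsum sU has_sum_uminusI sR)
    from has_sum_imp_sums[OF this] 1 show ?thesis using sums_unique2 by fastforce
  qed
  have RK: "R (K - b) = R b" for b using r1[of b] r1[of "K - b"] by (simp add: add.commute)
  have UK: "U b = \<epsilon> * U (K - P - b)" for b
  proof -
    have "\<epsilon> * U (K - P - b) = \<epsilon> * x (K - P - b) + (\<epsilon> * \<epsilon>) * x b"
      unfolding r2[of "K - P - b", symmetric] by (simp add: distrib_left mult.assoc)
    then show ?thesis using r2[of b] unfolding e by (simp add: add.commute)
  qed
  have pe: "\<epsilon> powi (- n) = \<epsilon> powi n" for n
  proof -
    have "inverse \<epsilon> = \<epsilon>" using e by (rule inverse_unique)
    then show ?thesis by (metis power_int_minus power_int_inverse)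
  qed
  have "2 * x a - R a = x a - x (K - a)" using r1[of a] by (simp add: algebra_simps)
  \<comment> \<open>The series for K - a is carried to the negative indices j by the symmetries
    \<open>RK\<close> and \<open>UK\<close>.\<close>
  also have "x (K - a) = (\<Sum>\<^sub>\<infinity>i::nat. \<epsilon> powi (- 1 - int i) * U (a + P * (- 1 - int i))) - (\<Sum>\<^sub>\<infinity>i::nat. \<epsilon> powi (- 1 - int i) * R (a + P * (- 1 - int i)))"
  proof -
    have "\<epsilon> powi (int i) * U (K - a + P * int i) = \<epsilon> powi (- 1 - int i) * U (a + P * (- 1 - int i))" for i
    proof -
      have eq: "K - P - (K - a + P * int i) = a + P * (- 1 - int i)" by (simp add: algebra_simps)
      have "U (K - a + P * int i) = \<epsilon> * U (a + P * (- 1 - int i))" by (rule UK[of "K - a + P * int i", unfolded eq])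
      moreover have "\<epsilon> powi (- 1 - int i) = \<epsilon> powi (int i) * \<epsilon>"
        using pe[of "1 + int i"] e0 by (simp add: power_int_add mult.commute)
      ultimately show ?thesis by simp
    qed
    moreover have "\<epsilon> powi (1 + int i) * R (K - a + P * (1 + int i)) = \<epsilon> powi (- 1 - int i) * R (a + P * (- 1 - int i))" for i
    proof -
      have eq: "K - (K - a + P * (1 + int i)) = a + P * (- 1 - int i)" by (simp add: algebra_simps)
      have "R (K - a + P * (1 + int i)) = R (a + P * (- 1 - int i))" by (rule RK[of "K - a + P * (1 + int i)", unfolded eq, symmetric])
      moreover have "\<epsilon> powi (- 1 - int i) = \<epsilon> powi (1 + int i)" using pe[of "1 + int i"] by simp
      ultimately show ?thesis by simp
    qed
    ultimately show ?thesis by (subst half) simp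
  qed
  finally show ?thesis
    unfolding infsum_int_sg[OF sm[OF U]] infsum_int_sgn[OF sm[OF R]]
    by (simp only:) (unfold half[of a], simp)
qed

section \<open>Gaussian weights and partial theta series for the coefficient sequences\<close>

lemma qpow_add: "qpow (a + b) \<tau> = qpow a \<tau> * qpow b \<tau>"
  by (simp add: qpow_def algebra_simps flip: exp_add)

lemma qpow_0 [simp]: "qpow 0 \<tau> = 1"
  by (simp add: qpow_def)

lemma qpow_nonzero [simp]: "qpow a \<tau> \<noteq> 0"
  by (simp add: qpow_def)

lemma qpow_minus: "qpow (- a) \<tau> = inverse (qpow a \<tau>)"
  by (simp add: qpow_def exp_minus)

lemma qpow_diff: "qpow (a - b) \<tau> = qpow a \<tau> / qpow b \<tau>"
  using qpow_add[of a "- b" \<tau>] by (simp add: qpow_minus divide_inverse)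

lemma norm_qpow: "norm (qpow a \<tau>) = exp (- 2 * pi * Im \<tau> * a)"
  by (simp add: qpow_def norm_exp_eq_Re)

lemma qpow_powi: "qpow a \<tau> powi n = qpow (of_int n * a) \<tau>"
  by (simp add: qpow_def exp_power_int algebra_simps)

lemma qpow_power: "qpow a \<tau> ^ n = qpow (of_nat n * a) \<tau>"
  using qpow_powi[of a \<tau> "int n"] by simp

locale tau =
  fixes \<tau> :: complex
  assumes tau: "Im \<tau> > 0"
begin

sublocale nome_sqrt "nome \<tau>" "qpow (1/2) \<tau>"
proof
  show "nome \<tau> \<noteq> 0" by simp
  show "norm (nome \<tau>) < 1" using tau by (simp add: norm_qpow)
  show "(qpow (1/2) \<tau>)\<^sup>2 = nome \<tau>" by (simp add: qpow_power)
qed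

abbreviation e :: "real \<Rightarrow> complex" where "e a \<equiv> qpow a \<tau>"

lemma nome_powi: "nome \<tau> powi n = e (of_int n)"
  by (simp add: qpow_powi)

text \<open>Supplies the summability hypothesis of \<open>two_reflections\<close>: the coefficient
  sequences grow at most exponentially, and the Gaussian weight wins.\<close>

lemma gauss_mult_summable:
  fixes X :: "int \<Rightarrow> complex"
  assumes X: "\<And>a. norm (X a) \<le> K * exp (\<beta> * \<bar>real_of_int a\<bar>)" and c: "c > 0"
  shows "(\<lambda>a. e (c * (of_int a - d)\<^sup>2) * X a) summable_on UNIV"
proof (rule summable_on_int_gauss)
  define A where "A = 2 * pi * Im \<tau> * c"
  have A: "A > 0" using tau c by (simp add: A_def)
  then show "A > 0" .
  fix a :: int
  have le: "- A * (of_int a - d)\<^sup>2 + \<beta> * \<bar>of_int a\<bar> \<le> - A * d\<^sup>2 + (- A * (of_int a)\<^sup>2 + (2 * A * \<bar>d\<bar> + \<beta>) * \<bar>of_int a\<bar>)"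
  proof -
    have "A * (2 * (of_int a * d)) \<le> A * (2 * (\<bar>d\<bar> * \<bar>of_int a\<bar>))"
      using A abs_ge_self[of "of_int a * d"] by (intro mult_left_mono) (auto simp: abs_mult mult.commute)
    then show ?thesis by (simp add: power2_eq_square algebra_simps)
  qed
  have K: "K \<ge> 0" using X[of 0] order_trans[OF norm_ge_zero X[of 0]] by simp
  have "norm (e (c * (of_int a - d)\<^sup>2) * X a) \<le> exp (- A * (of_int a - d)\<^sup>2) * (K * exp (\<beta> * \<bar>real_of_int a\<bar>))"
    using X[of a] by (simp add: norm_mult norm_qpow A_def mult_ac mult_left_mono)
  also have "\<dots> = K * exp (- A * (of_int a - d)\<^sup>2 + \<beta> * \<bar>of_int a\<bar>)" by (simp flip: exp_add)
  also have "\<dots> \<le> K * exp (- A * d\<^sup>2 + (- A * (of_int a)\<^sup>2 + (2 * A * \<bar>d\<bar> + \<beta>) * \<bar>of_int a\<bar>))"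
    using le K by (intro mult_left_mono) auto
  also have "\<dots> = K * exp (- A * d\<^sup>2) * exp (- A * (of_int a)\<^sup>2 + (2 * A * \<bar>d\<bar> + \<beta>) * \<bar>of_int a\<bar>)"
    by (simp add: mult.assoc flip: exp_add)
  finally show "norm (e (c * (of_int a - d)\<^sup>2) * X a)
    \<le> K * exp (- A * d\<^sup>2) * exp (- A * (of_int a)\<^sup>2 + (2 * A * \<bar>d\<bar> + \<beta>) * \<bar>of_int a\<bar>)" .
qed

text \<open>One nonzero point of convergence is enough, since each term is at most the sum of all
  norms.\<close>

lemma laurent_coeff_bound:
  assumes "((\<lambda>n. c n * z powi n) has_sum s) UNIV" "z \<noteq> 0"
  shows "\<exists>K \<beta>. \<forall>n::int. norm (c n :: complex) \<le> K * exp (\<beta> * \<bar>real_of_int n\<bar>)"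
proof -
  have s: "(\<lambda>n. norm (c n * z powi n)) summable_on UNIV"
    using has_sum_imp_summable[OF assms(1)] by (simp add: summable_on_iff_abs_summable_on_complex)
  define K where "K = (\<Sum>\<^sub>\<infinity>n. norm (c n * z powi n))"
  have "norm (c n) \<le> K * exp (\<bar>ln (norm z)\<bar> * \<bar>real_of_int n\<bar>)" for n
  proof -
    have "(\<Sum>n\<in>{n}. norm (c n * z powi n)) \<le> K"
      unfolding K_def by (rule finite_sum_le_infsum[OF s]) auto
    then have 1: "norm (c n) * exp (of_int n * ln (norm z)) \<le> K"
      using assms(2) by (simp add: norm_mult norm_power_int powi_eq_exp)
    have K0: "K \<ge> 0" unfolding K_def by (rule infsum_nonneg) auto
    have "norm (c n) = norm (c n) * exp (of_int n * ln (norm z)) * exp (- (of_int n * ln (norm z)))"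
      by (simp add: mult.assoc flip: exp_add)
    also have "\<dots> \<le> K * exp (- (of_int n * ln (norm z)))" by (rule mult_right_mono[OF 1]) auto
    also have "\<dots> \<le> K * exp (\<bar>ln (norm z)\<bar> * \<bar>real_of_int n\<bar>)"
      using abs_ge_minus_self[of "of_int n * ln (norm z)"] K0 by (intro mult_left_mono) (auto simp: abs_mult mult.commute)
    finally show ?thesis .
  qed
  then show ?thesis by blast
qed

lemma minus_bound:
  assumes "\<exists>K \<beta>. \<forall>n::int. norm (c (- n) :: complex) \<le> K * exp (\<beta> * \<bar>real_of_int n\<bar>)"
  shows "\<exists>K \<beta>. \<forall>n::int. norm (c n) \<le> K * exp (\<beta> * \<bar>real_of_int n\<bar>)"
  using assms by (metis abs_minus_cancel minus_minus of_int_minus)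

lemma mult_const_bound:
  assumes "\<exists>K \<beta>. \<forall>n::int. norm (c n :: complex) \<le> K * exp (\<beta> * \<bar>real_of_int n\<bar>)"
  shows "\<exists>K \<beta>. \<forall>n::int. norm (x * c n) \<le> K * exp (\<beta> * \<bar>real_of_int n\<bar>)"
proof -
  obtain K \<beta> where "\<And>n. norm (c n) \<le> K * exp (\<beta> * \<bar>real_of_int n\<bar>)" using assms by blast
  then have "norm (x * c n) \<le> norm x * K * exp (\<beta> * \<bar>real_of_int n\<bar>)" for n
    by (simp add: norm_mult mult.assoc mult_left_mono)
  then show ?thesis by blast
qed

lemma add_bound:
  assumes "\<exists>K \<beta>. \<forall>n::int. norm (c n :: complex) \<le> K * exp (\<beta> * \<bar>real_of_int n\<bar>)"
    "\<exists>K \<beta>. \<forall>n::int. norm (d n :: complex) \<le> K * exp (\<beta> * \<bar>real_of_int n\<bar>)"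
  shows "\<exists>K \<beta>. \<forall>n::int. norm (c n + d n) \<le> K * exp (\<beta> * \<bar>real_of_int n\<bar>)"
proof -
  obtain K \<beta> where 1: "\<And>n. norm (c n) \<le> K * exp (\<beta> * \<bar>real_of_int n\<bar>)" using assms by blast
  obtain L \<gamma> where 2: "\<And>n. norm (d n) \<le> L * exp (\<gamma> * \<bar>real_of_int n\<bar>)" using assms by blast
  have K: "K \<ge> 0" "L \<ge> 0" using order_trans[OF norm_ge_zero 1[of 0]] order_trans[OF norm_ge_zero 2[of 0]] by auto
  have "norm (c n + d n) \<le> (K + L) * exp ((\<bar>\<beta>\<bar> + \<bar>\<gamma>\<bar>) * \<bar>real_of_int n\<bar>)" for n
  proof -
    have "\<beta> * \<bar>real_of_int n\<bar> \<le> (\<bar>\<beta>\<bar> + \<bar>\<gamma>\<bar>) * \<bar>real_of_int n\<bar>" "\<gamma> * \<bar>real_of_int n\<bar> \<le> (\<bar>\<beta>\<bar> + \<bar>\<gamma>\<bar>) * \<bar>real_of_int n\<bar>"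
      by (intro mult_right_mono; simp)+
    then have "K * exp (\<beta> * \<bar>real_of_int n\<bar>) \<le> K * exp ((\<bar>\<beta>\<bar> + \<bar>\<gamma>\<bar>) * \<bar>real_of_int n\<bar>)"
      "L * exp (\<gamma> * \<bar>real_of_int n\<bar>) \<le> L * exp ((\<bar>\<beta>\<bar> + \<bar>\<gamma>\<bar>) * \<bar>real_of_int n\<bar>)"
      using K by (auto intro!: mult_left_mono)
    then show ?thesis using 1[of n] 2[of n] norm_triangle_ineq[of "c n" "d n"] by (simp add: distrib_right)
  qed
  then show ?thesis by blast
qed

lemma rho0_circle: "norm (complex_of_real \<rho>0) = \<rho>0" "complex_of_real \<rho>0 \<noteq> 0"
  using \<rho>0_pos by auto

lemma tn_bound: "\<exists>K \<beta>. \<forall>n::int. norm (tn n) \<le> K * exp (\<beta> * \<bar>real_of_int n\<bar>)"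
proof -
  have "norm (nome \<tau>) < r0" using \<rho>0_bounds r0_pos mult_strict_left_mono[of r0 1 r0] by simp
  then have "norm (nome \<tau>) < \<rho>0" using \<rho>0_bounds by simp
  from has_laurentD(2)[OF has_laurent_T3[OF this \<rho>0_bounds(2)], of "of_real \<rho>0"] rho0_circle
  show ?thesis unfolding tn_def by - (rule mult_const_bound, rule minus_bound, rule laurent_coeff_bound, auto)
qed

lemma sn_bound: "\<exists>K \<beta>. \<forall>n::int. norm (sn n) \<le> K * exp (\<beta> * \<bar>real_of_int n\<bar>)"
proof -
  have "norm (qpow (1/2) \<tau>) < \<rho>0" using \<rho>0_bounds by (simp add: r0_def)
  from has_laurentD(2)[OF has_laurent_T4[OF this \<rho>0_bounds(2)], of "of_real \<rho>0"] rho0_circle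
  show ?thesis unfolding sn_def by - (rule mult_const_bound, rule minus_bound, rule laurent_coeff_bound, auto)
qed

lemma cPsi_bound: "\<exists>K \<beta>. \<forall>m::int. norm (cPsi m n) \<le> K * exp (\<beta> * \<bar>real_of_int m\<bar>)"
proof (rule laurent_coeff_bound)
  let ?u = "complex_of_real r0" and ?v = "complex_of_real \<rho>0"
  have "((\<lambda>(m, n). cPsi m n * ?u powi m * ?v powi n) has_sum Psi ?u ?v) UNIV"
    by (rule has_laurent2D[OF has_laurent2_Psi]) (use r0_pos \<rho>0_pos in auto)
  then have s: "(\<lambda>p. case p of (m, n) \<Rightarrow> cPsi m n * ?u powi m * ?v powi n) summable_on UNIV" by (rule has_sum_imp_summable)
  have "(\<lambda>(m, n). cPsi m n * ?u powi m * ?v powi n) summable_on ((\<lambda>m. (m, n)) ` UNIV)"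
    by (rule summable_on_subset_banach[OF s]) auto
  then have "(\<lambda>m. cPsi m n * ?u powi m * ?v powi n) summable_on UNIV"
    by (subst (asm) summable_on_reindex) (auto simp: o_def inj_on_def)
  then have "(\<lambda>m. cPsi m n * ?u powi m * ?v powi n * inverse (?v powi n)) summable_on UNIV"
    by (rule summable_on_cmult_left)
  moreover have "?v powi n \<noteq> 0" using \<rho>0_pos by simp
  ultimately have "(\<lambda>m. cPsi m n * ?u powi m) summable_on UNIV" by (simp add: mult.assoc)
  then show "((\<lambda>m. cPsi m n * ?u powi m) has_sum (\<Sum>\<^sub>\<infinity>m. cPsi m n * ?u powi m)) UNIV" by (rule has_sum_infsum)
  show "?u \<noteq> 0" using r0_pos by simp
qed

lemma yseq_bound: "\<exists>K \<beta>. \<forall>m::int. norm (yseq m) \<le> K * exp (\<beta> * \<bar>real_of_int m\<bar>)"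
  unfolding yseq_def by (rule mult_const_bound, rule minus_bound) (simp add: cPsi_bound)

lemma zseq_bound: "\<exists>K \<beta>. \<forall>m::int. norm (zseq m) \<le> K * exp (\<beta> * \<bar>real_of_int m\<bar>)"
  unfolding zseq_def by (rule mult_const_bound, rule minus_bound) (simp add: cPsi_bound add_bound)

lemma three_step_series:
  assumes x: "\<exists>K \<beta>. \<forall>n::int. norm (x n) \<le> K * exp (\<beta> * \<bar>real_of_int n\<bar>)"
    and sh: "\<And>a. x a = nome \<tau> powi a * x (- a)" and R: "\<And>a. x a + x (3 - a) = R a"
  shows "2 * x a - R a = - (\<Sum>\<^sub>\<infinity>j. of_int (sgn j) * ((-1) powi j * e (((of_int (a + 3 * j) - 3/2)\<^sup>2 - (of_int a - 3/2)\<^sup>2) / 6) * R (a + 3 * j)))"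
proof -
  \<comment> \<open>The weight q^((a - 3/2)^2 / 6) is invariant under a -> 3 - a and satisfies h (a)
    q^a = h (- a). The shift thus becomes a reflection with sign - 1 and right-hand side 0.\<close>
  define h where "h a = e (1/6 * (of_int a - 3/2)\<^sup>2)" for a :: int
  have h0: "h a \<noteq> 0" for a by (simp add: h_def)
  obtain K \<beta> where "\<And>n. norm (x n) \<le> K * exp (\<beta> * \<bar>real_of_int n\<bar>)" using x by blast
  then have sm: "(\<lambda>a. h a * x a) summable_on UNIV"
    unfolding h_def by (intro gauss_mult_summable) auto
  have "2 * (h a * x a) - h a * R a = (\<Sum>\<^sub>\<infinity>j. sg j * ((-1) powi j * 0)) - (\<Sum>\<^sub>\<infinity>j. of_int (sgn j) * ((-1) powi j * (h (a + 3 * j) * R (a + 3 * j))))"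
  proof (rule two_reflections[where K=3 and P=3, OF _ _ _ _ sm])
    show "h b * x b + h (3 - b) * x (3 - b) = h b * R b" for b
    proof -
      have "h (3 - b) = h b" by (simp add: h_def power2_eq_square algebra_simps)
      then show ?thesis by (simp add: R[symmetric] algebra_simps)
    qed
    show "h b * x b + - 1 * (h (3 - 3 - b) * x (3 - 3 - b)) = 0" for b
    proof -
      have "h b * nome \<tau> powi b = h (- b)"
        unfolding h_def nome_powi qpow_add[symmetric] by (simp add: power2_eq_square field_simps)
      moreover have "h b * x b = (h b * nome \<tau> powi b) * x (- b)" by (subst sh[of b]) (simp only: mult.assoc)
      ultimately show ?thesis by simp
    qed
  qed auto
  then have "2 * x a - R a = - (inverse (h a) * (\<Sum>\<^sub>\<infinity>j. of_int (sgn j) * ((-1) powi j * (h (a + 3 * j) * R (a + 3 * j)))))"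
    using h0[of a] by (simp add: field_simps)
  also have "inverse (h a) * (\<Sum>\<^sub>\<infinity>j. of_int (sgn j) * ((-1) powi j * (h (a + 3 * j) * R (a + 3 * j))))
     = (\<Sum>\<^sub>\<infinity>j. of_int (sgn j) * ((-1) powi j * e (((of_int (a + 3 * j) - 3/2)\<^sup>2 - (of_int a - 3/2)\<^sup>2) / 6) * R (a + 3 * j)))"
    unfolding infsum_cmult_right'[symmetric]
  proof (rule infsum_cong)
    fix j
    have X: "h (a + 3 * j) * inverse (h a) = e (((of_int (a + 3 * j) - 3/2)\<^sup>2 - (of_int a - 3/2)\<^sup>2) / 6)"
      unfolding h_def qpow_minus[symmetric] qpow_add[symmetric] by (simp add: field_simps)
    show "inverse (h a) * (of_int (sgn j) * ((-1) powi j * (h (a + 3 * j) * R (a + 3 * j))))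
      = of_int (sgn j) * ((-1) powi j * e (((of_int (a + 3 * j) - 3/2)\<^sup>2 - (of_int a - 3/2)\<^sup>2) / 6) * R (a + 3 * j))"
      unfolding X[symmetric] by (simp only: mult_ac)
  qed
  finally show ?thesis .
qed

text \<open>\<open>AA\<close>, \<open>- q\<^sup>1\<^sup>/\<^sup>2 B'\<close> and \<open>q\<^sup>1\<^sup>/\<^sup>2 C'\<close> are the three quotients \<open>\<eta>\<^sup>6 / \<vartheta>\<^sup>2\<close> in \<open>F0\<close>.\<close>

definition AA :: complex where "AA = E ^ 4 / T (-1) ^ 2"
definition B' :: complex where "B' = E ^ 4 / T (qpow (1/2) \<tau>) ^ 2"
definition C' :: complex where "C' = E ^ 4 / T (- qpow (1/2) \<tau>) ^ 2"
definition EE :: complex where "EE = 1 - 24 * Y"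

text \<open>Residue terms: \<open>w0\<close> from v^2 = 1, in the centred index N = b - 2,
  \<open>w1\<close> from v^2 = q, and \<open>rho3\<close> from the triple pole of 1 / T v ^ 3. The
  factor \<open>e (1/4)\<close> of \<open>w1\<close> comes from completing a square in
  \<open>DD_series\<close>.\<close>

definition w0 :: "int \<Rightarrow> complex" where "w0 N = (of_int N)\<^sup>2 / 4 - EE / 8 + (-1) powi N * AA / 2"
definition w1 :: "int \<Rightarrow> complex" where "w1 N = - e (1/4) * (B' - (-1) powi N * C') / 2"
definition rho3 :: "int \<Rightarrow> complex" where "rho3 b = (of_int b - 3/2)\<^sup>2 / 2 - EE / 8"

lemma tn_reflect: "tn b + tn (3 - b) = rho3 b"
  using tseq_reflect[of b] E_nonzero by (simp add: tn_def rho3_def EE_def distrib_left[symmetric])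

lemma tn_shift: "tn b = nome \<tau> powi b * tn (- b)"
  using tseq_shift[of b] by (simp add: tn_def)

lemma sn_reflect: "sn b + sn (4 - b) = w0 (b - 2)"
proof -
  have "(-1) powi (b - 2) = ((-1) powi b :: complex)" by (simp add: minus_one_powi_cases)
  then show ?thesis using sseq_reflect[of b] E_nonzero
    by (simp add: sn_def w0_def EE_def AA_def distrib_left[symmetric])
qed

lemma sn_shift: "sn b + e (of_int b + 1) * sn (- 2 - b) = e (of_int b / 2) * (B' + (-1) powi b * C') / 2"
proof -
  have 1: "nome \<tau> powi (b + 1) = e (of_int b + 1)" by (simp add: nome_powi)
  have 2: "qpow (1/2) \<tau> powi b = e (of_int b / 2)" by (simp add: qpow_powi)
  have 3: "E ^ 6 * (x / (2 * E\<^sup>2)) = E ^ 4 * (x / 2)" for x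
  proof -
    have "E ^ 6 = E ^ 4 * E\<^sup>2" by (simp flip: power_add)
    moreover have "E\<^sup>2 * (x / (2 * E\<^sup>2)) = x / 2" using E_nonzero by simp
    ultimately show ?thesis by (simp only: mult.assoc)
  qed
  have "sn b + e (of_int b + 1) * sn (- 2 - b) = E ^ 6 * (sseq b + nome \<tau> powi (b + 1) * sseq (- 2 - b))"
    unfolding 1 by (simp add: sn_def algebra_simps)
  also have "\<dots> = E ^ 4 * (e (of_int b / 2) * (1 / T (qpow (1/2) \<tau>) ^ 2 + (-1) powi b / T (- qpow (1/2) \<tau>) ^ 2) / 2)"
    unfolding sseq_shift 2 3 ..
  also have "\<dots> = e (of_int b / 2) * (B' + (-1) powi b * C') / 2"
    by (simp add: B'_def C'_def algebra_simps)
  finally show ?thesis .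
qed

text \<open>The part odd under b -> 3 - b, namely tn b - tn (3 - b); likewise \<open>DD b\<close> is
  sn b - sn (4 - b).\<close>

definition dd :: "int \<Rightarrow> complex" where "dd b = 2 * tn b - rho3 b"
text \<open>h = 0 runs over full steps of 6, for the poles v^2 = 1, and h = 1 over the points
  half-way between, for v^2 = q. Correspondingly \<open>sgn (2 * i + h)\<close> is sgn i or
  \<open>sg i\<close>.\<close>

definition Dh :: "int \<Rightarrow> (int \<Rightarrow> complex) \<Rightarrow> int \<Rightarrow> complex" where
  "Dh h w b = - (\<Sum>\<^sub>\<infinity>i. of_int (sgn (2 * i + h)) *
      (e ((of_int (b - 2 + 6 * i + 3 * h) ^ 2 - of_int (b - 2) ^ 2) / 12) * w (b - 2 + 6 * i + 3 * h)))"
definition DD :: "int \<Rightarrow> complex" where "DD b = 2 * sn b - w0 (b - 2)"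

lemma dd_series: "dd b = - (\<Sum>\<^sub>\<infinity>j. of_int (sgn j) * ((-1) powi j * e (((of_int (b + 3 * j) - 3/2)\<^sup>2 - (of_int b - 3/2)\<^sup>2) / 6) * rho3 (b + 3 * j)))"
  unfolding dd_def by (rule three_step_series[where x=tn and R=rho3, OF tn_bound tn_shift tn_reflect])

lemma DD_series: "DD b = Dh 0 w0 b + Dh 1 w1 b"
proof -
  \<comment> \<open>This weight is invariant under b -> 4 - b and satisfies h (b) q^(b + 1) = h (- 2
    - b); the resulting step is 6.\<close>
  define h where "h a = e (1/12 * (of_int a - 2)\<^sup>2)" for a :: int
  have h0: "h a \<noteq> 0" for a by (simp add: h_def)
  have hq: "h (a + c) * inverse (h a) = e (((of_int (a + c) - 2)\<^sup>2 - (of_int a - 2)\<^sup>2) / 12)" for a c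
    unfolding h_def qpow_minus[symmetric] qpow_add[symmetric] by (simp add: field_simps)
  define U where "U b = e (of_int b / 2) * (B' + (-1) powi b * C') / 2" for b
  obtain K \<beta> where "\<And>n. norm (sn n) \<le> K * exp (\<beta> * \<bar>real_of_int n\<bar>)" using sn_bound by blast
  then have sm: "(\<lambda>a. h a * sn a) summable_on UNIV"
    unfolding h_def by (intro gauss_mult_summable) auto
  have "2 * (h b * sn b) - h b * w0 (b - 2) = (\<Sum>\<^sub>\<infinity>j. sg j * (1 powi j * (h (b + 6 * j) * U (b + 6 * j)))) - (\<Sum>\<^sub>\<infinity>j. of_int (sgn j) * (1 powi j * (h (b + 6 * j) * w0 (b + 6 * j - 2))))"
  proof (rule two_reflections[where K=4 and P=6, OF _ _ _ _ sm])
    show "h b * sn b + h (4 - b) * sn (4 - b) = h b * w0 (b - 2)" for b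
    proof -
      have "h (4 - b) = h b" by (simp add: h_def power2_eq_square algebra_simps)
      then show ?thesis by (simp add: sn_reflect[symmetric] algebra_simps)
    qed
    show "h b * sn b + 1 * (h (4 - 6 - b) * sn (4 - 6 - b)) = h b * U b" for b
    proof -
      have "h b * e (of_int b + 1) = h (- 2 - b)"
        unfolding h_def qpow_add[symmetric] by (simp add: power2_eq_square field_simps)
      moreover have "h b * U b = h b * sn b + (h b * e (of_int b + 1)) * sn (- 2 - b)"
        unfolding U_def sn_shift[symmetric] by (simp add: algebra_simps)
      ultimately show ?thesis by simp
    qed
  qed auto
  then have "DD b = inverse (h b) * (\<Sum>\<^sub>\<infinity>j. sg j * (h (b + 6 * j) * U (b + 6 * j))) - inverse (h b) * (\<Sum>\<^sub>\<infinity>j. of_int (sgn j) * (h (b + 6 * j) * w0 (b + 6 * j - 2)))"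
    using h0[of b] by (simp add: DD_def field_simps)
  also have "inverse (h b) * (\<Sum>\<^sub>\<infinity>j. sg j * (h (b + 6 * j) * U (b + 6 * j))) = Dh 1 w1 b"
    unfolding Dh_def infsum_uminus[symmetric] infsum_cmult_right'[symmetric]
  proof (rule infsum_cong)
    fix j :: int
    let ?N = "b - 2 + 6 * j + 3 * 1"
    have sgn: "of_int (sgn (2 * j + 1)) = sg j" by (simp add: sg_def sgn_if)
    have m: "(-1) powi ?N = - ((-1) powi (b + 6 * j) :: complex)" by (simp add: minus_one_powi_cases)
    have "inverse (h b) * (h (b + 6 * j) * U (b + 6 * j)) = e (((of_int (b + 6 * j) - 2)\<^sup>2 - (of_int b - 2)\<^sup>2) / 12) * U (b + 6 * j)"
      using hq[of b "6 * j"] by (simp add: mult_ac)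
    also have "\<dots> = e (((of_int (b + 6 * j) - 2)\<^sup>2 - (of_int b - 2)\<^sup>2) / 12 + of_int (b + 6 * j) / 2) * ((B' + (-1) powi (b + 6 * j) * C') / 2)"
      by (simp add: U_def qpow_add)
    \<comment> \<open>Moving the centre by 3 absorbs the linear exponent of U into a square, at the
      price of q^(1/4).\<close>
    also have "((of_int (b + 6 * j) - 2)\<^sup>2 - (of_int b - 2)\<^sup>2) / 12 + of_int (b + 6 * j) / 2 = (of_int ?N ^ 2 - of_int (b - 2) ^ 2) / 12 + (1 / 4 :: real)"
      by (simp add: power2_eq_square field_simps)
    also have "e \<dots> * ((B' + (-1) powi (b + 6 * j) * C') / 2) = - (e ((of_int ?N ^ 2 - of_int (b - 2) ^ 2) / 12) * w1 ?N)"
      unfolding w1_def m qpow_add by simp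
    finally show "inverse (h b) * (sg j * (h (b + 6 * j) * U (b + 6 * j))) = - (of_int (sgn (2 * j + 1)) * (e ((of_int ?N ^ 2 - of_int (b - 2) ^ 2) / 12) * w1 ?N))"
      unfolding sgn by (simp add: mult_ac)
  qed
  also have "inverse (h b) * (\<Sum>\<^sub>\<infinity>j. of_int (sgn j) * (h (b + 6 * j) * w0 (b + 6 * j - 2))) = - Dh 0 w0 b"
    unfolding Dh_def minus_minus infsum_cmult_right'[symmetric]
  proof (rule infsum_cong)
    fix j :: int
    have "sgn (2 * j + 0) = sgn j" by (simp add: sgn_if)
    then show "inverse (h b) * (of_int (sgn j) * (h (b + 6 * j) * w0 (b + 6 * j - 2))) = of_int (sgn (2 * j + 0)) * (e ((of_int (b - 2 + 6 * j + 3 * 0) ^ 2 - of_int (b - 2) ^ 2) / 12) * w0 (b - 2 + 6 * j + 3 * 0))"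
      using hq[of b "6 * j"] by (simp add: algebra_simps)
  qed
  finally show ?thesis by simp
qed

lemma yseq_reflect': "yseq a + yseq (3 - a) = - dd 1 + DD a - DD (a + 1)"
proof -
  have "tn 2 = rho3 1 - tn 1" using tn_reflect[of 1] by (simp add: algebra_simps)
  moreover have "sn (4 - a) = w0 (a - 2) - sn a" using sn_reflect[of a] by (simp add: algebra_simps)
  moreover have "sn (3 - a) = w0 (a + 1 - 2) - sn (a + 1)" using sn_reflect[of "a + 1"] by (simp add: algebra_simps)
  ultimately show ?thesis unfolding yseq_reflect dd_def DD_def by (simp add: algebra_simps)
qed

lemma zseq_reflect': "zseq a + zseq (3 - a) = - dd 0 + DD (a - 1) - DD (a + 2)"
proof -
  have "tn 3 = rho3 0 - tn 0" using tn_reflect[of 0] by (simp add: algebra_simps)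
  moreover have "sn (5 - a) = w0 (a - 1 - 2) - sn (a - 1)" using sn_reflect[of "a - 1"] by (simp add: algebra_simps)
  moreover have "sn (2 - a) = w0 (a + 2 - 2) - sn (a + 2)" using sn_reflect[of "a + 2"] by (simp add: algebra_simps)
  ultimately show ?thesis unfolding zseq_reflect dd_def DD_def by (simp add: algebra_simps)
qed

text \<open>The indices 0 and 3, and likewise 1 and 2, are exchanged by a -> 3 - a, so the
  differences in \<open>cF_eq\<close> are the odd parts that \<open>three_step_series\<close>
  computes.\<close>

lemma cF_series: "E ^ 8 * cF 0 0 =
   - (\<Sum>\<^sub>\<infinity>j. of_int (sgn j) * ((-1) powi j * e (3 * of_int j * (of_int j - 1) / 2) * (- dd 1 + DD (3 * j) - DD (3 * j + 1))))
   + (\<Sum>\<^sub>\<infinity>j. of_int (sgn j) * ((-1) powi j * e ((3 * (of_int j)\<^sup>2 - of_int j) / 2) * (- dd 0 + DD (3 * j) - DD (3 * j + 3))))"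
proof -
  have y: "yseq 0 - yseq 3 = 2 * yseq 0 - (- dd 1 + DD 0 - DD (0 + 1))" using yseq_reflect'[of 0] by (simp add: algebra_simps)
  have z: "zseq 1 - zseq 2 = 2 * zseq 1 - (- dd 0 + DD (1 - 1) - DD (1 + 2))" using zseq_reflect'[of 1] by (simp add: algebra_simps)
  have e1: "e (((of_int (0 + 3 * j) - 3/2)\<^sup>2 - (of_int 0 - 3/2)\<^sup>2) / 6) = e (3 * of_int j * (of_int j - 1) / 2)" for j
    by (rule arg_cong[where f=e]) (simp add: power2_eq_square field_simps)
  have e2: "e (((of_int (1 + 3 * j) - 3/2)\<^sup>2 - (of_int 1 - 3/2)\<^sup>2) / 6) = e ((3 * (of_int j)\<^sup>2 - of_int j) / 2)" for j
    by (rule arg_cong[where f=e]) (simp add: power2_eq_square field_simps)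
  have "E ^ 8 * cF 0 0 = (yseq 0 - yseq 3) - (zseq 1 - zseq 2)" by (simp add: cF_eq)
  also have "yseq 0 - yseq 3 = - (\<Sum>\<^sub>\<infinity>j. of_int (sgn j) * ((-1) powi j * e (3 * of_int j * (of_int j - 1) / 2) * (- dd 1 + DD (3 * j) - DD (3 * j + 1))))"
    unfolding y using three_step_series[where x=yseq and R="\<lambda>a. - dd 1 + DD a - DD (a + 1)" and a=0, OF yseq_bound yseq_shift yseq_reflect'] unfolding e1 by simp
  also have "zseq 1 - zseq 2 = - (\<Sum>\<^sub>\<infinity>j. of_int (sgn j) * ((-1) powi j * e ((3 * (of_int j)\<^sup>2 - of_int j) / 2) * (- dd 0 + DD (3 * j) - DD (3 * j + 3))))"
    unfolding z using three_step_series[where x=zseq and R="\<lambda>a. - dd 0 + DD (a - 1) - DD (a + 2)" and a=1, OF zseq_bound zseq_shift zseq_reflect'] unfolding e2 by (simp add: algebra_simps)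
  finally show ?thesis by simp
qed

end

section \<open>Double sums\<close>

text \<open>Fubini combined with a change of variables; summability comes from X alone, since the
  sign factor is bounded.\<close>

lemma iterated_reindex:
  fixes X :: "int \<times> int \<Rightarrow> complex"
  assumes X: "X summable_on UNIV" and k: "\<And>p. norm (\<kappa> p) \<le> K"
    and inv: "\<And>p. \<psi> (\<phi> p) = p" "\<And>p. \<phi> (\<psi> p) = p"
    and f: "\<And>j i. f j i = \<kappa> (\<phi> (j, i)) * X (\<phi> (j, i))"
  shows "((\<lambda>j. \<Sum>\<^sub>\<infinity>i. f j i) has_sum (\<Sum>\<^sub>\<infinity>p. \<kappa> p * X p)) UNIV"
proof -
  have "((\<lambda>p. \<kappa> p * X p) has_sum (\<Sum>\<^sub>\<infinity>p. \<kappa> p * X p)) UNIV"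
    by (rule has_sum_infsum[OF summable_on_bounded_mult[OF X k]])
  then have s: "((\<lambda>(j, i). f j i) has_sum (\<Sum>\<^sub>\<infinity>p. \<kappa> p * X p)) (UNIV \<times> UNIV)"
    by (subst has_sum_reindex_bij_witness[where i=\<psi> and j=\<phi> and T=UNIV and h="\<lambda>p. \<kappa> p * X p" and s'="\<Sum>\<^sub>\<infinity>p. \<kappa> p * X p"])
       (auto simp: inv f)
  show ?thesis
  proof (rule has_sum_SigmaD[OF s])
    fix j
    have "f j summable_on UNIV" using summable_on_SigmaD1[OF has_sum_imp_summable[OF s], of j] by simp
    then show "((\<lambda>i. case (j, i) of (j, i) \<Rightarrow> f j i) has_sum (\<Sum>\<^sub>\<infinity>i. f j i)) UNIV" by simp
  qed
qed

lemma infsum_line: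
  fixes F :: "'a \<Rightarrow> complex"
  assumes F: "F summable_on UNIV" and inj: "inj \<phi>" and Q: "\<And>p. Q p \<longleftrightarrow> p \<in> range \<phi>"
  shows "((\<lambda>p. of_bool (Q p) * F p) has_sum (\<Sum>\<^sub>\<infinity>i. F (\<phi> i))) UNIV"
proof -
  have "F summable_on range \<phi>" by (rule summable_on_subset_banach[OF F]) auto
  then have "(F has_sum (\<Sum>\<^sub>\<infinity>p\<in>range \<phi>. F p)) (range \<phi>)" by (rule has_sum_infsum)
  also have "(\<Sum>\<^sub>\<infinity>p\<in>range \<phi>. F p) = (\<Sum>\<^sub>\<infinity>i. F (\<phi> i))"
    using infsum_reindex[OF inj] by (simp add: o_def)
  finally show ?thesis
    by (subst has_sum_cong_neutral[where T="range \<phi>" and g=F]) (auto simp: Q)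
qed

lemma infsum_odd:
  fixes F :: "'a \<Rightarrow> complex"
  assumes "\<And>p. \<phi> (\<phi> p) = p" "\<And>p. F (\<phi> p) = - F p"
  shows "infsum F UNIV = 0"
proof -
  have "infsum F UNIV = (\<Sum>\<^sub>\<infinity>p. - F p)"
    by (rule infsum_reindex_bij_witness[of _ \<phi> \<phi>]) (auto simp: assms)
  then have "infsum F UNIV = - infsum F UNIV" by (simp add: infsum_uminus)
  then show ?thesis by simp
qed

abbreviation sgc :: "int \<Rightarrow> complex" where "sgc n \<equiv> of_int (sgn n)"

context tau
begin

text \<open>With \<open>n\<^sub>1 = m1 + 1/3\<close> and \<open>n\<^sub>2 = m2 + h / 2 + 1/6\<close> one has \<open>3 n\<^sub>1 = 3 m1 + 1\<close>, \<open>3 (n\<^sub>1 + 2 n\<^sub>2) = NN h m1 m2\<close>, and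
  the exponent in \<open>XX\<close> is \<open>Q_B n\<^sub>1 n\<^sub>2 - 5/12\<close>.\<close>

definition NN :: "int \<Rightarrow> int \<Rightarrow> int \<Rightarrow> int" where "NN h m1 m2 = 3 * m1 + 6 * m2 + 2 + 3 * h"

definition XX :: "int \<Rightarrow> (int \<Rightarrow> complex) \<Rightarrow> int \<times> int \<Rightarrow> complex" where
  "XX h w = (\<lambda>(m1, m2). (-1) powi m1 * (e (((3 * of_int m1 + 1)\<^sup>2 + (of_int (NN h m1 m2))\<^sup>2 - 5) / 12) * w (NN h m1 m2)))"

lemma XX_summable:
  assumes h: "h = 0 \<or> h = 1" and w: "\<And>N. norm (w N) \<le> C * (1 + (of_int N)\<^sup>2)"
  shows "XX h w summable_on UNIV"
proof (rule summable_on_int2_gauss)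
  define A where "A = 2 * pi * Im \<tau>"
  have A: "A > 0" using tau by (simp add: A_def)
  then show "A / 2 > 0" by simp
  have C: "C \<ge> 0" using order_trans[OF norm_ge_zero w[of 0]] by simp
  fix m n :: int
  define x y where "x = real_of_int m" and "y = real_of_int n"
  define c where "c = real_of_int (2 + 3 * h)"
  have c: "0 \<le> c" "c \<le> 5" using h by (auto simp: c_def)
  have N: "of_int (NN h m n) = 3 * x + 6 * y + c" by (simp add: NN_def x_def y_def c_def)
  have "6 * (x\<^sup>2 + y\<^sup>2) - 60 * (\<bar>x\<bar> + \<bar>y\<bar>) - 4 \<le> (3 * x + 1)\<^sup>2 + (3 * x + 6 * y + c)\<^sup>2 - 5"
  proof -
    have 1: "c * x \<ge> - 5 * \<bar>x\<bar>" "c * y \<ge> - 5 * \<bar>y\<bar>"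
    proof -
      have "\<bar>c * x\<bar> \<le> 5 * \<bar>x\<bar>" "\<bar>c * y\<bar> \<le> 5 * \<bar>y\<bar>" using c by (auto simp: abs_mult intro!: mult_right_mono)
      then show "c * x \<ge> - 5 * \<bar>x\<bar>" "c * y \<ge> - 5 * \<bar>y\<bar>" by linarith+
    qed
    have 2: "0 \<le> 3 * (2 * x + 3 * y)\<^sup>2 + 3 * y\<^sup>2" by simp
    \<comment> \<open>Splitting off squares shows that the quadratic part dominates 6 (x^2 + y^2);
      the linear terms are estimated separately.\<close>
    have 3: "(3 * x + 1)\<^sup>2 + (3 * x + 6 * y + c)\<^sup>2 - 5 = 6 * (x\<^sup>2 + y\<^sup>2) + (3 * (2 * x + 3 * y)\<^sup>2 + 3 * y\<^sup>2) + 6 * x + 6 * (c * x) + 12 * (c * y) + c\<^sup>2 - 4"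
      by (simp add: power2_eq_square algebra_simps)
    have 4: "0 \<le> c\<^sup>2" "- \<bar>x\<bar> \<le> x" by auto
    show ?thesis unfolding 3 distrib_left using 1 2 4 abs_ge_zero[of x] by linarith
  qed
  then have mono: "A * (6 * (x\<^sup>2 + y\<^sup>2) - 60 * (\<bar>x\<bar> + \<bar>y\<bar>) - 4) \<le> A * ((3 * x + 1)\<^sup>2 + (3 * x + 6 * y + c)\<^sup>2 - 5)"
    using A by (intro mult_left_mono) auto
  have lin: "- A * (S / 12) \<le> A / 3 + (- (A / 2) * Q + 5 * A * L)" if "A * (6 * Q - 60 * L - 4) \<le> A * S" for S Q L
    using that by (simp add: algebra_simps)
  have ex: "- A * (((3 * x + 1)\<^sup>2 + (3 * x + 6 * y + c)\<^sup>2 - 5) / 12) \<le> A / 3 + (- (A / 2) * (x\<^sup>2 + y\<^sup>2) + 5 * A * (\<bar>x\<bar> + \<bar>y\<bar>))"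
    by (rule lin[OF mono])
  define Nr where "Nr = 3 * x + 6 * y + c"
  have Nr: "\<bar>Nr\<bar> \<le> 5 + 6 * (\<bar>x\<bar> + \<bar>y\<bar>)" using c by (simp add: Nr_def)
  have "1 + Nr\<^sup>2 \<le> 2 * exp (2 * \<bar>Nr\<bar>)"
  proof -
    have "\<bar>Nr\<bar> \<le> exp \<bar>Nr\<bar>" using exp_ge_add_one_self[of "\<bar>Nr\<bar>"] by linarith
    then have "\<bar>Nr\<bar>\<^sup>2 \<le> (exp \<bar>Nr\<bar>)\<^sup>2" by (intro power_mono) auto
    also have "\<dots> = exp (2 * \<bar>Nr\<bar>)" by (simp add: exp_double)
    finally have "Nr\<^sup>2 \<le> exp (2 * \<bar>Nr\<bar>)" by simp
    moreover have "1 \<le> exp (2 * \<bar>Nr\<bar>)" by simp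
    ultimately show ?thesis by linarith
  qed
  also have "\<dots> \<le> 2 * exp (10 + 12 * (\<bar>x\<bar> + \<bar>y\<bar>))" using Nr by simp
  finally have wb: "norm (w (NN h m n)) \<le> C * (2 * exp (10 + 12 * (\<bar>x\<bar> + \<bar>y\<bar>)))"
    using w[of "NN h m n"] C unfolding N Nr_def[symmetric] by (meson mult_left_mono order_trans)
  have "norm (XX h w (m, n)) = exp (- A * (((3 * x + 1)\<^sup>2 + (3 * x + 6 * y + c)\<^sup>2 - 5) / 12)) * norm (w (NN h m n))"
    by (simp add: XX_def norm_mult norm_power_int norm_qpow N x_def[symmetric] A_def)
  also have "\<dots> \<le> exp (A / 3 + (- (A / 2) * (x\<^sup>2 + y\<^sup>2) + 5 * A * (\<bar>x\<bar> + \<bar>y\<bar>))) * (C * (2 * exp (10 + 12 * (\<bar>x\<bar> + \<bar>y\<bar>))))"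
    using ex wb by (intro mult_mono) auto
  also have "\<dots> = 2 * C * exp (A / 3 + 10) * exp (- (A / 2) * (x\<^sup>2 + y\<^sup>2) + (5 * A + 12) * (\<bar>x\<bar> + \<bar>y\<bar>))"
    by (simp add: algebra_simps flip: exp_add)
  finally show "norm (XX h w (m, n)) \<le> 2 * C * exp (A / 3 + 10) * exp (- (A / 2) * ((real_of_int m)\<^sup>2 + (real_of_int n)\<^sup>2) + (5 * A + 12) * (\<bar>real_of_int m\<bar> + \<bar>real_of_int n\<bar>))"
    by (simp add: x_def y_def)
qed

lemma norm_sgc_mult: "norm (sgc a * sgc b) \<le> 1" "norm (- (sgc a * sgc b)) \<le> 1"
  by (auto simp: sgn_if)

definition c0 :: "int \<Rightarrow> complex" where "c0 j = (-1) powi j * e (3 * of_int j * (of_int j - 1) / 2)"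
definition c1 :: "int \<Rightarrow> complex" where "c1 j = (-1) powi j * e ((3 * (of_int j)\<^sup>2 - of_int j) / 2)"

lemma Dh_term:
  "sgc j * (c * e a * Dh h w b) = (\<Sum>\<^sub>\<infinity>i. - (sgc j * (c * (sgc (2 * i + h) * (e (a + (of_int (b - 2 + 6 * i + 3 * h) ^ 2 - of_int (b - 2) ^ 2) / 12) * w (b - 2 + 6 * i + 3 * h))))))"
  unfolding Dh_def infsum_uminus mult_minus_right infsum_cmult_right'[symmetric] qpow_add by (simp add: mult_ac)

text \<open>Each change of variables brings the exponent, outer plus inner, to the common form in
  \<open>XX\<close>; where it reverses the sign of \<open>NN\<close>, the evenness of w
  compensates.\<close>

lemma Dh_double_sums:
  assumes h: "h = 0 \<or> h = 1" and w: "\<And>N. norm (w N) \<le> C * (1 + (of_int N)\<^sup>2)" and ev: "\<And>N. w (- N) = w N"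
  shows "((\<lambda>j. sgc j * (c0 j * Dh h w (3 * j))) has_sum (\<Sum>\<^sub>\<infinity>p. (case p of (m1, m2) \<Rightarrow> - (sgc m1 * sgc (2 * m2 + h))) * XX h w p)) UNIV"
    and "((\<lambda>j. sgc j * (c0 j * Dh h w (3 * j + 1))) has_sum (\<Sum>\<^sub>\<infinity>p. (case p of (m1, m2) \<Rightarrow> sgc (m1 + 1) * sgc (2 * m2 + h)) * XX h w p)) UNIV"
    and "((\<lambda>j. sgc j * (c1 j * Dh h w (3 * j))) has_sum (\<Sum>\<^sub>\<infinity>p. (case p of (m1, m2) \<Rightarrow> sgc m1 * sgc (2 * m1 + 2 * m2 + h)) * XX h w p)) UNIV"
    and "((\<lambda>j. sgc j * (c1 j * Dh h w (3 * j + 3))) has_sum (\<Sum>\<^sub>\<infinity>p. (case p of (m1, m2) \<Rightarrow> - (sgc (m1 + 1) * sgc (2 * m1 + 2 * m2 + 2 + h))) * XX h w p)) UNIV"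
proof -
  note X = XX_summable[OF h w]
  have sm: "sgc (- n) = - sgc n" for n by (simp add: sgn_if)
  have pm: "(-1) powi (- n) = ((-1) powi n :: complex)" "(-1) powi (n - 1) = - ((-1) powi n :: complex)" for n
    by (simp_all add: minus_one_powi_cases)
  show "((\<lambda>j. sgc j * (c0 j * Dh h w (3 * j))) has_sum (\<Sum>\<^sub>\<infinity>p. (case p of (m1, m2) \<Rightarrow> - (sgc m1 * sgc (2 * m2 + h))) * XX h w p)) UNIV"
    unfolding c0_def Dh_term
  proof (rule iterated_reindex[where K=1 and \<phi>="\<lambda>(j, i). (- j, - i - h)" and \<psi>="\<lambda>(j, i). (- j, - i - h)", OF X])
    fix j i :: int
    let ?N = "3 * j - 2 + 6 * i + 3 * h"
    have N: "NN h (- j) (- i - h) = - ?N" by (simp add: NN_def)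
    have s: "2 * (- i - h) + h = - (2 * i + h)" by simp
    have ex: "3 * of_int j * (of_int j - 1) / 2 + (of_int ?N ^ 2 - of_int (3 * j - 2) ^ 2) / 12 = ((3 * of_int (- j) + 1)\<^sup>2 + (of_int (- ?N))\<^sup>2 - 5) / (12 :: real)"
      by (simp add: power2_eq_square field_simps)
    show "- (sgc j * ((-1) powi j * (sgc (2 * i + h) * (e (3 * of_int j * (of_int j - 1) / 2 + (of_int ?N ^ 2 - of_int (3 * j - 2) ^ 2) / 12) * w ?N))))
      = (case (case (j, i) of (j, i) \<Rightarrow> (- j, - i - h)) of (m1, m2) \<Rightarrow> - (sgc m1 * sgc (2 * m2 + h))) * XX h w (case (j, i) of (j, i) \<Rightarrow> (- j, - i - h))"
      unfolding XX_def prod.case N s sm ev pm ex by simp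
  qed (auto simp: norm_sgc_mult split: prod.splits)
  show "((\<lambda>j. sgc j * (c0 j * Dh h w (3 * j + 1))) has_sum (\<Sum>\<^sub>\<infinity>p. (case p of (m1, m2) \<Rightarrow> sgc (m1 + 1) * sgc (2 * m2 + h)) * XX h w p)) UNIV"
    unfolding c0_def Dh_term
  proof (rule iterated_reindex[where K=1 and \<phi>="\<lambda>(j, i). (j - 1, i)" and \<psi>="\<lambda>(j, i). (j + 1, i)", OF X])
    fix j i :: int
    let ?N = "3 * j + 1 - 2 + 6 * i + 3 * h"
    have N: "NN h (j - 1) i = ?N" by (simp add: NN_def)
    have ex: "3 * of_int j * (of_int j - 1) / 2 + (of_int ?N ^ 2 - of_int (3 * j + 1 - 2) ^ 2) / 12 = ((3 * of_int (j - 1) + 1)\<^sup>2 + (of_int ?N)\<^sup>2 - 5) / (12 :: real)"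
      by (simp add: power2_eq_square field_simps)
    show "- (sgc j * ((-1) powi j * (sgc (2 * i + h) * (e (3 * of_int j * (of_int j - 1) / 2 + (of_int ?N ^ 2 - of_int (3 * j + 1 - 2) ^ 2) / 12) * w ?N))))
      = (case (case (j, i) of (j, i) \<Rightarrow> (j - 1, i)) of (m1, m2) \<Rightarrow> sgc (m1 + 1) * sgc (2 * m2 + h)) * XX h w (case (j, i) of (j, i) \<Rightarrow> (j - 1, i))"
      unfolding XX_def prod.case N pm ex by simp
  qed (auto simp: norm_sgc_mult split: prod.splits)
  show "((\<lambda>j. sgc j * (c1 j * Dh h w (3 * j))) has_sum (\<Sum>\<^sub>\<infinity>p. (case p of (m1, m2) \<Rightarrow> sgc m1 * sgc (2 * m1 + 2 * m2 + h)) * XX h w p)) UNIV"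
    unfolding c1_def Dh_term
  proof (rule iterated_reindex[where K=1 and \<phi>="\<lambda>(j, i). (j, - j - i - h)" and \<psi>="\<lambda>(j, i). (j, - j - i - h)", OF X])
    fix j i :: int
    let ?N = "3 * j - 2 + 6 * i + 3 * h"
    have N: "NN h j (- j - i - h) = - ?N" by (simp add: NN_def)
    have s: "2 * j + 2 * (- j - i - h) + h = - (2 * i + h)" by simp
    have ex: "(3 * (of_int j)\<^sup>2 - of_int j) / 2 + (of_int ?N ^ 2 - of_int (3 * j - 2) ^ 2) / 12 = ((3 * of_int j + 1)\<^sup>2 + (of_int (- ?N))\<^sup>2 - 5) / (12 :: real)"
      by (simp add: power2_eq_square field_simps)
    show "- (sgc j * ((-1) powi j * (sgc (2 * i + h) * (e ((3 * (of_int j)\<^sup>2 - of_int j) / 2 + (of_int ?N ^ 2 - of_int (3 * j - 2) ^ 2) / 12) * w ?N))))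
      = (case (case (j, i) of (j, i) \<Rightarrow> (j, - j - i - h)) of (m1, m2) \<Rightarrow> sgc m1 * sgc (2 * m1 + 2 * m2 + h)) * XX h w (case (j, i) of (j, i) \<Rightarrow> (j, - j - i - h))"
      unfolding XX_def prod.case N s sm ev ex by simp
  qed (auto simp: norm_sgc_mult split: prod.splits)
  show "((\<lambda>j. sgc j * (c1 j * Dh h w (3 * j + 3))) has_sum (\<Sum>\<^sub>\<infinity>p. (case p of (m1, m2) \<Rightarrow> - (sgc (m1 + 1) * sgc (2 * m1 + 2 * m2 + 2 + h))) * XX h w p)) UNIV"
    unfolding c1_def Dh_term
  proof (rule iterated_reindex[where K=1 and \<phi>="\<lambda>(j, i). (j - 1, - j - i - h)" and \<psi>="\<lambda>(j, i). (j + 1, - j - 1 - i - h)", OF X])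
    fix j i :: int
    let ?N = "3 * j + 3 - 2 + 6 * i + 3 * h"
    have N: "NN h (j - 1) (- j - i - h) = - ?N" by (simp add: NN_def)
    have s: "2 * (j - 1) + 2 * (- j - i - h) + 2 + h = - (2 * i + h)" by simp
    have ex: "(3 * (of_int j)\<^sup>2 - of_int j) / 2 + (of_int ?N ^ 2 - of_int (3 * j + 3 - 2) ^ 2) / 12 = ((3 * of_int (j - 1) + 1)\<^sup>2 + (of_int (- ?N))\<^sup>2 - 5) / (12 :: real)"
      by (simp add: power2_eq_square field_simps)
    show "- (sgc j * ((-1) powi j * (sgc (2 * i + h) * (e ((3 * (of_int j)\<^sup>2 - of_int j) / 2 + (of_int ?N ^ 2 - of_int (3 * j + 3 - 2) ^ 2) / 12) * w ?N))))
      = (case (case (j, i) of (j, i) \<Rightarrow> (j - 1, - j - i - h)) of (m1, m2) \<Rightarrow> - (sgc (m1 + 1) * sgc (2 * m1 + 2 * m2 + 2 + h))) * XX h w (case (j, i) of (j, i) \<Rightarrow> (j - 1, - j - i - h))"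
      unfolding XX_def prod.case N s sm ev pm ex by simp
  qed (auto simp: norm_sgc_mult split: prod.splits)
qed

text \<open>The four sign products of \<open>Dh_double_sums\<close>, added with the signs they carry
  in \<open>cF_series\<close>.\<close>

definition Ker :: "int \<Rightarrow> int \<Rightarrow> int \<Rightarrow> int" where
  "Ker h m1 m2 = (sgn m1 + sgn (m1 + 1)) * sgn (2 * m2 + h) + sgn m1 * sgn (2 * m1 + 2 * m2 + h)
     + sgn (m1 + 1) * sgn (2 * m1 + 2 * m2 + 2 + h)"

definition kersum :: "int \<Rightarrow> (int \<Rightarrow> complex) \<Rightarrow> complex" where
  "kersum h w = (\<Sum>\<^sub>\<infinity>p. (case p of (m1, m2) \<Rightarrow> of_int (Ker h m1 m2)) * XX h w p)"

lemma kersum_eq: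
  assumes h: "h = 0 \<or> h = 1" and w: "\<And>N. norm (w N) \<le> C * (1 + (of_int N)\<^sup>2)"
  shows "kersum h w = - (\<Sum>\<^sub>\<infinity>p. (case p of (m1, m2) \<Rightarrow> - (sgc m1 * sgc (2 * m2 + h))) * XX h w p)
    + (\<Sum>\<^sub>\<infinity>p. (case p of (m1, m2) \<Rightarrow> sgc (m1 + 1) * sgc (2 * m2 + h)) * XX h w p)
    + (\<Sum>\<^sub>\<infinity>p. (case p of (m1, m2) \<Rightarrow> sgc m1 * sgc (2 * m1 + 2 * m2 + h)) * XX h w p)
    - (\<Sum>\<^sub>\<infinity>p. (case p of (m1, m2) \<Rightarrow> - (sgc (m1 + 1) * sgc (2 * m1 + 2 * m2 + 2 + h))) * XX h w p)"
proof -
  note X = XX_summable[OF h w]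
  have s: "((\<lambda>p. \<kappa> p * XX h w p) has_sum (\<Sum>\<^sub>\<infinity>p. \<kappa> p * XX h w p)) UNIV" if "\<And>p. norm (\<kappa> p) \<le> 1" for \<kappa>
    by (rule has_sum_infsum[OF summable_on_bounded_mult[OF X that]])
  let ?a = "\<lambda>p. (case p of (m1, m2) \<Rightarrow> - (sgc m1 * sgc (2 * m2 + h)))"
  let ?b = "\<lambda>p. (case p of (m1, m2) \<Rightarrow> sgc (m1 + 1) * sgc (2 * m2 + h))"
  let ?c = "\<lambda>p. (case p of (m1, m2) \<Rightarrow> sgc m1 * sgc (2 * m1 + 2 * m2 + h))"
  let ?d = "\<lambda>p. (case p of (m1, m2) \<Rightarrow> - (sgc (m1 + 1) * sgc (2 * m1 + 2 * m2 + 2 + h)))"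
  have "((\<lambda>p. - (?a p * XX h w p) + ?b p * XX h w p + ?c p * XX h w p + - (?d p * XX h w p)) has_sum
     (- (\<Sum>\<^sub>\<infinity>p. ?a p * XX h w p) + (\<Sum>\<^sub>\<infinity>p. ?b p * XX h w p) + (\<Sum>\<^sub>\<infinity>p. ?c p * XX h w p) + - (\<Sum>\<^sub>\<infinity>p. ?d p * XX h w p))) UNIV"
    by (intro has_sum_add has_sum_uminusI s) (auto simp: norm_sgc_mult split: prod.splits)
  also have "(\<lambda>p. - (?a p * XX h w p) + ?b p * XX h w p + ?c p * XX h w p + - (?d p * XX h w p)) = (\<lambda>p. (case p of (m1, m2) \<Rightarrow> of_int (Ker h m1 m2)) * XX h w p)"
    by (auto simp: fun_eq_iff Ker_def algebra_simps)
  finally show ?thesis unfolding kersum_def by (simp add: infsumI)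
qed

lemma w0_even: "w0 (- N) = w0 N" and w1_even: "w1 (- N) = w1 N"
  by (simp_all add: w0_def w1_def minus_one_powi_cases)

lemma w0_bound: "\<exists>C. \<forall>N. norm (w0 N) \<le> C * (1 + (of_int N)\<^sup>2)"
proof (intro exI allI)
  fix N :: int
  define L where "L = norm (EE / 8) + norm (AA / 2)"
  have L: "L \<ge> 0" by (simp add: L_def)
  have "norm (w0 N) \<le> norm ((of_int N)\<^sup>2 / 4 - EE / 8 :: complex) + norm ((-1) powi N * AA / 2)"
    unfolding w0_def by (rule norm_triangle_ineq)
  also have "\<dots> \<le> norm ((of_int N)\<^sup>2 / 4 :: complex) + norm (EE / 8) + norm ((-1) powi N * AA / 2)"
    by (intro add_right_mono norm_triangle_ineq4)
  also have "\<dots> = (of_int N)\<^sup>2 / 4 + L"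
    by (simp add: L_def norm_mult norm_divide norm_power norm_power_int)
  also have "\<dots> \<le> (1 + L) * (1 + (of_int N)\<^sup>2)"
  proof -
    have "0 \<le> L * (of_int N)\<^sup>2" using L by simp
    then show ?thesis by (simp add: algebra_simps)
  qed
  finally show "norm (w0 N) \<le> (1 + L) * (1 + (of_int N)\<^sup>2)" .
qed

lemma w1_bound: "\<exists>C. \<forall>N. norm (w1 N) \<le> C * (1 + (of_int N)\<^sup>2)"
proof (intro exI allI)
  fix N :: int
  define L where "L = norm (e (1/4) / 2) * (norm B' + norm C')"
  have L: "L \<ge> 0" by (simp add: L_def)
  have "norm (w1 N) = norm (e (1/4) / 2) * norm (B' - (-1) powi N * C')"
    by (simp add: w1_def norm_mult norm_divide)
  also have "norm (B' - (-1) powi N * C') \<le> norm B' + norm ((-1) powi N * C')" by (rule norm_triangle_ineq4)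
  also have "norm ((-1) powi N * C') = norm C'" by (simp add: norm_mult norm_power_int)
  finally have "norm (w1 N) \<le> L * 1" by (simp add: L_def mult_left_mono)
  also have "\<dots> \<le> L * (1 + (of_int N)\<^sup>2)" using L by (intro mult_left_mono) auto
  finally show "norm (w1 N) \<le> L * (1 + (of_int N)\<^sup>2)" .
qed

lemma c0_summable: "c0 summable_on UNIV" and c1_summable: "c1 summable_on UNIV"
proof -
  have b: "norm ((-1) powi a * e c :: complex) \<le> norm (e c) * exp (0 * \<bar>real_of_int a\<bar>)" for a :: int and c
    by (simp add: norm_mult norm_power_int)
  have "(\<lambda>a. e (3/2 * (of_int a - 1/2)\<^sup>2) * ((-1) powi a * e (- 3/8))) summable_on UNIV"
    by (rule gauss_mult_summable[OF b]) simp
  also have "(\<lambda>a. e (3/2 * (of_int a - 1/2)\<^sup>2) * ((-1) powi a * e (- 3/8))) = c0"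
  proof
    fix a :: int
    have "3 * of_int a * (of_int a - 1) / 2 = 3/2 * (of_int a - 1/2)\<^sup>2 + (- 3/8 :: real)" by (simp add: power2_eq_square field_simps)
    then show "e (3/2 * (of_int a - 1/2)\<^sup>2) * ((-1) powi a * e (- 3/8)) = c0 a"
      unfolding c0_def by (simp only: qpow_add mult_ac)
  qed
  finally show "c0 summable_on UNIV" .
  have "(\<lambda>a. e (3/2 * (of_int a - 1/6)\<^sup>2) * ((-1) powi a * e (- 1/24))) summable_on UNIV"
    by (rule gauss_mult_summable[OF b]) simp
  also have "(\<lambda>a. e (3/2 * (of_int a - 1/6)\<^sup>2) * ((-1) powi a * e (- 1/24))) = c1"
  proof
    fix a :: int
    have "(3 * (of_int a)\<^sup>2 - of_int a) / 2 = 3/2 * (of_int a - 1/6)\<^sup>2 + (- 1/24 :: real)" by (simp add: power2_eq_square field_simps)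
    then show "e (3/2 * (of_int a - 1/6)\<^sup>2) * ((-1) powi a * e (- 1/24)) = c1 a"
      unfolding c1_def by (simp only: qpow_add mult_ac)
  qed
  finally show "c1 summable_on UNIV" .
qed

lemma cF_kersum: "E ^ 8 * cF 0 0 = dd 1 * (\<Sum>\<^sub>\<infinity>j. sgc j * c0 j) - dd 0 * (\<Sum>\<^sub>\<infinity>j. sgc j * c1 j) + kersum 0 w0 + kersum 1 w1"
proof -
  obtain C where C: "\<And>N. norm (w0 N) \<le> C * (1 + (of_int N)\<^sup>2)" using w0_bound by blast
  obtain C' where C': "\<And>N. norm (w1 N) \<le> C' * (1 + (of_int N)\<^sup>2)" using w1_bound by blast
  have h: "(0::int) = 0 \<or> (0::int) = 1" "(1::int) = 0 \<or> (1::int) = 1" by auto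
  note D0 = Dh_double_sums[of 0 w0 C, OF h(1) C w0_even]
  note D1 = Dh_double_sums[of 1 w1 C', OF h(2) C' w1_even]
  have s0: "((\<lambda>j. sgc j * c0 j) has_sum (\<Sum>\<^sub>\<infinity>j. sgc j * c0 j)) UNIV"
    by (rule has_sum_infsum[OF summable_on_bounded_mult[OF c0_summable norm_of_int_sgn]])
  have s1: "((\<lambda>j. sgc j * c1 j) has_sum (\<Sum>\<^sub>\<infinity>j. sgc j * c1 j)) UNIV"
    by (rule has_sum_infsum[OF summable_on_bounded_mult[OF c1_summable norm_of_int_sgn]])
  note S0 = has_sum_add[OF has_sum_add[OF has_sum_add[OF has_sum_add[OF has_sum_cmult_right[OF s0, of "- dd 1"] D0(1)] D1(1)] has_sum_uminusI[OF D0(2)]] has_sum_uminusI[OF D1(2)]]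
  note S1 = has_sum_add[OF has_sum_add[OF has_sum_add[OF has_sum_add[OF has_sum_cmult_right[OF s1, of "- dd 0"] D0(3)] D1(3)] has_sum_uminusI[OF D0(4)]] has_sum_uminusI[OF D1(4)]]
  have e0: "of_int (sgn j) * ((-1) powi j * e (3 * of_int j * (of_int j - 1) / 2) * (- dd 1 + DD (3 * j) - DD (3 * j + 1)))
    = - dd 1 * (sgc j * c0 j) + sgc j * (c0 j * Dh 0 w0 (3 * j)) + sgc j * (c0 j * Dh 1 w1 (3 * j)) + - (sgc j * (c0 j * Dh 0 w0 (3 * j + 1))) + - (sgc j * (c0 j * Dh 1 w1 (3 * j + 1)))" for j
    unfolding DD_series c0_def[symmetric] by (simp add: algebra_simps)
  have e1: "of_int (sgn j) * ((-1) powi j * e ((3 * (of_int j)\<^sup>2 - of_int j) / 2) * (- dd 0 + DD (3 * j) - DD (3 * j + 3)))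
    = - dd 0 * (sgc j * c1 j) + sgc j * (c1 j * Dh 0 w0 (3 * j)) + sgc j * (c1 j * Dh 1 w1 (3 * j)) + - (sgc j * (c1 j * Dh 0 w0 (3 * j + 3))) + - (sgc j * (c1 j * Dh 1 w1 (3 * j + 3)))" for j
    unfolding DD_series c1_def[symmetric] by (simp add: algebra_simps)
  show ?thesis
    unfolding cF_series e0 e1 infsumI[OF S0] infsumI[OF S1] kersum_eq[OF h(1) C] kersum_eq[OF h(2) C'] by simp
qed

text \<open>sgn and the sign with value 1 at 0 differ only at 0. Hence the kernel is twice a product
  of signs up to terms on m1 = 0, m1 = - 1, m2 = 0, m1 + m2 = 0 and m1 + m2 = - 1, and at two
  points.\<close>

lemma Ker_0:
  "Ker 0 m1 m2 = 2 * (if m1 \<ge> 0 then 1 else -1) * ((if m2 \<ge> 0 then 1 else -1) + (if m1 + m2 \<ge> 0 then 1 else -1))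
     - 2 * (if m1 \<ge> 0 then 1 else -1) * of_bool (m2 = 0) - (if m1 \<ge> 0 then 1 else -1) * of_bool (m1 + m2 = 0)
     + (if m1 \<ge> 0 then 1 else -1) * of_bool (m1 + m2 = -1) - 2 * (if m2 \<ge> 0 then 1 else -1) * of_bool (m1 = 0)
     + 2 * (if m2 - 1 \<ge> 0 then 1 else -1) * of_bool (m1 = -1) + 2 * of_bool (m1 = -1 \<and> m2 = 0) + 2 * of_bool (m1 = 0 \<and> m2 = 0)"
proof -
  have "sgn (2 * n) = sgn n" for n :: int by (simp add: sgn_mult)
  from this[of m2] this[of "m1 + m2"] this[of "m1 + m2 + 1"]
  have "Ker 0 m1 m2 = (sgn m1 + sgn (m1 + 1)) * sgn m2 + sgn m1 * sgn (m1 + m2) + sgn (m1 + 1) * sgn (m1 + m2 + 1)"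
    by (simp add: Ker_def algebra_simps)
  then show ?thesis by (auto simp: sgn_if)
qed

text \<open>2 m2 + 1 is never 0, so only the lines m1 = 0 and m1 = - 1 are exceptional; the signs of
  2 s + 1 and 2 s + 3 average to sgn (s + 1).\<close>

lemma Ker_1:
  "Ker 1 m1 m2 = 2 * (if m1 \<ge> 0 then 1 else -1) * (sgn (m1 + m2 + 1) + (if m2 \<ge> 0 then 1 else -1))
     - 2 * (if m2 \<ge> 0 then 1 else -1) * of_bool (m1 = 0) + 2 * (if m2 \<ge> 0 then 1 else -1) * of_bool (m1 = -1)"
  by (auto simp: Ker_def sgn_if)

end

section \<open>Terms on lines\<close>

lemma sgn_shift: "0 < d \<Longrightarrow> d < 1 \<Longrightarrow> sgn (real_of_int m + d) = (if m \<ge> 0 then 1 else -1)"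
proof (cases "m \<ge> 0")
  case True
  assume "0 < d"
  moreover have "0 \<le> real_of_int m" using True by simp
  ultimately have "0 < real_of_int m + d" by linarith
  then show ?thesis using True by simp
next
  case False
  assume "d < 1"
  moreover have "real_of_int m \<le> -1" using False by simp
  ultimately have "real_of_int m + d < 0" by linarith
  then show ?thesis using False by simp
qed

definition s0 :: "int \<Rightarrow> complex" where "s0 m = sg m * (-1) powi m"

lemma norm_s0: "norm (s0 m) \<le> 1"
  by (simp add: s0_def norm_mult norm_power_int)

context tau
begin

text \<open>Terms of false theta functions. In \<open>G\<close>, k = 0 gives the value and k = 2, up
  to a constant, the derivative in tau; see \<open>GF_has_derivative\<close>. This is how the Serre
  derivatives of \<open>F0\<close> arise.\<close>

definition gs :: "real \<Rightarrow> real \<Rightarrow> (int \<Rightarrow> complex) \<Rightarrow> nat \<Rightarrow> int \<Rightarrow> complex" where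
  "gs c d s k m = s m * (of_int m + of_real d) ^ k * e (c * (of_int m + d)\<^sup>2)"

definition G :: "real \<Rightarrow> real \<Rightarrow> (int \<Rightarrow> complex) \<Rightarrow> nat \<Rightarrow> complex" where
  "G c d s k = infsum (gs c d s k) UNIV"

lemma gs_has_sum:
  assumes c: "c > 0" and s: "\<And>m. norm (s m) \<le> 1"
  shows "(gs c d s k has_sum G c d s k) UNIV"
proof -
  have "norm (s m * (of_int m + of_real d) ^ k) \<le> exp (real k * \<bar>d\<bar>) * exp (real k * \<bar>real_of_int m\<bar>)" for m
  proof -
    have eq: "of_int m + complex_of_real d = of_real (of_int m + d)" by simp
    have "\<bar>of_int m + d\<bar> \<le> exp (\<bar>d\<bar> + \<bar>real_of_int m\<bar>)"
      using exp_ge_add_one_self[of "\<bar>d\<bar> + \<bar>real_of_int m\<bar>"] by linarith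
    then have "\<bar>of_int m + d\<bar> ^ k \<le> exp (\<bar>d\<bar> + \<bar>real_of_int m\<bar>) ^ k" by (intro power_mono) auto
    also have "\<dots> = exp (real k * \<bar>d\<bar>) * exp (real k * \<bar>real_of_int m\<bar>)"
      unfolding exp_of_nat_mult[symmetric] distrib_left by (rule exp_add)
    finally have "norm ((of_int m + complex_of_real d) ^ k) \<le> \<dots>" unfolding eq by (simp only: norm_power norm_of_real)
    then have "norm (s m) * norm ((of_int m + complex_of_real d) ^ k) \<le> 1 * (exp (real k * \<bar>d\<bar>) * exp (real k * \<bar>real_of_int m\<bar>))"
      by (intro mult_mono s) auto
    then show ?thesis by (simp add: norm_mult)
  qed
  from gauss_mult_summable[OF this c, of "- d"] have "gs c d s k summable_on UNIV"
    by (simp add: gs_def[abs_def] mult.commute)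
  then show ?thesis by (simp add: G_def)
qed

lemmas gsa = gs_has_sum[of "3/2" s0 "1/2", OF _ norm_s0, simplified]
lemmas gsb = gs_has_sum[of "3/2" s0 "1/6", OF _ norm_s0, simplified]
lemmas gsc = gs_has_sum[of 3 sg "1/3", simplified]
lemmas gsd = gs_has_sum[of 3 sg "1/6", simplified]
lemmas gse = gs_has_sum[of "3/2" sg "1/2", simplified]

text \<open>Completing squares; the constants 3/8, 1/24, 1/3 and 1/12 of this and the next three
  lemmas are the exponents of the prefactors in \<open>F0\<close>.\<close>

lemma ea: "e ((3 * (of_int m)\<^sup>2 + 3 * of_int m) / 2) = e (- 3/8) * e (3/2 * (of_int m + 1/2)\<^sup>2)"
  unfolding qpow_add[symmetric] by (rule arg_cong[where f=e]) (simp add: power2_eq_square field_simps)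
lemma eb: "e ((3 * (of_int m)\<^sup>2 + of_int m) / 2) = e (- 1/24) * e (3/2 * (of_int m + 1/6)\<^sup>2)"
  unfolding qpow_add[symmetric] by (rule arg_cong[where f=e]) (simp add: power2_eq_square field_simps)
lemma ec: "e (3 * (of_int m)\<^sup>2 + 2 * of_int m) = e (- 1/3) * e (3 * (of_int m + 1/3)\<^sup>2)"
  unfolding qpow_add[symmetric] by (rule arg_cong[where f=e]) (simp add: power2_eq_square field_simps)
lemma ed: "e (3 * (of_int m)\<^sup>2 + of_int m) = e (- 1/12) * e (3 * (of_int m + 1/6)\<^sup>2)"
  unfolding qpow_add[symmetric] by (rule arg_cong[where f=e]) (simp add: power2_eq_square field_simps)

text \<open>The two signs differ in the single term j = 0, which produces the constants 1, 1/8 - EE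
  / 8 and 9/8 - EE / 8 below.\<close>

lemma infsum_sgc_eq_sg:
  assumes "(f has_sum S) UNIV" and "\<And>j. f j = sg j * g j"
  shows "(\<Sum>\<^sub>\<infinity>j. sgc j * g j) = S - g 0"
proof -
  have "((\<lambda>j. if j = 0 then g j else 0) has_sum g 0) UNIV"
    by (rule has_sum_finite_neutralI[of "{0}"]) auto
  from has_sum_add[OF assms(1) has_sum_uminusI[OF this]]
  have "((\<lambda>j. f j + - (if j = 0 then g j else 0)) has_sum S - g 0) UNIV" by simp
  also have "(\<lambda>j. f j + - (if j = 0 then g j else 0)) = (\<lambda>j. sgc j * g j)"
    by (auto simp: fun_eq_iff assms(2) sg_def sgn_if)
  finally show ?thesis by (rule infsumI)
qed

lemma infsum_neg: "(\<Sum>\<^sub>\<infinity>j::int. f j) = (\<Sum>\<^sub>\<infinity>j. f (- j))" for f :: "int \<Rightarrow> complex"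
  by (rule infsum_reindex_bij_witness[of _ uminus uminus]) auto

lemma infsum_neg1: "(\<Sum>\<^sub>\<infinity>j::int. f j) = (\<Sum>\<^sub>\<infinity>j. f (- 1 - j))" for f :: "int \<Rightarrow> complex"
  by (rule infsum_reindex_bij_witness[of _ "\<lambda>j. - 1 - j" "\<lambda>j. - 1 - j"]) auto

lemma sgc_neg: "sgc (- j) = - sgc j"
  by (simp add: sgn_if)

lemma sum_c0: "(\<Sum>\<^sub>\<infinity>j. sgc j * c0 j) = 1 - e (- 3/8) * G (3/2) (1/2) s0 0"
proof -
  have "(\<Sum>\<^sub>\<infinity>j. sgc j * c0 j) = (\<Sum>\<^sub>\<infinity>j. - (sgc j * ((-1) powi j * e ((3 * (of_int j)\<^sup>2 + 3 * of_int j) / 2))))"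
    by (subst infsum_neg) (simp add: sgc_neg c0_def minus_one_powi_cases power2_eq_square algebra_simps)
  also have "\<dots> = - (e (- 3/8) * G (3/2) (1/2) s0 0 - (-1) powi 0 * e ((3 * (of_int 0)\<^sup>2 + 3 * of_int 0) / 2))"
    unfolding infsum_uminus
    by (rule arg_cong[where f=uminus], rule infsum_sgc_eq_sg[OF has_sum_cmult_right[OF gsa[of 0], of "e (- 3/8)"]])
       (unfold ea gs_def s0_def power_0, simp)
  finally show ?thesis by simp
qed

lemma sum_c1: "(\<Sum>\<^sub>\<infinity>j. sgc j * c1 j) = 1 - e (- 1/24) * G (3/2) (1/6) s0 0"
proof -
  have "(\<Sum>\<^sub>\<infinity>j. sgc j * c1 j) = (\<Sum>\<^sub>\<infinity>j. - (sgc j * ((-1) powi j * e ((3 * (of_int j)\<^sup>2 + of_int j) / 2))))"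
    by (subst infsum_neg) (simp add: sgc_neg c1_def minus_one_powi_cases power2_eq_square algebra_simps)
  also have "\<dots> = - (e (- 1/24) * G (3/2) (1/6) s0 0 - (-1) powi 0 * e ((3 * (of_int 0)\<^sup>2 + of_int 0) / 2))"
    unfolding infsum_uminus
    by (rule arg_cong[where f=uminus], rule infsum_sgc_eq_sg[OF has_sum_cmult_right[OF gsb[of 0], of "e (- 1/24)"]])
       (unfold eb gs_def s0_def power_0, simp)
  finally show ?thesis by simp
qed

lemma dd_1: "dd 1 = e (- 1/24) * (9/2 * G (3/2) (1/6) s0 2 - EE / 8 * G (3/2) (1/6) s0 0) - (1/8 - EE / 8)"
proof -
  have "dd 1 = - (\<Sum>\<^sub>\<infinity>j. sgc j * ((-1) powi j * e (((of_int (1 + 3 * j) - 3/2)\<^sup>2 - (of_int 1 - 3/2)\<^sup>2) / 6) * rho3 (1 + 3 * j)))"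
    by (rule dd_series)
  also have "\<dots> = (\<Sum>\<^sub>\<infinity>j. sgc j * ((-1) powi j * e ((3 * (of_int j)\<^sup>2 + of_int j) / 2) * ((3 * of_int j + 1/2)\<^sup>2 / 2 - EE / 8)))"
  proof (subst infsum_neg, subst infsum_uminus[symmetric], rule infsum_cong)
    fix j :: int
    have ex: "((of_int (1 + 3 * (- j)) - 3/2)\<^sup>2 - (of_int 1 - 3/2)\<^sup>2) / 6 = (3 * (of_int j)\<^sup>2 + of_int j) / (2 :: real)"
      by (simp add: power2_eq_square field_simps)
    have r: "rho3 (1 + 3 * (- j)) = (3 * of_int j + 1/2)\<^sup>2 / 2 - EE / 8"
      by (simp add: rho3_def power2_eq_square field_simps)
    have m: "(-1) powi (- j) = ((-1) powi j :: complex)" by (simp add: minus_one_powi_cases)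
    show "- (sgc (- j) * ((-1) powi (- j) * e (((of_int (1 + 3 * (- j)) - 3/2)\<^sup>2 - (of_int 1 - 3/2)\<^sup>2) / 6) * rho3 (1 + 3 * (- j))))
      = sgc j * ((-1) powi j * e ((3 * (of_int j)\<^sup>2 + of_int j) / 2) * ((3 * of_int j + 1/2)\<^sup>2 / 2 - EE / 8))"
      unfolding ex r m sgc_neg by simp
  qed
  also have "\<dots> = (e (- 1/24) * (9/2 * G (3/2) (1/6) s0 2 + - (EE / 8) * G (3/2) (1/6) s0 0)) - (-1) powi 0 * e ((3 * (of_int 0)\<^sup>2 + of_int 0) / 2) * ((3 * of_int 0 + 1/2)\<^sup>2 / 2 - EE / 8)"
  proof (rule infsum_sgc_eq_sg[OF has_sum_cmult_right[OF has_sum_add[OF has_sum_cmult_right[OF gsb] has_sum_cmult_right[OF gsb]]]])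
    fix j :: int
    have "(3 * of_int j + 1/2)\<^sup>2 / 2 = 9/2 * (of_int j + complex_of_real (1/6))\<^sup>2" by (simp add: power2_eq_square field_simps)
    then show "e (- 1/24) * (9/2 * gs (3/2) (1/6) s0 2 j + - (EE / 8) * gs (3/2) (1/6) s0 0 j) =
        sg j * ((-1) powi j * e ((3 * (of_int j)\<^sup>2 + of_int j) / 2) * ((3 * of_int j + 1/2)\<^sup>2 / 2 - EE / 8))"
      by (simp only: eb gs_def s0_def power_0) (simp add: algebra_simps)
  qed
  finally show ?thesis by (simp add: power2_eq_square)
qed

lemma dd_0: "dd 0 = e (- 3/8) * (9/2 * G (3/2) (1/2) s0 2 - EE / 8 * G (3/2) (1/2) s0 0) - (9/8 - EE / 8)"
proof -
  have "dd 0 = - (\<Sum>\<^sub>\<infinity>j. sgc j * ((-1) powi j * e (((of_int (0 + 3 * j) - 3/2)\<^sup>2 - (of_int 0 - 3/2)\<^sup>2) / 6) * rho3 (0 + 3 * j)))"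
    by (rule dd_series)
  also have "\<dots> = (\<Sum>\<^sub>\<infinity>j. sgc j * ((-1) powi j * e ((3 * (of_int j)\<^sup>2 + 3 * of_int j) / 2) * ((3 * of_int j + 3/2)\<^sup>2 / 2 - EE / 8)))"
  proof (subst infsum_neg, subst infsum_uminus[symmetric], rule infsum_cong)
    fix j :: int
    have ex: "((of_int (0 + 3 * (- j)) - 3/2)\<^sup>2 - (of_int 0 - 3/2)\<^sup>2) / 6 = (3 * (of_int j)\<^sup>2 + 3 * of_int j) / (2 :: real)"
      by (simp add: power2_eq_square field_simps)
    have r: "rho3 (0 + 3 * (- j)) = (3 * of_int j + 3/2)\<^sup>2 / 2 - EE / 8"
      by (simp add: rho3_def power2_eq_square field_simps)
    have m: "(-1) powi (- j) = ((-1) powi j :: complex)" by (simp add: minus_one_powi_cases)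
    show "- (sgc (- j) * ((-1) powi (- j) * e (((of_int (0 + 3 * (- j)) - 3/2)\<^sup>2 - (of_int 0 - 3/2)\<^sup>2) / 6) * rho3 (0 + 3 * (- j))))
      = sgc j * ((-1) powi j * e ((3 * (of_int j)\<^sup>2 + 3 * of_int j) / 2) * ((3 * of_int j + 3/2)\<^sup>2 / 2 - EE / 8))"
      unfolding ex r m sgc_neg by simp
  qed
  also have "\<dots> = (e (- 3/8) * (9/2 * G (3/2) (1/2) s0 2 + - (EE / 8) * G (3/2) (1/2) s0 0)) - (-1) powi 0 * e ((3 * (of_int 0)\<^sup>2 + 3 * of_int 0) / 2) * ((3 * of_int 0 + 3/2)\<^sup>2 / 2 - EE / 8)"
  proof (rule infsum_sgc_eq_sg[OF has_sum_cmult_right[OF has_sum_add[OF has_sum_cmult_right[OF gsa] has_sum_cmult_right[OF gsa]]]])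
    fix j :: int
    have "(3 * of_int j + 3/2)\<^sup>2 / 2 = 9/2 * (of_int j + complex_of_real (1/2))\<^sup>2" by (simp add: power2_eq_square field_simps)
    then show "e (- 3/8) * (9/2 * gs (3/2) (1/2) s0 2 j + - (EE / 8) * gs (3/2) (1/2) s0 0 j) =
        sg j * ((-1) powi j * e ((3 * (of_int j)\<^sup>2 + 3 * of_int j) / 2) * ((3 * of_int j + 3/2)\<^sup>2 / 2 - EE / 8))"
      by (simp only: ea gs_def s0_def power_0) (simp add: algebra_simps)
  qed
  finally show ?thesis by (simp add: power2_eq_square)
qed

definition main0 :: complex where
  "main0 = (\<Sum>\<^sub>\<infinity>p. (case p of (m1, m2) \<Rightarrow> 2 * sg m1 * (sg m2 + sg (m1 + m2))) * XX 0 w0 p)"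
definition main1 :: complex where
  "main1 = (\<Sum>\<^sub>\<infinity>p. (case p of (m1, m2) \<Rightarrow> 2 * sg m1 * (sgc (m1 + m2 + 1) + sg m2)) * XX 1 w1 p)"

lemma XX0_summable: "XX 0 w0 summable_on UNIV" and XX1_summable: "XX 1 w1 summable_on UNIV"
  using w0_bound w1_bound XX_summable[of 0 w0] XX_summable[of 1 w1] by auto

lemma of_int_sg: "of_int (if m \<ge> 0 then 1 else - 1) = sg m"
  by (simp add: sg_def)

lemma kersum_0: "kersum 0 w0 = main0 - 2 * (\<Sum>\<^sub>\<infinity>m. sg m * XX 0 w0 (m, 0)) - (\<Sum>\<^sub>\<infinity>m. sg m * XX 0 w0 (m, - m))
   + (\<Sum>\<^sub>\<infinity>m. sg m * XX 0 w0 (m, - 1 - m)) - 2 * (\<Sum>\<^sub>\<infinity>n. sg n * XX 0 w0 (0, n)) + 2 * (\<Sum>\<^sub>\<infinity>n. sg (n - 1) * XX 0 w0 (-1, n))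
   + 2 * XX 0 w0 (-1, 0) + 2 * XX 0 w0 (0, 0)"
proof -
  let ?X = "XX 0 w0"
  have s: "(\<lambda>p. \<kappa> p * ?X p) summable_on UNIV" if "\<And>p. norm (\<kappa> p) \<le> 4" for \<kappa>
    by (rule summable_on_bounded_mult[OF XX0_summable that])
  have n4: "norm (2 * sg a * (sg b + sg c)) \<le> 4" "norm (sg a) \<le> 4" for a b c
    using norm_triangle_ineq[of "sg b" "sg c"] by (simp_all add: norm_mult)
  have m: "((\<lambda>p. (case p of (m1, m2) \<Rightarrow> 2 * sg m1 * (sg m2 + sg (m1 + m2))) * ?X p) has_sum main0) UNIV"
    unfolding main0_def by (rule has_sum_infsum[OF s]) (auto simp: n4 split: prod.splits)
  have l1: "((\<lambda>p. of_bool (snd p = 0) * (sg (fst p) * ?X p)) has_sum (\<Sum>\<^sub>\<infinity>m. sg (fst (m, 0::int)) * ?X (m, 0))) UNIV"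
    by (rule infsum_line[where \<phi>="\<lambda>m. (m, 0)"]) (auto intro!: s simp: n4 inj_def prod_eq_iff)
  have l2: "((\<lambda>p. of_bool (fst p + snd p = 0) * (sg (fst p) * ?X p)) has_sum (\<Sum>\<^sub>\<infinity>m. sg (fst (m, - m)) * ?X (m, - m))) UNIV"
    by (rule infsum_line[where \<phi>="\<lambda>m. (m, - m)"]) (auto intro!: s simp: n4 inj_def prod_eq_iff image_iff)
  have l3: "((\<lambda>p. of_bool (fst p + snd p = -1) * (sg (fst p) * ?X p)) has_sum (\<Sum>\<^sub>\<infinity>m. sg (fst (m, - 1 - m)) * ?X (m, - 1 - m))) UNIV"
    by (rule infsum_line[where \<phi>="\<lambda>m. (m, - 1 - m)"]) (auto intro!: s simp: n4 inj_def prod_eq_iff image_iff)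
  have l4: "((\<lambda>p. of_bool (fst p = 0) * (sg (snd p) * ?X p)) has_sum (\<Sum>\<^sub>\<infinity>n. sg (snd (0::int, n)) * ?X (0, n))) UNIV"
    by (rule infsum_line[where \<phi>="\<lambda>n. (0, n)"]) (auto intro!: s simp: n4 inj_def prod_eq_iff image_iff)
  have l5: "((\<lambda>p. of_bool (fst p = -1) * (sg (snd p - 1) * ?X p)) has_sum (\<Sum>\<^sub>\<infinity>n. sg (snd (-1::int, n) - 1) * ?X (-1, n))) UNIV"
    by (rule infsum_line[where \<phi>="\<lambda>n. (-1, n)"]) (auto intro!: s simp: n4 inj_def prod_eq_iff image_iff)
  have l6: "((\<lambda>p. of_bool (p = (-1, 0)) * ?X p) has_sum ?X (-1, 0)) UNIV"
    by (rule has_sum_finite_neutralI[of "{(-1, 0)}"]) auto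
  have l7: "((\<lambda>p. of_bool (p = (0, 0)) * ?X p) has_sum ?X (0, 0)) UNIV"
    by (rule has_sum_finite_neutralI[of "{(0, 0)}"]) auto
  note S = has_sum_add[OF has_sum_add[OF has_sum_add[OF has_sum_add[OF has_sum_add[OF has_sum_add[OF has_sum_add[OF m
      has_sum_cmult_right[OF l1, of "-2"]] has_sum_cmult_right[OF l2, of "-1"]] l3] has_sum_cmult_right[OF l4, of "-2"]]
      has_sum_cmult_right[OF l5, of 2]] has_sum_cmult_right[OF l6, of 2]] has_sum_cmult_right[OF l7, of 2]]
  have "(case p of (m1, m2) \<Rightarrow> of_int (Ker 0 m1 m2)) * ?X p =
      (case p of (m1, m2) \<Rightarrow> 2 * sg m1 * (sg m2 + sg (m1 + m2))) * ?X p + - 2 * (of_bool (snd p = 0) * (sg (fst p) * ?X p))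
      + - 1 * (of_bool (fst p + snd p = 0) * (sg (fst p) * ?X p)) + of_bool (fst p + snd p = -1) * (sg (fst p) * ?X p)
      + - 2 * (of_bool (fst p = 0) * (sg (snd p) * ?X p)) + 2 * (of_bool (fst p = -1) * (sg (snd p - 1) * ?X p))
      + 2 * (of_bool (p = (-1, 0)) * ?X p) + 2 * (of_bool (p = (0, 0)) * ?X p)" for p
  proof (cases p)
    case (Pair m1 m2)
    have k: "of_int (Ker 0 m1 m2) = 2 * sg m1 * (sg m2 + sg (m1 + m2)) - 2 * sg m1 * of_bool (m2 = 0) - sg m1 * of_bool (m1 + m2 = 0)
      + sg m1 * of_bool (m1 + m2 = -1) - 2 * sg m2 * of_bool (m1 = 0) + 2 * sg (m2 - 1) * of_bool (m1 = -1)
      + 2 * of_bool (m1 = -1 \<and> m2 = 0) + 2 * (of_bool (m1 = 0 \<and> m2 = 0) :: complex)"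
      unfolding Ker_0 of_int_add of_int_diff of_int_mult of_int_sg of_int_of_bool of_int_numeral ..
    show ?thesis unfolding Pair prod.case k by (simp add: algebra_simps)
  qed
  then show ?thesis unfolding kersum_def using infsumI[OF S] by simp
qed

lemma kersum_1: "kersum 1 w1 = main1 - 2 * (\<Sum>\<^sub>\<infinity>n. sg n * XX 1 w1 (0, n)) + 2 * (\<Sum>\<^sub>\<infinity>n. sg n * XX 1 w1 (-1, n))"
proof -
  let ?X = "XX 1 w1"
  have s: "(\<lambda>p. \<kappa> p * ?X p) summable_on UNIV" if "\<And>p. norm (\<kappa> p) \<le> 4" for \<kappa>
    by (rule summable_on_bounded_mult[OF XX1_summable that])
  have n4: "norm (2 * sg a * (sgc b + sg c)) \<le> 4" "norm (sg a) \<le> 4" for a b c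
    using norm_triangle_ineq[of "sgc b" "sg c"] norm_of_int_sgn[of b] by (simp_all add: norm_mult)
  have m: "((\<lambda>p. (case p of (m1, m2) \<Rightarrow> 2 * sg m1 * (sgc (m1 + m2 + 1) + sg m2)) * ?X p) has_sum main1) UNIV"
    unfolding main1_def by (rule has_sum_infsum[OF s]) (auto simp: n4 split: prod.splits)
  have l4: "((\<lambda>p. of_bool (fst p = 0) * (sg (snd p) * ?X p)) has_sum (\<Sum>\<^sub>\<infinity>n. sg (snd (0::int, n)) * ?X (0, n))) UNIV"
    by (rule infsum_line[where \<phi>="\<lambda>n. (0, n)"]) (auto intro!: s simp: n4 inj_def prod_eq_iff image_iff)
  have l5: "((\<lambda>p. of_bool (fst p = -1) * (sg (snd p) * ?X p)) has_sum (\<Sum>\<^sub>\<infinity>n. sg (snd (-1::int, n)) * ?X (-1, n))) UNIV"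
    by (rule infsum_line[where \<phi>="\<lambda>n. (-1, n)"]) (auto intro!: s simp: n4 inj_def prod_eq_iff image_iff)
  note S = has_sum_add[OF has_sum_add[OF m has_sum_cmult_right[OF l4, of "-2"]] has_sum_cmult_right[OF l5, of 2]]
  have "(case p of (m1, m2) \<Rightarrow> of_int (Ker 1 m1 m2)) * ?X p =
      (case p of (m1, m2) \<Rightarrow> 2 * sg m1 * (sgc (m1 + m2 + 1) + sg m2)) * ?X p
      + - 2 * (of_bool (fst p = 0) * (sg (snd p) * ?X p)) + 2 * (of_bool (fst p = -1) * (sg (snd p) * ?X p))" for p
  proof (cases p)
    case (Pair m1 m2)
    have k: "of_int (Ker 1 m1 m2) = 2 * sg m1 * (sgc (m1 + m2 + 1) + sg m2)
      - 2 * sg m2 * of_bool (m1 = 0) + 2 * sg m2 * (of_bool (m1 = -1) :: complex)"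
      unfolding Ker_1 of_int_add of_int_diff of_int_mult of_int_sg of_int_of_bool of_int_numeral ..
    show ?thesis unfolding Pair prod.case k by (simp add: algebra_simps)
  qed
  then show ?thesis unfolding kersum_def using infsumI[OF S] by simp
qed

text \<open>Centred at m + 1/2, the linear part of \<open>w0\<close> and its \<open>AA\<close> part
  both lead to terms odd under m -> - 1 - m, which sum to 0.\<close>

lemma line_A: "(\<Sum>\<^sub>\<infinity>m. sg m * XX 0 w0 (m, 0)) = e (- 3/8) * (9/4 * G (3/2) (1/2) s0 2 + (1/16 - EE / 8) * G (3/2) (1/2) s0 0)"
proof -
  have odd1: "G (3/2) (1/2) s0 1 = 0"
    unfolding G_def
  proof (rule infsum_odd[where \<phi>="\<lambda>m. - 1 - m"])
    show "gs (3/2) (1/2) s0 1 (- 1 - p) = - gs (3/2) (1/2) s0 1 p" for p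
    proof -
      have "(real_of_int (- 1 - p) + 1/2)\<^sup>2 = (real_of_int p + 1/2)\<^sup>2" by (simp add: power2_eq_square algebra_simps)
      moreover have "s0 (- 1 - p) = s0 p" by (auto simp: s0_def sg_def minus_one_powi_cases)
      ultimately show ?thesis unfolding gs_def by (simp add: algebra_simps)
    qed
  qed simp
  have odd2: "G (3/2) (1/2) sg 0 = 0"
    unfolding G_def
  proof (rule infsum_odd[where \<phi>="\<lambda>m. - 1 - m"])
    show "gs (3/2) (1/2) sg 0 (- 1 - p) = - gs (3/2) (1/2) sg 0 p" for p
    proof -
      have "(real_of_int (- 1 - p) + 1/2)\<^sup>2 = (real_of_int p + 1/2)\<^sup>2" by (simp add: power2_eq_square algebra_simps)
      moreover have "sg (- 1 - p) = - sg p" by (auto simp: sg_def)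
      ultimately show ?thesis unfolding gs_def by simp
    qed
  qed simp
  have "((\<lambda>m. e (- 3/8) * (9/4 * gs (3/2) (1/2) s0 2 m + (1/16 - EE / 8) * gs (3/2) (1/2) s0 0 m + 3/4 * gs (3/2) (1/2) s0 1 m + AA / 2 * gs (3/2) (1/2) sg 0 m))
     has_sum e (- 3/8) * (9/4 * G (3/2) (1/2) s0 2 + (1/16 - EE / 8) * G (3/2) (1/2) s0 0 + 3/4 * G (3/2) (1/2) s0 1 + AA / 2 * G (3/2) (1/2) sg 0)) UNIV"
    by (intro has_sum_cmult_right has_sum_add gsa gse)
  also have "(\<lambda>m. e (- 3/8) * (9/4 * gs (3/2) (1/2) s0 2 m + (1/16 - EE / 8) * gs (3/2) (1/2) s0 0 m + 3/4 * gs (3/2) (1/2) s0 1 m + AA / 2 * gs (3/2) (1/2) sg 0 m))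
     = (\<lambda>m. sg m * XX 0 w0 (m, 0))"
  proof
    fix m :: int
    have ex: "((3 * of_int m + 1)\<^sup>2 + (of_int (NN 0 m 0))\<^sup>2 - 5) / 12 = (3 * (of_int m)\<^sup>2 + 3 * of_int m) / (2 :: real)"
      by (simp add: NN_def power2_eq_square field_simps)
    have par: "(-1) powi (NN 0 m 0) = ((-1) powi m :: complex)" by (simp add: NN_def minus_one_powi_cases)
    have mm: "(-1) powi m * (-1) powi m = (1 :: complex)" by (simp add: minus_one_powi_cases)
    have w: "w0 (NN 0 m 0) = 9/4 * (of_int m + of_real (1/2))\<^sup>2 + (1/16 - EE / 8) + 3/4 * (of_int m + of_real (1/2)) + (-1) powi m * (AA / 2)"
      unfolding w0_def par by (simp add: NN_def power2_eq_square field_simps)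
    show "e (- 3/8) * (9/4 * gs (3/2) (1/2) s0 2 m + (1/16 - EE / 8) * gs (3/2) (1/2) s0 0 m + 3/4 * gs (3/2) (1/2) s0 1 m + AA / 2 * gs (3/2) (1/2) sg 0 m) = sg m * XX 0 w0 (m, 0)"
    proof -
      define y f P where "y = complex_of_int m + of_real (1/2)" and "f = e (3/2 * (of_int m + 1/2)\<^sup>2)" and "P = ((-1) powi m :: complex)"
      have PP: "P * P = 1" using mm by (simp add: P_def)
      have "sg m * XX 0 w0 (m, 0) = sg m * (P * (e (- 3/8) * f * (9/4 * y\<^sup>2 + (1/16 - EE / 8) + 3/4 * y + P * (AA / 2))))"
        unfolding XX_def prod.case ex ea w y_def f_def P_def ..
      also have "\<dots> = sg m * P * (e (- 3/8) * f * (9/4 * y\<^sup>2 + (1/16 - EE / 8) + 3/4 * y)) + sg m * (P * P) * (e (- 3/8) * f * (AA / 2))"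
        by (simp add: algebra_simps)
      also have "\<dots> = e (- 3/8) * (9/4 * (sg m * P * y\<^sup>2 * f) + (1/16 - EE / 8) * (sg m * P * 1 * f) + 3/4 * (sg m * P * y * f) + AA / 2 * (sg m * 1 * f))"
        unfolding PP by (simp add: algebra_simps)
      finally show ?thesis unfolding gs_def s0_def power_0 power_one_right y_def f_def P_def ..
    qed
  qed
  finally show ?thesis using odd1 odd2 by (simp add: infsumI)
qed

text \<open>Parametrised by m2, the two lines carry the same Gaussian, and their \<open>AA\<close>
  parts cancel because 3 m + 2 and 3 m - 1 have opposite parity. The term 2 * \<open>w0 2\<close> is
  the correction to sg (- m) = - sg m at m = 0.\<close>

lemma line_BC: "- (\<Sum>\<^sub>\<infinity>m. sg m * XX 0 w0 (m, - m)) + (\<Sum>\<^sub>\<infinity>m. sg m * XX 0 w0 (m, - 1 - m))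
   = e (- 1/24) * (9/2 * G (3/2) (1/6) s0 2 + (9/8 - EE / 4) * G (3/2) (1/6) s0 0) - 2 * w0 2"
proof -
  have sB: "(\<lambda>m. sg m * XX 0 w0 (m, - m)) summable_on UNIV" and sC: "(\<lambda>m. sg m * XX 0 w0 (m, - 1 - m)) summable_on UNIV"
  proof -
    have "(\<lambda>m. XX 0 w0 (m, - m)) summable_on UNIV" "(\<lambda>m. XX 0 w0 (m, - 1 - m)) summable_on UNIV"
      using summable_on_reindex[of "\<lambda>m. (m, - m)" UNIV "XX 0 w0"] summable_on_reindex[of "\<lambda>m. (m, - 1 - m)" UNIV "XX 0 w0"]
        summable_on_subset_banach[OF XX0_summable] by (auto simp: inj_on_def o_def)
    then show "(\<lambda>m. sg m * XX 0 w0 (m, - m)) summable_on UNIV" "(\<lambda>m. sg m * XX 0 w0 (m, - 1 - m)) summable_on UNIV"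
      by (auto intro!: summable_on_bounded_mult[where K=1])
  qed
  have B: "((\<lambda>m. sg (- m) * XX 0 w0 (- m, m)) has_sum (\<Sum>\<^sub>\<infinity>m. sg m * XX 0 w0 (m, - m))) UNIV"
    by (subst has_sum_reindex_bij_witness[where i=uminus and j=uminus and T=UNIV and h="\<lambda>m. sg m * XX 0 w0 (m, - m)" and s'="\<Sum>\<^sub>\<infinity>m. sg m * XX 0 w0 (m, - m)"])
       (use sB in auto)
  have C: "((\<lambda>m. sg (- 1 - m) * XX 0 w0 (- 1 - m, m)) has_sum (\<Sum>\<^sub>\<infinity>m. sg m * XX 0 w0 (m, - 1 - m))) UNIV"
    by (subst has_sum_reindex_bij_witness[where i="\<lambda>m. - 1 - m" and j="\<lambda>m. - 1 - m" and T=UNIV and h="\<lambda>m. sg m * XX 0 w0 (m, - 1 - m)" and s'="\<Sum>\<^sub>\<infinity>m. sg m * XX 0 w0 (m, - 1 - m)"])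
       (use sC in auto)
  have Z: "((\<lambda>m. if m = 0 then 2 * w0 2 else 0) has_sum 2 * w0 2) (UNIV :: int set)"
    by (rule has_sum_finite_neutralI[of "{0}"]) auto
  have "((\<lambda>m. e (- 1/24) * (9/2 * gs (3/2) (1/6) s0 2 m + (9/8 - EE / 4) * gs (3/2) (1/6) s0 0 m) + - (if m = 0 then 2 * w0 2 else 0))
     has_sum e (- 1/24) * (9/2 * G (3/2) (1/6) s0 2 + (9/8 - EE / 4) * G (3/2) (1/6) s0 0) + - (2 * w0 2)) UNIV"
    by (intro has_sum_cmult_right has_sum_add gsb has_sum_uminusI Z)
  also have "(\<lambda>m. e (- 1/24) * (9/2 * gs (3/2) (1/6) s0 2 m + (9/8 - EE / 4) * gs (3/2) (1/6) s0 0 m) + - (if m = 0 then 2 * w0 2 else 0))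
    = (\<lambda>m. - (sg (- m) * XX 0 w0 (- m, m)) + sg (- 1 - m) * XX 0 w0 (- 1 - m, m))"
  proof
    fix m :: int
    have N: "NN 0 (- m) m = 3 * m + 2" "NN 0 (- 1 - m) m = 3 * m - 1" by (simp_all add: NN_def)
    have ex: "((3 * of_int (- m) + 1)\<^sup>2 + (of_int (3 * m + 2))\<^sup>2 - 5) / 12 = (3 * (of_int m)\<^sup>2 + of_int m) / (2 :: real)"
      "((3 * of_int (- 1 - m) + 1)\<^sup>2 + (of_int (3 * m - 1))\<^sup>2 - 5) / 12 = (3 * (of_int m)\<^sup>2 + of_int m) / (2 :: real)"
      by (simp_all add: power2_eq_square field_simps)
    have par: "(-1) powi (- m) = ((-1) powi m :: complex)" "(-1) powi (- 1 - m) = - ((-1) powi m :: complex)"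
      by (simp_all add: minus_one_powi_cases)
    have sgs: "sg (- m) = - sg m + (if m = 0 then 2 else 0)" "sg (- 1 - m) = - sg m" by (auto simp: sg_def)
    have w: "w0 (3 * m + 2) + w0 (3 * m - 1) = 9/2 * (of_int m + of_real (1/6))\<^sup>2 + (9/8 - EE / 4)"
      unfolding w0_def by (simp add: minus_one_powi_cases power2_eq_square field_simps)
    have "- (sg (- m) * XX 0 w0 (- m, m)) + sg (- 1 - m) * XX 0 w0 (- 1 - m, m)
      = sg m * ((-1) powi m * e ((3 * (of_int m)\<^sup>2 + of_int m) / 2)) * (w0 (3 * m + 2) + w0 (3 * m - 1)) + - (if m = 0 then 2 * w0 2 else 0)"
      unfolding XX_def prod.case N ex par sgs by (auto simp: algebra_simps)
    also have "sg m * ((-1) powi m * e ((3 * (of_int m)\<^sup>2 + of_int m) / 2)) * (w0 (3 * m + 2) + w0 (3 * m - 1))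
      = e (- 1/24) * (9/2 * gs (3/2) (1/6) s0 2 m + (9/8 - EE / 4) * gs (3/2) (1/6) s0 0 m)"
      unfolding w eb gs_def s0_def power_0 by (simp only: distrib_left mult_ac mult_1_left mult_1_right)
    finally show "e (- 1/24) * (9/2 * gs (3/2) (1/6) s0 2 m + (9/8 - EE / 4) * gs (3/2) (1/6) s0 0 m) + - (if m = 0 then 2 * w0 2 else 0)
      = - (sg (- m) * XX 0 w0 (- m, m)) + sg (- 1 - m) * XX 0 w0 (- 1 - m, m)" ..
  qed
  finally show ?thesis using has_sum_unique[OF has_sum_add[OF has_sum_uminusI[OF B] C]] by simp
qed

lemma line_D: "(\<Sum>\<^sub>\<infinity>n. sg n * XX 0 w0 (0, n)) = e (- 1/3) * (9 * G 3 (1/3) sg 2 + (AA / 2 - EE / 8) * G 3 (1/3) sg 0)"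
proof -
  have "((\<lambda>m. e (- 1/3) * (9 * gs 3 (1/3) sg 2 m + (AA / 2 - EE / 8) * gs 3 (1/3) sg 0 m))
     has_sum e (- 1/3) * (9 * G 3 (1/3) sg 2 + (AA / 2 - EE / 8) * G 3 (1/3) sg 0)) UNIV"
    by (intro has_sum_cmult_right has_sum_add gsc)
  also have "(\<lambda>m. e (- 1/3) * (9 * gs 3 (1/3) sg 2 m + (AA / 2 - EE / 8) * gs 3 (1/3) sg 0 m)) = (\<lambda>n. sg n * XX 0 w0 (0, n))"
  proof
    fix n :: int
    have ex: "((3 * of_int 0 + 1)\<^sup>2 + (of_int (NN 0 0 n))\<^sup>2 - 5) / 12 = (3 * (of_int n)\<^sup>2 + 2 * of_int n :: real)"
      by (simp add: NN_def power2_eq_square field_simps)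
    have w: "w0 (NN 0 0 n) = 9 * (of_int n + of_real (1/3))\<^sup>2 + (AA / 2 - EE / 8)"
      unfolding w0_def by (simp add: NN_def minus_one_powi_cases power2_eq_square field_simps)
    show "e (- 1/3) * (9 * gs 3 (1/3) sg 2 n + (AA / 2 - EE / 8) * gs 3 (1/3) sg 0 n) = sg n * XX 0 w0 (0, n)"
      unfolding XX_def prod.case ex ec w gs_def power_0 by (simp add: algebra_simps)
  qed
  finally show ?thesis by (rule infsumI)
qed

text \<open>The shifted sign \<open>sg (n - 1)\<close> is the one that becomes exactly - sg n under
  n -> - n, without a correction at 0.\<close>

lemma line_E: "(\<Sum>\<^sub>\<infinity>n. sg (n - 1) * XX 0 w0 (-1, n)) = e (- 1/12) * (9 * G 3 (1/6) sg 2 - (AA / 2 + EE / 8) * G 3 (1/6) sg 0)"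
proof -
  have "((\<lambda>m. e (- 1/12) * (9 * gs 3 (1/6) sg 2 m + - (AA / 2 + EE / 8) * gs 3 (1/6) sg 0 m))
     has_sum e (- 1/12) * (9 * G 3 (1/6) sg 2 + - (AA / 2 + EE / 8) * G 3 (1/6) sg 0)) UNIV"
    by (intro has_sum_cmult_right has_sum_add gsd)
  also have "(\<lambda>m. e (- 1/12) * (9 * gs 3 (1/6) sg 2 m + - (AA / 2 + EE / 8) * gs 3 (1/6) sg 0 m)) = (\<lambda>n. sg (- n - 1) * XX 0 w0 (-1, - n))"
  proof
    fix n :: int
    have ex: "((3 * of_int (-1) + 1)\<^sup>2 + (of_int (NN 0 (-1) (- n)))\<^sup>2 - 5) / 12 = (3 * (of_int n)\<^sup>2 + of_int n :: real)"
      by (simp add: NN_def power2_eq_square field_simps)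
    have w: "w0 (NN 0 (-1) (- n)) = 9 * (of_int n + of_real (1/6))\<^sup>2 + - (AA / 2 + EE / 8)"
      unfolding w0_def by (simp add: NN_def minus_one_powi_cases power2_eq_square field_simps)
    have sgs: "sg (- n - 1) = - sg n" by (auto simp: sg_def)
    show "e (- 1/12) * (9 * gs 3 (1/6) sg 2 n + - (AA / 2 + EE / 8) * gs 3 (1/6) sg 0 n) = sg (- n - 1) * XX 0 w0 (-1, - n)"
      unfolding XX_def prod.case ex ed w gs_def power_0 sgs by (simp add: algebra_simps)
  qed
  finally have "(\<Sum>\<^sub>\<infinity>n. sg (- n - 1) * XX 0 w0 (-1, - n)) = e (- 1/12) * (9 * G 3 (1/6) sg 2 + - (AA / 2 + EE / 8) * G 3 (1/6) sg 0)"
    by (rule infsumI)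
  then show ?thesis by (subst infsum_neg) (simp only: mult_minus_left diff_conv_add_uminus)
qed

lemma line_D1: "(\<Sum>\<^sub>\<infinity>n. sg n * XX 1 w1 (0, n)) = (B' + C') / 2 * (e (- 1/12) * G 3 (1/6) sg 0)"
proof -
  have "((\<lambda>m. (B' + C') / 2 * (e (- 1/12) * gs 3 (1/6) sg 0 m)) has_sum (B' + C') / 2 * (e (- 1/12) * G 3 (1/6) sg 0)) UNIV"
    by (intro has_sum_cmult_right gsd)
  also have "(\<lambda>m. (B' + C') / 2 * (e (- 1/12) * gs 3 (1/6) sg 0 m)) = (\<lambda>n. sg (- 1 - n) * XX 1 w1 (0, - 1 - n))"
  proof
    fix n :: int
    have ex: "((3 * of_int 0 + 1)\<^sup>2 + (of_int (NN 1 0 (- 1 - n)))\<^sup>2 - 5) / 12 = (3 * (of_int n)\<^sup>2 + of_int n) + - (1/4 :: real)"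
      by (simp add: NN_def power2_eq_square field_simps)
    have w: "w1 (NN 1 0 (- 1 - n)) = - e (1/4) * (B' + C') / 2"
      unfolding w1_def by (simp add: NN_def minus_one_powi_cases)
    have sgs: "sg (- 1 - n) = - sg n" by (auto simp: sg_def)
    have e4: "e (- (1/4)) * e (1/4) = 1" by (simp add: qpow_minus)
    have "sg (- 1 - n) * XX 1 w1 (0, - 1 - n) = (e (- (1/4)) * e (1/4)) * (sg n * (e (3 * (of_int n)\<^sup>2 + of_int n) * ((B' + C') / 2)))"
      unfolding XX_def prod.case ex w sgs qpow_add by (simp add: algebra_simps)
    then show "(B' + C') / 2 * (e (- 1/12) * gs 3 (1/6) sg 0 n) = sg (- 1 - n) * XX 1 w1 (0, - 1 - n)"
      unfolding e4 ed gs_def power_0 by (simp add: algebra_simps)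
  qed
  finally show ?thesis by (subst infsum_neg1) (simp add: infsumI)
qed

lemma line_E1: "(\<Sum>\<^sub>\<infinity>n. sg n * XX 1 w1 (-1, n)) = e (1/2) * (B' - C') / 2 * (e (- 1/3) * G 3 (1/3) sg 0)"
proof -
  have "((\<lambda>m. e (1/2) * (B' - C') / 2 * (e (- 1/3) * gs 3 (1/3) sg 0 m)) has_sum e (1/2) * (B' - C') / 2 * (e (- 1/3) * G 3 (1/3) sg 0)) UNIV"
    by (intro has_sum_cmult_right gsc)
  also have "(\<lambda>m. e (1/2) * (B' - C') / 2 * (e (- 1/3) * gs 3 (1/3) sg 0 m)) = (\<lambda>n. sg n * XX 1 w1 (-1, n))"
  proof
    fix n :: int
    have ex: "((3 * of_int (-1) + 1)\<^sup>2 + (of_int (NN 1 (-1) n))\<^sup>2 - 5) / 12 = (3 * (of_int n)\<^sup>2 + 2 * of_int n) + (1/4 :: real)"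
      by (simp add: NN_def power2_eq_square field_simps)
    have w: "w1 (NN 1 (-1) n) = - e (1/4) * (B' - C') / 2"
      unfolding w1_def by (simp add: NN_def minus_one_powi_cases)
    have e4: "e (1/4) * e (1/4) = e (1/2)" by (simp add: qpow_add[symmetric])
    have "sg n * XX 1 w1 (-1, n) = (e (1/4) * e (1/4)) * (sg n * (e (3 * (of_int n)\<^sup>2 + 2 * of_int n) * ((B' - C') / 2)))"
      unfolding XX_def prod.case ex w qpow_add by (simp add: algebra_simps)
    then show "e (1/2) * (B' - C') / 2 * (e (- 1/3) * gs 3 (1/3) sg 0 n) = sg n * XX 1 w1 (-1, n)"
      unfolding e4 ec gs_def power_0 by (simp add: algebra_simps)
  qed
  finally show ?thesis by (rule infsumI)
qed

text \<open>In \<open>dd 1\<close> times 1 - O0 minus \<open>dd 0\<close> times 1 - Q0 the two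
  multiples of EE O0 Q0 cancel; the quadratic remainder Q0 O2 - O0 Q2 is what becomes
  \<open>Phi2\<close>.\<close>

lemma cF_explicit:
  defines "O0 \<equiv> e (- 3/8) * G (3/2) (1/2) s0 0" and "O2 \<equiv> e (- 3/8) * G (3/2) (1/2) s0 2"
    and "Q0 \<equiv> e (- 1/24) * G (3/2) (1/6) s0 0" and "Q2 \<equiv> e (- 1/24) * G (3/2) (1/6) s0 2"
    and "R0 \<equiv> e (- 1/3) * G 3 (1/3) sg 0" and "R2 \<equiv> e (- 1/3) * G 3 (1/3) sg 2"
    and "S0 \<equiv> e (- 1/12) * G 3 (1/6) sg 0" and "S2 \<equiv> e (- 1/12) * G 3 (1/6) sg 2"
  shows "E ^ 8 * cF 0 0 = main0 + main1 + 9/2 * (Q0 * O2 - O0 * Q2)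
     + (EE + 2) / 4 + AA + (9 * Q2 - EE / 4 * Q0) - (9 * O2 - EE / 4 * O0)
     + ((18 * S2 - EE / 4 * S0) - (AA + B' + C') * S0)
     - ((18 * R2 - EE / 4 * R0) + (AA - e (1/2) * (B' - C')) * R0)"
proof -
  have X: "XX 0 w0 (-1, 0) = - w0 1" "XX 0 w0 (0, 0) = w0 2"
    using w0_even[of 1] by (simp_all add: XX_def NN_def)
  have w: "w0 1 = 1/4 - EE / 8 - AA / 2" "w0 2 = 1 - EE / 8 + AA / 2"
    by (simp_all add: w0_def minus_one_powi_cases)
  have k0: "kersum 0 w0 = main0 - 2 * (9/4 * O2 + (1/16 - EE / 8) * O0) + (9/2 * Q2 + (9/8 - EE / 4) * Q0 - 2 * w0 2)
     - 2 * (9 * R2 + (AA / 2 - EE / 8) * R0) + 2 * (9 * S2 - (AA / 2 + EE / 8) * S0) - 2 * w0 1 + 2 * w0 2"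
    unfolding kersum_0 line_A line_D line_E X O0_def O2_def Q0_def Q2_def R0_def R2_def S0_def S2_def
    using line_BC by (simp add: algebra_simps)
  have k1: "kersum 1 w1 = main1 - (B' + C') * S0 + e (1/2) * (B' - C') * R0"
    unfolding kersum_1 line_D1 line_E1 R0_def S0_def by simp
  have d: "dd 1 = 9/2 * Q2 - EE / 8 * Q0 - (1/8 - EE / 8)" "dd 0 = 9/2 * O2 - EE / 8 * O0 - (9/8 - EE / 8)"
    unfolding dd_1 dd_0 O0_def O2_def Q0_def Q2_def by (simp_all add: algebra_simps)
  have c: "(\<Sum>\<^sub>\<infinity>j. sgc j * c0 j) = 1 - O0" "(\<Sum>\<^sub>\<infinity>j. sgc j * c1 j) = 1 - Q0"
    unfolding sum_c0 sum_c1 O0_def Q0_def by simp_all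
  show ?thesis unfolding cF_kersum k0 k1 d c w by (simp add: algebra_simps add_divide_distrib diff_divide_distrib)
qed

end

section \<open>Theta and eta quotients\<close>

definition GF :: "real \<Rightarrow> real \<Rightarrow> (int \<Rightarrow> complex) \<Rightarrow> complex \<Rightarrow> complex" where
  "GF c d s x = (\<Sum>\<^sub>\<infinity>m. s m * qpow (c * (of_int m + d)\<^sup>2) x)"

lemma has_sum_int_sums:
  fixes f :: "int \<Rightarrow> 'a :: {comm_monoid_add, t2_space}"
  assumes "(f has_sum s) UNIV"
  shows "(\<lambda>n. f (int_decode n)) sums s"
proof -
  have "((\<lambda>n. f (int_decode n)) has_sum s) UNIV"
    using has_sum_reindex_bij_betw[OF bij_int_decode, of f s] assms by simp
  then show ?thesis by (rule has_sum_imp_sums)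
qed

lemma sg_real: "0 < d \<Longrightarrow> d < 1 \<Longrightarrow> complex_of_real (sgn (real_of_int m + d)) = sg m"
  by (simp add: sgn_shift sg_def)

lemma phi_1_eq: "phi 1 = GF 3 (1/6) sg"
  by (rule ext) (simp add: phi_def GF_def Let_def sg_real)

lemma phi_2_eq: "phi 2 = GF 3 (1/3) sg"
  by (rule ext) (simp add: phi_def GF_def Let_def sg_real)

lemma omega_0_eq: "omega 0 = GF (3/2) (1/2) s0"
  by (rule ext) (simp add: omega_def GF_def Let_def sg_real s0_def mult_ac)

text \<open>The coset Z + 5/6 is the negative of Z + 1/6; under m -> - 1 - m the sign and the parity
  factor both change, so their product does not.\<close>

lemma omega_1_eq: "omega 1 = GF (3/2) (1/6) s0"
proof
  fix x
  have "omega 1 x = (\<Sum>\<^sub>\<infinity>m. (-1) powi m * sg m * qpow (3/2 * (of_int m + 5/6)\<^sup>2) x)"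
    by (simp add: omega_def Let_def sg_real add.assoc)
  also have "\<dots> = GF (3/2) (1/6) s0 x"
    unfolding GF_def
  proof (rule infsum_reindex_bij_witness[of _ "\<lambda>m. - 1 - m" "\<lambda>m. - 1 - m"])
    fix m :: int
    have "(real_of_int (- 1 - m) + 1/6)\<^sup>2 = (of_int m + 5/6)\<^sup>2" by (simp add: power2_eq_square algebra_simps)
    moreover have "s0 (- 1 - m) = (-1) powi m * sg m" by (auto simp: s0_def sg_def minus_one_powi_cases)
    ultimately show "s0 (- 1 - m) * qpow (3/2 * (of_int (- 1 - m) + 1/6)\<^sup>2) x = (-1) powi m * sg m * qpow (3/2 * (of_int m + 5/6)\<^sup>2) x"
      by simp
  qed auto
  finally show "omega 1 x = GF (3/2) (1/6) s0 x" .
qed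

section \<open>Derivatives of the false theta functions and theta values at the half periods\<close>

context tau
begin

lemma GF_eq: "GF c d s \<tau> = G c d s 0"
  by (simp add: GF_def G_def gs_def[abs_def])

text \<open>Termwise differentiation on the half plane Im x > y0 with y0 = Im tau / 2, where the
  differentiated terms are dominated by their norms at i y0.\<close>

lemma GF_has_derivative:
  assumes c: "c > 0" and s: "\<And>m. norm (s m) \<le> 1"
  shows "(GF c d s has_field_derivative (2 * of_real pi * \<i> * of_real c * G c d s 2)) (at \<tau>)"
proof -
  define y0 where "y0 = Im \<tau> / 2"
  have y0: "y0 > 0" "y0 < Im \<tau>" using tau by (auto simp: y0_def)
  interpret t: tau "\<i> * of_real y0" by standard (use y0 in simp)
  define S where "S = {x. Im x > y0}"
  define A where "A m = c * (of_int m + d)\<^sup>2" for m :: int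
  have A0: "A m \<ge> 0" for m using c by (simp add: A_def)
  \<comment> \<open>The integers are enumerated by \<open>int_decode\<close>, so that the
    Weierstrass test for sequences of partial sums applies.\<close>
  define f where "f n x = s (int_decode n) * qpow (A (int_decode n)) x" for n x
  define f' where "f' n x = s (int_decode n) * (2 * of_real pi * \<i> * of_real (A (int_decode n)) * qpow (A (int_decode n)) x)" for n x
  have sums_at: "(\<lambda>n. f n x) sums GF c d s x" if "x \<in> S" for x
  proof -
    interpret u: tau x by standard (use that y0 in \<open>simp add: S_def\<close>)
    have "(u.gs c d s 0 has_sum GF c d s x) UNIV"
      unfolding u.GF_eq by (rule u.gs_has_sum[OF c s])
    from has_sum_int_sums[OF this] show ?thesis by (simp add: f_def u.gs_def A_def)
  qed
  have tS: "\<tau> \<in> S" using y0 by (simp add: S_def)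
  have opS: "open S" unfolding S_def by (rule open_halfspace_Im_gt)
  have "((\<lambda>x. \<Sum>n. f n x) has_field_derivative (\<Sum>n. f' n \<tau>)) (at \<tau>)"
  proof (rule has_field_derivative_series')
    show "convex S" unfolding S_def by (rule convex_halfspace_Im_gt)
    show "(f n has_field_derivative f' n x) (at x within S)" for n x
      unfolding f_def[abs_def] f'_def qpow_def by (auto intro!: derivative_eq_intros)
    show "uniformly_convergent_on S (\<lambda>n x. \<Sum>i<n. f' i x)"
    proof (rule Weierstrass_m_test')
      define g where "g m = 2 * pi * c * norm (t.gs c d (\<lambda>_. 1) 2 m)" for m
      show "norm (f' n x) \<le> g (int_decode n)" if "x \<in> S" for n x
      proof -
        let ?m = "int_decode n"
        have "- 2 * pi * Im x * A ?m \<le> - 2 * pi * y0 * A ?m"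
          using that A0[of ?m] mult_right_mono[of y0 "Im x" "2 * pi * A ?m"] by (simp add: S_def algebra_simps)
        then have q: "norm (qpow (A ?m) x) \<le> norm (qpow (A ?m) (\<i> * of_real y0))"
          by (simp add: norm_qpow)
        have "norm (f' n x) = norm (s ?m) * (2 * pi * A ?m * norm (qpow (A ?m) x))"
          using A0[of ?m] by (simp add: f'_def norm_mult)
        also have "\<dots> \<le> 1 * (2 * pi * A ?m * norm (qpow (A ?m) (\<i> * of_real y0)))"
          using A0[of ?m] q s[of ?m] by (intro mult_mono) auto
        also have "\<dots> = g ?m"
        proof -
          have "of_int ?m + complex_of_real d = of_real (of_int ?m + d)" by simp
          then have "norm ((of_int ?m + complex_of_real d)\<^sup>2) = (of_int ?m + d)\<^sup>2"
            by (metis norm_of_real norm_power power2_abs)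
          then show ?thesis by (simp add: g_def t.gs_def A_def norm_mult)
        qed
        finally show ?thesis .
      qed
      have "(\<lambda>m. norm (t.gs c d (\<lambda>_. 1) 2 m)) summable_on UNIV"
        using has_sum_imp_summable[OF t.gs_has_sum[OF c, of "\<lambda>_. 1"]] by (simp add: summable_on_iff_abs_summable_on_complex)
      then have "g summable_on UNIV" unfolding g_def by (rule summable_on_cmult_right)
      then obtain a where "(g has_sum a) UNIV" by (auto simp: summable_on_def)
      from has_sum_int_sums[OF this] show "summable (\<lambda>n. g (int_decode n))" by (simp add: sums_iff)
    qed
    show "summable (\<lambda>n. f n \<tau>)" using sums_at[OF tS] by (simp add: sums_iff)
  qed (use tS opS in \<open>auto simp: interior_open\<close>)
  then have "(GF c d s has_field_derivative (\<Sum>n. f' n \<tau>)) (at \<tau>)"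
    by (rule has_field_derivative_transform_within_open[OF _ opS tS]) (use sums_at in \<open>auto simp: sums_iff\<close>)
  moreover have "((\<lambda>m. 2 * of_real pi * \<i> * of_real c * gs c d s 2 m) has_sum 2 * of_real pi * \<i> * of_real c * G c d s 2) UNIV"
    by (rule has_sum_cmult_right[OF gs_has_sum[OF c s]])
  from has_sum_int_sums[OF this] have "(\<lambda>n. f' n \<tau>) sums (2 * of_real pi * \<i> * of_real c * G c d s 2)"
    by (simp add: f'_def gs_def A_def mult_ac)
  ultimately show ?thesis by (simp add: sums_iff)
qed

lemma E2_eq: "E2 \<tau> = EE"
  unfolding E2_def EE_def divisor_sum_eq_Y ..

lemma eta_eq: "eta \<tau> = e (1/24) * E"
  by (simp add: eta_def E_def qpoch_inf_def)

lemma serre_GF: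
  assumes "c > 0" "\<And>m. norm (s m) \<le> 1"
  shows "6 * serre_D (1/2) (GF c d s) \<tau> = 6 * of_real c * G c d s 2 - EE / 4 * G c d s 0"
  using DERIV_imp_deriv[OF GF_has_derivative[OF assms]] by (simp add: serre_D_def E2_eq GF_eq)

text \<open>The triple product at x = exp (-2 pi i z), with n replaced by - n; the hypothesis on z
  is its condition |q| < |x|.\<close>

lemma theta_eq:
  assumes z: "norm (nome \<tau>) < norm (exp (- (2 * of_real pi * \<i> * z)))"
  shows "theta z \<tau> = \<i> * e (1/8) * exp (of_real pi * \<i> * z) * (E * T (exp (- (2 * of_real pi * \<i> * z))))"
proof -
  define x where "x = exp (- (2 * of_real pi * \<i> * z))"
  define K where "K = \<i> * e (1/8) * exp (of_real pi * \<i> * z)"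
  have "((\<lambda>n. K * theta_term x n) has_sum K * (E * T x)) UNIV"
    by (rule has_sum_cmult_right[OF jacobi_triple_product]) (use z in \<open>simp add: x_def\<close>)
  then have "((\<lambda>m. K * theta_term x (- m)) has_sum K * (E * T x)) UNIV"
    by (subst has_sum_reindex_bij_witness[where i=uminus and j=uminus and T=UNIV and h="\<lambda>n. K * theta_term x n" and s'="K * (E * T x)"]) auto
  also have "(\<lambda>m. K * theta_term x (- m)) = (\<lambda>m. let n = of_int m + 1/2 :: real in
     exp (of_real pi * \<i> * of_real n) * qpow (n\<^sup>2 / 2) \<tau> * exp (2 * of_real pi * \<i> * of_real n * z))"
  proof
    fix m :: int
    define n where "n = real_of_int m + 1/2"
    have 1: "exp (of_real pi * \<i> * of_real n) = (-1) powi (- m) * \<i>"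
    proof -
      have "of_real pi * \<i> * of_real n = of_int m * (of_real pi * \<i>) + of_real (pi / 2) * \<i>"
        by (simp add: n_def algebra_simps)
      then have "exp (of_real pi * \<i> * of_real n) = exp (of_real pi * \<i>) powi m * exp (of_real (pi / 2) * \<i>)"
        by (simp only: exp_add exp_power_int)
      also have "exp (of_real (pi / 2) * \<i>) = \<i>" using cis_pi_half by (simp add: cis_conv_exp mult.commute)
      also have "exp (of_real pi * \<i>) = -1" using exp_pi_i by simp
      finally show ?thesis by (simp add: minus_one_powi_cases)
    qed
    have "real_of_int (- m * (- m - 1) div 2) = of_int m * (of_int m + 1) / 2"
      using real_triangular_int[of "- m"] by (simp add: algebra_simps)
    then have 2: "qpow (n\<^sup>2 / 2) \<tau> = e (1/8) * nome \<tau> powi (- m * (- m - 1) div 2)"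
      unfolding nome_powi qpow_add[symmetric]
      by (intro arg_cong[where f=e]) (simp add: n_def power2_eq_square field_simps)
    have 3: "exp (2 * of_real pi * \<i> * of_real n * z) = exp (of_real pi * \<i> * z) * x powi (- m)"
      unfolding x_def exp_power_int exp_add[symmetric] by (simp add: n_def algebra_simps)
    show "K * theta_term x (- m) = (let n = of_int m + 1/2 :: real in
     exp (of_real pi * \<i> * of_real n) * qpow (n\<^sup>2 / 2) \<tau> * exp (2 * of_real pi * \<i> * of_real n * z))"
      unfolding Let_def n_def[symmetric] 1 2 3 by (simp add: K_def theta_term_def)
  qed
  finally show ?thesis unfolding theta_def x_def K_def by (rule infsumI)
qed

lemma exp_half_tau: "exp (of_real pi * \<i> * \<tau>) = e (1/2)"
  by (simp add: qpow_def)

lemma T_inv_sq: "x \<noteq> 0 \<Longrightarrow> T (1 / x) ^ 2 = T x ^ 2 / x\<^sup>2"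
  by (simp add: T_inverse power_divide)

lemma theta_sq:
  assumes "exp (- (2 * of_real pi * \<i> * z)) = x" "norm (nome \<tau>) < norm x"
  shows "theta z \<tau> ^ 2 = - e (1/4) * exp (2 * of_real pi * \<i> * z) * (E * T x) ^ 2"
proof -
  have "theta z \<tau> = \<i> * e (1/8) * exp (of_real pi * \<i> * z) * (E * T x)"
    using theta_eq[of z] assms by simp
  then have "theta z \<tau> ^ 2 = (\<i> * \<i>) * (e (1/8) * e (1/8)) * (exp (of_real pi * \<i> * z) * exp (of_real pi * \<i> * z)) * (E * T x) ^ 2"
    by (simp add: power2_eq_square mult_ac)
  also have "e (1/8) * e (1/8) = e (1/4)" by (simp flip: qpow_add)
  also have "exp (of_real pi * \<i> * z) * exp (of_real pi * \<i> * z) = exp (2 * of_real pi * \<i> * z)"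
    by (simp add: algebra_simps flip: exp_add)
  finally show ?thesis by simp
qed

lemma theta_half_sq: "theta (1/2) \<tau> ^ 2 = e (1/4) * E ^ 2 * T (-1) ^ 2"
proof -
  have "exp (2 * of_real pi * \<i> * (1/2)) = -1" by simp
  moreover from this have "exp (- (2 * of_real pi * \<i> * (1/2))) = -1" by (simp only: exp_minus) simp
  ultimately show ?thesis using theta_sq[of "1/2" "-1"] q1 by (simp only: power_mult_distrib) simp
qed

lemma e_quarter: "e (1/4) * e (1/2) / e (1/2) ^ 2 = e (- 1/4)"
  unfolding qpow_power qpow_add[symmetric] qpow_diff[symmetric] by simp

lemma nome_less_inverse: "norm (nome \<tau>) < norm (1 / e (1/2))" "norm (nome \<tau>) < norm (1 / (- e (1/2)))"
proof -
  have "1 < 1 / norm (e (1/2))" using p0 norm_p_less by simp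
  then have "norm (nome \<tau>) < 1 / norm (e (1/2))" using q1 by linarith
  then show "norm (nome \<tau>) < norm (1 / e (1/2))" "norm (nome \<tau>) < norm (1 / (- e (1/2)))"
    by (simp_all only: norm_divide norm_one norm_minus_cancel)
qed

lemma theta_tau_sq: "theta (\<tau>/2) \<tau> ^ 2 = - e (- 1/4) * E ^ 2 * T (e (1/2)) ^ 2"
proof -
  have z: "exp (2 * of_real pi * \<i> * (\<tau>/2)) = e (1/2)" using exp_half_tau by (simp add: mult.assoc)
  then have "exp (- (2 * of_real pi * \<i> * (\<tau>/2))) = 1 / e (1/2)" by (simp only: exp_minus divide_inverse mult_1_left)
  then have "theta (\<tau>/2) \<tau> ^ 2 = - e (1/4) * e (1/2) * (E * T (1 / e (1/2))) ^ 2"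
    using theta_sq[OF _ nome_less_inverse(1)] unfolding z[symmetric] by blast
  also have "\<dots> = - (e (1/4) * e (1/2) / e (1/2) ^ 2) * E ^ 2 * T (e (1/2)) ^ 2"
    by (simp add: power_mult_distrib T_inv_sq)
  finally show ?thesis unfolding e_quarter .
qed

lemma theta_tau1_sq: "theta ((\<tau> + 1)/2) \<tau> ^ 2 = e (- 1/4) * E ^ 2 * T (- e (1/2)) ^ 2"
proof -
  have "2 * of_real pi * \<i> * ((\<tau> + 1)/2) = of_real pi * \<i> * \<tau> + of_real pi * \<i>" by (simp add: field_simps)
  then have "exp (2 * of_real pi * \<i> * ((\<tau> + 1)/2)) = exp (of_real pi * \<i> * \<tau>) * exp (of_real pi * \<i>)"
    by (simp only: exp_add)
  also have "\<dots> = - e (1/2)" unfolding exp_half_tau by simp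
  finally have z: "exp (2 * of_real pi * \<i> * ((\<tau> + 1)/2)) = - e (1/2)" .
  then have "exp (- (2 * of_real pi * \<i> * ((\<tau> + 1)/2))) = 1 / (- e (1/2))" by (simp only: exp_minus divide_inverse mult_1_left)
  from theta_sq[OF this nome_less_inverse(2)]
  have "theta ((\<tau> + 1)/2) \<tau> ^ 2 = - e (1/4) * (- e (1/2)) * (E * T (1 / (- e (1/2)))) ^ 2"
    unfolding z .
  also have "\<dots> = (e (1/4) * e (1/2) / e (1/2) ^ 2) * E ^ 2 * T (- e (1/2)) ^ 2"
    by (subst power_mult_distrib, subst T_inv_sq) simp_all
  finally show ?thesis unfolding e_quarter .
qed

section \<open>Identification with \<open>Lambda\<close>, \<open>Phi1\<close> and
  \<open>Phi2\<close>\<close>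

lemma QB_eq: "Q_B (of_int m1 + 1/3) (of_int m2 + (of_int h / 2 + 1/6)) = ((3 * of_int m1 + 1)\<^sup>2 + (of_int (NN h m1 m2))\<^sup>2 - 5) / 12 + 5/12"
  by (simp add: Q_B_def NN_def power2_eq_square field_simps)

definition qb :: "int \<Rightarrow> int \<times> int \<Rightarrow> complex" where
  "qb h = (\<lambda>(m1, m2). e (Q_B (of_int m1 + 1/3) (of_int m2 + (of_int h / 2 + 1/6))))"

lemma XX_qb: "XX h w (m1, m2) = e (- 5/12) * ((-1) powi m1 * (qb h (m1, m2) * w (NN h m1 m2)))"
proof -
  have "e (- 5/12) * qb h (m1, m2) = e (((3 * of_int m1 + 1)\<^sup>2 + (of_int (NN h m1 m2))\<^sup>2 - 5) / 12)"
    unfolding qb_def prod.case QB_eq qpow_add[symmetric] by simp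
  from this[symmetric] show ?thesis unfolding XX_def prod.case by (simp only: mult_ac)
qed

lemma qb_summable: "h = 0 \<or> h = 1 \<Longrightarrow> (\<And>p. norm (k p) \<le> K) \<Longrightarrow> (\<lambda>p. k p * qb h p) summable_on UNIV"
proof (rule summable_on_bounded_mult)
  assume h: "h = 0 \<or> h = 1"
  have "XX h (\<lambda>_. 1) summable_on UNIV" by (rule XX_summable[OF h, of _ 1]) auto
  then have "(\<lambda>p. (e (5/12) * (-1) powi (fst p)) * XX h (\<lambda>_. 1) p) summable_on UNIV"
    by (rule summable_on_bounded_mult[where K="norm (e (5/12))"]) (simp add: norm_mult norm_power_int)
  also have "(\<lambda>p. (e (5/12) * (-1) powi (fst p)) * XX h (\<lambda>_. 1) p) = qb h"
  proof
    fix p :: "int \<times> int"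
    have "e (5/12) * e (- 5/12) = 1" by (simp flip: qpow_add)
    moreover have "(-1) powi (fst p) * (-1) powi (fst p) = (1 :: complex)" by (simp add: minus_one_powi_cases)
    moreover have "(e (5/12) * (-1) powi (fst p)) * XX h (\<lambda>_. 1) p = (e (5/12) * e (- 5/12)) * ((-1) powi (fst p) * (-1) powi (fst p)) * qb h p"
      by (cases p) (simp add: XX_qb)
    ultimately show "(e (5/12) * (-1) powi (fst p)) * XX h (\<lambda>_. 1) p = qb h p" by simp
  qed
  finally show "qb h summable_on UNIV" .
qed

text \<open>If m2 and m1 + m2 have the same sign, their sum m1 + 2 m2 has it too; otherwise both
  sides vanish. The summand 1 on the right leads to \<open>Lambda\<close>, while the product of four
  signs is odd and sums to 0.\<close>

lemma sg_identity0: "sg m1 * (sg m2 + sg (m1 + m2)) = sg m1 * sg (m1 + 2 * m2) * (1 + sg m2 * sg (m1 + m2))"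
  by (auto simp: sg_def)

lemma sg_identity1: "sg m1 * (sgc (m1 + m2 + 1) + sg m2) = sg m1 * sg (m1 + 2 * m2 + 1) * (1 + sgc (m1 + m2 + 1) * sg m2)"
  by (auto simp: sg_def sgn_if)

lemma norm_sg_mult: "norm (sg a * sg b) \<le> 1" "norm (sg a * sg b * (sg c * sg d)) \<le> 1" "norm (sg a * sg b * (sgc c * sg d)) \<le> 1"
  using norm_of_int_sgn[of c] by (simp_all add: norm_mult)

lemma Lambda_01: "Lambda 0 1 \<tau> = (\<Sum>\<^sub>\<infinity>p. (case p of (m1, m2) \<Rightarrow> sg m1 * sg (m1 + 2 * m2)) * qb 0 p)"
  unfolding Lambda_def
proof (rule infsum_cong)
  fix p :: "int \<times> int"
  obtain m1 m2 where p: "p = (m1, m2)" by (cases p)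
  have "(real_of_int m1 + 1/3) + 2 * (real_of_int m2 + (of_int 0 / 2 + 1/6)) = of_int (m1 + 2 * m2) + 2/3" by simp
  then show "(case p of (m1, m2) \<Rightarrow> let n1 = of_int m1 + 1/3 :: real; n2 = of_int m2 + (of_int 0 / 2 + 1/6) :: real in
     (-1) powi ((1 + 1) * m1) * of_real (sgn n1 * sgn (n1 + 2 * n2)) * qpow (Q_B n1 n2) \<tau>)
    = (case p of (m1, m2) \<Rightarrow> sg m1 * sg (m1 + 2 * m2)) * qb 0 p"
    unfolding p prod.case Let_def of_real_mult qb_def
    by (simp only: sg_real) (simp add: minus_one_powi_cases sg_real[symmetric, of "2/3"] sg_real[symmetric, of "1/3"])
qed

lemma Lambda_1x:
  "Lambda 1 0 \<tau> = (\<Sum>\<^sub>\<infinity>p. (case p of (m1, m2) \<Rightarrow> (-1) powi m1 * (sg m1 * sg (m1 + 2 * m2 + 1))) * qb 1 p)"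
  "Lambda 1 1 \<tau> = (\<Sum>\<^sub>\<infinity>p. (case p of (m1, m2) \<Rightarrow> sg m1 * sg (m1 + 2 * m2 + 1)) * qb 1 p)"
proof -
  have eq: "(real_of_int m1 + 1/3) + 2 * (real_of_int m2 + (of_int 1 / 2 + 1/6)) = of_int (m1 + 2 * m2 + 1) + 2/3" for m1 m2 by simp
  have k: "complex_of_real (sgn (real_of_int m1 + 1/3) * sgn ((real_of_int m1 + 1/3) + 2 * (real_of_int m2 + (of_int 1 / 2 + 1/6)))) = sg m1 * sg (m1 + 2 * m2 + 1)" for m1 m2
    unfolding eq of_real_mult by (simp add: sg_real del: of_int_add of_int_mult)
  show "Lambda 1 0 \<tau> = (\<Sum>\<^sub>\<infinity>p. (case p of (m1, m2) \<Rightarrow> (-1) powi m1 * (sg m1 * sg (m1 + 2 * m2 + 1))) * qb 1 p)"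
    unfolding Lambda_def Let_def k by (rule infsum_cong) (simp add: qb_def split: prod.splits)
  show "Lambda 1 1 \<tau> = (\<Sum>\<^sub>\<infinity>p. (case p of (m1, m2) \<Rightarrow> sg m1 * sg (m1 + 2 * m2 + 1)) * qb 1 p)"
    unfolding Lambda_def Let_def k by (rule infsum_cong) (simp add: qb_def minus_one_powi_cases split: prod.splits)
qed

lemma main0_eq: "main0 = 9/2 * e (- 5/12) * Phi1 \<tau> + AA * e (- 5/12) * Lambda 0 1 \<tau>"
proof -
  define a where "a p = (case p of (m1, m2) \<Rightarrow> let n1 = of_int m1 + 1/3 :: real; n2 = of_int m2 + 1/6 :: real in
     (-1) powi m1 * of_real ((sgn n2 + sgn (n1 + n2)) * sgn n1) *
     (of_real ((n1 + 2 * n2)\<^sup>2) - E2 \<tau> / 18) * qpow (Q_B n1 n2) \<tau>)" for p :: "int \<times> int"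
  define l where "l p = (case p of (m1, m2) \<Rightarrow> sg m1 * sg (m1 + 2 * m2)) * qb 0 p" for p
  define o' where "o' p = (case p of (m1, m2) \<Rightarrow> sg m1 * sg (m1 + 2 * m2) * (sg m2 * sg (m1 + m2))) * qb 0 p" for p
  have split: "(case p of (m1, m2) \<Rightarrow> 2 * sg m1 * (sg m2 + sg (m1 + m2))) * XX 0 w0 p
     = 9/2 * e (- 5/12) * a p + AA * e (- 5/12) * (l p + o' p)" for p
  proof -
    obtain m1 m2 where p: "p = (m1, m2)" by (cases p)
    define s where "s = sg m1 * (sg m2 + sg (m1 + m2))"
    define P where "P = ((-1) powi m1 :: complex)"
    have PP: "P * P = 1" by (simp add: P_def minus_one_powi_cases)
    have Nn: "real_of_int (NN 0 m1 m2) = 3 * ((of_int m1 + 1/3) + 2 * (of_int m2 + 1/6))" by (simp add: NN_def)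
    define y where "y = (real_of_int m1 + 1/3) + 2 * (of_int m2 + 1/6)"
    have par: "(-1) powi NN 0 m1 m2 = P" by (simp add: P_def NN_def minus_one_powi_cases)
    have "complex_of_int (NN 0 m1 m2) = of_real (real_of_int (NN 0 m1 m2))" by simp
    then have Nc: "complex_of_int (NN 0 m1 m2) = 3 * of_real y" unfolding Nn y_def[symmetric] by simp
    have w: "w0 (NN 0 m1 m2) = 9/4 * (of_real (y\<^sup>2) - EE / 18) + P * (AA / 2)"
      unfolding w0_def par Nc by (simp add: power2_eq_square field_simps)
    have n12: "(real_of_int m1 + 1/3) + (real_of_int m2 + 1/6) = of_int (m1 + m2) + 1/2" by simp
    have "a p = P * s * (of_real (y\<^sup>2) - EE / 18) * qb 0 p"
      unfolding a_def p prod.case Let_def y_def[symmetric] n12 of_real_mult of_real_add qb_def E2_eq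
      by (simp add: sg_real P_def s_def del: of_int_add)
    moreover have "l p + o' p = s * qb 0 p"
      unfolding l_def o'_def p prod.case s_def sg_identity0 by (simp add: algebra_simps)
    moreover have "(case p of (m1, m2) \<Rightarrow> 2 * sg m1 * (sg m2 + sg (m1 + m2))) * XX 0 w0 p
      = 2 * s * (e (- 5/12) * (P * (qb 0 p * (9/4 * (of_real (y\<^sup>2) - EE / 18) + P * (AA / 2)))))"
      unfolding p prod.case XX_qb w s_def P_def by (simp only: mult.assoc)
    moreover have "2 * s * (e (- 5/12) * (P * (qb 0 p * (9/4 * (of_real (y\<^sup>2) - EE / 18) + P * (AA / 2)))))
      = 9/2 * e (- 5/12) * (P * s * (of_real (y\<^sup>2) - EE / 18) * qb 0 p) + AA * e (- 5/12) * (s * qb 0 p) * (P * P)"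
      by (simp add: algebra_simps)
    ultimately show ?thesis unfolding PP by simp
  qed
  have ls: "(l has_sum Lambda 0 1 \<tau>) UNIV"
    unfolding Lambda_01 l_def by (rule has_sum_infsum[OF qb_summable[where K=1]]) (use norm_sg_mult in \<open>auto split: prod.splits\<close>)
  have "(o' has_sum infsum o' UNIV) UNIV"
    unfolding o'_def by (rule has_sum_infsum[OF qb_summable[where K=1]]) (use norm_sg_mult in \<open>auto split: prod.splits\<close>)
  \<comment> \<open>The involution sends n1 to - (n1 + 2 n2) and n1 + 2 n2 to - n1, and Q_B = 3/4
    (n1^2 + (n1 + 2 n2)^2).\<close>
  moreover have "infsum o' UNIV = 0"
  proof (rule infsum_odd[where \<phi>="\<lambda>(m1, m2). (- m1 - 2 * m2 - 1, m2)"])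
    show "o' ((\<lambda>(m1, m2). (- m1 - 2 * m2 - 1, m2)) p) = - o' p" for p
    proof -
      obtain m1 m2 where p: "p = (m1, m2)" by (cases p)
      have 1: "sg (- m1 - 2 * m2 - 1) = - sg (m1 + 2 * m2)" "sg (- m1 - 2 * m2 - 1 + 2 * m2) = - sg m1" "sg (- m1 - 2 * m2 - 1 + m2) = - sg (m1 + m2)"
        by (auto simp: sg_def)
      have 2: "qb 0 (- m1 - 2 * m2 - 1, m2) = qb 0 (m1, m2)"
        unfolding qb_def prod.case by (rule arg_cong[where f=e]) (simp add: Q_B_def power2_eq_square field_simps)
      show ?thesis unfolding p o'_def prod.case 1 2 by simp
    qed
  qed auto
  ultimately have os: "(o' has_sum 0) UNIV" by simp
  have XXs: "((\<lambda>p. (case p of (m1, m2) \<Rightarrow> 2 * sg m1 * (sg m2 + sg (m1 + m2))) * XX 0 w0 p) has_sum main0) UNIV"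
    unfolding main0_def
  proof (rule has_sum_infsum, rule summable_on_bounded_mult[OF XX0_summable, of _ 4])
    show "norm (case p of (m1, m2) \<Rightarrow> 2 * sg m1 * (sg m2 + sg (m1 + m2))) \<le> 4" for p
      using norm_triangle_ineq[of "sg (snd p)" "sg (fst p + snd p)"] by (cases p) (simp add: norm_mult)
  qed
  \<comment> \<open>The sum of the \<open>Phi1\<close> terms is obtained by subtracting two sums
    already known to converge.\<close>
  have "((\<lambda>p. (case p of (m1, m2) \<Rightarrow> 2 * sg m1 * (sg m2 + sg (m1 + m2))) * XX 0 w0 p + - (AA * e (- 5/12)) * (l p + o' p))
     has_sum main0 + - (AA * e (- 5/12)) * (Lambda 0 1 \<tau> + 0)) UNIV"
    by (intro has_sum_add has_sum_cmult_right XXs ls os)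
  then have "((\<lambda>p. 9/2 * e (- 5/12) * a p) has_sum main0 - AA * e (- 5/12) * Lambda 0 1 \<tau>) UNIV"
    unfolding split by simp
  from infsumI[OF this] have "9/2 * e (- 5/12) * Phi1 \<tau> = main0 - AA * e (- 5/12) * Lambda 0 1 \<tau>"
    unfolding infsum_cmult_right' Phi1_def a_def .
  then show ?thesis by (simp only: eq_diff_eq)
qed

lemma main1_eq: "main1 = - e (- 1/6) * (B' * Lambda 1 0 \<tau> + C' * Lambda 1 1 \<tau>)"
proof -
  define l where "l p = (case p of (m1, m2) \<Rightarrow> (-1) powi m1 * (sg m1 * sg (m1 + 2 * m2 + 1))) * qb 1 p" for p
  define l' where "l' p = (case p of (m1, m2) \<Rightarrow> sg m1 * sg (m1 + 2 * m2 + 1)) * qb 1 p" for p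
  define o' where "o' p = (case p of (m1, m2) \<Rightarrow> (-1) powi m1 * (sg m1 * sg (m1 + 2 * m2 + 1) * (sgc (m1 + m2 + 1) * sg m2))) * qb 1 p" for p
  define o'' where "o'' p = (case p of (m1, m2) \<Rightarrow> sg m1 * sg (m1 + 2 * m2 + 1) * (sgc (m1 + m2 + 1) * sg m2)) * qb 1 p" for p
  have split: "(case p of (m1, m2) \<Rightarrow> 2 * sg m1 * (sgc (m1 + m2 + 1) + sg m2)) * XX 1 w1 p
     = - e (- 1/6) * (B' * (l p + o' p) + C' * (l' p + o'' p))" for p
  proof -
    obtain m1 m2 where p: "p = (m1, m2)" by (cases p)
    define s where "s = sg m1 * (sgc (m1 + m2 + 1) + sg m2)"
    define P where "P = ((-1) powi m1 :: complex)"
    have PP: "P * P = 1" by (simp add: P_def minus_one_powi_cases)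
    have par: "(-1) powi NN 1 m1 m2 = - P" by (simp add: P_def NN_def minus_one_powi_cases)
    have w: "w1 (NN 1 m1 m2) = - e (1/4) * (B' + P * C') / 2" unfolding w1_def par by simp
    have e6: "e (- 5/12) * e (1/4) = e (- 1/6)" by (simp flip: qpow_add)
    have "(case p of (m1, m2) \<Rightarrow> 2 * sg m1 * (sgc (m1 + m2 + 1) + sg m2)) * XX 1 w1 p
      = 2 * s * (e (- 5/12) * (P * (qb 1 p * (- e (1/4) * (B' + P * C') / 2))))"
      unfolding p prod.case XX_qb w s_def P_def by (simp only: mult.assoc)
    also have "\<dots> = - (e (- 5/12) * e (1/4)) * (B' * (P * s * qb 1 p) + C' * ((P * P) * s * qb 1 p))"
      by (simp add: algebra_simps add_divide_distrib diff_divide_distrib)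
    also have "P * s * qb 1 p = l p + o' p"
      unfolding l_def o'_def p prod.case s_def sg_identity1 P_def by (simp add: algebra_simps)
    also have "(P * P) * s * qb 1 p = l' p + o'' p"
      unfolding PP l'_def o''_def p prod.case s_def sg_identity1 by (simp add: algebra_simps)
    finally show ?thesis unfolding e6 .
  qed
  have nm: "norm ((-1) powi m * x :: complex) = norm x" for m x by (simp add: norm_mult norm_power_int)
  have ls: "(l has_sum Lambda 1 0 \<tau>) UNIV" "(l' has_sum Lambda 1 1 \<tau>) UNIV"
    unfolding Lambda_1x l_def l'_def
    by (rule has_sum_infsum[OF qb_summable[where K=1]]; use norm_sg_mult in \<open>auto simp: nm split: prod.splits\<close>)+
  have sm: "(o' has_sum infsum o' UNIV) UNIV" "(o'' has_sum infsum o'' UNIV) UNIV"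
    unfolding o'_def o''_def by (rule has_sum_infsum[OF qb_summable[where K=1]]; use norm_sg_mult in \<open>auto simp: nm split: prod.splits\<close>)+
  \<comment> \<open>The involution used for \<open>main0\<close>, in terms of n1 and n1 + 2 n2; for
    h = 1 the half-integral shift of n2 turns the integer constant into - 2.\<close>
  have odd: "o' ((\<lambda>(m1, m2). (- m1 - 2 * m2 - 2, m2)) p) = - o' p" "o'' ((\<lambda>(m1, m2). (- m1 - 2 * m2 - 2, m2)) p) = - o'' p" for p
  proof -
    obtain m1 m2 where p: "p = (m1, m2)" by (cases p)
    have 1: "sg (- m1 - 2 * m2 - 2) = - sg (m1 + 2 * m2 + 1)" "sg (- m1 - 2 * m2 - 2 + 2 * m2 + 1) = - sg m1" "sgc (- m1 - 2 * m2 - 2 + m2 + 1) = - sgc (m1 + m2 + 1)"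
      by (auto simp: sg_def sgn_if)
    have 2: "qb 1 (- m1 - 2 * m2 - 2, m2) = qb 1 (m1, m2)"
      unfolding qb_def prod.case by (rule arg_cong[where f=e]) (simp add: Q_B_def power2_eq_square field_simps)
    have 3: "(-1) powi (- m1 - 2 * m2 - 2) = ((-1) powi m1 :: complex)" by (simp add: minus_one_powi_cases)
    show "o' ((\<lambda>(m1, m2). (- m1 - 2 * m2 - 2, m2)) p) = - o' p" "o'' ((\<lambda>(m1, m2). (- m1 - 2 * m2 - 2, m2)) p) = - o'' p"
      unfolding p o'_def o''_def prod.case 1 2 3 by simp_all
  qed
  have "infsum o' UNIV = 0"
    by (rule infsum_odd[where \<phi>="\<lambda>(m1, m2). (- m1 - 2 * m2 - 2, m2)" and F=o', OF _ odd(1)]) auto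
  moreover have "infsum o'' UNIV = 0"
    by (rule infsum_odd[where \<phi>="\<lambda>(m1, m2). (- m1 - 2 * m2 - 2, m2)" and F=o'', OF _ odd(2)]) auto
  ultimately have os: "(o' has_sum 0) UNIV" "(o'' has_sum 0) UNIV" using sm by simp_all
  have "((\<lambda>p. - e (- 1/6) * (B' * (l p + o' p) + C' * (l' p + o'' p))) has_sum - e (- 1/6) * (B' * (Lambda 1 0 \<tau> + 0) + C' * (Lambda 1 1 \<tau> + 0))) UNIV"
    by (intro has_sum_add has_sum_cmult_right ls os)
  from infsumI[OF this] show ?thesis unfolding main1_def split by simp
qed

text \<open>With x = n1 + n2 the form splits as 3/2 x^2 + 3/2 n2^2, and n1 (n1 + 2 n2) = x^2 - n2^2,
  so the double sum separates into products.\<close>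

lemma Phi2_term:
  fixes m1 m2 :: int
  defines "n1 \<equiv> of_int m1 + 1/3 :: real" and "n2 \<equiv> of_int m2 + 1/6 :: real"
  shows "(-1) powi m1 * of_real (sgn (n1 + n2) * sgn n2 * n1 * (n1 + 2 * n2)) * e (Q_B n1 n2)
    = gs (3/2) (1/2) s0 2 (m1 + m2) * gs (3/2) (1/6) s0 0 m2 - gs (3/2) (1/2) s0 0 (m1 + m2) * gs (3/2) (1/6) s0 2 m2"
proof -
  define x where "x = real_of_int (m1 + m2) + 1/2"
  have n1: "n1 = x - n2" by (simp add: x_def n1_def n2_def)
  have Q: "Q_B (x - n2) n2 = 3/2 * x\<^sup>2 + 3/2 * n2\<^sup>2" by (simp add: Q_B_def power2_eq_square field_simps)
  have X: "complex_of_real x = of_int (m1 + m2) + of_real (1/2)" "complex_of_real n2 = of_int m2 + of_real (1/6)"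
    by (simp_all add: x_def n2_def)
  have par: "(-1) powi (m1 + m2) * (-1) powi m2 = ((-1) powi m1 :: complex)" by (auto simp: minus_one_powi_cases)
  have sx: "complex_of_real (sgn x) = sg (m1 + m2)" "complex_of_real (sgn n2) = sg m2"
    unfolding x_def n2_def by (rule sg_real; simp)+
  have "(-1) powi m1 * of_real (sgn (n1 + n2) * sgn n2 * n1 * (n1 + 2 * n2)) * e (Q_B n1 n2)
    = (-1) powi m1 * of_real (sgn x * sgn n2 * (x - n2) * (x + n2)) * (e (3/2 * x\<^sup>2) * e (3/2 * n2\<^sup>2))"
    unfolding n1 Q qpow_add by simp
  also have "\<dots> = ((-1) powi (m1 + m2) * (-1) powi m2) * (sg (m1 + m2) * sg m2 * ((of_real x)\<^sup>2 - (of_real n2)\<^sup>2)) * (e (3/2 * x\<^sup>2) * e (3/2 * n2\<^sup>2))"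
    unfolding par of_real_mult sx by (simp add: power2_eq_square algebra_simps)
  also have "\<dots> = gs (3/2) (1/2) s0 2 (m1 + m2) * gs (3/2) (1/6) s0 0 m2 - gs (3/2) (1/2) s0 0 (m1 + m2) * gs (3/2) (1/6) s0 2 m2"
    unfolding gs_def s0_def X[symmetric] x_def[symmetric] n2_def[symmetric] power_0 by (simp add: algebra_simps)
  finally show ?thesis .
qed

lemma Phi2_eq: "Phi2 \<tau> = G (3/2) (1/6) s0 0 * G (3/2) (1/2) s0 2 - G (3/2) (1/2) s0 0 * G (3/2) (1/6) s0 2"
proof -
  define f where "f p = (case p of (k, l) \<Rightarrow> gs (3/2) (1/2) s0 2 k * gs (3/2) (1/6) s0 0 l) + - (case p of (k, l) \<Rightarrow> gs (3/2) (1/2) s0 0 k * gs (3/2) (1/6) s0 2 l)" for p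
  have "(f has_sum G (3/2) (1/2) s0 2 * G (3/2) (1/6) s0 0 + - (G (3/2) (1/2) s0 0 * G (3/2) (1/6) s0 2)) (UNIV \<times> UNIV)"
    unfolding f_def by (intro has_sum_add has_sum_uminusI has_sum_product gsa gsb)
  then have fs: "infsum f UNIV = G (3/2) (1/2) s0 2 * G (3/2) (1/6) s0 0 - G (3/2) (1/2) s0 0 * G (3/2) (1/6) s0 2"
    by (simp add: infsumI)
  have "Phi2 \<tau> = (\<Sum>\<^sub>\<infinity>p. f (case p of (m1, m2) \<Rightarrow> (m1 + m2, m2)))"
    unfolding Phi2_def by (rule infsum_cong) (auto simp only: f_def Phi2_term Let_def diff_conv_add_uminus split: prod.splits)
  also have "\<dots> = infsum f UNIV"
    by (rule infsum_reindex_bij_witness[of _ "\<lambda>(k, l). (k - l, l)" "\<lambda>(m1, m2). (m1 + m2, m2)"]) auto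
  finally show ?thesis unfolding fs by (simp add: mult.commute)
qed

lemma ct_formula:
  "cF 0 0 = qpow (1/3) \<tau> / eta \<tau> ^ 8 * F0 \<tau>
              + 9 * qpow (-1/12) \<tau> / (2 * eta \<tau> ^ 8) * Phi \<tau>
              + qpow (-1/12) \<tau> / eta \<tau> ^ 2 *
                  (Lambda 0 1 \<tau> / theta (1/2) \<tau> ^ 2
                   + qpow (-1/4) \<tau> * Lambda 1 0 \<tau> / theta (\<tau>/2) \<tau> ^ 2
                   - qpow (-1/4) \<tau> * Lambda 1 1 \<tau> / theta ((\<tau> + 1)/2) \<tau> ^ 2)"
proof -
  have E0: "E \<noteq> 0" by (rule E_nonzero)
  have eta6: "eta \<tau> ^ 6 = e (1/4) * E ^ 6" and eta8: "eta \<tau> ^ 8 = e (1/3) * E ^ 8" and eta2: "eta \<tau> ^ 2 = e (1/12) * E ^ 2"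
    unfolding eta_eq power_mult_distrib qpow_power by simp_all
  have E6: "E ^ 6 = E ^ 4 * E ^ 2" "E ^ 8 = E ^ 4 * E ^ 2 * E ^ 2" by (simp_all flip: power_add)
  have T1: "T (-1) \<noteq> 0" by (rule T_nonzero) (use q0 q1 in \<open>auto simp: annulus_def field_simps\<close>)
  have frac: "a * (y * x) / (b * x * t) = a / b * (y / t)" if "x \<noteq> 0" for a b x y t :: complex
    using that by simp
  have A: "eta \<tau> ^ 6 / theta (1/2) \<tau> ^ 2 = AA"
    unfolding eta6 theta_half_sq AA_def E6(1) using E0 by (subst frac) simp_all
  have e12: "e (1/4) / e (- 1/4) = e (1/2)" unfolding qpow_diff[symmetric] by simp
  have B: "eta \<tau> ^ 6 / theta (\<tau>/2) \<tau> ^ 2 = - e (1/2) * B'"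
    unfolding eta6 theta_tau_sq B'_def E6(1) e12[symmetric] using E0 by (subst frac) simp_all
  have C: "eta \<tau> ^ 6 / theta ((\<tau> + 1)/2) \<tau> ^ 2 = e (1/2) * C'"
    unfolding eta6 theta_tau1_sq C'_def E6(1) e12[symmetric] using E0 by (subst frac) simp_all
  have F0: "F0 \<tau> = (EE + 2) / 4 + AA + e (- 1/24) * (6 * serre_D (1/2) (omega 1) \<tau>) - e (- 3/8) * (6 * serre_D (1/2) (omega 0) \<tau>)
     + e (- 1/12) * (6 * serre_D (1/2) (phi 1) \<tau> + (- AA + e (- 1/2) * (- e (1/2) * B') - e (- 1/2) * (e (1/2) * C')) * phi 1 \<tau>)
     - e (- 1/3) * (6 * serre_D (1/2) (phi 2) \<tau> + (AA + - e (1/2) * B' + e (1/2) * C') * phi 2 \<tau>)"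
    unfolding F0_def Let_def A B C E2_eq by (simp only: mult_ac)
  have eh: "e (- 1/2) * (- e (1/2) * B') = - B'" "e (- 1/2) * (e (1/2) * C') = C'"
    by (simp_all add: mult.assoc[symmetric] flip: qpow_add)
  have sD: "6 * serre_D (1/2) (omega 1) \<tau> = 9 * G (3/2) (1/6) s0 2 - EE / 4 * G (3/2) (1/6) s0 0"
    "6 * serre_D (1/2) (omega 0) \<tau> = 9 * G (3/2) (1/2) s0 2 - EE / 4 * G (3/2) (1/2) s0 0"
    "6 * serre_D (1/2) (phi 1) \<tau> = 18 * G 3 (1/6) sg 2 - EE / 4 * G 3 (1/6) sg 0"
    "6 * serre_D (1/2) (phi 2) \<tau> = 18 * G 3 (1/3) sg 2 - EE / 4 * G 3 (1/3) sg 0"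
    unfolding omega_1_eq omega_0_eq phi_1_eq phi_2_eq by (subst serre_GF; simp add: norm_s0)+
  have ph: "phi 1 \<tau> = G 3 (1/6) sg 0" "phi 2 \<tau> = G 3 (1/3) sg 0"
    unfolding phi_1_eq phi_2_eq GF_eq by simp_all
  \<comment> \<open>5/12 is also 1/3 + 1/12, the exponent that remains when q^(-1/12) is divided by
    the q^(1/3) in eta^8.\<close>
  have pr: "e (- 1/24) * e (- 3/8) = e (- 5/12)" by (simp flip: qpow_add)
  have fin: "E ^ 8 * cF 0 0 = F0 \<tau> + 9/2 * e (- 5/12) * Phi \<tau> + AA * e (- 5/12) * Lambda 0 1 \<tau> - e (- 1/6) * (B' * Lambda 1 0 \<tau> + C' * Lambda 1 1 \<tau>)"
    unfolding cF_explicit main0_eq main1_eq F0 sD ph eh Phi_def Phi2_eq pr[symmetric] by (simp add: algebra_simps)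
  have i1: "1 / theta (1/2) \<tau> ^ 2 = AA / eta \<tau> ^ 6" "1 / theta (\<tau>/2) \<tau> ^ 2 = - e (1/2) * B' / eta \<tau> ^ 6"
    "1 / theta ((\<tau> + 1)/2) \<tau> ^ 2 = e (1/2) * C' / eta \<tau> ^ 6"
    unfolding A[symmetric] B[symmetric] C[symmetric] using E0 by (simp_all add: eta6)
  have g1: "e (1/3) / eta \<tau> ^ 8 = 1 / E ^ 8" "9 * e (-1/12) / (2 * eta \<tau> ^ 8) = 9/2 * e (- 5/12) / E ^ 8"
  proof -
    show "e (1/3) / eta \<tau> ^ 8 = 1 / E ^ 8" unfolding eta8 by simp
    have "e (-1/12) / e (1/3) = e (- 5/12)" unfolding qpow_diff[symmetric] by simp
    then show "9 * e (-1/12) / (2 * eta \<tau> ^ 8) = 9/2 * e (- 5/12) / E ^ 8" unfolding eta8 by (simp add: field_simps)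
  qed
  have g2: "e (-1/12) / eta \<tau> ^ 2 / eta \<tau> ^ 6 = e (- 5/12) / E ^ 8"
  proof -
    have "eta \<tau> ^ 2 * eta \<tau> ^ 6 = e (1/3) * E ^ 8" unfolding eta8[symmetric] by (simp flip: power_add)
    moreover have "e (-1/12) / e (1/3) = e (- 5/12)" unfolding qpow_diff[symmetric] by simp
    ultimately show ?thesis by (simp add: field_simps)
  qed
  have collect: "c * (L0 * (A / t) + x * L1 * (- h * B / t) - x * L2 * (h * C / t)) = c / t * (A * L0 - x * h * (B * L1 + C * L2))"
    for c L0 L1 L2 x h A B C t :: complex
    by (simp add: divide_inverse algebra_simps)
  have collect': "k * (A * L0 - y * h * (B * L1 + C * L2)) = (A * a * L0 - a * (y * h) * (B * L1 + C * L2)) / b" if "k = a / b"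
    for k a b y L0 L1 L2 h A B C :: complex
    unfolding that by (simp add: divide_inverse algebra_simps)
  have g3: "e (- 5/12) * (e (- 1/4) * e (1/2)) = e (- 1/6)" by (simp flip: qpow_add)
  have "e (-1/12) / eta \<tau> ^ 2 * (Lambda 0 1 \<tau> / theta (1/2) \<tau> ^ 2 + e (-1/4) * Lambda 1 0 \<tau> / theta (\<tau>/2) \<tau> ^ 2 - e (-1/4) * Lambda 1 1 \<tau> / theta ((\<tau> + 1)/2) \<tau> ^ 2)
    = e (-1/12) / eta \<tau> ^ 2 * (Lambda 0 1 \<tau> * (1 / theta (1/2) \<tau> ^ 2) + e (-1/4) * Lambda 1 0 \<tau> * (1 / theta (\<tau>/2) \<tau> ^ 2) - e (-1/4) * Lambda 1 1 \<tau> * (1 / theta ((\<tau> + 1)/2) \<tau> ^ 2))"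
    by simp
  also have "\<dots> = (e (-1/12) / eta \<tau> ^ 2 / eta \<tau> ^ 6) * (AA * Lambda 0 1 \<tau> - e (- 1/4) * e (1/2) * (B' * Lambda 1 0 \<tau> + C' * Lambda 1 1 \<tau>))"
    unfolding i1 by (rule collect)
  also have "\<dots> = (AA * e (- 5/12) * Lambda 0 1 \<tau> - (e (- 5/12) * (e (- 1/4) * e (1/2))) * (B' * Lambda 1 0 \<tau> + C' * Lambda 1 1 \<tau>)) / E ^ 8"
    by (rule collect'[OF g2])
  finally have L: "e (-1/12) / eta \<tau> ^ 2 * (Lambda 0 1 \<tau> / theta (1/2) \<tau> ^ 2 + e (-1/4) * Lambda 1 0 \<tau> / theta (\<tau>/2) \<tau> ^ 2 - e (-1/4) * Lambda 1 1 \<tau> / theta ((\<tau> + 1)/2) \<tau> ^ 2)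
    = (AA * e (- 5/12) * Lambda 0 1 \<tau> - e (- 1/6) * (B' * Lambda 1 0 \<tau> + C' * Lambda 1 1 \<tau>)) / E ^ 8"
    unfolding g3 .
  have "cF 0 0 = (E ^ 8 * cF 0 0) / E ^ 8" using E0 by simp
  then show ?thesis unfolding L g1 fin by (simp add: add_divide_distrib diff_divide_distrib)
qed

section \<open>From the variables u, v back to \<open>\<zeta>1\<close> and
  \<open>\<zeta>2\<close>\<close>

lemma F_B2_eq:
  assumes "(\<zeta>1, \<zeta>2) \<in> range_B2 \<tau>"
  shows "F_B2 \<tau> (\<zeta>1, \<zeta>2) = W (\<zeta>1 * \<zeta>2) * W \<zeta>1 * (W (\<zeta>1 * \<zeta>2 * \<zeta>1) * W (\<zeta>1 * \<zeta>2 / \<zeta>1))"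
proof -
  have "\<zeta>1 \<noteq> 0" using assms by (auto simp: range_B2_def)
  moreover have "\<zeta>1 powi (-2) * \<zeta>2 powi (-1) * nome \<tau> = nome \<tau> / (\<zeta>1 * \<zeta>2 * \<zeta>1)"
    by (simp add: power_int_minus divide_inverse power2_eq_square mult_ac)
  moreover have "\<zeta>1 powi (-1) * \<zeta>2 powi (-1) * nome \<tau> = nome \<tau> / (\<zeta>1 * \<zeta>2)" "x powi (-1) * nome \<tau> = nome \<tau> / x" for x
    by (simp_all add: power_int_minus divide_inverse mult_ac)
  moreover have "\<zeta>1 ^ 2 * \<zeta>2 * nome \<tau> = \<zeta>1 * \<zeta>2 * \<zeta>1 * nome \<tau>" by (simp add: power2_eq_square)
  ultimately show ?thesis unfolding F_B2_def Let_def prod.case qpoch_inf_list_def W_def by (simp only:) simp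
qed

text \<open>With u = \<open>\<zeta>1 * \<zeta>2\<close> and v = \<open>\<zeta>1\<close>, the
  monomial u^j v^(i - j) has exponent i in \<open>\<zeta>1\<close> and j in
  \<open>\<zeta>2\<close>.\<close>

lemma laurent_F_B2: "is_laurent_expansion (F_B2 \<tau>) (range_B2 \<tau>) (\<lambda>i j. cF j (i - j))"
  unfolding is_laurent_expansion_def
proof (clarify)
  fix \<zeta>1 \<zeta>2 assume r: "(\<zeta>1, \<zeta>2) \<in> range_B2 \<tau>"
  have z0: "\<zeta>1 \<noteq> 0" using r by (auto simp: range_B2_def)
  \<comment> \<open>The range restricts the square of \<open>\<zeta>1\<close>; as its norm is below
    1, the norm of \<open>\<zeta>1\<close> is at least that of the square.\<close>
  have n1: "norm (nome \<tau>) < norm \<zeta>1" "norm \<zeta>1 < 1"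
  proof -
    have s: "norm (nome \<tau>) < norm \<zeta>1 ^ 2" "norm \<zeta>1 ^ 2 < 1" using r by (auto simp: range_B2_def norm_power)
    show 1: "norm \<zeta>1 < 1" using s(2) by (simp add: power_less_one_iff)
    have "norm \<zeta>1 ^ 2 \<le> norm \<zeta>1" using 1 mult_left_mono[of "norm \<zeta>1" 1 "norm \<zeta>1"] by (simp add: power2_eq_square)
    then show "norm (nome \<tau>) < norm \<zeta>1" using s by simp
  qed
  have q': "1 < 1 / norm (nome \<tau>)" using q0 q1 by simp
  have in_ann: "x \<in> annulus" if "norm (nome \<tau>) < norm x" "norm x < 1" for x
    using that less_trans[OF that(2) q'] unfolding annulus_def by blast
  define h where "h p = (case p of (m, n) \<Rightarrow> cF m n * (\<zeta>1 * \<zeta>2) powi m * \<zeta>1 powi n)" for p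
  have "((\<lambda>(m, n). cF m n * (\<zeta>1 * \<zeta>2) powi m * \<zeta>1 powi n) has_sum W (\<zeta>1 * \<zeta>2) * W \<zeta>1 * (W (\<zeta>1 * \<zeta>2 * \<zeta>1) * W (\<zeta>1 * \<zeta>2 / \<zeta>1))) UNIV"
    by (rule has_sum_cF; rule in_ann) (use r n1 z0 in \<open>auto simp: range_B2_def power2_eq_square mult_ac\<close>)
  then have "(h has_sum F_B2 \<tau> (\<zeta>1, \<zeta>2)) UNIV"
    unfolding F_B2_eq[OF r] h_def .
  moreover have "bij (\<lambda>(m :: int, n :: int). (n, m - n))"
    by (rule o_bij[where g="\<lambda>(m, n). (m + n, m)"]) (auto simp: fun_eq_iff)
  ultimately have "((\<lambda>p. h (case p of (m, n) \<Rightarrow> (n, m - n))) has_sum F_B2 \<tau> (\<zeta>1, \<zeta>2)) UNIV"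
    by (subst has_sum_reindex_bij_betw)
  also have "(\<lambda>p. h (case p of (m, n) \<Rightarrow> (n, m - n))) = (\<lambda>(m, n). cF n (m - n) * \<zeta>1 powi m * \<zeta>2 powi n)"
    using z0 by (auto simp: h_def fun_eq_iff power_int_mult_distrib power_int_diff)
  finally show "((\<lambda>(m, n). cF n (m - n) * \<zeta>1 powi m * \<zeta>2 powi n) has_sum F_B2 \<tau> (\<zeta>1, \<zeta>2)) UNIV" .
qed

text \<open>The torus of \<open>has_laurent2_F\<close> lies inside the range, and coefficients are
  determined there.\<close>

lemma laurent_F_B2_unique:
  assumes "is_laurent_expansion (F_B2 \<tau>) (range_B2 \<tau>) c"
  shows "c = (\<lambda>i j. cF j (i - j))"
proof -
  have "has_laurent2 (\<lambda>u v. W u * W v * (W (u * v) * W (u / v))) r0 \<rho>0 (\<lambda>m n. c (m + n) m)"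
    unfolding has_laurent2_def
  proof (intro allI impI)
    fix u v :: complex assume uv: "norm u = r0" "norm v = \<rho>0"
    have v0: "v \<noteq> 0" "u \<noteq> 0" using uv \<rho>0_pos r0_pos by auto
    note t = torus_in_annulus[OF uv, unfolded disc_annulus_def]
    have r0': "r0 < 1" "norm (nome \<tau>) < r0" using t(1) uv by auto
    have "norm (v\<^sup>2) = r0" by (simp only: norm_power uv power2_eq_square norm_mult \<rho>0_bounds)
    moreover have "v\<^sup>2 * (u / v) = u * v" "v * (u / v) = u" using v0 by (simp_all add: power2_eq_square)
    ultimately have r: "(v, u / v) \<in> range_B2 \<tau>"
      using t r0' uv by (auto simp: range_B2_def)
    define h where "h p = (case p of (m, n) \<Rightarrow> c m n * v powi m * (u / v) powi n)" for p
    have "(h has_sum F_B2 \<tau> (v, u / v)) UNIV"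
      using assms r by (auto simp: is_laurent_expansion_def h_def[abs_def])
    moreover have "F_B2 \<tau> (v, u / v) = W u * W v * (W (u * v) * W (u / v))"
      unfolding F_B2_eq[OF r] using v0 by (simp add: mult_ac)
    moreover have "bij (\<lambda>(m :: int, n :: int). (m + n, m))"
      by (rule o_bij[where g="\<lambda>(m, n). (n, m - n)"]) (auto simp: fun_eq_iff)
    ultimately have "((\<lambda>p. h (case p of (m, n) \<Rightarrow> (m + n, m))) has_sum W u * W v * (W (u * v) * W (u / v))) UNIV"
      by (subst has_sum_reindex_bij_betw) simp_all
    also have "(\<lambda>p. h (case p of (m, n) \<Rightarrow> (m + n, m))) = (\<lambda>(m, n). c (m + n) m * u powi m * v powi n)"
      using v0 by (auto simp: h_def fun_eq_iff power_int_divide_distrib power_int_add)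
    finally show "((\<lambda>(m, n). c (m + n) m * u powi m * v powi n) has_sum W u * W v * (W (u * v) * W (u / v))) UNIV" .
  qed
  from has_laurent2_unique[OF this has_laurent2_F r0_pos \<rho>0_pos]
  have "c (m + n) m = cF m n" for m n by (simp add: fun_eq_iff)
  from this[of j "i - j" for i j] show ?thesis by (simp add: fun_eq_iff)
qed

lemma constant_term_eq: "\<exists>!c. is_laurent_expansion (F_B2 \<tau>) (range_B2 \<tau>) c"
    "constant_term (F_B2 \<tau>) (range_B2 \<tau>) = cF 0 0"
proof -
  have u: "is_laurent_expansion (F_B2 \<tau>) (range_B2 \<tau>) c \<longleftrightarrow> c = (\<lambda>i j. cF j (i - j))" for c
    using laurent_F_B2 laurent_F_B2_unique by (metis (no_types, lifting))
  show "\<exists>!c. is_laurent_expansion (F_B2 \<tau>) (range_B2 \<tau>) c"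
    unfolding u by simp
  show "constant_term (F_B2 \<tau>) (range_B2 \<tau>) = cF 0 0" unfolding constant_term_def u by simp
qed

end

section \<open>Coefficient bounds\<close>

lemma norm_infsum_geometric:
  fixes f :: "int \<Rightarrow> complex"
  assumes f: "\<And>m. m \<ge> 0 \<Longrightarrow> norm (f m) \<le> K * r ^ nat m" and r: "0 \<le> r" "r < 1"
  shows "norm (infsum f {0..}) \<le> K / (1 - r)"
proof (cases "f summable_on {0..}")
  case True
  have K: "K \<ge> 0" using order_trans[OF norm_ge_zero f[of 0]] by simp
  have "((\<lambda>n. K * r ^ n) has_sum K * (1 / (1 - r))) UNIV"
    using r K by (intro sums_nonneg_imp_has_sum sums_mult geometric_sums) auto
  also have "?this \<longleftrightarrow> ((\<lambda>m. K * r ^ nat m) has_sum K * (1 / (1 - r))) {0..}"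
    by (rule has_sum_reindex_bij_witness[where i=nat and j=int]) auto
  finally have "norm (infsum f {0..}) \<le> K * (1 / (1 - r))"
    by (rule norm_infsum_le[OF has_sum_infsum[OF True]]) (use f in auto)
  then show ?thesis by simp
next
  case False
  then show ?thesis using order_trans[OF norm_ge_zero f[of 0]] r by (simp add: infsum_not_exists)
qed

context nome_sqrt
begin

text \<open>The terms 4^(- n) strengthen the induction: they pay for the factor between 1 - 4^(- n -
  1) and 1 + 4^(- n - 1) of the next step, which constant bounds could not.\<close>

lemma norm_qfac_bounds:
  assumes q: "norm q \<le> 1/4"
  shows "norm (qfac n) \<ge> 2/3 + (1/4) ^ n / 3" "norm (qfac n) \<le> 2 - (1/4) ^ n"
proof -
  have "norm (qfac n) \<ge> 2/3 + (1/4) ^ n / 3 \<and> norm (qfac n) \<le> 2 - (1/4) ^ n"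
  proof (induction n)
    case (Suc n)
    define t where "t = (1/4 :: real) ^ n"
    have t: "0 \<le> t" "t \<le> 1" by (auto simp: t_def power_le_one)
    then have tt: "t * t \<le> t" by (simp add: mult_left_le)
    have "norm (q ^ Suc n) \<le> (1/4) ^ Suc n" unfolding norm_power by (intro power_mono q) auto
    then have x: "norm (1 - q ^ Suc n) \<le> 1 + t/4" "norm (1 - q ^ Suc n) \<ge> 1 - t/4"
      using norm_triangle_ineq4[of 1 "q ^ Suc n"] norm_triangle_ineq2[of 1 "q ^ Suc n"] by (auto simp: t_def)
    have IH: "norm (qfac n) \<ge> 2/3 + t/3" "norm (qfac n) \<le> 2 - t" using Suc by (auto simp: t_def)
    have "(2/3 + t/3) * (1 - t/4) \<le> norm (qfac n) * norm (1 - q ^ Suc n)"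
      using t by (intro mult_mono IH x) auto
    moreover have "norm (qfac n) * norm (1 - q ^ Suc n) \<le> (2 - t) * (1 + t/4)"
      using t by (intro mult_mono IH x) auto
    moreover have "(2/3 + t/3) * (1 - t/4) \<ge> 2/3 + t/4/3" "(2 - t) * (1 + t/4) \<le> 2 - t/4"
      using t tt by (auto simp: algebra_simps)
    ultimately show ?case by (simp add: qfac_Suc norm_mult t_def)
  qed auto
  then show "norm (qfac n) \<ge> 2/3 + (1/4) ^ n / 3" "norm (qfac n) \<le> 2 - (1/4) ^ n" by auto
qed

lemma norm_inverse_qfac_le:
  assumes q: "norm q \<le> 1/4"
  shows "norm (1 / qfac n) \<le> 3/2"
proof -
  have "norm (qfac n) \<ge> 2/3" using norm_qfac_bounds(1)[OF q, of n] zero_le_power[of "1/4::real" n] by linarith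
  then have "1 / norm (qfac n) \<le> 1 / (2/3)" by (intro divide_left_mono mult_pos_pos) auto
  then show ?thesis by (simp add: norm_divide)
qed

lemma norm_E_le:
  assumes q: "norm q \<le> 1/4"
  shows "norm E \<le> 2"
proof (rule LIMSEQ_le_const2)
  show "(\<lambda>n. norm (qfac n)) \<longlonglongrightarrow> norm E"
    unfolding qfac_def E_def by (intro tendsto_intros qpoch_LIMSEQ)
  have "norm (qfac n) \<le> 2" for n using norm_qfac_bounds(2)[OF q, of n] zero_le_power[of "1/4::real" n] by linarith
  then show "\<exists>N. \<forall>n\<ge>N. norm (qfac n) \<le> 2" by blast
qed

text \<open>The quotient is 1 / P (q ^ Suc n), to which Euler's series applies; so E may be replaced
  by a finite product at this precision.\<close>

lemma qfac_div_E:
  assumes q: "norm q \<le> 1/4"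
  shows "norm (qfac n / E - 1) \<le> 2 * norm q ^ Suc n"
proof -
  define x where "x = q ^ Suc n"
  have x: "norm x \<le> 1/4"
    using q power_mono[of "norm q" "1/4" n] power_le_one[of "1/4::real" n]
      mult_mono[of "norm q" "1/4" "norm q ^ n" 1] by (simp add: x_def norm_mult norm_power power_le_one)
  have "((\<lambda>n. x ^ n / qfac n) has_sum (1 / P x)) UNIV" by (rule euler_inverse_qpoch) (use x in simp)
  then have "((\<lambda>n. x ^ n / qfac n) has_sum (1 / P x - 1)) (UNIV - {0})"
    by (rule has_sum_Diff) (use has_sum_finite[of "{0::nat}" "\<lambda>n. x ^ n / qfac n"] in auto)
  then have s: "((\<lambda>n. x ^ Suc n / qfac (Suc n)) has_sum (1 / P x - 1)) UNIV"
    by (subst has_sum_reindex_bij_witness[where i="\<lambda>n. n - 1" and j=Suc and T="UNIV - {0}" and h="\<lambda>n. x ^ n / qfac n" and s'="1 / P x - 1"]) auto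
  have "((\<lambda>n. 3/2 * norm x * norm x ^ n) has_sum 3/2 * norm x * (1 / (1 - norm x))) UNIV"
    using x by (intro sums_nonneg_imp_has_sum sums_mult geometric_sums) auto
  then have "norm (1 / P x - 1) \<le> 3/2 * norm x * (1 / (1 - norm x))"
  proof (rule norm_infsum_le[OF s])
    show "norm (x ^ Suc n / qfac (Suc n)) \<le> 3/2 * norm x * norm x ^ n" for n
      using mult_left_mono[OF norm_inverse_qfac_le[OF q, of "Suc n"], of "norm (x ^ Suc n)"]
      by (simp add: norm_divide norm_mult norm_power mult_ac)
  qed
  also have "\<dots> \<le> 3/2 * norm x * (4/3)"
    using x by (intro mult_left_mono) (auto simp: field_simps)
  also have "1 / P x = qfac n / E"
    using qpoch_qpower[of n] qfac_nonzero[of n] by (simp add: x_def flip: qpoch_qpower[of n])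
  finally show ?thesis by (simp add: x_def norm_mult norm_power)
qed

lemma norm_M_le:
  assumes q: "norm q \<le> 1/4"
  shows "norm (M a) \<le> 3 * norm q ^ nat \<bar>a\<bar>"
proof -
  have nonneg: "norm (M (- a)) \<le> 3 * norm q ^ nat a" if a: "a \<ge> 0" for a
  proof -
    have ec: "norm (ecoef i) \<le> 3/2 * norm q ^ nat i" for i
      using mult_left_mono[OF norm_inverse_qfac_le[OF q, of "nat i"], of "norm (q ^ nat i)"]
      by (auto simp: ecoef_def norm_divide norm_power mult_ac)
    have "M (- a) = (\<Sum>\<^sub>\<infinity>j. ecoef j * ecoef (a + j))"
      by (simp add: M_def conv_def algebra_simps)
    also have "\<dots> = (\<Sum>\<^sub>\<infinity>j\<in>{0..}. ecoef j * ecoef (a + j))"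
      by (rule infsum_cong_neutral) (auto simp: ecoef_def)
    also have "norm \<dots> \<le> (9/4 * norm q ^ nat a) / (1 - (norm q)\<^sup>2)"
    proof (rule norm_infsum_geometric)
      fix j :: int assume j: "j \<ge> 0"
      have "norm (ecoef j * ecoef (a + j)) \<le> (3/2 * norm q ^ nat j) * (3/2 * norm q ^ nat (a + j))"
        unfolding norm_mult by (intro mult_mono ec) auto
      also have "\<dots> = 9/4 * norm q ^ nat a * (norm q)\<^sup>2 ^ nat j"
        using a j by (simp add: nat_add_distrib power_add power2_eq_square power_mult_distrib)
      finally show "norm (ecoef j * ecoef (a + j)) \<le> 9/4 * norm q ^ nat a * (norm q)\<^sup>2 ^ nat j" .
    qed (use q1 in \<open>auto simp: power_less_one_iff\<close>)
    also have "\<dots> \<le> 9/4 * norm q ^ nat a * (4/3)"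
    proof -
      have "(norm q)\<^sup>2 \<le> 1/4" using mult_mono[OF q q] by (simp add: power2_eq_square)
      then have "1 / (1 - (norm q)\<^sup>2) \<le> 4/3" by (simp add: field_simps)
      from mult_left_mono[OF this, of "9/4 * norm q ^ nat a"] show ?thesis by simp
    qed
    finally show ?thesis by simp
  qed
  show ?thesis using nonneg[of a] nonneg[of "- a"] by (cases "a \<ge> 0") auto
qed

definition hseq :: "int \<Rightarrow> complex" where "hseq a = E\<^sup>2 * half (\<lambda>_. 1) M a"

lemma has_sum_M: "(M has_sum 1 / E\<^sup>2) UNIV"
  using has_laurentD(2)[OF has_laurent_W one_in_annulus] by (simp add: W_1)

text \<open>The residue of 1 / T at its simple pole z = 1, in the form of
  \<open>half_reflect\<close> with K = 1.\<close>

lemma hseq_reflect: "hseq a + hseq (1 - a) = 1"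
proof -
  have "half (\<lambda>_. 1) M a + half (\<lambda>_. 1) M (1 - a) = 1 / E\<^sup>2"
    by (rule half_reflect) (use has_sum_M in \<open>simp_all add: has_sum_shift_int[of M a]\<close>)
  then show ?thesis using E_nonzero by (simp add: hseq_def distrib_left[symmetric])
qed

text \<open>Up to E^2 and reversal of the index, \<open>hseq\<close> lists the coefficients of 1 /
  T, so T (q / z) = T z on |z| = |q|^(1/2) gives the shift.\<close>

lemma hseq_shift: "hseq a = q powi a * hseq (- a)"
proof -
  define r where "r = sqrt (norm q)"
  have r: "norm q < r" "r < 1" "0 < r" "r * r = norm q"
    using q0 q1 by (auto simp: r_def real_less_rsqrt power2_eq_square)
  have sub: "{z :: complex. norm z = r} \<subseteq> {z. norm q < norm z \<and> norm z < 1}" using r(1,2) by auto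
  note L = has_laurent_subset[OF has_laurent_inverse_T sub]
  have "norm (q / z) = r" if "norm z = r" for z :: complex
    using that r(3) by (simp add: norm_divide r(4)[symmetric])
  then have "has_laurent (\<lambda>z. 1 / T (q / z)) {z. norm z = r} (\<lambda>n. lseq (- n) * q powi (- n))"
    by (intro has_laurent_reflect[OF L q0]) auto
  then have "has_laurent (\<lambda>z. 1 / T z) {z. norm z = r} (\<lambda>n. lseq (- n) * q powi (- n))"
    by (rule has_laurent_cong) (use r(3) in \<open>auto simp: T_q_div\<close>)
  from fun_cong[OF has_laurent_unique[OF L this r(3)], of "- a"]
  show ?thesis by (simp add: lseq_def hseq_def mult_ac)
qed

lemma hseq_rec: "hseq (int a) = q ^ a * (1 - hseq (int (Suc a)))"
  using hseq_shift[of "int a"] hseq_reflect[of "- int a"] by (simp add: eq_diff_eq add.commute)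

lemma M_eq_hseq: "E\<^sup>2 * M a = hseq a - hseq (a + 1)"
proof -
  have s: "(\<lambda>m. M (a + m)) summable_on A" for A
    by (rule summable_on_subset_banach[of _ UNIV])
       (use has_sum_imp_summable[OF has_sum_M] in \<open>auto simp: has_sum_shift_int[of M a] summable_on_def\<close>)
  have "half (\<lambda>_. 1) M a = (\<Sum>\<^sub>\<infinity>m\<in>insert 0 {1..}. M (a + m))"
    unfolding half_def by (rule infsum_cong_neutral) auto
  also have "\<dots> = M a + (\<Sum>\<^sub>\<infinity>m\<in>{1..}. M (a + m))"
    by (subst infsum_insert) (auto intro: s)
  also have "(\<Sum>\<^sub>\<infinity>m\<in>{1..}. M (a + m)) = half (\<lambda>_. 1) M (a + 1)"
    unfolding half_def by (rule infsum_reindex_bij_witness[of _ "\<lambda>m. m + 1" "\<lambda>m. m - 1"]) (auto simp: algebra_simps)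
  finally show ?thesis by (simp add: hseq_def algebra_simps)
qed

lemma norm_hseq_le:
  assumes q: "norm q \<le> 1/4"
  shows "norm (hseq (int a)) \<le> 16 * norm q ^ a"
proof -
  have "norm (half (\<lambda>_. 1) M (int a)) \<le> (3 * norm q ^ a) / (1 - norm q)"
    unfolding half_def
  proof (rule norm_infsum_geometric)
    fix m :: int assume "m \<ge> 0"
    then show "norm (1 * M (int a + m)) \<le> 3 * norm q ^ a * norm q ^ nat m"
      using norm_M_le[OF q, of "int a + m"] by (simp add: nat_add_distrib power_add)
  qed (use q1 in auto)
  also have "\<dots> \<le> 3 * norm q ^ a * (4/3)"
    using q mult_left_mono[of "1 / (1 - norm q)" "4/3" "3 * norm q ^ a"] by (simp add: field_simps)
  finally have "norm (half (\<lambda>_. 1) M (int a)) \<le> 4 * norm q ^ a" by simp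
  moreover have "norm E ^ 2 \<le> 2 ^ 2" by (intro power_mono norm_E_le q) auto
  ultimately have "norm E ^ 2 * norm (half (\<lambda>_. 1) M (int a)) \<le> 2 ^ 2 * (4 * norm q ^ a)"
    by (intro mult_mono) auto
  then show ?thesis by (simp add: hseq_def norm_mult norm_power)
qed

text \<open>Four steps of \<open>hseq_rec\<close> leave the remainder q^(4 a + 6) times
  \<open>hseq\<close> at a + 4. Its order 5 a + 10 is at least 10 for every a.\<close>

lemma hseq_expansion:
  assumes q: "norm q \<le> 1/4"
  shows "norm (hseq (int a) - (q ^ a - q ^ (2 * a + 1) + q ^ (3 * a + 3) - q ^ (4 * a + 6))) \<le> 16 * norm q ^ (5 * a + 10)"
proof -
  have "hseq (int a) = q ^ a * (1 - q ^ (a + 1) * (1 - q ^ (a + 2) * (1 - q ^ (a + 3) * (1 - hseq (int (a + 4))))))"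
    using hseq_rec[of a] hseq_rec[of "a + 1"] hseq_rec[of "a + 2"] hseq_rec[of "a + 3"] by (simp add: numeral_eq_Suc)
  also have "\<dots> = (q ^ a - q ^ (2 * a + 1) + q ^ (3 * a + 3) - q ^ (4 * a + 6)) + q ^ (4 * a + 6) * hseq (int (a + 4))"
  proof -
    have "a + (a + 1) = 2 * a + 1" "a + (a + 1) + (a + 2) = 3 * a + 3" "a + (a + 1) + (a + 2) + (a + 3) = 4 * a + 6" by simp_all
    then have "q ^ (2 * a + 1) = q ^ a * q ^ (a + 1)" "q ^ (3 * a + 3) = q ^ a * q ^ (a + 1) * q ^ (a + 2)"
      "q ^ (4 * a + 6) = q ^ a * q ^ (a + 1) * q ^ (a + 2) * q ^ (a + 3)"
      by (metis power_add)+
    then show ?thesis by (simp only:) (simp add: algebra_simps)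
  qed
  finally have "norm (hseq (int a) - (q ^ a - q ^ (2 * a + 1) + q ^ (3 * a + 3) - q ^ (4 * a + 6))) = norm q ^ (4 * a + 6) * norm (hseq (int (a + 4)))"
    by (simp add: norm_mult norm_power)
  also have "\<dots> \<le> norm q ^ (4 * a + 6) * (16 * norm q ^ (a + 4))"
    by (intro mult_left_mono norm_hseq_le q) auto
  also have "\<dots> = 16 * norm q ^ (5 * a + 10)" by (simp flip: power_add)
  finally show ?thesis .
qed

lemma cF_0_0: "((\<lambda>(i, j). M (i + j) * M (i - j) * (M i * M j)) has_sum cF 0 0) UNIV"
proof -
  have "((\<lambda>i. M i * 1 powi i) has_sum 1 / E\<^sup>2) UNIV" "((\<lambda>i. M i * (1 * 1) powi i) has_sum 1 / E\<^sup>2) UNIV"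
    "((\<lambda>i. M i * (1 / 1) powi i) has_sum 1 / E\<^sup>2) UNIV"
    using has_sum_M by simp_all
  from has_sum_coef4(2)[OF _ _ this(1,1) this(2,3), of 0 0]
  have "(\<lambda>(i, j). M (0 - i - j) * M (0 - i + j) * (M i * M j)) summable_on UNIV" by simp
  then have "((\<lambda>(i, j). M (0 - i - j) * M (0 - i + j) * (M i * M j)) has_sum cF 0 0) UNIV"
    unfolding cF_def coef4_def by (rule has_sum_infsum)
  moreover have "M (0 - i - j) = M (i + j)" "M (0 - i + j) = M (i - j)" for i j
    using M_minus[of "i + j"] M_minus[of "i - j"] by (simp_all add: algebra_simps)
  ultimately show ?thesis by simp
qed

lemma cF_tail:
  assumes q: "norm q \<le> 1/4"
  shows "norm (cF 0 0 - (\<Sum>(i, j)\<in>{-3..3} \<times> {-3..3}. M (i + j) * M (i - j) * (M i * M j)))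
    \<le> 1296 * (\<Sum>\<^sub>\<infinity>(i :: int, j :: int). exp (- \<bar>real_of_int i\<bar>) * exp (- \<bar>real_of_int j\<bar>)) * norm q ^ 10"
proof -
  define f where "f = (\<lambda>(i, j). M (i + j) * M (i - j) * (M i * M j))"
  define g where "g = (\<lambda>(i :: int, j :: int). exp (- \<bar>real_of_int i\<bar>) * exp (- \<bar>real_of_int j\<bar>))"
  define S where "S = {-3..3 :: int} \<times> {-3..3 :: int}"
  have "finite S" by (simp add: S_def)
  then have "(f has_sum (cF 0 0 - sum f S)) (UNIV - S)"
    by (intro has_sum_Diff has_sum_finite) (use cF_0_0 in \<open>auto simp: f_def\<close>)
  moreover have gs: "g summable_on UNIV"
    using summable_on_int2_exp_neg_abs by (simp add: g_def)
  have gS: "g summable_on (UNIV - S)" by (rule summable_on_subset_banach[OF gs]) auto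
  then have "((\<lambda>p. 1296 * norm q ^ 10 * g p) has_sum 1296 * norm q ^ 10 * infsum g (UNIV - S)) (UNIV - S)"
    by (intro has_sum_cmult_right has_sum_infsum)
  ultimately have "norm (cF 0 0 - sum f S) \<le> 1296 * norm q ^ 10 * infsum g (UNIV - S)"
  proof (rule norm_infsum_le)
    fix p assume p: "p \<in> UNIV - S"
    obtain i j where ij: "p = (i, j)" by (cases p)
    define k where "k = nat \<bar>i\<bar> + nat \<bar>j\<bar>"
    define n where "n = nat \<bar>i + j\<bar> + nat \<bar>i - j\<bar> + (nat \<bar>i\<bar> + nat \<bar>j\<bar>)"
    have "3 < \<bar>i\<bar> \<or> 3 < \<bar>j\<bar>" using p by (auto simp: ij S_def)
    moreover have "2 * \<bar>i\<bar> \<le> \<bar>i + j\<bar> + \<bar>i - j\<bar>" "2 * \<bar>j\<bar> \<le> \<bar>i + j\<bar> + \<bar>i - j\<bar>"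
      using abs_triangle_ineq[of "i + j" "i - j"] abs_triangle_ineq4[of "i + j" "i - j"] by simp_all
    moreover have "int n = \<bar>i + j\<bar> + \<bar>i - j\<bar> + (\<bar>i\<bar> + \<bar>j\<bar>)" "int k = \<bar>i\<bar> + \<bar>j\<bar>" by (simp_all add: n_def k_def)
    ultimately have "n \<ge> 10" "n \<ge> k + 8" by linarith+
    \<comment> \<open>Of the n powers of q, ten are kept for the estimate and the others, at least k
      - 2 many, give the decay that makes the sum over (i, j) converge. The offset 2 costs 16 = 4^2,
      and 1296 = 3^4 * 16.\<close>
    then have n: "n \<ge> 10" "n - 10 + 2 \<ge> k" by linarith+
    have "norm (f p) \<le> (3 * norm q ^ nat \<bar>i + j\<bar>) * (3 * norm q ^ nat \<bar>i - j\<bar>) * ((3 * norm q ^ nat \<bar>i\<bar>) * (3 * norm q ^ nat \<bar>j\<bar>))"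
      unfolding f_def ij prod.case norm_mult by (intro mult_mono norm_M_le q) auto
    also have "\<dots> = 81 * (norm q ^ 10 * norm q ^ (n - 10))"
      using n by (simp add: n_def flip: power_add)
    also have "\<dots> \<le> 81 * (norm q ^ 10 * (16 * g p))"
    proof (intro mult_left_mono)
      have "norm q ^ (n - 10) \<le> (1/4) ^ (n - 10)" by (intro power_mono q) auto
      also have "\<dots> = 16 * (1/4) ^ (n - 10 + 2)" by (simp add: power_add power2_eq_square)
      also have "\<dots> \<le> 16 * (1/4) ^ k" by (intro mult_left_mono power_decreasing n) auto
      also have "(1/4 :: real) ^ k \<le> exp (- 1) ^ k"
      proof (rule power_mono)
        have "exp 1 \<le> (4 :: real)" using exp_le by simp
        then show "1/4 \<le> exp (- 1 :: real)" by (simp add: exp_minus field_simps)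
      qed simp
      also have "exp (- 1 :: real) ^ k = g p"
        by (simp add: g_def ij k_def exp_of_nat_mult[symmetric] flip: exp_add)
      finally show "norm q ^ (n - 10) \<le> 16 * g p" by simp
    qed auto
    finally show "norm (f p) \<le> 1296 * norm q ^ 10 * g p" by simp
  qed
  also have "1296 * norm q ^ 10 * infsum g (UNIV - S) \<le> 1296 * norm q ^ 10 * infsum g UNIV"
    by (rule mult_left_mono[OF infsum_mono_neutral[OF gS gs]]) (auto simp: g_def)
  also have "\<dots> = 1296 * infsum g UNIV * norm q ^ 10" by simp
  finally show ?thesis unfolding f_def g_def S_def .
qed

end

section \<open>Expansions modulo powers of the nome\<close>

text \<open>Integer coefficient lists, constant term first, so that the final comparison is a
  computation for \<open>code_simp\<close>.\<close>

primrec lpoly :: "int list \<Rightarrow> complex \<Rightarrow> complex" where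
  "lpoly [] q = 0"
| "lpoly (c # cs) q = of_int c + q * lpoly cs q"

fun ladd :: "int list \<Rightarrow> int list \<Rightarrow> int list" where
  "ladd [] ys = ys"
| "ladd xs [] = xs"
| "ladd (x # xs) (y # ys) = (x + y) # ladd xs ys"

primrec lscale :: "int \<Rightarrow> int list \<Rightarrow> int list" where
  "lscale c [] = []"
| "lscale c (x # xs) = c * x # lscale c xs"

primrec lmul :: "int list \<Rightarrow> int list \<Rightarrow> int list" where
  "lmul [] ys = []"
| "lmul (x # xs) ys = ladd (lscale x ys) (0 # lmul xs ys)"

primrec lpow :: "nat \<Rightarrow> int list \<Rightarrow> nat \<Rightarrow> int list" where
  "lpow n xs 0 = [1]"
| "lpow n xs (Suc k) = take n (lmul xs (lpow n xs k))"

definition lmonom :: "int \<Rightarrow> nat \<Rightarrow> int list" where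
  "lmonom c n = replicate n 0 @ [c]"

lemma lpoly_ladd: "lpoly (ladd xs ys) q = lpoly xs q + lpoly ys q"
  by (induction xs ys rule: ladd.induct) (simp_all add: algebra_simps)

lemma lpoly_lscale: "lpoly (lscale c xs) q = of_int c * lpoly xs q"
  by (induction xs) (simp_all add: algebra_simps)

lemma lpoly_lmul: "lpoly (lmul xs ys) q = lpoly xs q * lpoly ys q"
  by (induction xs) (simp_all add: lpoly_ladd lpoly_lscale algebra_simps)

lemma lpoly_lmonom: "lpoly (lmonom c n) q = of_int c * q ^ n"
  by (induction n) (simp_all add: lmonom_def)

lemma lpoly_take_drop: "lpoly xs q = lpoly (take n xs) q + q ^ n * lpoly (drop n xs) q"
proof (induction xs arbitrary: n)
  case (Cons x xs)
  show ?case
  proof (cases n)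
    case (Suc m)
    have "q * lpoly xs q = q * (lpoly (take m xs) q + q ^ m * lpoly (drop m xs) q)" using Cons[of m] by (rule arg_cong)
    with Suc show ?thesis by (simp add: algebra_simps)
  qed simp
qed simp

lemma lpoly_bigo: "lpoly xs \<in> O[at 0](\<lambda>_. 1)"
proof -
  have "isCont (lpoly xs) a" for a by (induction xs) (auto intro!: continuous_intros)
  then have "(lpoly xs \<longlongrightarrow> lpoly xs 0) (at 0)" by (simp add: isCont_def)
  then show ?thesis by (intro bigoI_tendsto[where c="lpoly xs 0"]) auto
qed

definition expands :: "nat \<Rightarrow> (complex \<Rightarrow> complex) \<Rightarrow> int list \<Rightarrow> bool" where
  "expands n f xs \<longleftrightarrow> (\<lambda>q. f q - lpoly xs q) \<in> O[at 0](\<lambda>q. q ^ n)"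

lemma eventually_at_0_quarter: "eventually (\<lambda>q :: complex. q \<noteq> 0 \<and> norm q \<le> 1/4) (at 0)"
  unfolding eventually_at by (intro exI[of _ "1/4"]) auto

lemma expandsI:
  assumes "\<And>q. q \<noteq> 0 \<Longrightarrow> norm q \<le> 1/4 \<Longrightarrow> norm (f q - lpoly xs q) \<le> C * norm q ^ n"
  shows "expands n f xs"
  unfolding expands_def
  by (rule bigoI[of _ C]) (use eventually_at_0_quarter in eventually_elim, use assms in \<open>simp add: norm_power\<close>)

lemma expands_lpoly: "expands n (lpoly xs) xs"
  by (simp add: expands_def)

lemma expands_bigo:
  assumes "expands n f xs"
  shows "f \<in> O[at 0](\<lambda>_. 1)"
proof -
  have "(\<lambda>q :: complex. q ^ n) \<in> O[at 0](\<lambda>_. 1)"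
    by (rule bigoI[of _ 1]) (use eventually_at_0_quarter in eventually_elim, auto simp: norm_power intro!: power_le_one)
  then have "(\<lambda>q. f q - lpoly xs q) \<in> O[at 0](\<lambda>_. 1)"
    using assms landau_o.big_trans unfolding expands_def by blast
  from sum_in_bigo(1)[OF this lpoly_bigo[of xs]] show ?thesis by simp
qed

lemma expands_take:
  assumes "expands n f xs"
  shows "expands n f (take n xs)"
proof -
  have "(\<lambda>q. q ^ n * lpoly (drop n xs) q) \<in> O[at 0](\<lambda>q. q ^ n * 1)"
    by (intro landau_o.big.mult lpoly_bigo) auto
  then have "(\<lambda>q. q ^ n * lpoly (drop n xs) q) \<in> O[at 0](\<lambda>q. q ^ n)" by simp
  from sum_in_bigo(1)[OF assms[unfolded expands_def] this]
  have "(\<lambda>q. f q - lpoly xs q + q ^ n * lpoly (drop n xs) q) \<in> O[at 0](\<lambda>q. q ^ n)" .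
  moreover have "f q - lpoly xs q + q ^ n * lpoly (drop n xs) q = f q - lpoly (take n xs) q" for q
    using lpoly_take_drop[of xs q n] by simp
  ultimately show ?thesis by (simp only: expands_def)
qed

lemma expands_mult:
  assumes f: "expands n f xs" and g: "expands n g ys"
  shows "expands n (\<lambda>q. f q * g q) (take n (lmul xs ys))"
proof (rule expands_take)
  have "(\<lambda>q. (f q - lpoly xs q) * g q) \<in> O[at 0](\<lambda>q. q ^ n * 1)"
    using f expands_bigo[OF g] unfolding expands_def by (rule landau_o.big.mult)
  moreover have "(\<lambda>q. lpoly xs q * (g q - lpoly ys q)) \<in> O[at 0](\<lambda>q. 1 * q ^ n)"
    using lpoly_bigo g unfolding expands_def by (rule landau_o.big.mult)
  ultimately have "(\<lambda>q. (f q - lpoly xs q) * g q + lpoly xs q * (g q - lpoly ys q)) \<in> O[at 0](\<lambda>q. q ^ n)"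
    by (intro sum_in_bigo) simp_all
  then show "expands n (\<lambda>q. f q * g q) (lmul xs ys)"
    by (simp add: expands_def lpoly_lmul algebra_simps)
qed

lemma expands_power:
  assumes "expands n f xs"
  shows "expands n (\<lambda>q. f q ^ k) (lpow n xs k)"
proof (induction k)
  case 0
  show ?case using expands_lpoly[of n "[1]"] by (simp add: lpoly.simps[abs_def])
next
  case (Suc k)
  show ?case using expands_mult[OF assms Suc] by simp
qed

lemma expands_add:
  assumes "expands n f xs" "expands n g ys"
  shows "expands n (\<lambda>q. f q + g q) (ladd xs ys)"
  using sum_in_bigo(1)[OF assms[unfolded expands_def]] by (simp add: expands_def lpoly_ladd algebra_simps)

lemma expands_scale:
  assumes "expands n f xs"
  shows "expands n (\<lambda>q. of_int c * f q) (lscale c xs)"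
proof -
  have "(\<lambda>q. of_int c * (f q - lpoly xs q)) \<in> O[at 0](\<lambda>q. q ^ n)"
    using assms by (auto simp: expands_def)
  then show ?thesis by (simp add: expands_def lpoly_lscale right_diff_distrib)
qed

lemma expands_perturb:
  assumes "expands n f xs" "\<And>q. q \<noteq> 0 \<Longrightarrow> norm q \<le> 1/4 \<Longrightarrow> norm (g q - f q) \<le> C * norm q ^ n"
  shows "expands n g xs"
proof -
  have "(\<lambda>q. g q - f q) \<in> O[at 0](\<lambda>q. q ^ n)"
    by (rule bigoI[of _ C]) (use eventually_at_0_quarter in eventually_elim, use assms(2) in \<open>simp add: norm_power\<close>)
  from sum_in_bigo(1)[OF this assms(1)[unfolded expands_def]] show ?thesis by (simp add: expands_def)
qed

section \<open>Coefficient lists modulo q^10\<close>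

definition hcoeffs :: "nat \<Rightarrow> int list" where
  "hcoeffs a = ladd (lmonom 1 a) (ladd (lmonom (- 1) (2 * a + 1)) (ladd (lmonom 1 (3 * a + 3)) (lmonom (- 1) (4 * a + 6))))"

definition mcoeffs :: "nat \<Rightarrow> int list" where
  "mcoeffs a = take 10 (ladd (hcoeffs a) (lscale (- 1) (hcoeffs (a + 1))))"

primrec qcoeffs :: "nat \<Rightarrow> int list" where
  "qcoeffs 0 = [1]"
| "qcoeffs (Suc n) = take 10 (lmul (ladd [1] (lmonom (- 1) (Suc n))) (qcoeffs n))"

definition mprod :: "nat \<Rightarrow> nat \<Rightarrow> nat \<Rightarrow> nat \<Rightarrow> int list" where
  "mprod a b c d = take 10 (lmul (take 10 (lmul (mcoeffs a) (mcoeffs b))) (take 10 (lmul (mcoeffs c) (mcoeffs d))))"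

text \<open>Each \<open>mprod\<close> stands for one orbit of pairs (i, j) under the symmetries of
  the square, weighted by the orbit size 1, 4 or 8.\<close>

definition ctcoeffs :: "int list" where
  "ctcoeffs = ladd (mprod 0 0 0 0) (ladd
    (lscale 4 (ladd (mprod 1 1 1 0) (ladd (mprod 2 2 2 0) (ladd (mprod 3 3 3 0)
      (ladd (mprod 2 0 1 1) (ladd (mprod 4 0 2 2) (mprod 6 0 3 3)))))))
    (lscale 8 (ladd (mprod 3 1 2 1) (ladd (mprod 4 2 3 1) (mprod 5 1 3 2)))))"

definition target :: "int list" where
  "target = [1, 0, 4, 12, 38, 100, 276, 688, 1709, 4020]"

text \<open>Both sides carry the eighth power of the product of the first nine factors of E, so that
  no series has to be inverted. The list [1] represents that product divided by E, which is 1 modulo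
  q^10.\<close>

lemma coeffs_identity: "take 10 (lmul (lpow 10 [1] 8) ctcoeffs) = take 10 (lmul (lpow 10 (qcoeffs 9) 8) target)"
  by code_simp

lemma expands_M: "expands 10 (\<lambda>q. nome_disc.E q ^ 2 * nome_disc.M q (int a)) (mcoeffs a)"
  unfolding mcoeffs_def
proof (rule expands_take, rule expandsI)
  fix q :: complex assume q: "q \<noteq> 0" "norm q \<le> 1/4"
  \<comment> \<open>Any square root of q serves here, as \<open>M\<close> and \<open>cF\<close> are
    built from q itself.\<close>
  interpret nome_sqrt q "csqrt q" by standard (use q in auto)
  have h: "norm (hseq (int b) - lpoly (hcoeffs b) q) \<le> 16 * norm q ^ 10" for b
  proof -
    have "norm q ^ (5 * b + 10) \<le> norm q ^ 10" using q by (intro power_decreasing) auto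
    moreover have "lpoly (hcoeffs b) q = q ^ b - q ^ (2 * b + 1) + q ^ (3 * b + 3) - q ^ (4 * b + 6)"
      unfolding hcoeffs_def lpoly_ladd lpoly_lmonom by simp
    ultimately show ?thesis using hseq_expansion[OF q(2), of b] by (simp only:)
  qed
  have "E ^ 2 * M (int a) - lpoly (ladd (hcoeffs a) (lscale (- 1) (hcoeffs (a + 1)))) q
    = (hseq (int a) - lpoly (hcoeffs a) q) - (hseq (int (a + 1)) - lpoly (hcoeffs (a + 1)) q)"
    using M_eq_hseq[of "int a"] by (simp add: lpoly_ladd lpoly_lscale algebra_simps)
  also have "norm \<dots> \<le> 16 * norm q ^ 10 + 16 * norm q ^ 10" by (intro norm_triangle_le_diff add_mono h)
  finally show "norm (E ^ 2 * M (int a) - lpoly (ladd (hcoeffs a) (lscale (- 1) (hcoeffs (a + 1)))) q) \<le> 32 * norm q ^ 10" by simp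
qed

lemma expands_qfac: "expands 10 (\<lambda>q. \<Prod>j<n. 1 - q * q ^ j) (qcoeffs n)"
proof (induction n)
  case 0
  show ?case using expands_lpoly[of 10 "[1]"] by (simp add: lpoly.simps[abs_def])
next
  case (Suc n)
  have "expands 10 (\<lambda>q. 1 - q * q ^ n) (ladd [1] (lmonom (- 1) (Suc n)))"
    by (rule expandsI[of _ _ 0]) (simp add: lpoly_ladd lpoly_lmonom)
  from expands_mult[OF this Suc] show ?case by (simp add: mult.commute)
qed

text \<open>The summand is invariant under swapping i and j and under each sign change: the axes and
  diagonals give orbits of size four, the pairs with 0 < |i|, 0 < |j| and |i| different from |j|
  orbits of size eight.\<close>

lemma sum_square_even:
  fixes m :: "int \<Rightarrow> complex"
  assumes "\<And>i. m (- i) = m i"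
  shows "(\<Sum>(i, j)\<in>{-3..3} \<times> {-3..3}. m (i + j) * m (i - j) * (m i * m j))
    = m 0 * m 0 * (m 0 * m 0)
      + (4 * (m 1 * m 1 * (m 1 * m 0) + (m 2 * m 2 * (m 2 * m 0) + (m 3 * m 3 * (m 3 * m 0)
        + (m 2 * m 0 * (m 1 * m 1) + (m 4 * m 0 * (m 2 * m 2) + m 6 * m 0 * (m 3 * m 3))))))
      + 8 * (m 3 * m 1 * (m 2 * m 1) + (m 4 * m 2 * (m 3 * m 1) + m 5 * m 1 * (m 3 * m 2))))"
proof -
  have "{-3..3} = {-3, -2, -1, 0, 1, 2, 3 :: int}" by auto
  moreover note assms[of 1] assms[of 2] assms[of 3] assms[of 4] assms[of 5] assms[of 6]
  ultimately show ?thesis unfolding sum.cartesian_product[symmetric] by (simp add: algebra_simps)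
qed

lemma expands_E8_cF: "expands 10 (\<lambda>q. nome_disc.E q ^ 8 * nome_sqrt.cF q 0 0) ctcoeffs"
proof (rule expands_perturb)
  define m where "m a q = nome_disc.E q ^ 2 * nome_disc.M q (int a)" for a q
  define P where "P a b c d q = m a q * m b q * (m c q * m d q)" for a b c d q
  have m: "expands 10 (m a) (mcoeffs a)" for a
    unfolding m_def[abs_def] by (rule expands_M)
  have P: "expands 10 (P a b c d) (mprod a b c d)" for a b c d
    unfolding P_def[abs_def] mprod_def by (intro expands_mult m)
  show "expands 10 (\<lambda>q. P 0 0 0 0 q + (of_int 4 * (P 1 1 1 0 q + (P 2 2 2 0 q + (P 3 3 3 0 q + (P 2 0 1 1 q + (P 4 0 2 2 q + P 6 0 3 3 q)))))
      + of_int 8 * (P 3 1 2 1 q + (P 4 2 3 1 q + P 5 1 3 2 q)))) ctcoeffs"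
    unfolding ctcoeffs_def by (intro expands_add expands_scale P)
  fix q :: complex assume q: "q \<noteq> 0" "norm q \<le> 1/4"
  interpret nome_sqrt q "csqrt q" by standard (use q in auto)
  define C where "C = 1296 * (\<Sum>\<^sub>\<infinity>(i :: int, j :: int). exp (- \<bar>real_of_int i\<bar>) * exp (- \<bar>real_of_int j\<bar>))"
  have "E ^ 8 * (\<Sum>(i, j)\<in>{-3..3} \<times> {-3..3}. M (i + j) * M (i - j) * (M i * M j))
    = (\<Sum>(i, j)\<in>{-3..3} \<times> {-3..3}. (E\<^sup>2 * M (i + j)) * (E\<^sup>2 * M (i - j)) * ((E\<^sup>2 * M i) * (E\<^sup>2 * M j)))"
    unfolding sum_distrib_left by (rule sum.cong) (auto simp: eval_nat_numeral)
  also have "\<dots> = P 0 0 0 0 q + (of_int 4 * (P 1 1 1 0 q + (P 2 2 2 0 q + (P 3 3 3 0 q + (P 2 0 1 1 q + (P 4 0 2 2 q + P 6 0 3 3 q)))))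
      + of_int 8 * (P 3 1 2 1 q + (P 4 2 3 1 q + P 5 1 3 2 q)))" (is "_ = ?R")
    by (subst sum_square_even[of "\<lambda>i. E\<^sup>2 * M i"]) (simp_all add: P_def m_def)
  finally have "E ^ 8 * cF 0 0 - ?R
    = E ^ 8 * (cF 0 0 - (\<Sum>(i, j)\<in>{-3..3} \<times> {-3..3}. M (i + j) * M (i - j) * (M i * M j)))"
    by (simp only: right_diff_distrib)
  also have "norm \<dots> \<le> 2 ^ 8 * (C * norm q ^ 10)"
    unfolding norm_mult norm_power C_def by (intro mult_mono power_mono norm_E_le cF_tail q) auto
  finally show "norm (E ^ 8 * cF 0 0 - ?R) \<le> 2 ^ 8 * (1296 * (\<Sum>\<^sub>\<infinity>(i :: int, j :: int). exp (- \<bar>real_of_int i\<bar>) * exp (- \<bar>real_of_int j\<bar>))) * norm q ^ 10"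
    unfolding C_def by (simp only: mult.assoc)
qed

lemma expands_cF: "expands 10 (\<lambda>q. nome_sqrt.cF q 0 0) target"
proof -
  \<comment> \<open>Nine factors, because the error in \<open>qfac_div_E\<close> is then of order
    q^10.\<close>
  define Q where "Q q = (\<Prod>j<9. 1 - q * q ^ j)" for q :: complex
  have "expands 10 (\<lambda>q. Q q / nome_disc.E q) [1]"
  proof (rule expandsI)
    fix q :: complex assume q: "q \<noteq> 0" "norm q \<le> 1/4"
    interpret nome_sqrt q "csqrt q" by standard (use q in auto)
    show "norm (Q q / E - lpoly [1] q) \<le> 2 * norm q ^ 10"
      using qfac_div_E[OF q(2), of 9] by (simp add: Q_def qfac_def)
  qed
  from expands_mult[OF expands_power[OF this, of 8] expands_E8_cF]
  have "expands 10 (\<lambda>q. Q q ^ 8 * nome_sqrt.cF q 0 0) (take 10 (lmul (lpow 10 [1] 8) ctcoeffs))"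
  proof (rule expands_perturb[where C=0])
    fix q :: complex assume q: "q \<noteq> 0" "norm q \<le> 1/4"
    interpret nome_sqrt q "csqrt q" by standard (use q in auto)
    show "norm (Q q ^ 8 * cF 0 0 - (Q q / E) ^ 8 * (E ^ 8 * cF 0 0)) \<le> 0 * norm q ^ 10"
      using E_nonzero by (simp add: power_divide)
  qed
  moreover have "expands 10 (\<lambda>q. Q q ^ 8 * lpoly target q) (take 10 (lmul (lpow 10 (qcoeffs 9) 8) target))"
    unfolding Q_def by (intro expands_mult expands_power expands_qfac expands_lpoly)
  ultimately have d: "(\<lambda>q. Q q ^ 8 * nome_sqrt.cF q 0 0 - Q q ^ 8 * lpoly target q) \<in> O[at 0](\<lambda>q. q ^ 10)"
    unfolding coeffs_identity expands_def by (auto dest: sum_in_bigo(2))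
  \<comment> \<open>Q is bounded away from 0 near q = 0, so Q^8 can be divided out of the
    estimate.\<close>
  have "(\<lambda>q. 1 / Q q ^ 8) \<in> O[at 0](\<lambda>_. 1)"
  proof (rule bigoI[of _ "(3/2) ^ 8"], use eventually_at_0_quarter in eventually_elim)
    fix q :: complex assume q: "q \<noteq> 0 \<and> norm q \<le> 1/4"
    interpret nome_sqrt q "csqrt q" by standard (use q in auto)
    have "norm (1 / Q q) ^ 8 \<le> (3/2) ^ 8" unfolding Q_def qfac_def[symmetric] by (intro power_mono norm_inverse_qfac_le) (use q in auto)
    then show "norm (1 / Q q ^ 8) \<le> (3/2) ^ 8 * norm (1 :: complex)" by (simp add: norm_divide norm_power power_divide)
  qed
  from landau_o.big.mult[OF this d]
  have "(\<lambda>q. 1 / Q q ^ 8 * (Q q ^ 8 * nome_sqrt.cF q 0 0 - Q q ^ 8 * lpoly target q)) \<in> O[at 0](\<lambda>q. q ^ 10)" by simp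
  also have "?this \<longleftrightarrow> (\<lambda>q. nome_sqrt.cF q 0 0 - lpoly target q) \<in> O[at 0](\<lambda>q. q ^ 10)"
  proof (rule landau_o.big.in_cong, use eventually_at_0_quarter in eventually_elim)
    fix q :: complex assume q: "q \<noteq> 0 \<and> norm q \<le> 1/4"
    interpret nome_sqrt q "csqrt q" by standard (use q in auto)
    show "1 / Q q ^ 8 * (Q q ^ 8 * cF 0 0 - Q q ^ 8 * lpoly target q) = cF 0 0 - lpoly target q"
      using qfac_nonzero[of 9] by (simp add: Q_def qfac_def[symmetric] diff_divide_distrib)
  qed
  finally show ?thesis by (simp add: expands_def)
qed

lemma filterlim_nome: "filterlim nome (at 0) (filtercomap Im at_top)"
proof -
  have "((\<lambda>y. exp (- (2 * pi * y))) \<longlongrightarrow> 0) at_top"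
  proof (rule filterlim_compose[OF exp_at_bot])
    have "filterlim (\<lambda>y. 2 * pi * y) at_top at_top"
      by (rule filterlim_tendsto_pos_mult_at_top[OF tendsto_const _ filterlim_ident]) simp
    then show "filterlim (\<lambda>y. - (2 * pi * y)) at_bot at_top" by (simp only: filterlim_uminus_at_top)
  qed
  from filterlim_compose[OF this filterlim_filtercomap]
  have "(nome \<longlongrightarrow> 0) (filtercomap Im at_top)"
    by (intro tendsto_norm_zero_cancel[of nome]) (simp add: norm_qpow)
  then show ?thesis by (intro filterlim_atI) auto
qed

theorem proposition6p1:
  shows "(\<forall>\<tau>::complex. Im \<tau> > 0 \<longrightarrow>
            (\<exists>!c. is_laurent_expansion (F_B2 \<tau>) (range_B2 \<tau>) c) \<and>
            constant_term (F_B2 \<tau>) (range_B2 \<tau>) =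
              qpow (1/3) \<tau> / eta \<tau> ^ 8 * F0 \<tau>
              + 9 * qpow (-1/12) \<tau> / (2 * eta \<tau> ^ 8) * Phi \<tau>
              + qpow (-1/12) \<tau> / eta \<tau> ^ 2 *
                  (Lambda 0 1 \<tau> / theta (1/2) \<tau> ^ 2
                   + qpow (-1/4) \<tau> * Lambda 1 0 \<tau> / theta (\<tau>/2) \<tau> ^ 2
                   - qpow (-1/4) \<tau> * Lambda 1 1 \<tau> / theta ((\<tau> + 1)/2) \<tau> ^ 2))
         \<and> (\<lambda>\<tau>. constant_term (F_B2 \<tau>) (range_B2 \<tau>)
                - (1 + 4 * nome \<tau> ^ 2 + 12 * nome \<tau> ^ 3 + 38 * nome \<tau> ^ 4 + 100 * nome \<tau> ^ 5
                   + 276 * nome \<tau> ^ 6 + 688 * nome \<tau> ^ 7 + 1709 * nome \<tau> ^ 8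
                   + 4020 * nome \<tau> ^ 9))
             \<in> O[filtercomap Im at_top](\<lambda>\<tau>. nome \<tau> ^ 10)"
proof (intro conjI allI impI)
  fix \<tau> :: complex assume "Im \<tau> > 0"
  then interpret tau \<tau> by unfold_locales
  show "\<exists>!c. is_laurent_expansion (F_B2 \<tau>) (range_B2 \<tau>) c" by (rule constant_term_eq)
  show "constant_term (F_B2 \<tau>) (range_B2 \<tau>) =
              qpow (1/3) \<tau> / eta \<tau> ^ 8 * F0 \<tau>
              + 9 * qpow (-1/12) \<tau> / (2 * eta \<tau> ^ 8) * Phi \<tau>
              + qpow (-1/12) \<tau> / eta \<tau> ^ 2 *
                  (Lambda 0 1 \<tau> / theta (1/2) \<tau> ^ 2
                   + qpow (-1/4) \<tau> * Lambda 1 0 \<tau> / theta (\<tau>/2) \<tau> ^ 2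
                   - qpow (-1/4) \<tau> * Lambda 1 1 \<tau> / theta ((\<tau> + 1)/2) \<tau> ^ 2)"
    unfolding constant_term_eq(2) by (rule ct_formula)
next
  have ev: "eventually (\<lambda>\<tau>. Im \<tau> > 0) (filtercomap Im at_top)"
    using eventually_gt_at_top[of "0::real"] by (rule eventually_filtercomapI)
  \<comment> \<open>The estimate as q tends to 0 is pulled back along the nome, which tends to 0
    without vanishing as Im tau grows.\<close>
  have "(\<lambda>\<tau>. nome_sqrt.cF (nome \<tau>) 0 0 - lpoly target (nome \<tau>)) \<in> O[filtercomap Im at_top](\<lambda>\<tau>. nome \<tau> ^ 10)"
    by (rule landau_o.big.compose[OF expands_cF[unfolded expands_def] filterlim_nome])
  also have "?this \<longleftrightarrow> (\<lambda>\<tau>. constant_term (F_B2 \<tau>) (range_B2 \<tau>)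
                - (1 + 4 * nome \<tau> ^ 2 + 12 * nome \<tau> ^ 3 + 38 * nome \<tau> ^ 4 + 100 * nome \<tau> ^ 5
                   + 276 * nome \<tau> ^ 6 + 688 * nome \<tau> ^ 7 + 1709 * nome \<tau> ^ 8
                   + 4020 * nome \<tau> ^ 9))
             \<in> O[filtercomap Im at_top](\<lambda>\<tau>. nome \<tau> ^ 10)"
  proof (rule landau_o.big.in_cong, use ev in eventually_elim)
    fix \<tau> :: complex assume "Im \<tau> > 0"
    then interpret tau \<tau> by unfold_locales
    have "lpoly target (nome \<tau>) = 1 + 4 * nome \<tau> ^ 2 + 12 * nome \<tau> ^ 3 + 38 * nome \<tau> ^ 4 + 100 * nome \<tau> ^ 5
                   + 276 * nome \<tau> ^ 6 + 688 * nome \<tau> ^ 7 + 1709 * nome \<tau> ^ 8 + 4020 * nome \<tau> ^ 9"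
      by (simp add: target_def eval_nat_numeral algebra_simps)
    then show "cF 0 0 - lpoly target (nome \<tau>) = constant_term (F_B2 \<tau>) (range_B2 \<tau>)
                - (1 + 4 * nome \<tau> ^ 2 + 12 * nome \<tau> ^ 3 + 38 * nome \<tau> ^ 4 + 100 * nome \<tau> ^ 5
                   + 276 * nome \<tau> ^ 6 + 688 * nome \<tau> ^ 7 + 1709 * nome \<tau> ^ 8
                   + 4020 * nome \<tau> ^ 9)"
      unfolding constant_term_eq(2) by (simp only:)
  qed
  finally show "(\<lambda>\<tau>. constant_term (F_B2 \<tau>) (range_B2 \<tau>)
                - (1 + 4 * nome \<tau> ^ 2 + 12 * nome \<tau> ^ 3 + 38 * nome \<tau> ^ 4 + 100 * nome \<tau> ^ 5
                   + 276 * nome \<tau> ^ 6 + 688 * nome \<tau> ^ 7 + 1709 * nome \<tau> ^ 8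
                   + 4020 * nome \<tau> ^ 9))
             \<in> O[filtercomap Im at_top](\<lambda>\<tau>. nome \<tau> ^ 10)" .
qed

end
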